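(* Let $\Omega\subset\mathbb R^d$, $d=2,3$, let $T>0$ be fixed, and let $(\mathbf u_h,p_h,\tilde{\mathbf u}_1,\tilde{\mathbf u}_2):(0,T)\to\mathcal V_h\times Q_h\times\widetilde V_1\times\widetilde V_2$ be a solution of the non-linear semi-discrete VMS problem \begin{align*} &(\partial_t\mathbf u_h,\mathbf v_h)+(2\mu(\cdot,|\nabla^s\mathbf u_h|)\nabla^s\mathbf u_h,\nabla^s\mathbf v_h)+\overline c(\mathbf u_h,\mathbf u_h,\mathbf v_h)-(p_h,\operatorname{div}\mathbf v_h)\\ &\qquad+(\tau_2\operatorname{div}\mathbf v_h,P_p^\perp[\operatorname{div}\mathbf u_h])-\overline c(\mathbf u_h,\mathbf v_h,\tilde{\mathbf u}_1)=\langle\mathbf f,\mathbf v_h\rangle,\\ &(q_h,\operatorname{div}\mathbf u_h)-(\nabla q_h,\tilde{\mathbf u}_2)=0,\\ &(\partial_t\tilde{\mathbf u}_1,\tilde{\mathbf v}_1)+\tau_1^{-1}(\tilde{\mathbf u}_1,\tilde{\mathbf v}_1)+\overline c(\mathbf u_h,\mathbf u_h,\tilde{\mathbf v}_1)=0,\\ &(\partial_t\tilde{\mathbf u}_2,\tilde{\mathbf v}_2)+\tau_1^{-1}(\tilde{\mathbf u}_2,\tilde{\mathbf v}_2)+(\nabla p_h,\tilde{\mathbf v}_2)=0 \end{align*} for all $(\mathbf v_h,q_h,\tilde{\mathbf v}_1,\tilde{\mathbf v}_2)\in\mathcal V_h\times Q_h\times\widetilde V_1\times\widetilde V_2$ a.e.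 in $(0,T)$, with $\mathbf u_h(0)=P_{u,0}[\mathbf u_0]$, $\tilde{\mathbf u}_1(0)=\widetilde P_1[\mathbf u_0]$, $\tilde{\mathbf u}_2(0)=\widetilde P_2[\mathbf u_0]$, where $\tau_i=\tau_i(\mathbf u_h)$ and $\mathbf u_0\in L^2(\Omega)^d$. If $\mathbf f\in L^2(0,T;H^{-1}(\Omega)^d)$, then $$\tau_0^{1/2}\,\big\|\nabla p_h+\mathcal N(\mathbf u_h,\mathbf u_h)\big\|_{H^{-1}(0,T;L^2(\Omega)^d)}\le C,$$ where $C$ is independent of $h$ and $\tau_0$ is the time-independent parameter defined by $$\tau_0^{-1}=c_1\frac{\mu_0}{h^2}+c_2\frac{\sup_{t\in[0,T]}\|\mathbf u_h(t)\|_\infty}{h}.$$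
   Context: $\Omega$ is a bounded polyhedral domain. $\|\cdot\|$ and $(\cdot,\cdot)$ are the $L^2(\Omega)$ norm and inner product (scalar, vector or tensor fields), $\|\cdot\|_\infty$ the $L^\infty(\Omega)$ norm, $H^{-1}(\Omega)$ is the dual of $H^1_0(\Omega)$ with pairing $\langle\cdot,\cdot\rangle$. $H^{-1}(0,T;L^2(\Omega)^d)$ denotes the dual of $H^1_0(0,T;L^2(\Omega)^d)$, a function $\mathbf g$ acting by $\mathbf v\mapsto\int_0^T(\mathbf g,\mathbf v)\,dt$. $\nabla^s\mathbf v=\frac12(\nabla\mathbf v+(\nabla\mathbf v)^T)$; $|\cdot|$ is the Frobenius norm. Viscosity: $\mu:\overline\Omega\times\mathbb R_{\ge0}\to\mathbb R$ satisfies, for some $C_\mu>0$ and $\mu_0>\mu_\infty>0$: $|\mu(\mathbf x,t)-\mu(\mathbf x,s)|\le C_\mu|t-s|$ and $\mu_\infty\le\mu(\mathbf x,t)\le\mu_0$ for all $s,t\ge0$, $\mathbf x\in\overline\Omega$. Convective form: $\mathcal N(\mathbf u,\mathbf v)=\mathbf u\cdot\nabla\mathbf v+\frac12(\operatorname{div}\mathbf u)\mathbf v$ and $\overline c(\mathbf u,\mathbf v,\mathbf w)=\int_\Omega\mathcal N(\mathbf u,\mathbf v)\cdot\mathbf w\,dx$. Finite elements: $\{\mathcal T_h\}$ is a quasi-uniform family of finite element partitions of $\Omega$, $h=\max_{K\in\mathcal T_h}\operatorname{diam}K$. For fixed $k\ge1$, $S_h=\{v\in C(\overline\Omega):v|_K\in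 P_k(K)\ \forall K\in\mathcal T_h\}$ with $P_k(K)$ the polynomials of degree $\le k$; $\mathcal V_h=[S_h\cap H^1_0(\Omega)]^d$, $Q_h=S_h/\mathbb R$. $P_u$, $P_p$, $P_{u,0}$ are the $L^2(\Omega)$-orthogonal projections onto $S_h^d$, $S_h$, $\mathcal V_h$ respectively; $P_u^\perp=I-P_u$, $P_p^\perp=I-P_p$. Subscale spaces: with $\{\phi_i\}_{i=1}^{n_u}$, $\{\varphi_k\}_{k=1}^{n_p}$ bases of the discrete velocity and pressure spaces, $\widetilde V_1=\operatorname{span}\{P_u^\perp[\mathcal N(\phi_i,\phi_j)]\}_{i,j=1}^{n_u}$, $\widetilde V_2=\operatorname{span}\{P_u^\perp[\nabla\varphi_k]\}_{k=1}^{n_p}$; $\widetilde P_1,\widetilde P_2$ are the $L^2(\Omega)$-orthogonal projections onto $\widetilde V_1,\widetilde V_2$. Stabilisation parameters (constant in space, functions of time): $\tau_1(\mathbf w_h)=\big(c_1\mu_c/h^2+c_2\|\mathbf w_h\|_\infty/h\big)^{-1}$, $\tau_2(\mathbf w_h)=h^2/(c_1\tau_1(\mathbf w_h))$, where $c_1,c_2>0$ are algorithmic constants and $\mu_c$ is a characteristic viscosity with $\mu_\infty\le\mu_c\le\mu_0$ (e.g. the spatial average of $\mu(\mathbf x,|\nabla^s\mathbf w_h|)$ over $\Omega$). Standing assumption on the meshes/spaces: there is $\beta_0>0$ independent of $h$ with $\|\mathbf z_h\|\le\frac1{\beta_0}\|P_{u,0}[\mathbf z_h]+P_u^\perp[\mathbf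 z_h]\|\le\frac1{\beta_0}(\|P_{u,0}[\mathbf z_h]\|+\|P_u^\perp[\mathbf z_h]\|)$ for every piecewise polynomial vector field $\mathbf z_h$. *)

theory Defs
  imports "HOL-Analysis.Analysis" "HOL-Probability.Essential_Supremum"
begin

section \<open>Lebesgue and Sobolev spaces on a domain\<close>

text \<open>
  Elements of function spaces are represented by functions on the whole space; only their values on
  the domain matter, and in the \<open>L\<^sup>2\<close> setting only up to null sets.
\<close>

definition L2 :: "(real^'n) set \<Rightarrow> (real^'n \<Rightarrow> 'b::euclidean_space) set" where
  "L2 \<Omega> = {v. v \<in> borel_measurable (lebesgue_on \<Omega>) \<and> integrable (lebesgue_on \<Omega>) (\<lambda>x. (norm (v x))\<^sup>2)}"

definition L2_inner :: "(real^'n) set \<Rightarrow> (real^'n \<Rightarrow> 'b::euclidean_space) \<Rightarrow> (real^'n \<Rightarrow> 'b) \<Rightarrow> real" where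
  "L2_inner \<Omega> v w = (\<integral>x. v x \<bullet> w x \<partial>lebesgue_on \<Omega>)"

definition L2_norm :: "(real^'n) set \<Rightarrow> (real^'n \<Rightarrow> 'b::euclidean_space) \<Rightarrow> real" where
  "L2_norm \<Omega> v = sqrt (L2_inner \<Omega> v v)"

definition Linf_norm :: "(real^'n) set \<Rightarrow> (real^'n \<Rightarrow> 'b::euclidean_space) \<Rightarrow> real" where
  "Linf_norm \<Omega> v = real_of_ereal (esssup (lebesgue_on \<Omega>) (\<lambda>x. ereal (norm (v x))))"

text \<open>
  The orthogonal projection is determined up to a null set, which is why a choice operator is used
  and why equalities with projections are stated almost everywhere.
\<close>

definition L2_proj ::
    "(real^'n) set \<Rightarrow> (real^'n \<Rightarrow> 'b::euclidean_space) set \<Rightarrow> (real^'n \<Rightarrow> 'b) \<Rightarrow> (real^'n \<Rightarrow> 'b)" where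
  "L2_proj \<Omega> W v = (SOME w. w \<in> W \<and> (\<forall>y\<in>W. L2_inner \<Omega> (\<lambda>x. v x - w x) y = 0))"

definition L2_perp ::
    "(real^'n) set \<Rightarrow> (real^'n \<Rightarrow> 'b::euclidean_space) set \<Rightarrow> (real^'n \<Rightarrow> 'b) \<Rightarrow> (real^'n \<Rightarrow> 'b)" where
  "L2_perp \<Omega> W v = (\<lambda>x. v x - L2_proj \<Omega> W v x)"

definition pderiv_at :: "'n \<Rightarrow> (real^'n \<Rightarrow> real) \<Rightarrow> (real^'n \<Rightarrow> real)" where
  "pderiv_at i \<phi> = (\<lambda>x. frechet_derivative \<phi> (at x) (axis i 1))"

primrec pderivs :: "'n list \<Rightarrow> (real^'n \<Rightarrow> real) \<Rightarrow> (real^'n \<Rightarrow> real)" where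
  "pderivs [] \<phi> = \<phi>"
| "pderivs (i # js) \<phi> = pderiv_at i (pderivs js \<phi>)"

text \<open>Test functions \<open>C\<^sub>c\<^sup>\<infinity>(\<Omega>)\<close>: partial derivatives of all orders exist and are differentiable.\<close>

definition test_functions :: "(real^'n) set \<Rightarrow> (real^'n \<Rightarrow> real) set" where
  "test_functions \<Omega> = {\<phi>. (\<forall>js x. pderivs js \<phi> differentiable (at x)) \<and>
     (\<exists>K. compact K \<and> K \<subseteq> \<Omega> \<and> (\<forall>x. x \<notin> K \<longrightarrow> \<phi> x = 0))}"

definition weak_gradient :: "(real^'n) set \<Rightarrow> (real^'n \<Rightarrow> real) \<Rightarrow> (real^'n \<Rightarrow> real^'n) \<Rightarrow> bool" where
  "weak_gradient \<Omega> v g \<longleftrightarrow> (\<forall>\<phi>\<in>test_functions \<Omega>. \<forall>i.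
     (\<integral>x. v x * pderiv_at i \<phi> x \<partial>lebesgue_on \<Omega>) = - (\<integral>x. (g x $ i) * \<phi> x \<partial>lebesgue_on \<Omega>))"

definition H1 :: "(real^'n) set \<Rightarrow> (real^'n \<Rightarrow> real) set" where
  "H1 \<Omega> = {v \<in> L2 \<Omega>. \<exists>g\<in>L2 \<Omega>. weak_gradient \<Omega> v g}"

definition grad :: "(real^'n) set \<Rightarrow> (real^'n \<Rightarrow> real) \<Rightarrow> (real^'n \<Rightarrow> real^'n)" where
  "grad \<Omega> v = (SOME g. g \<in> L2 \<Omega> \<and> weak_gradient \<Omega> v g)"

definition H1_norm :: "(real^'n) set \<Rightarrow> (real^'n \<Rightarrow> real) \<Rightarrow> real" where
  "H1_norm \<Omega> v = sqrt ((L2_norm \<Omega> v)\<^sup>2 + (L2_norm \<Omega> (grad \<Omega> v))\<^sup>2)"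

definition H10 :: "(real^'n) set \<Rightarrow> (real^'n \<Rightarrow> real) set" where
  "H10 \<Omega> = {v \<in> H1 \<Omega>. \<exists>\<phi>. (\<forall>m. \<phi> m \<in> test_functions \<Omega>) \<and>
     (\<lambda>m::nat. H1_norm \<Omega> (\<lambda>x. v x - \<phi> m x)) \<longlonglongrightarrow> 0}"

definition Hm1 :: "(real^'n) set \<Rightarrow> ((real^'n \<Rightarrow> real) \<Rightarrow> real) set" where
  "Hm1 \<Omega> = {l. (\<forall>v\<in>H10 \<Omega>. \<forall>w\<in>H10 \<Omega>. \<forall>a b. l (\<lambda>x. a * v x + b * w x) = a * l v + b * l w) \<and>
     (\<exists>B. \<forall>v\<in>H10 \<Omega>. \<bar>l v\<bar> \<le> B * H1_norm \<Omega> v)}"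

definition Hm1_norm :: "(real^'n) set \<Rightarrow> ((real^'n \<Rightarrow> real) \<Rightarrow> real) \<Rightarrow> real" where
  "Hm1_norm \<Omega> l = (SUP v\<in>{v \<in> H10 \<Omega>. H1_norm \<Omega> v \<le> 1}. \<bar>l v\<bar>)"

section \<open>Differential operators on vector fields\<close>

text \<open>\<open>(jacobian \<Omega> v x) $ i $ j\<close> is the derivative of the \<open>i\<close>-th component in direction \<open>j\<close>.\<close>

definition jacobian :: "(real^'n) set \<Rightarrow> (real^'n \<Rightarrow> real^'n) \<Rightarrow> (real^'n \<Rightarrow> real^'n^'n)" where
  "jacobian \<Omega> v = (\<lambda>x. \<chi> i. grad \<Omega> (\<lambda>y. v y $ i) x)"

definition symgrad :: "(real^'n) set \<Rightarrow> (real^'n \<Rightarrow> real^'n) \<Rightarrow> (real^'n \<Rightarrow> real^'n^'n)" where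
  "symgrad \<Omega> v = (\<lambda>x. (1/2) *\<^sub>R (jacobian \<Omega> v x + transpose (jacobian \<Omega> v x)))"

definition divergence :: "(real^'n) set \<Rightarrow> (real^'n \<Rightarrow> real^'n) \<Rightarrow> (real^'n \<Rightarrow> real)" where
  "divergence \<Omega> v = (\<lambda>x. \<Sum>i\<in>UNIV. jacobian \<Omega> v x $ i $ i)"

definition conv :: "(real^'n) set \<Rightarrow> (real^'n \<Rightarrow> real^'n) \<Rightarrow> (real^'n \<Rightarrow> real^'n) \<Rightarrow> (real^'n \<Rightarrow> real^'n)" where
  "conv \<Omega> u v = (\<lambda>x. jacobian \<Omega> v x *v u x + (1/2 * divergence \<Omega> u x) *\<^sub>R v x)"

definition conv_form ::
    "(real^'n) set \<Rightarrow> (real^'n \<Rightarrow> real^'n) \<Rightarrow> (real^'n \<Rightarrow> real^'n) \<Rightarrow> (real^'n \<Rightarrow> real^'n) \<Rightarrow> real" where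
  "conv_form \<Omega> u v w = (\<integral>x. conv \<Omega> u v x \<bullet> w x \<partial>lebesgue_on \<Omega>)"

section \<open>Spaces of functions of time\<close>

text \<open>
  \<open>L\<^sup>p(0,T;X)\<close> in the sense of Bochner, for a space \<open>X\<close> of functions with norm \<open>N\<close>:
  strong measurability (almost everywhere limit of simple functions) and integrability of \<open>N\<^sup>p\<close>.
\<close>

definition bochner_Lp ::
    "nat \<Rightarrow> real \<Rightarrow> ('y \<Rightarrow> 'b::euclidean_space) set \<Rightarrow> (('y \<Rightarrow> 'b) \<Rightarrow> real) \<Rightarrow> (real \<Rightarrow> 'y \<Rightarrow> 'b) set" where
  "bochner_Lp p T X N = {g.
     (AE t in lebesgue_on {0<..<T}. g t \<in> X) \<and>
     (\<exists>s. (\<forall>m. simple_function (lebesgue_on {0<..<T}) (s m) \<and> (\<forall>t\<in>{0<..<T}. s m t \<in> X)) \<and>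
          (AE t in lebesgue_on {0<..<T}. (\<lambda>m::nat. N (\<lambda>y. s m t y - g t y)) \<longlonglongrightarrow> 0)) \<and>
     integrable (lebesgue_on {0<..<T}) (\<lambda>t. N (g t) ^ p)}"

text \<open>
  \<open>v\<close> is the absolutely continuous representative of an element of \<open>W\<^sup>1\<^sup>,\<^sup>1(0,T;L\<^sup>2(\<Omega>))\<close> with time
  derivative \<open>v'\<close>: \<open>v(t) - v(0)\<close> is the Bochner integral of \<open>v'\<close> over \<open>(0,t)\<close>, which is identified by
  its inner products with the elements of \<open>L\<^sup>2(\<Omega>)\<close>.
\<close>

definition has_time_deriv ::
    "(real^'n) set \<Rightarrow> real \<Rightarrow> (real \<Rightarrow> real^'n \<Rightarrow> real^'n) \<Rightarrow> (real \<Rightarrow> real^'n \<Rightarrow> real^'n) \<Rightarrow> bool" where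
  "has_time_deriv \<Omega> T v v' \<longleftrightarrow>
     (\<forall>t\<in>{0..T}. v t \<in> L2 \<Omega>) \<and> v' \<in> bochner_Lp 1 T (L2 \<Omega>) (L2_norm \<Omega>) \<and>
     (\<forall>t\<in>{0..T}. \<forall>w\<in>L2 \<Omega>.
        L2_inner \<Omega> (\<lambda>x. v t x - v 0 x) w = (\<integral>s. L2_inner \<Omega> (v' s) w \<partial>lebesgue_on {0<..<t}))"

text \<open>Elements of the unit ball of \<open>H\<^sup>1\<^sub>0(0,T;L\<^sup>2(\<Omega>)\<^sup>d)\<close>, paired with their time derivatives.\<close>

definition H10_time_ball ::
    "(real^'n) set \<Rightarrow> real \<Rightarrow> ((real \<Rightarrow> real^'n \<Rightarrow> real^'n) \<times> (real \<Rightarrow> real^'n \<Rightarrow> real^'n)) set" where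
  "H10_time_ball \<Omega> T = {(v, v').
     has_time_deriv \<Omega> T v v' \<and>
     v \<in> bochner_Lp 2 T (L2 \<Omega>) (L2_norm \<Omega>) \<and> v' \<in> bochner_Lp 2 T (L2 \<Omega>) (L2_norm \<Omega>) \<and>
     L2_norm \<Omega> (v 0) = 0 \<and> L2_norm \<Omega> (v T) = 0 \<and>
     sqrt ((\<integral>t. (L2_norm \<Omega> (v t))\<^sup>2 \<partial>lebesgue_on {0<..<T})
         + (\<integral>t. (L2_norm \<Omega> (v' t))\<^sup>2 \<partial>lebesgue_on {0<..<T})) \<le> 1}"

text \<open>
  Dual norm of the functional \<open>v \<mapsto> \<integral>\<^sub>0\<^sup>T (g,v) dt\<close>; it is infinite if the functional is unbounded
  or if the time integral does not exist for some \<open>v\<close>.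
\<close>

definition Hm1_time_norm :: "(real^'n) set \<Rightarrow> real \<Rightarrow> (real \<Rightarrow> real^'n \<Rightarrow> real^'n) \<Rightarrow> ennreal" where
  "Hm1_time_norm \<Omega> T g = (SUP (v, v')\<in>H10_time_ball \<Omega> T.
     if integrable (lebesgue_on {0<..<T}) (\<lambda>t. L2_inner \<Omega> (g t) (v t))
     then ennreal \<bar>\<integral>t. L2_inner \<Omega> (g t) (v t) \<partial>lebesgue_on {0<..<T}\<bar> else \<infinity>)"

section \<open>Finite element spaces\<close>

definition polyhedral_domain :: "(real^'n) set \<Rightarrow> bool" where
  "polyhedral_domain \<Omega> \<longleftrightarrow> \<Omega> \<noteq> {} \<and> bounded \<Omega> \<and> open \<Omega> \<and> connected \<Omega> \<and>
     (\<exists>F. finite F \<and> (\<forall>P\<in>F. polytope P) \<and> \<Omega> = interior (\<Union>F))"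

text \<open>
  Elements may be arbitrary convex polytopes (in particular simplices) and need not match face to face.
\<close>

definition fe_partition :: "(real^'n) set \<Rightarrow> (real^'n) set set \<Rightarrow> bool" where
  "fe_partition \<Omega> \<T> \<longleftrightarrow> finite \<T> \<and> \<Union>\<T> = closure \<Omega> \<and>
     (\<forall>K\<in>\<T>. polytope K \<and> interior K \<noteq> {}) \<and>
     (\<forall>K\<in>\<T>. \<forall>L\<in>\<T>. K \<noteq> L \<longrightarrow> interior K \<inter> interior L = {})"

definition mesh_size :: "(real^'n) set set \<Rightarrow> real" where
  "mesh_size \<T> = Max (diameter ` \<T>)"

text \<open>
  Every element contains a ball whose radius is comparable with the global mesh size; this comprises
  shape regularity.
\<close>

definition quasi_uniform :: "(real^'n) set set set \<Rightarrow> bool" where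
  "quasi_uniform \<TT> \<longleftrightarrow> (\<exists>\<rho>>0. \<forall>\<T>\<in>\<TT>. \<forall>K\<in>\<T>. \<exists>x. ball x (\<rho> * mesh_size \<T>) \<subseteq> K)"

definition polys :: "nat \<Rightarrow> (real^'n \<Rightarrow> real) set" where
  "polys k = {p. \<exists>c. p = (\<lambda>x. \<Sum>\<alpha>\<in>{\<alpha>::'n \<Rightarrow> nat. (\<Sum>i\<in>UNIV. \<alpha> i) \<le> k}. c \<alpha> * (\<Prod>i\<in>UNIV. (x $ i) ^ \<alpha> i))}"

definition Sh :: "(real^'n) set \<Rightarrow> nat \<Rightarrow> (real^'n) set set \<Rightarrow> (real^'n \<Rightarrow> real) set" where
  "Sh \<Omega> k \<T> = {v. continuous_on (closure \<Omega>) v \<and> (\<forall>K\<in>\<T>. \<exists>p\<in>polys k. \<forall>x\<in>K. v x = p x)}"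

definition Shd :: "(real^'n) set \<Rightarrow> nat \<Rightarrow> (real^'n) set set \<Rightarrow> (real^'n \<Rightarrow> real^'n) set" where
  "Shd \<Omega> k \<T> = {v. \<forall>i. (\<lambda>x. v x $ i) \<in> Sh \<Omega> k \<T>}"

definition Vh :: "(real^'n) set \<Rightarrow> nat \<Rightarrow> (real^'n) set set \<Rightarrow> (real^'n \<Rightarrow> real^'n) set" where
  "Vh \<Omega> k \<T> = {v. \<forall>i. (\<lambda>x. v x $ i) \<in> Sh \<Omega> k \<T> \<inter> H10 \<Omega>}"

text \<open>
  Bases of \<open>V\<^sub>h\<close> and of the quotient \<open>Q\<^sub>h = S\<^sub>h/\<real>\<close>.  Classes in \<open>Q\<^sub>h\<close> are represented by elements
  of \<open>S\<^sub>h\<close>, so expansions in the pressure basis hold up to an additive constant.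
\<close>

definition velocity_basis ::
    "(real^'n) set \<Rightarrow> nat \<Rightarrow> (real^'n) set set \<Rightarrow> nat \<Rightarrow> (nat \<Rightarrow> real^'n \<Rightarrow> real^'n) \<Rightarrow> bool" where
  "velocity_basis \<Omega> k \<T> nu \<phi> \<longleftrightarrow> (\<forall>i<nu. \<phi> i \<in> Vh \<Omega> k \<T>) \<and>
     (\<forall>v\<in>Vh \<Omega> k \<T>. \<exists>!a. a \<in> {..<nu} \<rightarrow>\<^sub>E UNIV \<and> (\<forall>x\<in>closure \<Omega>. v x = (\<Sum>i<nu. a i *\<^sub>R \<phi> i x)))"

definition pressure_basis ::
    "(real^'n) set \<Rightarrow> nat \<Rightarrow> (real^'n) set set \<Rightarrow> nat \<Rightarrow> (nat \<Rightarrow> real^'n \<Rightarrow> real) \<Rightarrow> bool" where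
  "pressure_basis \<Omega> k \<T> np \<psi> \<longleftrightarrow> (\<forall>i<np. \<psi> i \<in> Sh \<Omega> k \<T>) \<and>
     (\<forall>q\<in>Sh \<Omega> k \<T>. \<exists>!a. a \<in> {..<np} \<rightarrow>\<^sub>E UNIV \<and>
        (\<exists>c. \<forall>x\<in>closure \<Omega>. q x = (\<Sum>i<np. a i * \<psi> i x) + c))"

definition subscale1 ::
    "(real^'n) set \<Rightarrow> nat \<Rightarrow> (real^'n) set set \<Rightarrow> nat \<Rightarrow> (nat \<Rightarrow> real^'n \<Rightarrow> real^'n) \<Rightarrow> (real^'n \<Rightarrow> real^'n) set" where
  "subscale1 \<Omega> k \<T> nu \<phi> = {w. \<exists>a. AE x in lebesgue_on \<Omega>.
     w x = (\<Sum>i<nu. \<Sum>j<nu. a i j *\<^sub>R L2_perp \<Omega> (Shd \<Omega> k \<T>) (conv \<Omega> (\<phi> i) (\<phi> j)) x)}"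

definition subscale2 ::
    "(real^'n) set \<Rightarrow> nat \<Rightarrow> (real^'n) set set \<Rightarrow> nat \<Rightarrow> (nat \<Rightarrow> real^'n \<Rightarrow> real) \<Rightarrow> (real^'n \<Rightarrow> real^'n) set" where
  "subscale2 \<Omega> k \<T> np \<psi> = {w. \<exists>a. AE x in lebesgue_on \<Omega>.
     w x = (\<Sum>i<np. a i *\<^sub>R L2_perp \<Omega> (Shd \<Omega> k \<T>) (grad \<Omega> (\<psi> i)) x)}"

text \<open>
  The piecewise polynomial fields to which the mesh condition with constant \<open>\<beta>\<^sub>0\<close> applies: linear
  combinations of the fields \<open>\<nabla>q\<^sub>h + N(v\<^sub>h,v\<^sub>h)\<close>.  The condition cannot hold for all piecewise
  polynomial fields, since \<open>P\<^sub>u\<^sub>,\<^sub>0 + P\<^sub>u\<^sup>\<bottom>\<close> vanishes on the orthogonal complement of \<open>V\<^sub>h\<close> in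
  \<open>S\<^sub>h\<^sup>d\<close>, which is nontrivial because \<open>S\<^sub>h\<close> contains the constants.
\<close>

definition residual_fields ::
    "(real^'n) set \<Rightarrow> nat \<Rightarrow> (real^'n) set set \<Rightarrow> (real^'n \<Rightarrow> real^'n) set" where
  "residual_fields \<Omega> k \<T> = {z. \<exists>(m::nat) a q v. (\<forall>j<m. q j \<in> Sh \<Omega> k \<T> \<and> v j \<in> Vh \<Omega> k \<T>) \<and>
     z = (\<lambda>x. \<Sum>j<m. a j *\<^sub>R (grad \<Omega> (q j) x + conv \<Omega> (v j) (v j) x))}"

section \<open>The semi-discrete problem\<close>

text \<open>The characteristic viscosity \<open>\<mu>c\<close> is a functional of the velocity field.\<close>

definition tau1 ::
    "(real^'n) set \<Rightarrow> real \<Rightarrow> real \<Rightarrow> ((real^'n \<Rightarrow> real^'n) \<Rightarrow> real) \<Rightarrow> real \<Rightarrow> (real^'n \<Rightarrow> real^'n) \<Rightarrow> real" where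
  "tau1 \<Omega> c1 c2 \<mu>c h w = inverse (c1 * \<mu>c w / h\<^sup>2 + c2 * Linf_norm \<Omega> w / h)"

definition tau2 ::
    "(real^'n) set \<Rightarrow> real \<Rightarrow> real \<Rightarrow> ((real^'n \<Rightarrow> real^'n) \<Rightarrow> real) \<Rightarrow> real \<Rightarrow> (real^'n \<Rightarrow> real^'n) \<Rightarrow> real" where
  "tau2 \<Omega> c1 c2 \<mu>c h w = h\<^sup>2 / (c1 * tau1 \<Omega> c1 c2 \<mu>c h w)"

definition tau0 ::
    "(real^'n) set \<Rightarrow> real \<Rightarrow> real \<Rightarrow> real \<Rightarrow> real \<Rightarrow> real \<Rightarrow> (real \<Rightarrow> real^'n \<Rightarrow> real^'n) \<Rightarrow> real" where
  "tau0 \<Omega> T c1 c2 \<mu>0 h u = inverse (c1 * \<mu>0 / h\<^sup>2 + c2 * (SUP t\<in>{0..T}. Linf_norm \<Omega> (u t)) / h)"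

text \<open>
  \<open>f i t\<close> is the \<open>i\<close>-th component of the force at time \<open>t\<close>, a functional on \<open>H\<^sup>1\<^sub>0(\<Omega>)\<close>.
\<close>

definition momentum_eq ::
    "(real^'n) set \<Rightarrow> nat \<Rightarrow> (real^'n) set set \<Rightarrow>
     (real^'n \<Rightarrow> real \<Rightarrow> real) \<Rightarrow> ((real^'n \<Rightarrow> real^'n) \<Rightarrow> real) \<Rightarrow> real \<Rightarrow> real \<Rightarrow>
     ('n \<Rightarrow> real \<Rightarrow> (real^'n \<Rightarrow> real) \<Rightarrow> real) \<Rightarrow> real \<Rightarrow>
     (real^'n \<Rightarrow> real^'n) \<Rightarrow> (real^'n \<Rightarrow> real^'n) \<Rightarrow> (real^'n \<Rightarrow> real) \<Rightarrow>
     (real^'n \<Rightarrow> real^'n) \<Rightarrow> (real^'n \<Rightarrow> real^'n) \<Rightarrow> bool" where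
  "momentum_eq \<Omega> k \<T> \<mu> \<mu>c c1 c2 f t u u' p u1 v \<longleftrightarrow>
     L2_inner \<Omega> u' v
     + L2_inner \<Omega> (\<lambda>x. (2 * \<mu> x (norm (symgrad \<Omega> u x))) *\<^sub>R symgrad \<Omega> u x) (symgrad \<Omega> v)
     + conv_form \<Omega> u u v
     - L2_inner \<Omega> p (divergence \<Omega> v)
     + L2_inner \<Omega> (\<lambda>x. tau2 \<Omega> c1 c2 \<mu>c (mesh_size \<T>) u * divergence \<Omega> v x)
                  (L2_perp \<Omega> (Sh \<Omega> k \<T>) (divergence \<Omega> u))
     - conv_form \<Omega> u v u1
     = (\<Sum>i\<in>UNIV. f i t (\<lambda>x. v x $ i))"

definition vms_solution ::
    "(real^'n) set \<Rightarrow> real \<Rightarrow> nat \<Rightarrow> (real^'n) set set \<Rightarrow>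
     (real^'n \<Rightarrow> real \<Rightarrow> real) \<Rightarrow> ((real^'n \<Rightarrow> real^'n) \<Rightarrow> real) \<Rightarrow> real \<Rightarrow> real \<Rightarrow>
     ('n \<Rightarrow> real \<Rightarrow> (real^'n \<Rightarrow> real) \<Rightarrow> real) \<Rightarrow> (real^'n \<Rightarrow> real^'n) \<Rightarrow>
     (real^'n \<Rightarrow> real^'n) set \<Rightarrow> (real^'n \<Rightarrow> real^'n) set \<Rightarrow>
     (real \<Rightarrow> real^'n \<Rightarrow> real^'n) \<Rightarrow> (real \<Rightarrow> real^'n \<Rightarrow> real) \<Rightarrow>
     (real \<Rightarrow> real^'n \<Rightarrow> real^'n) \<Rightarrow> (real \<Rightarrow> real^'n \<Rightarrow> real^'n) \<Rightarrow> bool" where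
  "vms_solution \<Omega> T k \<T> \<mu> \<mu>c c1 c2 f u0 W1 W2 u p u1 u2 \<longleftrightarrow>
     (\<forall>t\<in>{0..T}. u t \<in> Vh \<Omega> k \<T> \<and> u1 t \<in> W1 \<and> u2 t \<in> W2) \<and>
     (\<forall>t\<in>{0<..<T}. p t \<in> Sh \<Omega> k \<T>) \<and>
     (AE x in lebesgue_on \<Omega>. u 0 x = L2_proj \<Omega> (Vh \<Omega> k \<T>) u0 x) \<and>
     (AE x in lebesgue_on \<Omega>. u1 0 x = L2_proj \<Omega> W1 u0 x) \<and>
     (AE x in lebesgue_on \<Omega>. u2 0 x = L2_proj \<Omega> W2 u0 x) \<and>
     (\<exists>u' u1' u2'. has_time_deriv \<Omega> T u u' \<and> has_time_deriv \<Omega> T u1 u1' \<and> has_time_deriv \<Omega> T u2 u2' \<and>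
       (AE t in lebesgue_on {0<..<T}. \<forall>v\<in>Vh \<Omega> k \<T>. \<forall>q\<in>Sh \<Omega> k \<T>. \<forall>v1\<in>W1. \<forall>v2\<in>W2.
          momentum_eq \<Omega> k \<T> \<mu> \<mu>c c1 c2 f t (u t) (u' t) (p t) (u1 t) v \<and>
          L2_inner \<Omega> q (divergence \<Omega> (u t)) - L2_inner \<Omega> (grad \<Omega> q) (u2 t) = 0 \<and>
          L2_inner \<Omega> (u1' t) v1
            + inverse (tau1 \<Omega> c1 c2 \<mu>c (mesh_size \<T>) (u t)) * L2_inner \<Omega> (u1 t) v1
            + conv_form \<Omega> (u t) (u t) v1 = 0 \<and>
          L2_inner \<Omega> (u2' t) v2
            + inverse (tau1 \<Omega> c1 c2 \<mu>c (mesh_size \<T>) (u t)) * L2_inner \<Omega> (u2 t) v2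
            + L2_inner \<Omega> (grad \<Omega> (p t)) v2 = 0))"

end

theory Submission
  imports Defs
begin

text \<open>
  Testing the equations with the solution itself gives the energy estimate: it bounds the kinetic
  energies of \<open>u\<^sub>h\<close>, \<open>u\<^sub>1\<close>, \<open>u\<^sub>2\<close> uniformly in time and the time integral of the dissipation
  \<open>D = \<mu>\<^sub>\<infinity> |\<nabla>\<^sup>s u\<^sub>h|\<^sup>2 + \<tau>\<^sub>2 |P\<^sub>p\<^sup>\<bottom> div u\<^sub>h|\<^sup>2 + (|u\<^sub>1|\<^sup>2 + |u\<^sub>2|\<^sup>2) / \<tau>\<^sub>1\<close>.  Let \<open>R = \<nabla>p\<^sub>h + N(u\<^sub>h,u\<^sub>h)\<close> and
  \<open>B = P\<^sub>u\<^sub>,\<^sub>0 + P\<^sub>u\<^sup>\<bottom>\<close>.  By the mesh condition \<open>B\<close> is bounded below on the finite-dimensional space of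
  residual fields, so \<open>(R,v) = (B R, L v)\<close> with an operator \<open>L\<close> of norm at most \<open>1/\<beta>\<^sub>0\<close> that does not
  depend on time.  The components of \<open>B R\<close> in \<open>V\<^sub>h\<close> and in the two subscale spaces are, by the equations,
  minus the time derivatives of \<open>u\<^sub>h\<close>, \<open>u\<^sub>1\<close>, \<open>u\<^sub>2\<close> plus terms which, multiplied by the square root of \<open>\<tau>\<^sub>0\<close>,
  are bounded by the square root of \<open>D\<close> and by the force, thanks to inverse estimates.  The time derivatives are moved
  to \<open>L v\<close> by integration by parts in time; the latter requires only absolutely continuous coefficient
  functions and follows from Fubini's theorem.
\<close>

section \<open>The space of square integrable functions\<close>

text \<open>The time derivatives of the three unknowns are only integrable in time, so each has to
  be moved onto the test function before anything is estimated. This forces \<open>L\<close> to be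
  independent of time and leads to coefficients with respect to fixed bases of \<open>V\<close>,
  \<open>W1\<close> and \<open>W2\<close>. The mesh condition is an inequality between norms; it
  becomes an operator through residual fields \<open>z l\<close> whose images under
  \<open>Bres\<close> are orthonormal.

  The weight is \<open>tau0\<close> and not \<open>tau1\<close> because a weight depending on time
  would be differentiated along with the test function. Since \<open>tau0\<close> lies below
  \<open>tau1\<close> at every time, \<open>tau0 * s1 (u t) \<le> 1\<close>: one factor
  \<open>sqrt (s1 (u t))\<close> is absorbed by the weight, the other by the dissipation.

  The pressure carries no measurability in time, so integrability of the pairing is inherited from
  an expansion that agrees with it at almost every time. Gradients and projections are choices fixed
  only up to null sets; identities between them hold almost everywhere, and finite dimension is
  expressed by orthonormal families with a.e. expansions.\<close>

lemma borel_measurable_lebesgue_on_AE: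
  fixes v w :: "'a::euclidean_space \<Rightarrow> 'b::euclidean_space"
  assumes S: "S \<in> sets lebesgue" and v: "v \<in> borel_measurable (lebesgue_on S)"
    and eq: "AE x in lebesgue_on S. v x = w x"
  shows "w \<in> borel_measurable (lebesgue_on S)"
proof -
  have "AE x in lebesgue. (if x \<in> S then v x else 0) = (if x \<in> S then w x else 0)"
    using eq S by (subst (asm) AE_restrict_space_iff) (auto elim: eventually_mono)
  moreover have "(\<lambda>x. if x \<in> S then v x else 0) \<in> borel_measurable lebesgue"
    using v S by (simp add: borel_measurable_if)
  ultimately have "(\<lambda>x. if x \<in> S then w x else 0) \<in> borel_measurable lebesgue"
    by (rule borel_measurable_AE[rotated])
  then show ?thesis using S by (simp add: borel_measurable_if)
qed

lemma L2_zero [simp]: "(\<lambda>x. 0) \<in> L2 \<Omega>"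
  by (simp add: L2_def)

lemma L2_measurable [measurable_dest]: "v \<in> L2 \<Omega> \<Longrightarrow> v \<in> borel_measurable (lebesgue_on \<Omega>)"
  by (simp add: L2_def)

lemma L2_integrable_norm2: "v \<in> L2 \<Omega> \<Longrightarrow> integrable (lebesgue_on \<Omega>) (\<lambda>x. (norm (v x))\<^sup>2)"
  by (simp add: L2_def)

text \<open>The two functions may have different value types, so the same rule serves components,
  norms, matrix-vector products and products with a bounded factor.\<close>

lemma L2_dominated:
  fixes v :: "real^'n \<Rightarrow> 'b::euclidean_space" and w :: "real^'n \<Rightarrow> 'c::euclidean_space"
  assumes w: "w \<in> L2 \<Omega>" and v: "v \<in> borel_measurable (lebesgue_on \<Omega>)"
    and le: "AE x in lebesgue_on \<Omega>. norm (v x) \<le> B * norm (w x)"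
  shows "v \<in> L2 \<Omega>"
proof -
  have "integrable (lebesgue_on \<Omega>) (\<lambda>x. (norm (v x))\<^sup>2)"
  proof (rule Bochner_Integration.integrable_bound)
    show "integrable (lebesgue_on \<Omega>) (\<lambda>x. B\<^sup>2 * (norm (w x))\<^sup>2)"
      using L2_integrable_norm2[OF w] by simp
    show "AE x in lebesgue_on \<Omega>. norm ((norm (v x))\<^sup>2) \<le> norm (B\<^sup>2 * (norm (w x))\<^sup>2)"
      using le by eventually_elim (metis norm_ge_zero norm_power power_mono power_mult_distrib real_norm_def abs_of_nonneg zero_le_power2 mult_nonneg_nonneg)
  qed (use v in measurable)
  with v show ?thesis by (simp add: L2_def)
qed

lemma L2_scaleR: "v \<in> L2 \<Omega> \<Longrightarrow> (\<lambda>x. a *\<^sub>R v x) \<in> L2 \<Omega>"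
  by (rule L2_dominated[of v \<Omega> _ "\<bar>a\<bar>"]) (auto intro: L2_measurable)

lemma L2_add:
  assumes v: "v \<in> L2 \<Omega>" and w: "w \<in> L2 \<Omega>"
  shows "(\<lambda>x. v x + w x) \<in> L2 \<Omega>"
proof -
  have [measurable]: "v \<in> borel_measurable (lebesgue_on \<Omega>)" "w \<in> borel_measurable (lebesgue_on \<Omega>)"
    using v w by (auto simp: L2_measurable)
  have "(norm (v x + w x))\<^sup>2 \<le> 2 * (norm (v x))\<^sup>2 + 2 * (norm (w x))\<^sup>2" for x
  proof -
    have "(norm (v x + w x))\<^sup>2 \<le> (norm (v x) + norm (w x))\<^sup>2"
      by (simp add: norm_triangle_ineq power_mono)
    also have "\<dots> \<le> 2 * (norm (v x))\<^sup>2 + 2 * (norm (w x))\<^sup>2"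
      using zero_le_power2[of "norm (v x) - norm (w x)"] by (simp add: power2_eq_square algebra_simps)
    finally show ?thesis .
  qed
  then have "integrable (lebesgue_on \<Omega>) (\<lambda>x. (norm (v x + w x))\<^sup>2)"
    by (intro Bochner_Integration.integrable_bound[OF Bochner_Integration.integrable_add
        [OF integrable_mult_right[OF L2_integrable_norm2[OF v], of 2]
          integrable_mult_right[OF L2_integrable_norm2[OF w], of 2]]]) auto
  then show ?thesis by (simp add: L2_def)
qed

lemma L2_diff: "v \<in> L2 \<Omega> \<Longrightarrow> w \<in> L2 \<Omega> \<Longrightarrow> (\<lambda>x. v x - w x) \<in> L2 \<Omega>"
  using L2_add[of v \<Omega> "\<lambda>x. (-1) *\<^sub>R w x"] L2_scaleR[of w \<Omega> "-1"] by simp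

lemma L2_sum: "(\<And>i. i \<in> I \<Longrightarrow> v i \<in> L2 \<Omega>) \<Longrightarrow> (\<lambda>x. \<Sum>i\<in>I. v i x) \<in> L2 \<Omega>"
  by (induction I rule: infinite_finite_induct) (auto intro: L2_add)

lemma L2_lincomb: "(\<And>i. i \<in> I \<Longrightarrow> v i \<in> L2 \<Omega>) \<Longrightarrow> (\<lambda>x. \<Sum>i\<in>I. a i *\<^sub>R v i x) \<in> L2 \<Omega>"
  by (intro L2_sum L2_scaleR)

lemma L2_AE:
  assumes "\<Omega> \<in> sets lebesgue" "v \<in> L2 \<Omega>" "AE x in lebesgue_on \<Omega>. w x = v x"
  shows "w \<in> L2 \<Omega>"
proof (rule L2_dominated)
  show "w \<in> borel_measurable (lebesgue_on \<Omega>)"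
    by (rule borel_measurable_lebesgue_on_AE[OF assms(1) L2_measurable[OF assms(2)]])
      (use assms(3) in eventually_elim, simp)
  show "AE x in lebesgue_on \<Omega>. norm (w x) \<le> 1 * norm (v x)"
    using assms(3) by eventually_elim simp
qed (fact assms)

lemma L2_bounded:
  assumes "emeasure lebesgue \<Omega> < \<infinity>" "\<Omega> \<in> sets lebesgue" "v \<in> borel_measurable (lebesgue_on \<Omega>)"
    and "AE x in lebesgue_on \<Omega>. norm (v x) \<le> B"
  shows "v \<in> L2 \<Omega>"
proof (rule L2_dominated[where w="\<lambda>x. 1::real" and B=B])
  have "finite_measure (lebesgue_on \<Omega>)"
    using assms by (intro finite_measureI) (simp add: emeasure_restrict_space)
  then show "(\<lambda>x. 1::real) \<in> L2 \<Omega>"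
    by (simp add: L2_def finite_measure.integrable_const)
qed (use assms in auto)

lemma L2_component:
  fixes v :: "real^'n \<Rightarrow> 'b::euclidean_space^'m"
  assumes "v \<in> L2 \<Omega>" shows "(\<lambda>x. v x $ i) \<in> L2 \<Omega>"
proof (rule L2_dominated[OF assms, of _ 1])
  have "(\<lambda>y::'b^'m. y $ i) \<in> borel_measurable borel"
    by (intro borel_measurable_continuous_onI continuous_intros)
  then show "(\<lambda>x. v x $ i) \<in> borel_measurable (lebesgue_on \<Omega>)"
    using L2_measurable[OF assms] by (rule measurable_compose[rotated])
qed (simp add: Finite_Cartesian_Product.norm_nth_le)

lemma L2_inner_integrable:
  assumes "v \<in> L2 \<Omega>" "w \<in> L2 \<Omega>"
  shows "integrable (lebesgue_on \<Omega>) (\<lambda>x. v x \<bullet> w x)"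
proof -
  have [measurable]: "v \<in> borel_measurable (lebesgue_on \<Omega>)" "w \<in> borel_measurable (lebesgue_on \<Omega>)"
    using assms by (auto simp: L2_measurable)
  have "\<bar>v x \<bullet> w x\<bar> \<le> (norm (v x))\<^sup>2 + (norm (w x))\<^sup>2" for x
  proof -
    have "\<bar>v x \<bullet> w x\<bar> \<le> norm (v x) * norm (w x)" by (rule Cauchy_Schwarz_ineq2)
    also have "\<dots> \<le> (norm (v x))\<^sup>2 + (norm (w x))\<^sup>2"
      using zero_le_power2[of "norm (v x) - norm (w x)"] zero_le_power2[of "norm (v x) + norm (w x)"]
      by (simp add: power2_eq_square algebra_simps)
        (smt (verit) mult_nonneg_nonneg norm_ge_zero)
    finally show ?thesis .
  qed
  then show ?thesis
    by (intro Bochner_Integration.integrable_bound[OF Bochner_Integration.integrable_add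
        [OF L2_integrable_norm2[OF assms(1)] L2_integrable_norm2[OF assms(2)]]]) auto
qed

lemma L2_inner_commute: "L2_inner \<Omega> v w = L2_inner \<Omega> w v"
  by (simp add: L2_inner_def inner_commute)

lemma L2_inner_add_left:
  "v \<in> L2 \<Omega> \<Longrightarrow> w \<in> L2 \<Omega> \<Longrightarrow> y \<in> L2 \<Omega> \<Longrightarrow>
    L2_inner \<Omega> (\<lambda>x. v x + w x) y = L2_inner \<Omega> v y + L2_inner \<Omega> w y"
  unfolding L2_inner_def
  by (simp add: inner_add_left Bochner_Integration.integral_add L2_inner_integrable)

lemma L2_inner_diff_left:
  "v \<in> L2 \<Omega> \<Longrightarrow> w \<in> L2 \<Omega> \<Longrightarrow> y \<in> L2 \<Omega> \<Longrightarrow>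
    L2_inner \<Omega> (\<lambda>x. v x - w x) y = L2_inner \<Omega> v y - L2_inner \<Omega> w y"
  unfolding L2_inner_def
  by (simp add: inner_diff_left Bochner_Integration.integral_diff L2_inner_integrable)

lemma L2_inner_scaleR_left: "L2_inner \<Omega> (\<lambda>x. a *\<^sub>R v x) y = a * L2_inner \<Omega> v y"
  unfolding L2_inner_def by simp

lemma L2_inner_zero_left [simp]: "L2_inner \<Omega> (\<lambda>x. 0) y = 0"
  by (simp add: L2_inner_def)

lemma L2_inner_zero_right [simp]: "L2_inner \<Omega> y (\<lambda>x. 0) = 0"
  by (simp add: L2_inner_def)

lemma L2_inner_sum_left:
  assumes "\<And>i. i \<in> I \<Longrightarrow> v i \<in> L2 \<Omega>" "y \<in> L2 \<Omega>"
  shows "L2_inner \<Omega> (\<lambda>x. \<Sum>i\<in>I. v i x) y = (\<Sum>i\<in>I. L2_inner \<Omega> (v i) y)"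
  unfolding L2_inner_def inner_sum_left
  by (rule Bochner_Integration.integral_sum) (auto intro: L2_inner_integrable assms)

lemma L2_inner_lincomb_left:
  assumes "\<And>i. i \<in> I \<Longrightarrow> v i \<in> L2 \<Omega>" "y \<in> L2 \<Omega>"
  shows "L2_inner \<Omega> (\<lambda>x. \<Sum>i\<in>I. a i *\<^sub>R v i x) y = (\<Sum>i\<in>I. a i * L2_inner \<Omega> (v i) y)"
  using L2_inner_sum_left[of I "\<lambda>i x. a i *\<^sub>R v i x" \<Omega> y] assms
  by (simp add: L2_scaleR L2_inner_scaleR_left)

lemma L2_inner_lincomb_right:
  assumes "\<And>i. i \<in> I \<Longrightarrow> v i \<in> L2 \<Omega>" "y \<in> L2 \<Omega>"
  shows "L2_inner \<Omega> y (\<lambda>x. \<Sum>i\<in>I. a i *\<^sub>R v i x) = (\<Sum>i\<in>I. a i * L2_inner \<Omega> y (v i))"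
  using L2_inner_lincomb_left[OF assms, where a=a] by (simp add: L2_inner_commute)

lemma L2_inner_add_right:
  "v \<in> L2 \<Omega> \<Longrightarrow> w \<in> L2 \<Omega> \<Longrightarrow> y \<in> L2 \<Omega> \<Longrightarrow>
    L2_inner \<Omega> y (\<lambda>x. v x + w x) = L2_inner \<Omega> y v + L2_inner \<Omega> y w"
  using L2_inner_add_left[of v \<Omega> w y] by (simp add: L2_inner_commute)

lemma L2_inner_diff_right:
  "v \<in> L2 \<Omega> \<Longrightarrow> w \<in> L2 \<Omega> \<Longrightarrow> y \<in> L2 \<Omega> \<Longrightarrow>
    L2_inner \<Omega> y (\<lambda>x. v x - w x) = L2_inner \<Omega> y v - L2_inner \<Omega> y w"
  using L2_inner_diff_left[of v \<Omega> w y] by (simp add: L2_inner_commute)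

lemma L2_inner_scaleR_right: "L2_inner \<Omega> v (\<lambda>x. a *\<^sub>R y x) = a * L2_inner \<Omega> v y"
  unfolding L2_inner_def by simp

lemma L2_inner_cong_AE:
  assumes "\<Omega> \<in> sets lebesgue" "v \<in> L2 \<Omega>" "y \<in> L2 \<Omega>"
    and "AE x in lebesgue_on \<Omega>. v' x = v x" "AE x in lebesgue_on \<Omega>. y' x = y x"
  shows "L2_inner \<Omega> v' y' = L2_inner \<Omega> v y"
proof -
  have "v' \<in> L2 \<Omega>" "y' \<in> L2 \<Omega>" using L2_AE assms by blast+
  then show ?thesis
    unfolding L2_inner_def using assms
    by (intro integral_cong_AE) (auto simp: L2_measurable)
qed

lemma L2_inner_self_nonneg [simp]: "0 \<le> L2_inner \<Omega> v v"
  unfolding L2_inner_def by (simp add: Bochner_Integration.integral_nonneg)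

lemma L2_norm_power2: "(L2_norm \<Omega> v)\<^sup>2 = L2_inner \<Omega> v v"
  by (simp add: L2_norm_def)

lemma L2_norm_nonneg [simp]: "0 \<le> L2_norm \<Omega> v"
  by (simp add: L2_norm_def)

lemma L2_norm_zero [simp]: "L2_norm \<Omega> (\<lambda>x. 0) = 0"
  by (simp add: L2_norm_def)

lemma L2_norm_scaleR: "L2_norm \<Omega> (\<lambda>x. a *\<^sub>R v x) = \<bar>a\<bar> * L2_norm \<Omega> v"
  by (simp add: L2_norm_def L2_inner_scaleR_left L2_inner_scaleR_right real_sqrt_mult
      mult.assoc[symmetric] flip: power2_eq_square)

lemma L2_norm_cong_AE:
  assumes "\<Omega> \<in> sets lebesgue" "v \<in> L2 \<Omega>" "AE x in lebesgue_on \<Omega>. v' x = v x"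
  shows "L2_norm \<Omega> v' = L2_norm \<Omega> v"
  using L2_inner_cong_AE[of \<Omega> v v v' v'] assms by (simp add: L2_norm_def)

lemma L2_inner_AE_zero:
  assumes "AE x in lebesgue_on \<Omega>. v x = 0"
  shows "L2_inner \<Omega> v w = 0"
proof -
  have "AE x in lebesgue_on \<Omega>. v x \<bullet> w x = 0" using assms by eventually_elim simp
  then show ?thesis unfolding L2_inner_def by (rule integral_eq_zero_AE)
qed

lemma L2_norm_eq_0_iff:
  assumes "v \<in> L2 \<Omega>"
  shows "L2_norm \<Omega> v = 0 \<longleftrightarrow> (AE x in lebesgue_on \<Omega>. v x = 0)"
proof -
  have "L2_norm \<Omega> v = 0 \<longleftrightarrow> (\<integral>x. v x \<bullet> v x \<partial>lebesgue_on \<Omega>) = 0"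
    by (simp add: L2_norm_def L2_inner_def)
  also have "\<dots> \<longleftrightarrow> (AE x in lebesgue_on \<Omega>. v x \<bullet> v x = 0)"
    by (rule integral_nonneg_eq_0_iff_AE) (auto intro: L2_inner_integrable assms)
  finally show ?thesis by simp
qed

text \<open>\<open>L2_norm\<close> is only a seminorm on functions, so \<open>w\<close> of norm zero
  is treated apart: it vanishes almost everywhere, and so does the inner product. Otherwise the
  squared norm of \<open>v\<close> minus its component along \<open>w\<close> is
  nonnegative.\<close>

lemma L2_Cauchy_Schwarz:
  assumes v: "v \<in> L2 \<Omega>" and w: "w \<in> L2 \<Omega>"
  shows "\<bar>L2_inner \<Omega> v w\<bar> \<le> L2_norm \<Omega> v * L2_norm \<Omega> w"
proof (cases "L2_norm \<Omega> w = 0")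
  case True
  then have "AE x in lebesgue_on \<Omega>. w x = 0" using w by (simp add: L2_norm_eq_0_iff)
  then have "L2_inner \<Omega> v w = 0" by (subst L2_inner_commute) (rule L2_inner_AE_zero)
  then show ?thesis by simp
next
  case False
  define a where "a = L2_inner \<Omega> v w / L2_inner \<Omega> w w"
  have ww: "L2_inner \<Omega> w w > 0"
    using False L2_inner_self_nonneg[of \<Omega> w] by (auto simp: L2_norm_def less_eq_real_def)
  have aw: "(\<lambda>x. a *\<^sub>R w x) \<in> L2 \<Omega>" by (rule L2_scaleR[OF w])
  have "0 \<le> L2_inner \<Omega> (\<lambda>x. v x - a *\<^sub>R w x) (\<lambda>x. v x - a *\<^sub>R w x)" by simp
  also have "\<dots> = L2_inner \<Omega> v v - 2 * a * L2_inner \<Omega> v w + a\<^sup>2 * L2_inner \<Omega> w w"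
    using v w aw L2_diff[OF v aw] by (simp add: L2_inner_diff_left L2_inner_diff_right L2_inner_scaleR_left
        L2_inner_scaleR_right L2_inner_commute[of \<Omega> w v] power2_eq_square algebra_simps)
  also have "\<dots> = L2_inner \<Omega> v v - (L2_inner \<Omega> v w)\<^sup>2 / L2_inner \<Omega> w w"
    using ww by (simp add: a_def field_simps power2_eq_square)
  finally have "(L2_inner \<Omega> v w)\<^sup>2 \<le> L2_inner \<Omega> v v * L2_inner \<Omega> w w"
    using ww by (simp add: field_simps)
  then have "(L2_inner \<Omega> v w)\<^sup>2 \<le> (L2_norm \<Omega> v * L2_norm \<Omega> w)\<^sup>2"
    by (simp add: power_mult_distrib L2_norm_power2)
  then show ?thesis by (simp add: abs_le_square_iff[symmetric])
qed

lemma L2_norm_triangle: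
  assumes v: "v \<in> L2 \<Omega>" and w: "w \<in> L2 \<Omega>"
  shows "L2_norm \<Omega> (\<lambda>x. v x + w x) \<le> L2_norm \<Omega> v + L2_norm \<Omega> w"
proof (rule power2_le_imp_le)
  have "(L2_norm \<Omega> (\<lambda>x. v x + w x))\<^sup>2 = L2_inner \<Omega> v v + 2 * L2_inner \<Omega> v w + L2_inner \<Omega> w w"
    using v w by (simp add: L2_norm_power2 L2_inner_add_left L2_inner_add_right L2_add
        L2_inner_commute[of \<Omega> w v])
  then show "(L2_norm \<Omega> (\<lambda>x. v x + w x))\<^sup>2 \<le> (L2_norm \<Omega> v + L2_norm \<Omega> w)\<^sup>2"
    using L2_Cauchy_Schwarz[OF v w] by (simp add: power2_sum L2_norm_power2)
qed simp

lemma L2_norm_mono: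
  fixes v :: "real^'n \<Rightarrow> 'b::euclidean_space" and w :: "real^'n \<Rightarrow> 'c::euclidean_space"
  assumes w: "w \<in> L2 \<Omega>" and v: "v \<in> borel_measurable (lebesgue_on \<Omega>)"
    and le: "AE x in lebesgue_on \<Omega>. norm (v x) \<le> B * norm (w x)" and B: "0 \<le> B"
  shows "L2_norm \<Omega> v \<le> B * L2_norm \<Omega> w"
proof (rule power2_le_imp_le)
  have v': "v \<in> L2 \<Omega>" by (rule L2_dominated[OF w v le])
  have "L2_inner \<Omega> v v \<le> (\<integral>x. B\<^sup>2 * (w x \<bullet> w x) \<partial>lebesgue_on \<Omega>)"
    unfolding L2_inner_def
  proof (rule integral_mono_AE)
    show "AE x in lebesgue_on \<Omega>. v x \<bullet> v x \<le> B\<^sup>2 * (w x \<bullet> w x)"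
      using le by eventually_elim
        (metis dot_square_norm norm_ge_zero power_mono power_mult_distrib)
  qed (use L2_inner_integrable v' w in auto)
  then show "(L2_norm \<Omega> v)\<^sup>2 \<le> (B * L2_norm \<Omega> w)\<^sup>2"
    by (simp add: L2_norm_power2 power_mult_distrib L2_inner_def)
qed (use B in auto)

lemma L2_inner_cart_sum:
  fixes v w :: "real^'n \<Rightarrow> 'b::euclidean_space^'m"
  assumes "\<And>i. (\<lambda>x. v x $ i) \<in> L2 \<Omega>" "\<And>i. (\<lambda>x. w x $ i) \<in> L2 \<Omega>"
  shows "L2_inner \<Omega> v w = (\<Sum>i\<in>UNIV. L2_inner \<Omega> (\<lambda>x. v x $ i) (\<lambda>x. w x $ i))"
  unfolding L2_inner_def inner_vec_def
  by (rule Bochner_Integration.integral_sum) (use assms in \<open>auto intro: L2_inner_integrable\<close>)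

section \<open>Finite-dimensional subspaces and orthogonal projections\<close>

definition lin_closed :: "('a \<Rightarrow> 'b::real_vector) set \<Rightarrow> bool" where
  "lin_closed W \<longleftrightarrow> (\<lambda>x. 0) \<in> W \<and> (\<forall>v\<in>W. \<forall>w\<in>W. \<forall>a b. (\<lambda>x. a *\<^sub>R v x + b *\<^sub>R w x) \<in> W)"

lemma lin_closedD:
  "lin_closed W \<Longrightarrow> v \<in> W \<Longrightarrow> w \<in> W \<Longrightarrow> (\<lambda>x. a *\<^sub>R v x + b *\<^sub>R w x) \<in> W"
  by (simp add: lin_closed_def)

lemma lin_closed_sum:
  assumes "lin_closed W" "\<And>i. i \<in> I \<Longrightarrow> v i \<in> W"
  shows "(\<lambda>x. \<Sum>i\<in>I. a i *\<^sub>R v i x) \<in> W"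
  using assms(2)
proof (induction I rule: infinite_finite_induct)
  case (insert i I)
  then have "v i \<in> W" "(\<lambda>x. \<Sum>j\<in>I. a j *\<^sub>R v j x) \<in> W" by auto
  from lin_closedD[OF assms(1) this, of "a i" 1] show ?case using insert by simp
qed (use assms(1) in \<open>auto simp: lin_closed_def\<close>)

section \<open>Orthonormal families, Bessel's inequality and Gram-Schmidt\<close>

definition orthonormal_fam :: "(real^'n) set \<Rightarrow> nat \<Rightarrow> (nat \<Rightarrow> real^'n \<Rightarrow> 'b::euclidean_space) \<Rightarrow> bool" where
  "orthonormal_fam \<Omega> m e \<longleftrightarrow> (\<forall>i<m. e i \<in> L2 \<Omega>) \<and>
     (\<forall>i<m. \<forall>j<m. L2_inner \<Omega> (e i) (e j) = (if i = j then 1 else 0))"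

text \<open>Finite dimension modulo null functions. The subscale spaces are stable under changes on
  null sets, so a pointwise expansion would be too much to ask; the basis functions themselves,
  however, have to be members of \<open>W\<close>.\<close>

definition L2_onb ::
    "(real^'n) set \<Rightarrow> (real^'n \<Rightarrow> 'b::euclidean_space) set \<Rightarrow> nat \<Rightarrow> (nat \<Rightarrow> real^'n \<Rightarrow> 'b) \<Rightarrow> bool" where
  "L2_onb \<Omega> W m e \<longleftrightarrow> W \<subseteq> L2 \<Omega> \<and> lin_closed W \<and> (\<forall>i<m. e i \<in> W) \<and> orthonormal_fam \<Omega> m e \<and>
     (\<forall>w\<in>W. AE x in lebesgue_on \<Omega>. w x = (\<Sum>j<m. L2_inner \<Omega> w (e j) *\<^sub>R e j x))"

lemma orthonormal_fam_coeff:
  assumes "orthonormal_fam \<Omega> m e" "i < m"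
  shows "L2_inner \<Omega> (\<lambda>x. \<Sum>j<m. a j *\<^sub>R e j x) (e i) = a i"
proof -
  have "L2_inner \<Omega> (\<lambda>x. \<Sum>j<m. a j *\<^sub>R e j x) (e i) = (\<Sum>j<m. a j * L2_inner \<Omega> (e j) (e i))"
    using assms by (intro L2_inner_lincomb_left) (auto simp: orthonormal_fam_def)
  also have "\<dots> = (\<Sum>j<m. if j = i then a j else 0)"
    using assms by (intro sum.cong) (auto simp: orthonormal_fam_def)
  finally show ?thesis using assms by simp
qed

text \<open>The squared norm of \<open>v\<close> minus its Fourier sum \<open>w\<close> is
  nonnegative, and both \<open>(v, w)\<close> and \<open>(w, w)\<close> equal the sum of the squared
  coefficients.\<close>

lemma orthonormal_fam_Bessel:
  assumes e: "orthonormal_fam \<Omega> m e" and v: "v \<in> L2 \<Omega>"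
  shows "(\<Sum>j<m. (L2_inner \<Omega> v (e j))\<^sup>2) \<le> (L2_norm \<Omega> v)\<^sup>2"
proof -
  define w where "w = (\<lambda>x. \<Sum>j<m. L2_inner \<Omega> v (e j) *\<^sub>R e j x)"
  have w: "w \<in> L2 \<Omega>" unfolding w_def using e by (intro L2_lincomb) (auto simp: orthonormal_fam_def)
  have vw: "L2_inner \<Omega> v w = (\<Sum>j<m. (L2_inner \<Omega> v (e j))\<^sup>2)"
    unfolding w_def using e v
    by (subst L2_inner_lincomb_right) (auto simp: orthonormal_fam_def power2_eq_square)
  have "L2_inner \<Omega> w w = (\<Sum>j<m. L2_inner \<Omega> v (e j) * L2_inner \<Omega> w (e j))"
    using w e unfolding w_def by (subst L2_inner_lincomb_right) (auto simp: orthonormal_fam_def)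
  also have "\<dots> = (\<Sum>j<m. (L2_inner \<Omega> v (e j))\<^sup>2)"
    unfolding w_def
    by (intro sum.cong refl)
      (simp add: orthonormal_fam_coeff[OF e, where a="\<lambda>j. L2_inner \<Omega> v (e j)"] power2_eq_square)
  finally have ww: "L2_inner \<Omega> w w = (\<Sum>j<m. (L2_inner \<Omega> v (e j))\<^sup>2)" .
  have "0 \<le> L2_inner \<Omega> (\<lambda>x. v x - w x) (\<lambda>x. v x - w x)" by simp
  also have "\<dots> = L2_inner \<Omega> v v - (\<Sum>j<m. (L2_inner \<Omega> v (e j))\<^sup>2)"
    using v w vw ww by (simp add: L2_inner_diff_left L2_inner_diff_right L2_diff L2_inner_commute[of \<Omega> w v])
  finally show ?thesis by (simp add: L2_norm_power2)
qed

text \<open>A generator whose remainder has norm zero is dropped, so no independence is asked. The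
  matrix \<open>A\<close> gives each \<open>e j\<close> pointwise, not just almost everywhere, as a
  combination of the generators; the new functions therefore stay in every linear class that
  contains the \<open>g i\<close>, for instance the polynomials.\<close>

lemma gram_schmidt:
  fixes g :: "'i \<Rightarrow> real^'n \<Rightarrow> 'b::euclidean_space"
  assumes "finite I" "\<And>i. i \<in> I \<Longrightarrow> g i \<in> L2 \<Omega>"
  shows "\<exists>m A e. (\<forall>j x. e j x = (\<Sum>i\<in>I. A j i *\<^sub>R g i x)) \<and> orthonormal_fam \<Omega> m e \<and>
    (\<forall>i\<in>I. AE x in lebesgue_on \<Omega>. g i x = (\<Sum>j<m. L2_inner \<Omega> (g i) (e j) *\<^sub>R e j x))"
  using assms
proof (induction I)
  case empty
  show ?case by (rule exI[of _ 0], rule exI, rule exI[of _ "\<lambda>j x. 0"]) (auto simp: orthonormal_fam_def)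
next
  case (insert k I)
  obtain m A e where e_def: "\<And>j x. e j x = (\<Sum>i\<in>I. A j i *\<^sub>R g i x)"
    and e: "orthonormal_fam \<Omega> m e"
    and span: "\<And>i. i \<in> I \<Longrightarrow> AE x in lebesgue_on \<Omega>. g i x = (\<Sum>j<m. L2_inner \<Omega> (g i) (e j) *\<^sub>R e j x)"
    using insert.IH[OF insert.prems[OF insertI2]] by blast
  have eL: "j < m \<Longrightarrow> e j \<in> L2 \<Omega>" for j using e by (simp add: orthonormal_fam_def)
  have gk: "g k \<in> L2 \<Omega>" using insert by simp
  define s where "s = (\<lambda>x. \<Sum>j<m. L2_inner \<Omega> (g k) (e j) *\<^sub>R e j x)"
  define r where "r = (\<lambda>x. g k x - s x)"
  have s: "s \<in> L2 \<Omega>" unfolding s_def by (intro L2_lincomb) (auto intro: eL)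
  have r: "r \<in> L2 \<Omega>" unfolding r_def by (intro L2_diff gk s)
  have re: "L2_inner \<Omega> r (e j) = 0" if "j < m" for j
    using that gk s eL orthonormal_fam_coeff[OF e that, of "\<lambda>j. L2_inner \<Omega> (g k) (e j)"]
    unfolding r_def by (subst L2_inner_diff_left) (auto simp: s_def)
  show ?case
  proof (cases "L2_norm \<Omega> r = 0")
    case True
    define A' where "A' = (\<lambda>j i. if i = k then 0 else A j i)"
    have A'x: "e j x = (\<Sum>i\<in>insert k I. A' j i *\<^sub>R g i x)" for j x
      unfolding e_def A'_def using insert by (auto intro!: sum.cong)
    have "AE x in lebesgue_on \<Omega>. g k x = s x"
      using True r by (subst (asm) L2_norm_eq_0_iff) (auto simp: r_def)
    then have sp: "\<forall>i\<in>insert k I. AE x in lebesgue_on \<Omega>. g i x = (\<Sum>j<m. L2_inner \<Omega> (g i) (e j) *\<^sub>R e j x)"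
      using span by (auto simp: s_def)
    show ?thesis
      by (intro exI[of _ m] exI[of _ A'] exI[of _ e] conjI allI) (fact A'x, fact e, fact sp)
  next
    case False
    define n where "n = L2_norm \<Omega> r"
    have n: "n > 0" using False L2_norm_nonneg[of \<Omega> r] unfolding n_def by linarith
    \<comment> \<open>From index \<open>m\<close> on, the row holds the coefficients of
      \<open>(g k - s) / n\<close>, with \<open>s\<close> rewritten in terms of the earlier
      generators.\<close>
    define A' where "A' = (\<lambda>j i. if j < m then (if i = k then 0 else A j i) else
        (if i = k then 1 / n else - (\<Sum>l<m. L2_inner \<Omega> (g k) (e l) * A l i) / n))"
    define e' where "e' = (\<lambda>j. if j < m then e j else (\<lambda>x. (1/n) *\<^sub>R r x))"
    have A'x: "e' j x = (\<Sum>i\<in>insert k I. A' j i *\<^sub>R g i x)" for j x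
    proof (cases "j < m")
      case True
      then show ?thesis unfolding e_def A'_def e'_def using insert by (auto intro!: sum.cong)
    next
      case False
      have "s x = (\<Sum>l<m. \<Sum>i\<in>I. (L2_inner \<Omega> (g k) (e l) * A l i) *\<^sub>R g i x)"
        unfolding s_def by (simp add: e_def scaleR_sum_right)
      also have "\<dots> = (\<Sum>i\<in>I. (\<Sum>l<m. L2_inner \<Omega> (g k) (e l) * A l i) *\<^sub>R g i x)"
        by (subst sum.swap) (simp add: scaleR_sum_left)
      finally have sx: "s x = \<dots>" .
      have "(\<Sum>i\<in>I. (- (\<Sum>l<m. L2_inner \<Omega> (g k) (e l) * A l i) / n) *\<^sub>R g i x) = (1/n) *\<^sub>R (- s x)"
        unfolding sx by (simp add: scaleR_sum_right sum_negf divide_inverse mult.commute)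
      moreover have "(\<Sum>i\<in>I. A' j i *\<^sub>R g i x) = (\<Sum>i\<in>I. (- (\<Sum>l<m. L2_inner \<Omega> (g k) (e l) * A l i) / n) *\<^sub>R g i x)"
        using False insert(2) unfolding A'_def by (intro sum.cong) auto
      ultimately show ?thesis
        using False insert(1,2) by (simp add: A'_def e'_def r_def algebra_simps)
    qed
    have rr: "L2_inner \<Omega> r r = n\<^sup>2" by (simp add: n_def L2_norm_power2)
    have e'_lt: "e' i = e i" if "i < m" for i using that by (simp add: e'_def)
    have e'_m: "e' m = (\<lambda>x. (1/n) *\<^sub>R r x)" by (simp add: e'_def)
    have o': "orthonormal_fam \<Omega> (Suc m) e'"
      unfolding orthonormal_fam_def
    proof (intro conjI allI impI)
      fix i assume "i < Suc m"
      then show "e' i \<in> L2 \<Omega>"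
        using eL[of i] L2_scaleR[OF r] by (cases "i = m") (auto simp: e'_lt e'_m)
    next
      fix i j assume ij: "i < Suc m" "j < Suc m"
      consider "i < m" "j < m" | "i < m" "j = m" | "i = m" "j < m" | "i = m" "j = m"
        using ij by linarith
      then show "L2_inner \<Omega> (e' i) (e' j) = (if i = j then 1 else 0)"
      proof cases
        case 1 then show ?thesis using e by (simp add: e'_lt orthonormal_fam_def)
      next
        case 2 then show ?thesis
          using re[of i] by (simp add: e'_lt e'_m L2_inner_scaleR_right L2_inner_commute[of _ "e i"])
      next
        case 3 then show ?thesis using re[of j] by (simp add: e'_lt e'_m L2_inner_scaleR_left)
      next
        case 4 then show ?thesis
          using n by (simp add: e'_m L2_inner_scaleR_left L2_inner_scaleR_right rr power2_eq_square)
      qed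
    qed
    have sp: "AE x in lebesgue_on \<Omega>. g i x = (\<Sum>j<Suc m. L2_inner \<Omega> (g i) (e' j) *\<^sub>R e' j x)" 
      if i: "i \<in> insert k I" for i
    proof (cases "i = k")
      case True
      have "L2_inner \<Omega> s r = 0"
        unfolding s_def using r eL re by (subst L2_inner_lincomb_left) (auto simp: L2_inner_commute[of _ _ r])
      then have "L2_inner \<Omega> (g k) r = n\<^sup>2"
        using L2_inner_add_left[OF r s r] rr by (simp add: r_def)
      then have "L2_inner \<Omega> (g k) (e' m) = n"
        using n by (simp add: e'_def L2_inner_scaleR_right power2_eq_square)
      then have "g k x = (\<Sum>j<Suc m. L2_inner \<Omega> (g k) (e' j) *\<^sub>R e' j x)" for x
        using n by (simp add: e'_def s_def r_def)
      then show ?thesis using True by simp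
    next
      case False
      then have iI: "i \<in> I" using i by simp
      let ?s = "\<lambda>x. \<Sum>j<m. L2_inner \<Omega> (g i) (e j) *\<^sub>R e j x"
      have sL: "?s \<in> L2 \<Omega>" by (intro L2_lincomb) (auto intro: eL)
      \<comment> \<open>An old generator is a.e. a combination of the old \<open>e j\<close>, hence
        orthogonal to \<open>r\<close>: its new coefficient is zero and its expansion
        persists.\<close>
      have "AE x in lebesgue_on \<Omega>. g i x - ?s x = 0" using span[OF iI] by eventually_elim simp
      then have "L2_inner \<Omega> (\<lambda>x. g i x - ?s x) r = 0" by (rule L2_inner_AE_zero)
      moreover have "L2_inner \<Omega> ?s r = 0"
        using r eL re by (subst L2_inner_lincomb_left) (auto simp: L2_inner_commute[of _ _ r])
      ultimately have "L2_inner \<Omega> (g i) r = 0"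
        using L2_inner_diff_left[of "g i" \<Omega> ?s r] insert(4) iI sL r by simp
      then have "L2_inner \<Omega> (g i) (e' m) = 0" by (simp add: e'_def L2_inner_scaleR_right)
      then show ?thesis using span[OF iI] by (simp add: e'_def)
    qed
    show ?thesis
      by (intro exI[of _ "Suc m"] exI[of _ A'] exI[of _ e'] conjI allI ballI) (fact A'x, fact o', fact sp)
  qed
qed

text \<open>The Fourier coefficients are linear in \<open>w\<close>, so the expansions of the
  generators regroup to an expansion of every a.e. combination of them.\<close>

lemma L2_onb_exists:
  fixes g :: "'i \<Rightarrow> real^'n \<Rightarrow> 'b::euclidean_space"
  assumes W: "W \<subseteq> L2 \<Omega>" "lin_closed W" and I: "finite I" "\<And>i. i \<in> I \<Longrightarrow> g i \<in> W"
    and span: "\<And>w. w \<in> W \<Longrightarrow> \<exists>c. AE x in lebesgue_on \<Omega>. w x = (\<Sum>i\<in>I. c i *\<^sub>R g i x)"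
    and \<Omega>: "\<Omega> \<in> sets lebesgue"
  shows "\<exists>m e. L2_onb \<Omega> W m e"
proof -
  have gL: "i \<in> I \<Longrightarrow> g i \<in> L2 \<Omega>" for i using W I by auto
  obtain m A e where e_def: "\<And>j x. e j x = (\<Sum>i\<in>I. A j i *\<^sub>R g i x)"
    and e: "orthonormal_fam \<Omega> m e"
    and sp: "\<And>i. i \<in> I \<Longrightarrow> AE x in lebesgue_on \<Omega>. g i x = (\<Sum>j<m. L2_inner \<Omega> (g i) (e j) *\<^sub>R e j x)"
    using gram_schmidt[of I g \<Omega>, OF I(1) gL] by blast
  have e_fun: "e j = (\<lambda>x. \<Sum>i\<in>I. A j i *\<^sub>R g i x)" for j using e_def by blast
  have eW: "e j \<in> W" for j unfolding e_fun by (rule lin_closed_sum[OF W(2)]) (rule I(2))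
  have "AE x in lebesgue_on \<Omega>. w x = (\<Sum>j<m. L2_inner \<Omega> w (e j) *\<^sub>R e j x)" if w: "w \<in> W" for w
  proof -
    obtain c where c: "AE x in lebesgue_on \<Omega>. w x = (\<Sum>i\<in>I. c i *\<^sub>R g i x)" using span[OF w] by blast
    have "L2_inner \<Omega> w (e j) = (\<Sum>i\<in>I. c i * L2_inner \<Omega> (g i) (e j))" for j
    proof -
      have "L2_inner \<Omega> w (e j) = L2_inner \<Omega> (\<lambda>x. \<Sum>i\<in>I. c i *\<^sub>R g i x) (e j)"
        using \<Omega> c W eW gL by (intro L2_inner_cong_AE) (auto intro: L2_lincomb)
      also have "\<dots> = (\<Sum>i\<in>I. c i * L2_inner \<Omega> (g i) (e j))"
        using gL W eW by (intro L2_inner_lincomb_left) auto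
      finally show ?thesis .
    qed
    moreover have "AE x in lebesgue_on \<Omega>. \<forall>i\<in>I. g i x = (\<Sum>j<m. L2_inner \<Omega> (g i) (e j) *\<^sub>R e j x)"
      using I(1) sp by (simp add: AE_ball_countable uncountable_infinite countable_finite)
    with c have "AE x in lebesgue_on \<Omega>. w x = (\<Sum>i\<in>I. c i *\<^sub>R (\<Sum>j<m. L2_inner \<Omega> (g i) (e j) *\<^sub>R e j x))"
      by eventually_elim simp
    then have "AE x in lebesgue_on \<Omega>. w x = (\<Sum>j<m. (\<Sum>i\<in>I. c i * L2_inner \<Omega> (g i) (e j)) *\<^sub>R e j x)"
      by eventually_elim (simp add: scaleR_sum_right scaleR_sum_left sum.swap[of _ I])
    ultimately show ?thesis by simp
  qed
  then show ?thesis using W e eW unfolding L2_onb_def by blast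
qed

section \<open>Orthogonal projections onto finite-dimensional spaces\<close>

context
  fixes \<Omega> :: "(real^'n) set" and W :: "(real^'n \<Rightarrow> 'b::euclidean_space) set" and m e
  assumes \<Omega>: "\<Omega> \<in> sets lebesgue" and onb: "L2_onb \<Omega> W m e"
begin

lemma L2_onb_inner:
  assumes w: "w \<in> W" and y: "y \<in> L2 \<Omega>"
  shows "L2_inner \<Omega> w y = (\<Sum>j<m. L2_inner \<Omega> w (e j) * L2_inner \<Omega> y (e j))"
proof -
  have eL: "j < m \<Longrightarrow> e j \<in> L2 \<Omega>" for j using onb by (simp add: L2_onb_def orthonormal_fam_def)
  have "L2_inner \<Omega> w y = L2_inner \<Omega> (\<lambda>x. \<Sum>j<m. L2_inner \<Omega> w (e j) *\<^sub>R e j x) y"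
    using onb w y eL by (intro L2_inner_cong_AE[OF \<Omega>]) (auto simp: L2_onb_def intro: L2_lincomb)
  also have "\<dots> = (\<Sum>j<m. L2_inner \<Omega> w (e j) * L2_inner \<Omega> (e j) y)"
    using eL y by (intro L2_inner_lincomb_left) auto
  finally show ?thesis by (simp add: L2_inner_commute)
qed

lemma L2_onb_norm:
  assumes "w \<in> W" shows "(L2_norm \<Omega> w)\<^sup>2 = (\<Sum>j<m. (L2_inner \<Omega> w (e j))\<^sup>2)"
  using L2_onb_inner[OF assms, of w] assms onb
  by (simp add: L2_norm_power2 L2_onb_def subset_iff flip: power2_eq_square)

text \<open>\<open>L2_proj\<close> is a choice, so its defining property has to be secured by a
  witness: the Fourier sum of \<open>v\<close> lies in \<open>W\<close> and has the same inner
  products with \<open>W\<close> as \<open>v\<close>.\<close>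

lemma L2_proj_props:
  assumes v: "v \<in> L2 \<Omega>"
  shows L2_proj_in: "L2_proj \<Omega> W v \<in> W"
    and L2_proj_orth: "y \<in> W \<Longrightarrow> L2_inner \<Omega> (L2_proj \<Omega> W v) y = L2_inner \<Omega> v y"
proof -
  have WL: "W \<subseteq> L2 \<Omega>" using onb by (simp add: L2_onb_def)
  have eL: "j < m \<Longrightarrow> e j \<in> L2 \<Omega>" for j using onb by (simp add: L2_onb_def orthonormal_fam_def)
  define w where "w = (\<lambda>x. \<Sum>j<m. L2_inner \<Omega> v (e j) *\<^sub>R e j x)"
  have w: "w \<in> W" unfolding w_def using onb by (intro lin_closed_sum) (auto simp: L2_onb_def)
  have "L2_inner \<Omega> (\<lambda>x. v x - w x) y = 0" if y: "y \<in> W" for y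
  proof -
    have "L2_inner \<Omega> w y = (\<Sum>j<m. L2_inner \<Omega> v (e j) * L2_inner \<Omega> (e j) y)"
      unfolding w_def using eL WL y by (intro L2_inner_lincomb_left) auto
    also have "\<dots> = L2_inner \<Omega> v y"
      using L2_onb_inner[OF y v] by (simp add: L2_inner_commute mult.commute)
    finally show ?thesis using v w y WL by (subst L2_inner_diff_left) auto
  qed
  with w have "L2_proj \<Omega> W v \<in> W \<and> (\<forall>y\<in>W. L2_inner \<Omega> (\<lambda>x. v x - L2_proj \<Omega> W v x) y = 0)"
    unfolding L2_proj_def by (intro someI_ex[where P="\<lambda>w. w \<in> W \<and> (\<forall>y\<in>W. L2_inner \<Omega> (\<lambda>x. v x - w x) y = 0)"]) blast
  then have P: "L2_proj \<Omega> W v \<in> W" "\<And>y. y \<in> W \<Longrightarrow> L2_inner \<Omega> (\<lambda>x. v x - L2_proj \<Omega> W v x) y = 0"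
    by blast+
  show "L2_proj \<Omega> W v \<in> W" by (fact P)
  show "L2_inner \<Omega> (L2_proj \<Omega> W v) y = L2_inner \<Omega> v y" if "y \<in> W"
  proof -
    have "L2_proj \<Omega> W v \<in> L2 \<Omega>" "y \<in> L2 \<Omega>" using P(1) WL that by auto
    then show ?thesis using P(2)[OF that] L2_inner_diff_left[of v \<Omega> "L2_proj \<Omega> W v" y] v by simp
  qed
qed

lemma L2_proj_L2: "v \<in> L2 \<Omega> \<Longrightarrow> L2_proj \<Omega> W v \<in> L2 \<Omega>"
  using L2_proj_in onb by (auto simp: L2_onb_def)

lemma L2_perp_L2: "v \<in> L2 \<Omega> \<Longrightarrow> L2_perp \<Omega> W v \<in> L2 \<Omega>"
  unfolding L2_perp_def by (intro L2_diff L2_proj_L2)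

lemma L2_perp_orth: "v \<in> L2 \<Omega> \<Longrightarrow> y \<in> W \<Longrightarrow> L2_inner \<Omega> (L2_perp \<Omega> W v) y = 0"
  unfolding L2_perp_def using onb
  by (subst L2_inner_diff_left) (auto simp: L2_proj_L2 L2_proj_orth L2_onb_def)

text \<open>The difference of two candidates lies in \<open>W\<close> and is orthogonal to itself.
  The congruence and linearity rules for the projection follow by exhibiting a candidate.\<close>

lemma L2_proj_unique:
  assumes v: "v \<in> L2 \<Omega>" and w: "w \<in> W" and orth: "\<And>y. y \<in> W \<Longrightarrow> L2_inner \<Omega> w y = L2_inner \<Omega> v y"
  shows "AE x in lebesgue_on \<Omega>. L2_proj \<Omega> W v x = w x"
proof -
  have WL: "W \<subseteq> L2 \<Omega>" using onb by (simp add: L2_onb_def)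
  let ?P = "L2_proj \<Omega> W v"
  have "(\<lambda>x. 1 *\<^sub>R ?P x + (-1) *\<^sub>R w x) \<in> W"
    using onb by (intro lin_closedD L2_proj_in v w) (simp add: L2_onb_def)
  then have d: "(\<lambda>x. ?P x - w x) \<in> W" by simp
  have "L2_inner \<Omega> (\<lambda>x. ?P x - w x) (\<lambda>x. ?P x - w x) = 0"
    using d w WL L2_proj_in[OF v] L2_proj_orth[OF v d] orth[OF d]
    by (subst L2_inner_diff_left) auto
  then show ?thesis
    using L2_norm_eq_0_iff[of "\<lambda>x. ?P x - w x" \<Omega>] d WL by (auto simp: L2_norm_def)
qed

lemma L2_proj_cong_AE:
  assumes "v \<in> L2 \<Omega>" "AE x in lebesgue_on \<Omega>. v' x = v x"
  shows "AE x in lebesgue_on \<Omega>. L2_proj \<Omega> W v' x = L2_proj \<Omega> W v x"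
proof -
  have WL: "W \<subseteq> L2 \<Omega>" using onb by (simp add: L2_onb_def)
  have v': "v' \<in> L2 \<Omega>" using L2_AE \<Omega> assms by blast
  show ?thesis
    using assms WL by (intro L2_proj_unique v' L2_proj_in)
      (auto simp: L2_proj_orth intro!: L2_inner_cong_AE[OF \<Omega>, symmetric])
qed

lemma L2_proj_lincomb:
  assumes "\<And>i. i \<in> I \<Longrightarrow> v i \<in> L2 \<Omega>"
  shows "AE x in lebesgue_on \<Omega>. L2_proj \<Omega> W (\<lambda>x. \<Sum>i\<in>I. a i *\<^sub>R v i x) x = (\<Sum>i\<in>I. a i *\<^sub>R L2_proj \<Omega> W (v i) x)"
proof (rule L2_proj_unique)
  show "(\<lambda>x. \<Sum>i\<in>I. a i *\<^sub>R L2_proj \<Omega> W (v i) x) \<in> W"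
    using onb assms by (intro lin_closed_sum L2_proj_in) (auto simp: L2_onb_def)
  show "L2_inner \<Omega> (\<lambda>x. \<Sum>i\<in>I. a i *\<^sub>R L2_proj \<Omega> W (v i) x) y = L2_inner \<Omega> (\<lambda>x. \<Sum>i\<in>I. a i *\<^sub>R v i x) y"
    if "y \<in> W" for y
    using that onb assms by (subst (1 2) L2_inner_lincomb_left) (auto simp: L2_onb_def L2_proj_L2 L2_proj_orth)
qed (use assms L2_lincomb in blast)

lemma L2_perp_lincomb:
  assumes "\<And>i. i \<in> I \<Longrightarrow> v i \<in> L2 \<Omega>"
  shows "AE x in lebesgue_on \<Omega>. L2_perp \<Omega> W (\<lambda>x. \<Sum>i\<in>I. a i *\<^sub>R v i x) x = (\<Sum>i\<in>I. a i *\<^sub>R L2_perp \<Omega> W (v i) x)"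
proof -
  have "AE x in lebesgue_on \<Omega>.
      L2_proj \<Omega> W (\<lambda>x. \<Sum>i\<in>I. a i *\<^sub>R v i x) x = (\<Sum>i\<in>I. a i *\<^sub>R L2_proj \<Omega> W (v i) x)"
    by (rule L2_proj_lincomb[OF assms])
  then show ?thesis unfolding L2_perp_def
    by eventually_elim (simp add: scaleR_diff_right sum_subtractf)
qed

lemma L2_perp_cong_AE:
  assumes "v \<in> L2 \<Omega>" "AE x in lebesgue_on \<Omega>. v' x = v x"
  shows "AE x in lebesgue_on \<Omega>. L2_perp \<Omega> W v' x = L2_perp \<Omega> W v x"
  using L2_proj_cong_AE[OF assms] assms(2) unfolding L2_perp_def by eventually_elim simp

text \<open>The coefficients of the projection are those of \<open>v\<close>, so Bessel's inequality
  applies.\<close>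

lemma L2_norm_proj_le: "v \<in> L2 \<Omega> \<Longrightarrow> L2_norm \<Omega> (L2_proj \<Omega> W v) \<le> L2_norm \<Omega> v"
proof (rule power2_le_imp_le)
  assume v: "v \<in> L2 \<Omega>"
  have "(L2_norm \<Omega> (L2_proj \<Omega> W v))\<^sup>2 = (\<Sum>j<m. (L2_inner \<Omega> (L2_proj \<Omega> W v) (e j))\<^sup>2)"
    by (intro L2_onb_norm L2_proj_in v)
  also have "\<dots> = (\<Sum>j<m. (L2_inner \<Omega> v (e j))\<^sup>2)"
    using onb by (intro sum.cong) (auto simp: L2_proj_orth v L2_onb_def)
  also have "\<dots> \<le> (L2_norm \<Omega> v)\<^sup>2"
    using onb v by (intro orthonormal_fam_Bessel) (auto simp: L2_onb_def)
  finally show "(L2_norm \<Omega> (L2_proj \<Omega> W v))\<^sup>2 \<le> (L2_norm \<Omega> v)\<^sup>2" .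
qed simp

end

section \<open>Test functions\<close>

lemma has_derivative_pderiv_at:
  "(\<phi> has_derivative D) (at x) \<Longrightarrow> pderiv_at i \<phi> x = D (axis i 1)"
  by (simp add: pderiv_at_def frechet_derivative_at[symmetric])

lemma pderiv_at_has_derivative:
  assumes "\<phi> differentiable (at x)"
  shows "(\<phi> has_derivative (\<lambda>h. \<Sum>i\<in>UNIV. h $ i * pderiv_at i \<phi> x)) (at x)"
proof -
  obtain D where D: "(\<phi> has_derivative D) (at x)" using assms by (auto simp: differentiable_def)
  have "D h = (\<Sum>i\<in>UNIV. h $ i * pderiv_at i \<phi> x)" for h
  proof -
    have "D h = D (\<Sum>i\<in>UNIV. h $ i *\<^sub>R axis i 1)" by (metis basis_expansion scalar_mult_eq_scaleR)
    also have "\<dots> = (\<Sum>i\<in>UNIV. h $ i * D (axis i 1))"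
      using has_derivative_linear[OF D] by (simp add: linear_sum linear_scale)
    finally show ?thesis using has_derivative_pderiv_at[OF D] by simp
  qed
  then have "D = (\<lambda>h. \<Sum>i\<in>UNIV. h $ i * pderiv_at i \<phi> x)" by (rule ext)
  with D show ?thesis by simp
qed

lemma pderiv_at_const: "pderiv_at i (\<lambda>x. c) = (\<lambda>x. 0)"
  by (rule ext) (subst has_derivative_pderiv_at[OF has_derivative_const], simp)

lemma pderiv_at_coord: "pderiv_at i (\<lambda>x. x $ j) = (\<lambda>x. if i = j then 1 else 0)"
  by (rule ext) (subst has_derivative_pderiv_at[OF bounded_linear_imp_has_derivative[OF bounded_linear_vec_nth]],
    simp add: axis_def)

lemma pderiv_at_add:
  assumes "f differentiable (at x)" "g differentiable (at x)"
  shows "pderiv_at i (\<lambda>x. f x + g x) x = pderiv_at i f x + pderiv_at i g x"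
proof -
  obtain D E where D: "(f has_derivative D) (at x)" "(g has_derivative E) (at x)"
    using assms by (auto simp: differentiable_def)
  then show ?thesis
    using has_derivative_pderiv_at[OF has_derivative_add[OF D]] D[THEN has_derivative_pderiv_at] by simp
qed

lemma pderiv_at_mult:
  assumes "f differentiable (at x)" "g differentiable (at x)"
  shows "pderiv_at i (\<lambda>x. f x * g x) x = f x * pderiv_at i g x + pderiv_at i f x * g x"
proof -
  obtain D E where D: "(f has_derivative D) (at x)" "(g has_derivative E) (at x)"
    using assms by (auto simp: differentiable_def)
  then show ?thesis
    using has_derivative_pderiv_at[OF has_derivative_mult[OF D]] D[THEN has_derivative_pderiv_at] by simp
qed

text \<open>Equality near the point is enough; inside an element this identifies the derivatives of
  a piecewise function with those of the smooth function it coincides with there.\<close>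

lemma pderiv_at_cong:
  assumes "open S" "x \<in> S" "\<And>y. y \<in> S \<Longrightarrow> f y = g y" "g differentiable (at x)"
  shows "f differentiable (at x)" and "pderiv_at i f x = pderiv_at i g x"
proof -
  obtain D where D: "(g has_derivative D) (at x)"
    using assms by (auto simp: differentiable_def)
  have E: "(f has_derivative D) (at x)"
    by (rule has_derivative_transform_within_open[OF D assms(1,2)]) (use assms(3) in simp)
  then show "f differentiable (at x)" by (auto simp: differentiable_def)
  show "pderiv_at i f x = pderiv_at i g x"
    using has_derivative_pderiv_at[OF D] has_derivative_pderiv_at[OF E] by simp
qed

text \<open>\<open>flat 0\<close> is the standard smooth function vanishing on the negative half line; the other
  members of the family make it closed under differentiation.\<close>

definition flat :: "nat \<Rightarrow> real \<Rightarrow> real" where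
  "flat m s = (if s > 0 then exp (- 1 / s) / s ^ m else 0)"

text \<open>From the right, \<open>s = 1 / y\<close> turns the claim into
  \<open>y ^ m / exp y\<close> tending to zero at infinity; from the left the function is
  zero.\<close>

lemma flat_tendsto_0: "(flat m \<longlongrightarrow> 0) (at 0)"
proof -
  have "((\<lambda>y. y ^ m / exp y) \<longlongrightarrow> (0::real)) at_top" by (rule tendsto_power_div_exp_0)
  then have "((\<lambda>y. flat m (inverse y)) \<longlongrightarrow> 0) at_top"
    by (rule Lim_transform_eventually)
      (use eventually_gt_at_top[of 0] in eventually_elim,
        simp add: flat_def exp_minus field_simps)
  then have r: "(flat m \<longlongrightarrow> 0) (at_right 0)" by (simp add: filterlim_at_right_to_top)
  have "\<forall>\<^sub>F s in at_left 0. flat m s = 0"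
    by (auto simp: flat_def eventually_at_filter)
  then have "(flat m \<longlongrightarrow> 0) (at_left 0)" by (rule tendsto_eventually)
  with r show ?thesis by (simp add: filterlim_split_at)
qed

lemma flat_has_derivative:
  "(flat m has_real_derivative (flat (m + 2) s - real m * flat (m + 1) s)) (at s)"
proof -
  consider "s < 0" | "s > 0" | "s = 0" by linarith
  then show ?thesis
  proof cases
    case 1
    have "((\<lambda>s. 0) has_real_derivative 0) (at s)" by simp
    then have "(flat m has_real_derivative 0) (at s)"
      by (rule has_field_derivative_transform_within_open[where S="{..<0}"])
        (use 1 in \<open>auto simp: flat_def\<close>)
    then show ?thesis using 1 by (simp add: flat_def)
  next
    case 2
    have "((\<lambda>s. exp (- 1 / s) / s ^ m) has_real_derivative
        (flat (m + 2) s - real m * flat (m + 1) s)) (at s)"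
    proof (cases m)
      case 0
      then show ?thesis using 2
        by (auto intro!: derivative_eq_intros simp: flat_def divide_simps power2_eq_square)
    next
      case (Suc n)
      show ?thesis unfolding Suc using 2
        by (auto intro!: derivative_eq_intros simp: flat_def divide_simps power2_eq_square)
          (cases n; simp add: algebra_simps)
    qed
    then show ?thesis
      by (rule has_field_derivative_transform_within_open[where S="{0<..}"])
        (use 2 in \<open>auto simp: flat_def\<close>)
  next
    case 3
    \<comment> \<open>The difference quotient of \<open>flat m\<close> at 0 is
      \<open>flat (Suc m)\<close>, whose limit at 0 is known.\<close>
    have "((\<lambda>h. (flat m (0 + h) - flat m 0) / h) \<longlongrightarrow> 0) (at 0)"
      by (rule Lim_transform_eventually[OF flat_tendsto_0[of "Suc m"]])
        (auto simp: eventually_at_filter flat_def)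
    then have "(flat m has_real_derivative 0) (at 0)" by (simp add: DERIV_def)
    then show ?thesis using 3 by (simp add: flat_def)
  qed
qed

text \<open>A grammar for smooth functions: given ones enter through \<open>base\<close>, and the
  bump functions are built with the other rules. Each rule is matched by a first order
  differentiation rule whose result is again in the class, so derivatives of all orders exist
  without any higher product or chain rule.\<close>

inductive smooth_fun :: "(real^'n \<Rightarrow> real) \<Rightarrow> bool" where
  base: "(\<And>js x. pderivs js \<phi> differentiable (at x)) \<Longrightarrow> smooth_fun \<phi>"
| const: "smooth_fun (\<lambda>x. c)"
| coord: "smooth_fun (\<lambda>x. x $ j)"
| add: "smooth_fun f \<Longrightarrow> smooth_fun g \<Longrightarrow> smooth_fun (\<lambda>x. f x + g x)"
| mult: "smooth_fun f \<Longrightarrow> smooth_fun g \<Longrightarrow> smooth_fun (\<lambda>x. f x * g x)"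
| flat: "smooth_fun f \<Longrightarrow> smooth_fun (\<lambda>x. flat m (f x))"

lemma pderivs_append: "pderivs (js @ [i]) \<phi> = pderivs js (pderiv_at i \<phi>)"
  by (induction js) auto

lemma smooth_fun_pderiv_at:
  "smooth_fun f \<Longrightarrow> (\<forall>x. f differentiable (at x)) \<and> (\<forall>i. smooth_fun (pderiv_at i f))"
proof (induction rule: smooth_fun.induct)
  case (base \<phi>)
  \<comment> \<open>The head of the index list is differentiated last, so replacing
    \<open>\<phi>\<close> by one of its derivatives appends an index at the end.\<close>
  have "pderivs js (pderiv_at i \<phi>) differentiable (at x)" for js i x
    using base[of "js @ [i]" x] by (simp add: pderivs_append)
  then show ?case using base[of "[]"] by (auto intro: smooth_fun.base)
next
  case (const c)
  then show ?case by (auto simp: pderiv_at_const intro: smooth_fun.const)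
next
  case (coord j)
  have "(\<lambda>x. x $ j) differentiable (at x)" for x
    using bounded_linear_imp_has_derivative[OF bounded_linear_vec_nth] differentiableI by blast
  then show ?case by (auto simp: pderiv_at_coord intro: smooth_fun.const)
next
  case (add f g)
  then have "pderiv_at i (\<lambda>x. f x + g x) = (\<lambda>x. pderiv_at i f x + pderiv_at i g x)" for i
    by (auto simp: pderiv_at_add)
  with add show ?case by (auto intro: smooth_fun.add)
next
  case (mult f g)
  then have "pderiv_at i (\<lambda>x. f x * g x) = (\<lambda>x. f x * pderiv_at i g x + pderiv_at i f x * g x)" for i
    by (auto simp: pderiv_at_mult)
  with mult show ?case by (auto intro!: smooth_fun.add smooth_fun.mult)
next
  case (flat f m)
  have D: "((\<lambda>x. flat m (f x)) has_derivative
      (\<lambda>h. (\<Sum>i\<in>UNIV. h $ i * pderiv_at i f x) * (flat (m + 2) (f x) - real m * flat (m + 1) (f x)))) (at x)" for x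
    using has_derivative_compose[OF pderiv_at_has_derivative[of f x]
        has_field_derivative_imp_has_derivative[OF flat_has_derivative[of m "f x"]]] flat
    by (simp add: mult.commute)
  have e: "pderiv_at i (\<lambda>x. flat m (f x)) =
      (\<lambda>x. pderiv_at i f x * (flat (m + 2) (f x) + (- real m) * flat (m + 1) (f x)))" for i
    by (rule ext) (simp add: has_derivative_pderiv_at[OF D] axis_def if_distrib[of "\<lambda>x. x * _"] cong: if_cong)
  have "smooth_fun (pderiv_at i f)" for i using flat by blast
  then have "smooth_fun (pderiv_at i (\<lambda>x. flat m (f x)))" for i
    unfolding e by (intro smooth_fun.mult smooth_fun.add smooth_fun.const smooth_fun.flat flat)
  with D show ?case unfolding differentiable_def by blast
qed

lemma smooth_fun_pderivs: "smooth_fun f \<Longrightarrow> pderivs js f differentiable (at x)"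
proof -
  assume f: "smooth_fun f"
  have "smooth_fun (pderivs js f)" using f by (induction js) (auto dest: smooth_fun_pderiv_at)
  then show ?thesis using smooth_fun_pderiv_at by blast
qed

lemma smooth_fun_prod: "(\<And>i. i \<in> I \<Longrightarrow> smooth_fun (f i)) \<Longrightarrow> smooth_fun (\<lambda>x. \<Prod>i\<in>I. f i x)"
  by (induction I rule: infinite_finite_induct) (auto intro: smooth_fun.const smooth_fun.mult)

lemma test_functions_iff:
  "\<phi> \<in> test_functions \<Omega> \<longleftrightarrow> smooth_fun \<phi> \<and> (\<exists>K. compact K \<and> K \<subseteq> \<Omega> \<and> (\<forall>x. x \<notin> K \<longrightarrow> \<phi> x = 0))"
  unfolding test_functions_def using smooth_fun_pderivs smooth_fun.base by blast

lemma test_functions_cmult: "\<phi> \<in> test_functions \<Omega> \<Longrightarrow> (\<lambda>x. a * \<phi> x) \<in> test_functions \<Omega>"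
  unfolding test_functions_iff by (auto intro: smooth_fun.mult smooth_fun.const)

lemma test_functions_add:
  assumes "\<phi> \<in> test_functions \<Omega>" "\<psi> \<in> test_functions \<Omega>"
  shows "(\<lambda>x. \<phi> x + \<psi> x) \<in> test_functions \<Omega>"
proof -
  obtain K L where "compact K" "K \<subseteq> \<Omega>" "\<forall>x. x \<notin> K \<longrightarrow> \<phi> x = 0" "compact L" "L \<subseteq> \<Omega>" "\<forall>x. x \<notin> L \<longrightarrow> \<psi> x = 0"
    using assms by (auto simp: test_functions_iff)
  then have "compact (K \<union> L) \<and> K \<union> L \<subseteq> \<Omega> \<and> (\<forall>x. x \<notin> K \<union> L \<longrightarrow> \<phi> x + \<psi> x = 0)"
    by (auto simp: compact_Un)
  then show ?thesis using assms by (auto simp: test_functions_iff intro: smooth_fun.add)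
qed

section \<open>Continuously differentiable functions and their bounds on compact sets\<close>

definition C1 :: "(real^'n \<Rightarrow> real) \<Rightarrow> bool" where
  "C1 f \<longleftrightarrow> (\<forall>x. f differentiable (at x)) \<and> (\<forall>i. continuous_on UNIV (pderiv_at i f))"

lemma C1_continuous: "C1 f \<Longrightarrow> continuous_on S f"
  unfolding C1_def using differentiable_imp_continuous_within continuous_at_imp_continuous_on by blast

lemma smooth_fun_C1: "smooth_fun f \<Longrightarrow> C1 f"
  unfolding C1_def
  using smooth_fun_pderiv_at differentiable_imp_continuous_within continuous_at_imp_continuous_on by meson

lemma test_functions_C1: "\<phi> \<in> test_functions \<Omega> \<Longrightarrow> C1 \<phi>"
  by (simp add: test_functions_iff smooth_fun_C1)

lemma C1_const: "C1 (\<lambda>x. c)"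
  by (intro smooth_fun_C1 smooth_fun.const)

lemma C1_coord: "C1 (\<lambda>x. x $ i)"
  by (intro smooth_fun_C1 smooth_fun.coord)

lemma C1_add: "C1 f \<Longrightarrow> C1 g \<Longrightarrow> C1 (\<lambda>x. f x + g x)"
proof -
  assume fg: "C1 f" "C1 g"
  then have "pderiv_at i (\<lambda>x. f x + g x) = (\<lambda>x. pderiv_at i f x + pderiv_at i g x)" for i
    by (auto simp: pderiv_at_add C1_def)
  with fg show ?thesis by (auto simp: C1_def intro: continuous_on_add)
qed

lemma C1_mult: "C1 f \<Longrightarrow> C1 g \<Longrightarrow> C1 (\<lambda>x. f x * g x)"
proof -
  assume fg: "C1 f" "C1 g"
  then have "pderiv_at i (\<lambda>x. f x * g x) = (\<lambda>x. f x * pderiv_at i g x + pderiv_at i f x * g x)" for i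
    by (auto simp: pderiv_at_mult C1_def)
  with fg show ?thesis
    using C1_continuous by (auto simp: C1_def intro!: continuous_on_add continuous_on_mult)
qed

lemma C1_cmult: "C1 f \<Longrightarrow> C1 (\<lambda>x. a * f x)"
  by (intro C1_mult C1_const)

lemma C1_sum: "(\<And>i. i \<in> I \<Longrightarrow> C1 (f i)) \<Longrightarrow> C1 (\<lambda>x. \<Sum>i\<in>I. f i x)"
  by (induction I rule: infinite_finite_induct) (auto intro: C1_const C1_add)

lemma C1_prod: "(\<And>i. i \<in> I \<Longrightarrow> C1 (f i)) \<Longrightarrow> C1 (\<lambda>x. \<Prod>i\<in>I. f i x)"
  by (induction I rule: infinite_finite_induct) (auto intro: C1_const C1_mult)

lemma C1_power: "C1 f \<Longrightarrow> C1 (\<lambda>x. f x ^ m)"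
  by (induction m) (auto intro: C1_const C1_mult)

text \<open>The complement of the compact set is open and the function is zero on it, so the
  derivative vanishes there too and the support does not grow.\<close>

lemma test_functions_pderiv_at:
  assumes "\<phi> \<in> test_functions \<Omega>" shows "pderiv_at i \<phi> \<in> test_functions \<Omega>"
proof -
  obtain K where K: "compact K" "K \<subseteq> \<Omega>" "\<forall>x. x \<notin> K \<longrightarrow> \<phi> x = 0" and s: "smooth_fun \<phi>"
    using assms by (auto simp: test_functions_iff)
  have "pderiv_at i \<phi> x = 0" if "x \<notin> K" for x
    using pderiv_at_cong(2)[of "- K" x \<phi> "\<lambda>x. 0" i] K that
    by (simp add: pderiv_at_const compact_imp_closed open_Compl)
  moreover have "smooth_fun (pderiv_at i \<phi>)" using smooth_fun_pderiv_at[OF s] by blast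
  ultimately show ?thesis using K by (auto simp: test_functions_iff)
qed

lemma C1_compact_bound:
  assumes "C1 f" "compact K"
  shows "\<exists>B\<ge>0. (\<forall>x\<in>K. \<bar>f x\<bar> \<le> B) \<and> (\<forall>i. \<forall>x\<in>K. \<bar>pderiv_at i f x\<bar> \<le> B)"
proof -
  have cont: "bounded (g ` K)" if "continuous_on UNIV g" for g :: "real^'a \<Rightarrow> real"
    using that assms(2) compact_continuous_image continuous_on_subset compact_imp_bounded subset_UNIV by metis
  have "\<exists>B\<ge>0. \<forall>x\<in>K. \<bar>g x\<bar> \<le> B" if "continuous_on UNIV g" for g :: "real^'a \<Rightarrow> real"
    using cont[OF that] by (auto simp: bounded_iff) (meson abs_ge_zero dual_order.trans linorder_le_cases)
  then have ex: "\<forall>i. \<exists>B. B \<ge> 0 \<and> (\<forall>x\<in>K. \<bar>pderiv_at i f x\<bar> \<le> B)" and "\<exists>B0\<ge>0. \<forall>x\<in>K. \<bar>f x\<bar> \<le> B0"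
    using assms(1) C1_continuous[OF assms(1), of UNIV] unfolding C1_def by blast+
  then obtain B0 where B0: "B0 \<ge> 0" "\<And>x. x \<in> K \<Longrightarrow> \<bar>f x\<bar> \<le> B0" by blast
  obtain B where B: "\<And>i. B i \<ge> 0" "\<And>i x. x \<in> K \<Longrightarrow> \<bar>pderiv_at i f x\<bar> \<le> B i"
    using choice[OF ex] by blast
  have le: "B i \<le> (\<Sum>i\<in>UNIV. B i)" for i using B(1) by (intro member_le_sum) auto
  have nn: "0 \<le> (\<Sum>i\<in>UNIV. B i)" using B(1) by (intro sum_nonneg)
  have "\<bar>f x\<bar> \<le> B0 + (\<Sum>i\<in>UNIV. B i)" if "x \<in> K" for x using B0(2)[OF that] nn by linarith
  moreover have "\<bar>pderiv_at i f x\<bar> \<le> B0 + (\<Sum>i\<in>UNIV. B i)" if "x \<in> K" for x i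
    using B(2)[OF that, of i] le[of i] B0(1) by linarith
  ultimately show ?thesis using nn B0(1) by (intro exI[of _ "B0 + (\<Sum>i\<in>UNIV. B i)"]) auto
qed

text \<open>Mean value inequality on a convex set; the operator norm of the derivative is at most
  the dimension times the bound of the partial derivatives.\<close>

lemma C1_Lipschitz:
  assumes f: "C1 f" and K: "compact K" "convex K"
  shows "\<exists>L\<ge>0. \<forall>x\<in>K. \<forall>y\<in>K. \<bar>f x - f y\<bar> \<le> L * norm (x - y)"
proof -
  obtain B where B: "B \<ge> 0" "\<And>i x. x \<in> K \<Longrightarrow> \<bar>pderiv_at i f x\<bar> \<le> B"
    using C1_compact_bound[OF f K(1)] by blast
  define L where "L = B * CARD('a)"
  have on: "onorm (\<lambda>h. \<Sum>i\<in>UNIV. h $ i * pderiv_at i f x) \<le> L" if "x \<in> K" for x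
  proof (rule onorm_le)
    fix h :: "real^'a"
    have "norm (\<Sum>i\<in>UNIV. h $ i * pderiv_at i f x) \<le> (\<Sum>i\<in>(UNIV::'a set). norm h * B)"
      by (rule sum_norm_le)
        (auto simp: abs_mult intro!: mult_mono component_le_norm_cart B that)
    then show "norm (\<Sum>i\<in>UNIV. h $ i * pderiv_at i f x) \<le> L * norm h" by (simp add: L_def algebra_simps)
  qed
  have "norm (f x - f y) \<le> L * norm (x - y)" if "x \<in> K" "y \<in> K" for x y
    by (rule differentiable_bound[OF K(2) has_derivative_at_withinI[OF pderiv_at_has_derivative] on])
      (use f that in \<open>auto simp: C1_def\<close>)
  then show ?thesis using B(1) by (intro exI[of _ L]) (auto simp: L_def)
qed

section \<open>Weak gradients\<close>

lemma integral_lebesgue_on_lborel: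
  fixes f :: "'a::euclidean_space \<Rightarrow> 'b::euclidean_space"
  assumes "\<Omega> \<in> sets borel" "f \<in> borel_measurable borel"
  shows "integral\<^sup>L (lebesgue_on \<Omega>) f = (\<integral>x. indicator \<Omega> x *\<^sub>R f x \<partial>lborel)"
  using assms by (subst integral_restrict_space) (auto intro!: integral_completion)

lemma AE_lebesgue_lborel: "(AE x in lebesgue. P x) \<longleftrightarrow> (AE x in lborel. P x)"
  by (rule AE_completion_iff)

text \<open>With \<open>s i x\<close> the product of the signed distances to the two faces in
  direction \<open>i\<close>, the product of the factors \<open>exp (- 1 / (n * s i x))\<close>, cut
  off at zero, is smooth, lies between 0 and 1, vanishes off the open box and tends to 1 inside
  it.\<close>

lemma bump_sequence:
  fixes a b :: "real^'n"
  assumes "cbox a b \<subseteq> \<Omega>"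
  shows "\<exists>\<phi>. (\<forall>n::nat. \<phi> n \<in> test_functions \<Omega>) \<and> (\<forall>n x. \<bar>\<phi> n x\<bar> \<le> 1) \<and>
    (\<forall>x. (\<lambda>n. \<phi> n x) \<longlonglongrightarrow> indicator (box a b) x)"
proof -
  define s where "s = (\<lambda>i x::real^'n. (x $ i - a $ i) * (b $ i - x $ i))"
  \<comment> \<open>For crossed bounds \<open>a $ i > b $ i\<close> the factor \<open>s i\<close> is
    positive between them, so an empty box has to receive the zero function.\<close>
  define \<phi> where "\<phi> = (\<lambda>n x. if box a b = {} then 0 else \<Prod>i\<in>UNIV. flat 0 (real n * s i x))"
  have flat_bd: "0 \<le> flat 0 r" "flat 0 r \<le> 1" for r by (auto simp: flat_def)
  show ?thesis
  proof (cases "box a b = {}")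
    case True
    then show ?thesis
      by (intro exI[of _ "\<lambda>n x. 0"]) (auto simp: test_functions_iff intro: smooth_fun.const)
  next
    case False
    then have ab: "a $ i < b $ i" for i
      by (simp add: interval_ne_empty_cart)
    have in_box: "x \<in> box a b \<longleftrightarrow> (\<forall>i. s i x > 0)" for x
    proof
      show "\<forall>i. s i x > 0" if "x \<in> box a b" using that by (simp add: mem_box_cart s_def)
      show "x \<in> box a b" if "\<forall>i. s i x > 0"
        unfolding mem_box_cart
      proof
        fix i
        have "s i x > 0" using that by blast
        then show "a $ i < x $ i \<and> x $ i < b $ i"
          using ab[of i] by (auto simp: s_def zero_less_mult_iff)
      qed
    qed
    have out: "\<phi> n x = 0" if "x \<notin> box a b" for n x
    proof -
      have "\<not> (\<forall>i. s i x > 0)" using that in_box[of x] by simp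
      then obtain i where "\<not> s i x > 0" by blast
      then have i: "s i x \<le> 0" by simp
      then have "flat 0 (real n * s i x) = 0" by (simp add: flat_def mult_le_0_iff not_less)
      then have "(\<Prod>i\<in>UNIV. flat 0 (real n * s i x)) = 0" by (intro prod_zero) auto
      then show ?thesis by (simp add: \<phi>_def)
    qed
    have sm: "smooth_fun (\<phi> n)" for n
    proof -
      have "smooth_fun (\<lambda>x. \<Prod>i\<in>UNIV. flat 0 (real n * ((x $ i + - (a $ i)) * (b $ i + - 1 * x $ i))))"
        by (intro smooth_fun_prod smooth_fun.flat smooth_fun.mult smooth_fun.add smooth_fun.const smooth_fun.coord)
      then show ?thesis using False by (simp add: \<phi>_def s_def)
    qed
    have "\<phi> n x = 0" if "x \<notin> cbox a b" for n x
      using out[of x n] that box_subset_cbox[of a b] by blast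
    then have "\<phi> n \<in> test_functions \<Omega>" for n
      unfolding test_functions_iff using sm assms by (intro conjI sm exI[of _ "cbox a b"]) auto
    moreover have "\<bar>\<phi> n x\<bar> \<le> 1" for n x
      using flat_bd by (auto simp: \<phi>_def abs_prod intro!: prod_le_1)
    moreover have "(\<lambda>n. \<phi> n x) \<longlonglongrightarrow> indicator (box a b) x" for x
    proof (cases "x \<in> box a b")
      case True
      have "(\<lambda>n. flat 0 (real n * s i x)) \<longlonglongrightarrow> 1" for i
      proof -
        have s: "s i x > 0" using True in_box by blast
        have "(\<lambda>n. exp (- (1 / s i x) * inverse (real n))) \<longlonglongrightarrow> exp (- (1 / s i x) * 0)"
          by (intro tendsto_intros LIMSEQ_inverse_real_of_nat_add lim_inverse_n)
        then have "(\<lambda>n. exp (- (1 / s i x) * inverse (real n))) \<longlonglongrightarrow> 1" by simp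
        then show ?thesis
          by (rule Lim_transform_eventually)
            (use eventually_gt_at_top[of 0] in eventually_elim, use s in \<open>simp add: flat_def field_simps\<close>)
      qed
      then have "(\<lambda>n. \<Prod>i\<in>UNIV. flat 0 (real n * s i x)) \<longlonglongrightarrow> (\<Prod>i\<in>(UNIV::'n set). 1)"
        by (intro tendsto_prod) auto
      then show ?thesis using True False by (simp add: \<phi>_def)
    qed (simp add: out)
    ultimately show ?thesis by blast
  qed
qed

text \<open>Bump functions give zero integrals over boxes inside the domain. A Dynkin argument
  extends this from boxes to Borel sets, and countably many boxes cover the domain.\<close>

lemma fundamental_lemma_variations:
  fixes h :: "real^'n \<Rightarrow> real"
  assumes \<Omega>: "open \<Omega>" and h: "integrable (lebesgue_on \<Omega>) h"
    and zero: "\<And>\<phi>. \<phi> \<in> test_functions \<Omega> \<Longrightarrow> (\<integral>x. h x * \<phi> x \<partial>lebesgue_on \<Omega>) = 0"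
  shows "AE x in lebesgue_on \<Omega>. h x = 0"
proof -
  have \<Omega>b [measurable]: "\<Omega> \<in> sets borel" using \<Omega> by simp
  have "integrable lebesgue (\<lambda>x. indicator \<Omega> x *\<^sub>R h x)"
    using h by (subst (asm) integrable_restrict_space) auto
  then have hm: "(\<lambda>x. indicator \<Omega> x *\<^sub>R h x) \<in> borel_measurable lebesgue" and
    hi: "integrable lebesgue (\<lambda>x. indicator \<Omega> x *\<^sub>R h x)" by auto
  \<comment> \<open>A Borel representative is taken because boxes generate only the Borel sets,
    while \<open>h\<close> is Lebesgue measurable.\<close>
  obtain h' where h'm [measurable]: "h' \<in> borel_measurable lborel"
    and h'e: "AE x in lborel. indicator \<Omega> x *\<^sub>R h x = h' x"
    using completion_ex_borel_measurable_real[OF hm] by blast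
  have h'e': "AE x in lebesgue. indicator \<Omega> x *\<^sub>R h x = h' x"
    using h'e by (simp add: AE_lebesgue_lborel)
  have h'i: "integrable lborel h'"
  proof -
    have "integrable lebesgue h'"
      by (rule integrable_cong_AE_imp[OF hi measurable_completion[OF h'm] h'e'])
    then show ?thesis by (simp add: integrable_completion)
  qed
  have zero': "(\<integral>x. h' x * \<phi> x \<partial>lborel) = 0" if \<phi>: "\<phi> \<in> test_functions \<Omega>" for \<phi>
  proof -
    have [measurable]: "\<phi> \<in> borel_measurable borel"
      using C1_continuous[OF test_functions_C1[OF \<phi>], of UNIV] by (rule borel_measurable_continuous_onI)
    have "(\<integral>x. h' x * \<phi> x \<partial>lborel) = (\<integral>x. h' x * \<phi> x \<partial>lebesgue)"
      by (rule integral_completion[symmetric]) measurable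
    also have "\<dots> = (\<integral>x. indicator \<Omega> x *\<^sub>R (h x * \<phi> x) \<partial>lebesgue)"
    proof (rule integral_cong_AE)
      have "(\<lambda>x. (indicator \<Omega> x *\<^sub>R h x) * \<phi> x) \<in> borel_measurable lebesgue"
        by (intro borel_measurable_times hm measurable_completion) simp
      then show "(\<lambda>x. indicator \<Omega> x *\<^sub>R (h x * \<phi> x)) \<in> borel_measurable lebesgue"
        by (simp add: mult.assoc)
      show "AE x in lebesgue. h' x * \<phi> x = indicator \<Omega> x *\<^sub>R (h x * \<phi> x)"
        using h'e' by eventually_elim (simp flip: mult.assoc)
      show "(\<lambda>x. h' x * \<phi> x) \<in> borel_measurable lebesgue"
        by (rule measurable_completion) measurable
    qed
    also have "\<dots> = (\<integral>x. h x * \<phi> x \<partial>lebesgue_on \<Omega>)"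
      by (subst integral_restrict_space) auto
    finally show ?thesis using zero[OF \<phi>] by simp
  qed
  have box0: "(\<integral>x. indicator (box a b) x * h' x \<partial>lborel) = 0" if ab: "cbox a b \<subseteq> \<Omega>" for a b
  proof -
    obtain \<phi> where \<phi>: "\<And>n::nat. \<phi> n \<in> test_functions \<Omega>" "\<And>n x. \<bar>\<phi> n x\<bar> \<le> 1"
      "\<And>x. (\<lambda>n. \<phi> n x) \<longlonglongrightarrow> indicator (box a b) x"
      using bump_sequence[OF ab] by blast
    have [measurable]: "\<phi> n \<in> borel_measurable borel" for n
      using C1_continuous[OF test_functions_C1[OF \<phi>(1)], of UNIV] by (rule borel_measurable_continuous_onI)
    have "(\<lambda>n. \<integral>x. h' x * \<phi> n x \<partial>lborel) \<longlonglongrightarrow> (\<integral>x. h' x * indicator (box a b) x \<partial>lborel)"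
    proof (rule integral_dominated_convergence[where w="\<lambda>x. \<bar>h' x\<bar>"])
      show "AE x in lborel. norm (h' x * \<phi> n x) \<le> \<bar>h' x\<bar>" for n
        using \<phi>(2)[of n] by (auto simp: abs_mult mult_left_le)
    qed (use \<phi>(3) h'i in \<open>auto intro!: tendsto_intros\<close>)
    then show ?thesis using zero'[OF \<phi>(1)] by (simp add: LIMSEQ_const_iff mult.commute)
  qed
  have cbox0: "AE x in lborel. x \<in> cbox a b \<longrightarrow> h' x = 0" if ab: "cbox a b \<subseteq> \<Omega>" for a b
  proof -
    \<comment> \<open>Cutting off at one box turns the integral over the whole space into an
      integral over a box, which the complement case of the induction requires.\<close>
    define f where "f = (\<lambda>x. indicator (box a b) x *\<^sub>R h' x)"
    have fi: "integrable lborel f"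
      unfolding f_def using h'i by (intro integrable_mult_indicator) auto
    \<comment> \<open>Boxes are closed under intersection, and the intersection stays in
      \<open>cbox a b\<close>, where \<open>box0\<close> is available.\<close>
    have f_box: "(\<integral>x. indicator (box c d) x * f x \<partial>lborel) = 0" for c d
    proof -
      obtain a' b' where e: "box c d \<inter> box a b = box a' b'" unfolding box_Int_box by blast
      show ?thesis
      proof (cases "box a' b' = {}")
        case True
        then have z: "indicator (box c d) x * f x = 0" for x using e by (auto simp: f_def indicator_def)
        show ?thesis by (simp only: z) simp
      next
        case False
        have "closure (box a' b') \<subseteq> cbox a b"
          unfolding e[symmetric] using box_subset_cbox[of a b] by (intro closure_minimal) auto
        then have "cbox a' b' \<subseteq> cbox a b" using False by simp
        then have "(\<integral>x. indicator (box a' b') x * h' x \<partial>lborel) = 0" using ab by (intro box0) auto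
        moreover have "indicator (box a' b') x * h' x = indicator (box c d) x * f x" for x
          unfolding e[symmetric] f_def by (auto simp: indicator_def)
        ultimately show ?thesis by (simp only: )
      qed
    qed
    have "set_lebesgue_integral lborel A f = 0" if A: "A \<in> sets lborel" for A
    proof -
      have st: "Int_stable (range (\<lambda>(a, b). box a b :: (real^'n) set))"
        by (auto simp: Int_stable_def box_Int_box)
      have sub: "range (\<lambda>(a, b). box a b :: (real^'n) set) \<subseteq> Pow UNIV" by simp
      have "A \<in> sigma_sets UNIV (range (\<lambda>(a, b). box a b :: (real^'n) set))"
        using A by (simp add: borel_eq_box)
      with st sub show ?thesis
      proof (induction rule: sigma_sets_induct_disjoint)
        case (basic A)
        then show ?case using f_box by (auto simp: set_lebesgue_integral_def)
      next
        case empty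
        then show ?case by (simp add: set_lebesgue_integral_def)
      next
        case (compl A)
        then have A: "A \<in> sets lborel" by (simp add: borel_eq_box)
        have "(\<integral>x. indicator (box a b) x * f x \<partial>lborel) = (\<integral>x. f x \<partial>lborel)"
          by (intro Bochner_Integration.integral_cong) (auto simp: f_def indicator_def)
        then have "(\<integral>x. f x \<partial>lborel) = 0" using f_box by simp
        moreover have "(\<integral>x. indicator (UNIV - A) x *\<^sub>R f x \<partial>lborel) = (\<integral>x. f x - indicator A x *\<^sub>R f x \<partial>lborel)"
          by (intro Bochner_Integration.integral_cong) (auto simp: indicator_def)
        moreover have "\<dots> = (\<integral>x. f x \<partial>lborel) - (\<integral>x. indicator A x *\<^sub>R f x \<partial>lborel)"
          by (intro Bochner_Integration.integral_diff fi integrable_mult_indicator A)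
        ultimately show ?case using compl by (simp add: set_lebesgue_integral_def)
      next
        case (union A)
        have "A i \<in> sets lborel" for i using union by (auto simp: borel_eq_box)
        then have "set_lebesgue_integral lborel (\<Union>i. A i) f = (\<Sum>i. set_lebesgue_integral lborel (A i) f)"
        proof (intro lebesgue_integral_countable_add)
          show "set_integrable lborel (\<Union>i. A i) f"
            unfolding set_integrable_def using \<open>\<And>i. A i \<in> sets lborel\<close>
            by (intro integrable_mult_indicator fi sets.countable_UN) auto
        qed (use union \<open>\<And>i. A i \<in> sets lborel\<close> in \<open>auto simp: disjoint_family_on_def\<close>)
        then show ?case using union by simp
      qed
    qed
    then have f0: "AE x in lborel. f x = 0"
      using fi by (intro sigma_finite_measure.density_zero[OF sigma_finite_lborel]) auto
    have "cbox a b - box a b \<in> null_sets lborel"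
      using null_sets_cbox_Diff_box by blast
    then have "AE x in lborel. x \<notin> cbox a b - box a b" by (rule AE_not_in)
    with f0 show ?thesis by eventually_elim (auto simp: f_def indicator_def split: if_splits)
  qed
  obtain \<D> where D: "countable \<D>" "\<D> \<subseteq> Pow \<Omega>" "\<And>X. X \<in> \<D> \<Longrightarrow> \<exists>a b. X = cbox a b" "\<Union>\<D> = \<Omega>"
    using open_countable_Union_open_cbox[OF \<Omega>] by blast
  have "AE x in lborel. \<forall>X\<in>\<D>. x \<in> X \<longrightarrow> h' x = 0"
  proof (subst AE_ball_countable[OF D(1)], intro ballI)
    fix X assume "X \<in> \<D>"
    then show "AE x in lborel. x \<in> X \<longrightarrow> h' x = 0" using D(2) D(3)[of X] cbox0 by blast
  qed
  then have "AE x in lborel. x \<in> \<Omega> \<longrightarrow> h x = 0"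
    using h'e by eventually_elim (use D(4) in \<open>auto simp: indicator_def\<close>)
  then show ?thesis by (subst AE_restrict_space_iff) (auto simp: AE_lebesgue_lborel)
qed

section \<open>Coordinate lines and the symmetry of second derivatives\<close>

lemma has_real_derivative_line:
  assumes "\<And>x. f differentiable (at x)"
  shows "((\<lambda>s. f (x + s *\<^sub>R axis i 1)) has_real_derivative pderiv_at i f (x + s *\<^sub>R axis i 1)) (at s)"
proof -
  have "((\<lambda>s. x + s *\<^sub>R axis i 1) has_derivative (\<lambda>h. h *\<^sub>R axis i 1)) (at s)"
    by (auto intro!: derivative_eq_intros)
  from has_derivative_compose[OF this pderiv_at_has_derivative[OF assms]]
  have "((\<lambda>s. f (x + s *\<^sub>R axis i 1)) has_derivative
      (\<lambda>h. \<Sum>j\<in>UNIV. (h *\<^sub>R axis i 1) $ j * pderiv_at j f (x + s *\<^sub>R axis i 1))) (at s)" .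
  moreover have "(\<Sum>j\<in>UNIV. (h *\<^sub>R axis i 1) $ j * pderiv_at j f (x + s *\<^sub>R axis i 1)) =
      h * pderiv_at i f (x + s *\<^sub>R axis i 1)" for h
  proof -
    have "(\<Sum>j\<in>UNIV. (h *\<^sub>R axis i 1) $ j * pderiv_at j f (x + s *\<^sub>R axis i 1)) =
        (\<Sum>j\<in>UNIV. if j = i then h * pderiv_at i f (x + s *\<^sub>R axis i 1) else 0)"
      by (intro sum.cong) (auto simp: axis_def)
    then show ?thesis by simp
  qed
  ultimately have "((\<lambda>s. f (x + s *\<^sub>R axis i 1)) has_derivative
      (\<lambda>h. h * pderiv_at i f (x + s *\<^sub>R axis i 1))) (at s)" by simp
  then show ?thesis unfolding has_field_derivative_def
    by (rule has_derivative_eq_rhs) (rule ext, rule mult.commute)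
qed

lemma mean_value_line:
  assumes "\<And>x. f differentiable (at x)" "0 < t"
  shows "\<exists>s. 0 < s \<and> s < t \<and> f (x + t *\<^sub>R axis i 1) - f x = t * pderiv_at i f (x + s *\<^sub>R axis i 1)"
  using MVT2[OF assms(2) has_real_derivative_line[OF assms(1)], of x i] by auto

lemma pderiv_at_shift:
  assumes "\<And>x. f differentiable (at x)"
  shows "(\<lambda>x. f (x + c)) differentiable (at x)" "pderiv_at i (\<lambda>x. f (x + c)) x = pderiv_at i f (x + c)"
proof -
  have "((\<lambda>x. x + c) has_derivative (\<lambda>h. h)) (at x)" by (auto intro!: derivative_eq_intros)
  from has_derivative_compose[OF this pderiv_at_has_derivative[OF assms]]
  have D: "((\<lambda>x. f (x + c)) has_derivative (\<lambda>h. \<Sum>i\<in>UNIV. h $ i * pderiv_at i f (x + c))) (at x)" .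
  then show "(\<lambda>x. f (x + c)) differentiable (at x)" by (auto simp: differentiable_def)
  show "pderiv_at i (\<lambda>x. f (x + c)) x = pderiv_at i f (x + c)"
    using has_derivative_pderiv_at[OF D, of i]
      has_derivative_pderiv_at[OF pderiv_at_has_derivative[OF assms[of "x + c"]], of i] by simp
qed

lemma pderiv_at_minus:
  assumes "f differentiable (at x)" "g differentiable (at x)"
  shows "pderiv_at i (\<lambda>x. f x - g x) x = pderiv_at i f x - pderiv_at i g x"
proof -
  obtain D E where D: "(f has_derivative D) (at x)" "(g has_derivative E) (at x)"
    using assms by (auto simp: differentiable_def)
  then show ?thesis
    using has_derivative_pderiv_at[OF has_derivative_diff[OF D]] D[THEN has_derivative_pderiv_at] by simp
qed

text \<open>The mean value theorem is applied in direction \<open>i\<close> to the increment of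
  \<open>\<phi>\<close> in direction \<open>j\<close>, and then in direction \<open>j\<close> to
  \<open>pderiv_at i \<phi>\<close>.\<close>

lemma second_difference:
  fixes \<phi> :: "real^'n \<Rightarrow> real"
  assumes s: "smooth_fun \<phi>" and t: "0 < t"
  shows "\<exists>y. norm (y - x) < 2 * t \<and>
    \<phi> (x + t *\<^sub>R axis i 1 + t *\<^sub>R axis j 1) - \<phi> (x + t *\<^sub>R axis i 1) - \<phi> (x + t *\<^sub>R axis j 1) + \<phi> x =
      t * t * pderiv_at j (pderiv_at i \<phi>) y"
proof -
  have d: "\<phi> differentiable (at x)" "pderiv_at i \<phi> differentiable (at x)" for x
    using smooth_fun_pderiv_at[OF s] smooth_fun_pderiv_at by blast+
  define g where "g = (\<lambda>x. \<phi> (x + t *\<^sub>R axis j 1) - \<phi> x)"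
  have dg: "g differentiable (at x)" for x
    unfolding g_def by (intro differentiable_diff pderiv_at_shift(1) d)
  have pg: "pderiv_at i g x = pderiv_at i \<phi> (x + t *\<^sub>R axis j 1) - pderiv_at i \<phi> x" for x
    unfolding g_def using pderiv_at_shift[OF d(1)] d(1) by (subst pderiv_at_minus) auto
  obtain r where r: "0 < r" "r < t" "g (x + t *\<^sub>R axis i 1) - g x = t * pderiv_at i g (x + r *\<^sub>R axis i 1)"
    using mean_value_line[OF dg t] by blast
  obtain q where q: "0 < q" "q < t" "pderiv_at i \<phi> (x + r *\<^sub>R axis i 1 + t *\<^sub>R axis j 1) - pderiv_at i \<phi> (x + r *\<^sub>R axis i 1)
      = t * pderiv_at j (pderiv_at i \<phi>) (x + r *\<^sub>R axis i 1 + q *\<^sub>R axis j 1)"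
    using mean_value_line[OF d(2) t] by blast
  have "norm (r *\<^sub>R axis i 1 + q *\<^sub>R axis j 1 :: real^'n) \<le> r + q"
    using r q norm_triangle_ineq[of "r *\<^sub>R axis i 1 :: real^'n" "q *\<^sub>R axis j 1"] by simp
  then have "norm ((x + r *\<^sub>R axis i 1 + q *\<^sub>R axis j 1) - x) < 2 * t" using r q by simp
  moreover have "\<phi> (x + t *\<^sub>R axis i 1 + t *\<^sub>R axis j 1) - \<phi> (x + t *\<^sub>R axis i 1) - \<phi> (x + t *\<^sub>R axis j 1) + \<phi> x =
      t * t * pderiv_at j (pderiv_at i \<phi>) (x + r *\<^sub>R axis i 1 + q *\<^sub>R axis j 1)"
  proof -
    have "\<phi> (x + t *\<^sub>R axis i 1 + t *\<^sub>R axis j 1) - \<phi> (x + t *\<^sub>R axis i 1) - \<phi> (x + t *\<^sub>R axis j 1) + \<phi> x =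
        g (x + t *\<^sub>R axis i 1) - g x" by (simp add: g_def)
    then show ?thesis using r(3) q(3) by (simp add: pg)
  qed
  ultimately show ?thesis by blast
qed

text \<open>The second difference is symmetric in the two directions. Divided by
  \<open>t * t\<close> it is a mixed derivative of either order at points closer than
  \<open>2 * t\<close> to \<open>x\<close>, and both mixed derivatives are continuous.\<close>

lemma pderiv_at_commute:
  assumes s: "smooth_fun \<phi>"
  shows "pderiv_at i (pderiv_at j \<phi>) x = pderiv_at j (pderiv_at i \<phi>) x"
proof -
  define t where "t = (\<lambda>n::nat. inverse (real (Suc n)))"
  have t: "t n > 0" for n by (simp add: t_def)
  have t0: "(\<lambda>n. 2 * t n) \<longlonglongrightarrow> 0"
    unfolding t_def using tendsto_mult_right_zero[OF LIMSEQ_inverse_real_of_nat] by auto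
  have ct: "isCont (pderiv_at i (pderiv_at j \<phi>)) x" for i j
    using smooth_fun_pderiv_at s differentiable_imp_continuous_within by blast
  have ex: "\<exists>y. \<forall>n. norm (y n - x) < 2 * t n \<and>
    \<phi> (x + t n *\<^sub>R axis i 1 + t n *\<^sub>R axis j 1) - \<phi> (x + t n *\<^sub>R axis i 1) - \<phi> (x + t n *\<^sub>R axis j 1) + \<phi> x =
      t n * t n * pderiv_at j (pderiv_at i \<phi>) (y n)" for i j
    by (intro choice allI) (rule second_difference[OF s t])
  obtain y where y: "\<And>n. norm (y n - x) < 2 * t n"
    "\<And>n. \<phi> (x + t n *\<^sub>R axis i 1 + t n *\<^sub>R axis j 1) - \<phi> (x + t n *\<^sub>R axis i 1) - \<phi> (x + t n *\<^sub>R axis j 1) + \<phi> x =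
      t n * t n * pderiv_at j (pderiv_at i \<phi>) (y n)"
    using ex[of i j] by blast
  obtain z where z: "\<And>n. norm (z n - x) < 2 * t n"
    "\<And>n. \<phi> (x + t n *\<^sub>R axis j 1 + t n *\<^sub>R axis i 1) - \<phi> (x + t n *\<^sub>R axis j 1) - \<phi> (x + t n *\<^sub>R axis i 1) + \<phi> x =
      t n * t n * pderiv_at i (pderiv_at j \<phi>) (z n)"
    using ex[of j i] by blast
  have eq: "pderiv_at j (pderiv_at i \<phi>) (y n) = pderiv_at i (pderiv_at j \<phi>) (z n)" for n
  proof -
    have "t n * t n * pderiv_at j (pderiv_at i \<phi>) (y n) = t n * t n * pderiv_at i (pderiv_at j \<phi>) (z n)"
      unfolding y(2)[symmetric] z(2)[symmetric] by (simp add: algebra_simps)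
    then show ?thesis using t[of n] by simp
  qed
  have lim: "w \<longlonglongrightarrow> x" if "\<And>n. norm (w n - x) < 2 * t n" for w
  proof (rule LIM_zero_cancel, rule tendsto_norm_zero_cancel)
    show "(\<lambda>n. norm (w n - x)) \<longlonglongrightarrow> 0"
      by (rule real_tendsto_sandwich[OF _ _ tendsto_const t0]) (auto intro!: always_eventually less_imp_le that)
  qed
  have "(\<lambda>n. pderiv_at j (pderiv_at i \<phi>) (y n)) \<longlonglongrightarrow> pderiv_at j (pderiv_at i \<phi>) x"
    by (rule isCont_tendsto_compose[OF ct lim[OF y(1)]])
  moreover have "(\<lambda>n. pderiv_at i (pderiv_at j \<phi>) (z n)) \<longlonglongrightarrow> pderiv_at i (pderiv_at j \<phi>) x"
    by (rule isCont_tendsto_compose[OF ct lim[OF z(1)]])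
  ultimately show ?thesis unfolding eq by (rule LIMSEQ_unique[symmetric])
qed

text \<open>The pieces are arbitrary closed sets, so they cannot be traversed in order. Instead the
  largest \<open>m\<close> with \<open>\<bar>g m - g 0\<bar> \<le> L * m\<close> exists by
  compactness and is shown to be 1.\<close>

lemma Lipschitz_closed_cover:
  fixes g :: "real \<Rightarrow> real"
  assumes "finite \<T>" "\<And>K. K \<in> \<T> \<Longrightarrow> closed (A K)" "{0..1} \<subseteq> (\<Union>K\<in>\<T>. A K)"
    and g: "continuous_on {0..1} g"
    and L: "\<And>K s s'. K \<in> \<T> \<Longrightarrow> s \<in> A K \<Longrightarrow> s' \<in> A K \<Longrightarrow> s \<in> {0..1} \<Longrightarrow> s' \<in> {0..1} \<Longrightarrow> \<bar>g s - g s'\<bar> \<le> L * \<bar>s - s'\<bar>"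
  shows "\<bar>g 1 - g 0\<bar> \<le> L"
proof -
  define S where "S = {s \<in> {0..1}. \<bar>g s - g 0\<bar> - L * s \<le> 0}"
  have "continuous_on {0..1} (\<lambda>s. \<bar>g s - g 0\<bar> - L * s)" by (intro continuous_intros g)
  then have "closed ({0..1} \<inter> (\<lambda>s. \<bar>g s - g 0\<bar> - L * s) -` {..0})"
    by (rule continuous_closed_preimage) auto
  moreover have "S = {0..1} \<inter> (\<lambda>s. \<bar>g s - g 0\<bar> - L * s) -` {..0}" by (auto simp: S_def)
  ultimately have "closed S" by simp
  moreover have "bounded S" unfolding S_def by (rule bounded_subset[of "{0..1}"]) auto
  ultimately have "compact S" by (simp add: compact_eq_bounded_closed)
  moreover have "0 \<in> S" by (simp add: S_def)
  ultimately obtain m where m: "m \<in> S" "\<And>s. s \<in> S \<Longrightarrow> s \<le> m"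
    using compact_attains_sup[of S] by auto
  have "m = 1"
  proof (rule ccontr)
    assume "m \<noteq> 1"
    with m have m1: "0 \<le> m" "m < 1" by (auto simp: S_def)
    \<comment> \<open>Near \<open>m\<close> only pieces containing \<open>m\<close> are met, so a
      slightly later point shares a piece with \<open>m\<close> and still belongs to
      \<open>S\<close>.\<close>
    define U where "U = (\<Inter>K\<in>{K\<in>\<T>. m \<notin> A K}. - A K)"
    have "open U" unfolding U_def using assms(1,2) by (intro open_INT) auto
    moreover have "m \<in> U" by (auto simp: U_def)
    ultimately obtain \<epsilon> where e: "\<epsilon> > 0" "ball m \<epsilon> \<subseteq> U" using open_contains_ball by blast
    define s where "s = min 1 (m + \<epsilon> / 2)"
    have s: "m < s" "s \<le> 1" "s \<in> U" using e m1 by (auto simp: s_def subset_iff dist_real_def)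
    then have "s \<in> (\<Union>K\<in>\<T>. A K)" using m1 by (intro subsetD[OF assms(3)]) simp
    then obtain K where K: "K \<in> \<T>" "s \<in> A K" by blast
    then have "m \<in> A K" using s(3) by (auto simp: U_def)
    then have "\<bar>g s - g m\<bar> \<le> L * \<bar>s - m\<bar>" using L[of K s m] K s m1 by auto
    moreover have "\<bar>g m - g 0\<bar> \<le> L * m" using m(1) by (simp add: S_def)
    ultimately have "\<bar>g s - g 0\<bar> \<le> L * s" using s by (simp add: algebra_simps)
    then have "s \<in> S" using s m1 by (simp add: S_def)
    then show False using m(2) s(1) by force
  qed
  then show ?thesis using m(1) by (simp add: S_def)
qed

lemma lborel_integral_shift:
  fixes f :: "'a::euclidean_space \<Rightarrow> real"
  assumes "f \<in> borel_measurable borel"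
  shows "(\<integral>x. f (x + c) \<partial>lborel) = (\<integral>x. f x \<partial>lborel)"
proof -
  have "(\<integral>x. f x \<partial>lborel) = (\<integral>x. f x \<partial>distr lborel borel ((+) c))" by (simp add: lborel_distr_plus)
  also have "\<dots> = (\<integral>x. f (c + x) \<partial>lborel)" using assms by (intro integral_distr) auto
  finally show ?thesis by (simp add: add.commute)
qed

section \<open>Uniqueness and linearity of weak gradients\<close>

definition wgrad :: "(real^'n) set \<Rightarrow> (real^'n \<Rightarrow> real) \<Rightarrow> (real^'n \<Rightarrow> real^'n) \<Rightarrow> bool" where
  "wgrad \<Omega> v g \<longleftrightarrow> g \<in> L2 \<Omega> \<and> weak_gradient \<Omega> v g"

lemma weak_gradient_L2_inner:
  "weak_gradient \<Omega> v g \<longleftrightarrow> (\<forall>\<phi>\<in>test_functions \<Omega>. \<forall>i.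
     L2_inner \<Omega> v (pderiv_at i \<phi>) = - L2_inner \<Omega> (\<lambda>x. g x $ i) \<phi>)"
  by (simp add: weak_gradient_def L2_inner_def)

lemma wgrad_grad: "wgrad \<Omega> v g \<Longrightarrow> wgrad \<Omega> v (grad \<Omega> v)"
  unfolding wgrad_def grad_def by (rule someI[where P="\<lambda>g. g \<in> L2 \<Omega> \<and> weak_gradient \<Omega> v g"])

context
  fixes \<Omega> :: "(real^'n) set"
  assumes op: "open \<Omega>" and bd: "bounded \<Omega>"
begin

lemma bounded_open_sets: "\<Omega> \<in> sets lebesgue" "emeasure lebesgue \<Omega> < \<infinity>"
  using op bd bounded_set_imp_lmeasurable[of \<Omega>] by (auto simp: fmeasurable_def)

lemma continuous_L2:
  fixes f :: "real^'n \<Rightarrow> 'b::euclidean_space"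
  assumes "continuous_on (closure \<Omega>) f"
  shows "f \<in> L2 \<Omega>"
proof -
  have "compact (closure \<Omega>)" using bd by simp
  then have "bounded (f ` closure \<Omega>)"
    by (intro compact_imp_bounded compact_continuous_image assms)
  then obtain B where "\<And>x. x \<in> closure \<Omega> \<Longrightarrow> norm (f x) \<le> B" by (auto simp: bounded_iff)
  then have "norm (f x) \<le> B" if "x \<in> \<Omega>" for x using that closure_subset[of \<Omega>] by (auto simp: subset_iff)
  moreover have "f \<in> borel_measurable (lebesgue_on \<Omega>)"
    using continuous_on_subset[OF assms closure_subset] bounded_open_sets(1)
    by (rule continuous_imp_measurable_on_sets_lebesgue)
  ultimately show ?thesis
    using bounded_open_sets by (intro L2_bounded[where B=B]) (auto intro!: AE_I2)
qed

lemma C1_L2: "C1 f \<Longrightarrow> f \<in> L2 \<Omega>" "C1 f \<Longrightarrow> pderiv_at i f \<in> L2 \<Omega>"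
proof -
  show "f \<in> L2 \<Omega>" if "C1 f" by (intro continuous_L2 C1_continuous that)
  show "pderiv_at i f \<in> L2 \<Omega>" if "C1 f"
    using that by (intro continuous_L2) (auto simp: C1_def intro: continuous_on_subset)
qed

lemma L2_integrable:
  assumes "v \<in> L2 \<Omega>" shows "integrable (lebesgue_on \<Omega>) (v :: real^'n \<Rightarrow> real)"
  using L2_inner_integrable[OF assms continuous_L2[OF continuous_on_const[of _ "1::real"]]] by simp

text \<open>Each component of the difference is orthogonal to every test function. This makes the
  choice in \<open>grad\<close> harmless up to null sets.\<close>

lemma wgrad_unique:
  assumes "wgrad \<Omega> v g" "wgrad \<Omega> v g'"
  shows "AE x in lebesgue_on \<Omega>. g x = g' x"
proof -
  have "AE x in lebesgue_on \<Omega>. g x $ i - g' x $ i = 0" for i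
  proof (rule fundamental_lemma_variations[OF op])
    have gi: "(\<lambda>x. g x $ i) \<in> L2 \<Omega>" "(\<lambda>x. g' x $ i) \<in> L2 \<Omega>"
      using assms by (auto simp: wgrad_def intro: L2_component)
    then show "integrable (lebesgue_on \<Omega>) (\<lambda>x. g x $ i - g' x $ i)" by (intro L2_integrable L2_diff)
    fix \<phi> assume \<phi>: "\<phi> \<in> test_functions \<Omega>"
    then have "L2_inner \<Omega> (\<lambda>x. g x $ i) \<phi> = L2_inner \<Omega> (\<lambda>x. g' x $ i) \<phi>"
      using assms[unfolded wgrad_def weak_gradient_L2_inner] by (metis neg_equal_iff_equal)
    then have "L2_inner \<Omega> (\<lambda>x. g x $ i - g' x $ i) \<phi> = 0"
      using gi C1_L2(1)[OF test_functions_C1[OF \<phi>]] by (subst L2_inner_diff_left) auto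
    then show "(\<integral>x. (g x $ i - g' x $ i) * \<phi> x \<partial>lebesgue_on \<Omega>) = 0" by (simp add: L2_inner_def)
  qed
  then have "AE x in lebesgue_on \<Omega>. \<forall>i. g x $ i - g' x $ i = 0" by (subst AE_all_countable) simp
  then show ?thesis by eventually_elim (simp add: vec_eq_iff)
qed

lemma wgrad_lincomb:
  assumes "\<And>j. j \<in> J \<Longrightarrow> v j \<in> L2 \<Omega>" "\<And>j. j \<in> J \<Longrightarrow> wgrad \<Omega> (v j) (g j)"
  shows "wgrad \<Omega> (\<lambda>x. \<Sum>j\<in>J. a j * v j x) (\<lambda>x. \<Sum>j\<in>J. a j *\<^sub>R g j x)"
proof -
  have "L2_inner \<Omega> (\<lambda>x. \<Sum>j\<in>J. a j *\<^sub>R v j x) (pderiv_at i \<phi>) =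
      - L2_inner \<Omega> (\<lambda>x. \<Sum>j\<in>J. a j *\<^sub>R (g j x $ i)) \<phi>" if \<phi>: "\<phi> \<in> test_functions \<Omega>" for \<phi> i
  proof -
    have gL: "(\<lambda>x. g j x $ i) \<in> L2 \<Omega>" if "j \<in> J" for j
      using assms(2)[OF that] by (auto simp: wgrad_def intro: L2_component)
    have "L2_inner \<Omega> (\<lambda>x. \<Sum>j\<in>J. a j *\<^sub>R v j x) (pderiv_at i \<phi>) = (\<Sum>j\<in>J. a j * L2_inner \<Omega> (v j) (pderiv_at i \<phi>))"
      by (intro L2_inner_lincomb_left assms C1_L2 test_functions_C1[OF \<phi>])
    also have "\<dots> = (\<Sum>j\<in>J. a j * - L2_inner \<Omega> (\<lambda>x. g j x $ i) \<phi>)"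
      using assms(2) \<phi> by (intro sum.cong) (auto simp: wgrad_def weak_gradient_L2_inner)
    also have "\<dots> = - L2_inner \<Omega> (\<lambda>x. \<Sum>j\<in>J. a j *\<^sub>R (g j x $ i)) \<phi>"
      using gL C1_L2(1)[OF test_functions_C1[OF \<phi>]]
      by (subst L2_inner_lincomb_left) (auto simp: sum_negf)
    finally show ?thesis .
  qed
  then show ?thesis using assms(2)
    unfolding wgrad_def weak_gradient_L2_inner by (auto intro!: L2_lincomb)
qed

lemma wgrad_cong_AE:
  assumes "v \<in> L2 \<Omega>" "wgrad \<Omega> v g" "AE x in lebesgue_on \<Omega>. v' x = v x"
  shows "wgrad \<Omega> v' g"
  unfolding wgrad_def weak_gradient_L2_inner
proof (intro conjI ballI allI)
  show "g \<in> L2 \<Omega>" using assms by (simp add: wgrad_def)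
  fix \<phi> i assume \<phi>: "\<phi> \<in> test_functions \<Omega>"
  have "L2_inner \<Omega> v' (pderiv_at i \<phi>) = L2_inner \<Omega> v (pderiv_at i \<phi>)"
    using assms C1_L2(2)[OF test_functions_C1[OF \<phi>]] by (intro L2_inner_cong_AE bounded_open_sets) auto
  then show "L2_inner \<Omega> v' (pderiv_at i \<phi>) = - L2_inner \<Omega> (\<lambda>x. g x $ i) \<phi>"
    using assms \<phi> by (simp add: wgrad_def weak_gradient_L2_inner)
qed

lemma grad_AE: "wgrad \<Omega> v g \<Longrightarrow> AE x in lebesgue_on \<Omega>. grad \<Omega> v x = g x"
  using wgrad_unique wgrad_grad by blast

lemma grad_lincomb_AE:
  assumes "\<And>j. j \<in> J \<Longrightarrow> v j \<in> L2 \<Omega>" "\<And>j. j \<in> J \<Longrightarrow> wgrad \<Omega> (v j) (g j)"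
    and "AE x in lebesgue_on \<Omega>. w x = (\<Sum>j\<in>J. a j * v j x)"
  shows "AE x in lebesgue_on \<Omega>. grad \<Omega> w x = (\<Sum>j\<in>J. a j *\<^sub>R grad \<Omega> (v j) x)"
proof (rule grad_AE, rule wgrad_cong_AE[OF _ wgrad_lincomb assms(3)])
  show "(\<lambda>x. \<Sum>j\<in>J. a j * v j x) \<in> L2 \<Omega>" using L2_lincomb[of J v \<Omega> a] assms(1) by simp
qed (rule assms(1), assumption, rule wgrad_grad, rule assms(2))

end

section \<open>Piecewise continuously differentiable functions on a partition\<close>

text \<open>On each element the function agrees with one that is \<open>C1\<close> on the whole
  space. Unlike the polynomials of a fixed degree, this class is stable under products and contains
  the test functions; the integrations by parts rely on both.\<close>

definition pw_C1 :: "(real^'n) set \<Rightarrow> (real^'n) set set \<Rightarrow> (real^'n \<Rightarrow> real) \<Rightarrow> bool" where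
  "pw_C1 \<Omega> \<T> v \<longleftrightarrow> continuous_on (closure \<Omega>) v \<and> (\<forall>K\<in>\<T>. \<exists>p. C1 p \<and> (\<forall>x\<in>K. v x = p x))"

text \<open>The classical gradient. For piecewise C1 functions it is meaningful in element
  interiors, hence almost everywhere in the domain.\<close>

definition pgrad :: "(real^'n \<Rightarrow> real) \<Rightarrow> real^'n \<Rightarrow> real^'n" where
  "pgrad v = (\<lambda>x. \<chi> i. pderiv_at i v x)"

lemma pgrad_nth [simp]: "pgrad v x $ i = pderiv_at i v x"
  by (simp add: pgrad_def)

lemma borel_measurable_vec_lambda:
  fixes f :: "'i::finite \<Rightarrow> 'a \<Rightarrow> real"
  assumes "\<And>i. f i \<in> borel_measurable M"
  shows "(\<lambda>x. \<chi> i. f i x) \<in> borel_measurable M"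
proof -
  have "(\<lambda>x. \<Sum>i\<in>UNIV. f i x *\<^sub>R (axis i 1 :: real^'i)) \<in> borel_measurable M"
    using assms by (intro borel_measurable_sum borel_measurable_scaleR borel_measurable_const)
  moreover have "(\<Sum>i\<in>UNIV. f i x *\<^sub>R (axis i 1 :: real^'i)) = (\<chi> i. f i x)" for x
    using basis_expansion[of "\<chi> i. f i x"] by (simp add: scalar_mult_eq_scaleR)
  ultimately show ?thesis by simp
qed

lemma integrable_bounded_support:
  fixes f :: "'a::euclidean_space \<Rightarrow> real"
  assumes "f \<in> borel_measurable borel" "bounded S" "\<And>x. \<bar>f x\<bar> \<le> B" "\<And>x. x \<notin> S \<Longrightarrow> f x = 0"
  shows "integrable lborel f"
proof -
  obtain a b where ab: "S \<subseteq> cbox a b" using bounded_subset_cbox_symmetric[OF assms(2)] by blast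
  show ?thesis
  proof (rule integrableI_bounded_set[where A="cbox a b" and B=B])
    show "AE x in lborel. x \<notin> cbox a b \<longrightarrow> f x = 0" using ab assms(4) by (auto intro!: AE_I2)
  qed (use assms(1,3) in \<open>auto simp: emeasure_lborel_cbox_eq\<close>)
qed

section \<open>Geometry of the partition and elementwise bounds\<close>

locale mesh =
  fixes \<Omega> :: "(real^'n) set" and \<T> :: "(real^'n) set set"
  assumes domain: "polyhedral_domain \<Omega>" and partition: "fe_partition \<Omega> \<T>"
begin

abbreviation "\<M> \<equiv> lebesgue_on \<Omega>"
abbreviation "ip \<equiv> L2_inner \<Omega>"
abbreviation "nrm \<equiv> L2_norm \<Omega>"

lemma op: "open \<Omega>" and bd: "bounded \<Omega>" and ne: "\<Omega> \<noteq> {}"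
  using domain by (auto simp: polyhedral_domain_def)

lemma \<Omega>_sets [measurable]: "\<Omega> \<in> sets lebesgue" and \<Omega>_borel [measurable]: "\<Omega> \<in> sets borel"
  and \<Omega>_fin: "emeasure lebesgue \<Omega> < \<infinity>"
  using bounded_open_sets[OF op bd] op by auto

lemma fin: "finite \<T>" and cover: "\<Union>\<T> = closure \<Omega>"
  and disj: "K \<in> \<T> \<Longrightarrow> L \<in> \<T> \<Longrightarrow> K \<noteq> L \<Longrightarrow> interior K \<inter> interior L = {}"
  and int_ne: "K \<in> \<T> \<Longrightarrow> interior K \<noteq> {}"
  using partition by (auto simp: fe_partition_def)

lemma elem: "K \<in> \<T> \<Longrightarrow> compact K" "K \<in> \<T> \<Longrightarrow> convex K" "K \<in> \<T> \<Longrightarrow> closed K"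
  using partition by (auto simp: fe_partition_def polytope_imp_compact polytope_imp_convex polytope_imp_closed)

lemma elem_subset: "K \<in> \<T> \<Longrightarrow> K \<subseteq> closure \<Omega>"
  using cover by blast

text \<open>A polyhedral domain is the interior of a finite union of closed polytopes and therefore
  contains the interior of its own closure: no slit can run through an element.\<close>

lemma interior_elem_subset: "K \<in> \<T> \<Longrightarrow> interior K \<subseteq> \<Omega>"
proof -
  assume K: "K \<in> \<T>"
  obtain F where F: "finite F" "\<And>P. P \<in> F \<Longrightarrow> polytope P" "\<Omega> = interior (\<Union>F)"
    using domain by (auto simp: polyhedral_domain_def)
  have "closed (\<Union>F)" using F by (intro closed_Union) (auto intro: polytope_imp_closed)
  then have "closure \<Omega> \<subseteq> \<Union>F" using F(3) interior_subset by (intro closure_minimal) auto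
  then have "interior K \<subseteq> interior (\<Union>F)" using elem_subset[OF K] by (intro interior_mono) blast
  then show ?thesis using F(3) by simp
qed

text \<open>Element boundaries are frontiers of convex sets, hence negligible, and there are
  finitely many of them.\<close>

lemma AE_interior: "AE x in lebesgue. x \<in> \<Omega> \<longrightarrow> (\<exists>K\<in>\<T>. x \<in> interior K)"
proof -
  have "negligible (\<Union>K\<in>\<T>. frontier K)"
    using fin by (intro negligible_Union) (auto intro: negligible_convex_frontier elem)
  then have "(\<Union>K\<in>\<T>. frontier K) \<in> null_sets lebesgue" by (simp add: negligible_iff_null_sets)
  then have "AE x in lebesgue. x \<notin> (\<Union>K\<in>\<T>. frontier K)" by (rule AE_not_in)
  then show ?thesis
  proof eventually_elim
    case (elim x)
    show ?case
    proof
      assume "x \<in> \<Omega>"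
      then have "x \<in> \<Union>\<T>" using cover closure_subset[of \<Omega>] by auto
      then obtain K where K: "K \<in> \<T>" "x \<in> K" by blast
      then have "x \<in> interior K" using elim elem(3)[OF K(1)] by (auto simp: frontier_def)
      then show "\<exists>K\<in>\<T>. x \<in> interior K" using K by blast
    qed
  qed
qed

lemma AE_interior_on: "AE x in \<M>. \<exists>K\<in>\<T>. x \<in> interior K"
  using AE_interior by (subst AE_restrict_space_iff) auto

text \<open>A single constant for values, derivatives and Lipschitz quotients on all elements. It
  may depend on the mesh, since it serves only integrability and dominated convergence and never
  enters an estimate.\<close>

lemma pw_C1_bound_ex:
  assumes "pw_C1 \<Omega> \<T> v"
  shows "\<exists>B\<ge>0. (\<forall>x\<in>closure \<Omega>. \<bar>v x\<bar> \<le> B) \<and>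
    (\<forall>K\<in>\<T>. \<forall>x\<in>interior K. v differentiable (at x) \<and> (\<forall>i. \<bar>pderiv_at i v x\<bar> \<le> B)) \<and>
    (\<forall>K\<in>\<T>. \<forall>x\<in>K. \<forall>y\<in>K. \<bar>v x - v y\<bar> \<le> B * norm (x - y))"
proof -
  have "\<exists>p. \<forall>K\<in>\<T>. C1 (p K) \<and> (\<forall>x\<in>K. v x = p K x)"
    using assms unfolding pw_C1_def by (intro bchoice) (rule conjunct2)
  then obtain p where p: "\<And>K. K \<in> \<T> \<Longrightarrow> C1 (p K)" "\<And>K x. K \<in> \<T> \<Longrightarrow> x \<in> K \<Longrightarrow> v x = p K x" by blast
  have "\<exists>B. \<forall>K\<in>\<T>. B K \<ge> 0 \<and> (\<forall>x\<in>K. \<bar>p K x\<bar> \<le> B K) \<and> (\<forall>i. \<forall>x\<in>K. \<bar>pderiv_at i (p K) x\<bar> \<le> B K)"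
    by (intro bchoice ballI C1_compact_bound p(1) elem(1))
  then obtain B where "\<forall>K\<in>\<T>. B K \<ge> 0 \<and> (\<forall>x\<in>K. \<bar>p K x\<bar> \<le> B K) \<and> (\<forall>i. \<forall>x\<in>K. \<bar>pderiv_at i (p K) x\<bar> \<le> B K)"
    by (rule exE)
  then have B: "\<And>K. K \<in> \<T> \<Longrightarrow> B K \<ge> 0" "\<And>K x. K \<in> \<T> \<Longrightarrow> x \<in> K \<Longrightarrow> \<bar>p K x\<bar> \<le> B K"
    "\<And>K i x. K \<in> \<T> \<Longrightarrow> x \<in> K \<Longrightarrow> \<bar>pderiv_at i (p K) x\<bar> \<le> B K" by auto
  have "\<exists>L. \<forall>K\<in>\<T>. L K \<ge> 0 \<and> (\<forall>x\<in>K. \<forall>y\<in>K. \<bar>p K x - p K y\<bar> \<le> L K * norm (x - y))"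
    by (intro bchoice ballI C1_Lipschitz p(1) elem(1,2))
  then obtain L where "\<forall>K\<in>\<T>. L K \<ge> 0 \<and> (\<forall>x\<in>K. \<forall>y\<in>K. \<bar>p K x - p K y\<bar> \<le> L K * norm (x - y))"
    by (rule exE)
  then have L: "\<And>K. K \<in> \<T> \<Longrightarrow> L K \<ge> 0"
    "\<And>K x y. K \<in> \<T> \<Longrightarrow> x \<in> K \<Longrightarrow> y \<in> K \<Longrightarrow> \<bar>p K x - p K y\<bar> \<le> L K * norm (x - y)" by auto
  define M where "M = (\<Sum>K\<in>\<T>. B K) + (\<Sum>K\<in>\<T>. L K)"
  have BL: "B K \<le> M" "L K \<le> M" if "K \<in> \<T>" for K
  proof -
    have "B K \<le> (\<Sum>K\<in>\<T>. B K)" "L K \<le> (\<Sum>K\<in>\<T>. L K)" "0 \<le> (\<Sum>K\<in>\<T>. B K)" "0 \<le> (\<Sum>K\<in>\<T>. L K)"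
      using that fin B(1) L(1) by (auto intro!: member_le_sum sum_nonneg)
    then show "B K \<le> M" "L K \<le> M" by (auto simp: M_def)
  qed
  have "M \<ge> 0" unfolding M_def using B(1) L(1) by (intro add_nonneg_nonneg sum_nonneg) auto
  moreover have "\<bar>v x\<bar> \<le> M" if "x \<in> closure \<Omega>" for x
  proof -
    have "x \<in> \<Union>\<T>" using that by (simp add: cover)
    then obtain K where K: "K \<in> \<T>" "x \<in> K" by blast
    then show ?thesis using B(2)[OF K] BL(1)[OF K(1)] p(2)[OF K] by simp
  qed
  moreover have "v differentiable (at x)" "\<bar>pderiv_at i v x\<bar> \<le> M" if K: "K \<in> \<T>" and x: "x \<in> interior K" for K x i
  proof -
    have d: "p K differentiable (at x)" using p(1)[OF K] by (simp add: C1_def)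
    have e: "v y = p K y" if "y \<in> interior K" for y using p(2)[OF K] that interior_subset by blast
    note c = pderiv_at_cong[OF open_interior x e d]
    show "v differentiable (at x)" by (rule c(1))
    show "\<bar>pderiv_at i v x\<bar> \<le> M"
      using c(2)[of i] B(3)[OF K, of x i] x interior_subset[of K] BL(1)[OF K] by auto
  qed
  moreover have "\<bar>v x - v y\<bar> \<le> M * norm (x - y)" if K: "K \<in> \<T>" "x \<in> K" "y \<in> K" for K x y
  proof -
    have "\<bar>v x - v y\<bar> \<le> L K * norm (x - y)" using L(2)[OF K] p(2)[OF K(1)] K by simp
    also have "\<dots> \<le> M * norm (x - y)" using BL(2)[OF K(1)] by (intro mult_right_mono) auto
    finally show ?thesis .
  qed
  ultimately show ?thesis by (intro exI[of _ M]) auto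
qed

lemma pw_C1_bound:
  assumes "pw_C1 \<Omega> \<T> v"
  obtains B where "B \<ge> 0" "\<And>x. x \<in> closure \<Omega> \<Longrightarrow> \<bar>v x\<bar> \<le> B"
    "\<And>K x. K \<in> \<T> \<Longrightarrow> x \<in> interior K \<Longrightarrow> v differentiable (at x)"
    "\<And>K x i. K \<in> \<T> \<Longrightarrow> x \<in> interior K \<Longrightarrow> \<bar>pderiv_at i v x\<bar> \<le> B"
    "\<And>K x y. K \<in> \<T> \<Longrightarrow> x \<in> K \<Longrightarrow> y \<in> K \<Longrightarrow> \<bar>v x - v y\<bar> \<le> B * norm (x - y)"
proof -
  from pw_C1_bound_ex[OF assms] obtain B where
    B: "B \<ge> 0" "\<forall>x\<in>closure \<Omega>. \<bar>v x\<bar> \<le> B"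
    "\<forall>K\<in>\<T>. \<forall>x\<in>interior K. v differentiable (at x) \<and> (\<forall>i. \<bar>pderiv_at i v x\<bar> \<le> B)"
    "\<forall>K\<in>\<T>. \<forall>x\<in>K. \<forall>y\<in>K. \<bar>v x - v y\<bar> \<le> B * norm (x - y)"
    by (elim exE conjE)
  show ?thesis by (rule that[of B]) (use B in auto)
qed

text \<open>Along the segment the preimages of the elements form a finite closed cover of the unit
  interval, so the elementwise Lipschitz constant survives the passage from element to
  element.\<close>

lemma pw_C1_segment:
  assumes v: "pw_C1 \<Omega> \<T> v" and L: "\<And>K x y. K \<in> \<T> \<Longrightarrow> x \<in> K \<Longrightarrow> y \<in> K \<Longrightarrow> \<bar>v x - v y\<bar> \<le> L * norm (x - y)"
    and xy: "closed_segment x y \<subseteq> closure \<Omega>"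
  shows "\<bar>v x - v y\<bar> \<le> L * norm (x - y)"
proof -
  define l where "l = (\<lambda>s. (1 - s) *\<^sub>R x + s *\<^sub>R y)"
  have cl: "continuous_on S l" for S unfolding l_def by (intro continuous_intros)
  have l_in: "l s \<in> closure \<Omega>" if "s \<in> {0..1}" for s
    using xy that by (auto simp: l_def closed_segment_def)
  have dl: "norm (l s - l s') = norm (x - y) * \<bar>s - s'\<bar>" for s s'
  proof -
    have "l s - l s' = (s' - s) *\<^sub>R (x - y)" by (simp add: l_def algebra_simps)
    then show ?thesis by (simp add: abs_minus_commute)
  qed
  have "\<bar>v (l 1) - v (l 0)\<bar> \<le> L * norm (x - y)"
  proof (rule Lipschitz_closed_cover[where A="\<lambda>K. l -` K" and \<T>=\<T>])
    show "finite \<T>" by (rule fin)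
    show "closed (l -` K)" if "K \<in> \<T>" for K
      using elem(3)[OF that] cl[of UNIV] by (auto simp: continuous_on_closed_vimage)
    have "l s \<in> \<Union>\<T>" if "s \<in> {0..1}" for s using l_in[OF that] by (simp add: cover)
    then show "{0..1} \<subseteq> (\<Union>K\<in>\<T>. l -` K)" by blast
    have "continuous_on (l ` {0..1}) v"
      using v l_in by (auto simp: pw_C1_def intro: continuous_on_subset)
    then show "continuous_on {0..1} (\<lambda>s. v (l s))"
      using continuous_on_compose[OF cl] by (simp add: o_def)
    fix K s s' assume K: "K \<in> \<T>" "s \<in> l -` K" "s' \<in> l -` K"
    then show "\<bar>v (l s) - v (l s')\<bar> \<le> L * norm (x - y) * \<bar>s - s'\<bar>"
      using L[of K "l s" "l s'"] by (simp add: dl mult.assoc)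
  qed
  then show ?thesis by (simp add: l_def abs_minus_commute)
qed

text \<open>On element boundaries the classical derivative is uncontrolled. Summing the derivatives
  of the smooth extensions over the disjoint interiors gives a Borel function that agrees with it
  inside.\<close>

lemma pw_C1_pderiv_measurable:
  assumes "pw_C1 \<Omega> \<T> v"
  shows "\<exists>g. g \<in> borel_measurable borel \<and> (\<forall>K\<in>\<T>. \<forall>x\<in>interior K. g x = pderiv_at i v x)"
proof -
  have "\<exists>p. \<forall>K\<in>\<T>. C1 (p K) \<and> (\<forall>x\<in>K. v x = p K x)"
    using assms unfolding pw_C1_def by (intro bchoice) (rule conjunct2)
  then obtain p where p: "\<And>K. K \<in> \<T> \<Longrightarrow> C1 (p K)" "\<And>K x. K \<in> \<T> \<Longrightarrow> x \<in> K \<Longrightarrow> v x = p K x" by blast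
  define g where "g = (\<lambda>x. \<Sum>K\<in>\<T>. indicator (interior K) x * pderiv_at i (p K) x)"
  have "pderiv_at i (p K) \<in> borel_measurable borel" if "K \<in> \<T>" for K
    using p(1)[OF that] by (auto simp: C1_def intro: borel_measurable_continuous_onI)
  then have "g \<in> borel_measurable borel" unfolding g_def by measurable
  moreover have "g x = pderiv_at i v x" if K: "K \<in> \<T>" and x: "x \<in> interior K" for K x
  proof -
    have d: "p K differentiable (at x)" using p(1)[OF K] by (simp add: C1_def)
    have e: "v y = p K y" if "y \<in> interior K" for y using p(2)[OF K] that interior_subset by blast
    have "g x = (\<Sum>L\<in>\<T>. if L = K then pderiv_at i (p K) x else 0)"
      unfolding g_def using disj[OF K] x by (intro sum.cong) (auto simp: indicator_def)
    then show ?thesis using pderiv_at_cong(2)[OF open_interior x e d] K fin by simp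
  qed
  ultimately show ?thesis by blast
qed

lemma pw_C1_L2: "pw_C1 \<Omega> \<T> v \<Longrightarrow> v \<in> L2 \<Omega>"
  by (intro continuous_L2[OF op bd]) (simp add: pw_C1_def)

lemma pgrad_measurable:
  assumes "pw_C1 \<Omega> \<T> v"
  shows "(\<lambda>x. pderiv_at i v x) \<in> borel_measurable \<M>"
proof -
  obtain g where g: "g \<in> borel_measurable borel" "\<And>K x. K \<in> \<T> \<Longrightarrow> x \<in> interior K \<Longrightarrow> g x = pderiv_at i v x"
    using pw_C1_pderiv_measurable[OF assms] by blast
  have "g \<in> borel_measurable \<M>"
    using g(1) by (intro measurable_restrict_space1 measurable_completion) simp
  then show ?thesis
    by (rule borel_measurable_lebesgue_on_AE[OF \<Omega>_sets]) (use AE_interior_on in eventually_elim, use g(2) in blast)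
qed

lemma pgrad_L2: "pw_C1 \<Omega> \<T> v \<Longrightarrow> pgrad v \<in> L2 \<Omega>"
proof -
  assume v: "pw_C1 \<Omega> \<T> v"
  obtain B where B: "B \<ge> 0" "\<And>x. x \<in> closure \<Omega> \<Longrightarrow> \<bar>v x\<bar> \<le> B"
    "\<And>K x. K \<in> \<T> \<Longrightarrow> x \<in> interior K \<Longrightarrow> v differentiable (at x)"
    "\<And>K x i. K \<in> \<T> \<Longrightarrow> x \<in> interior K \<Longrightarrow> \<bar>pderiv_at i v x\<bar> \<le> B"
    "\<And>K x y. K \<in> \<T> \<Longrightarrow> x \<in> K \<Longrightarrow> y \<in> K \<Longrightarrow> \<bar>v x - v y\<bar> \<le> B * norm (x - y)"
    by (rule pw_C1_bound[OF v]) (rule that; blast)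
  show ?thesis
  proof (rule L2_bounded[OF \<Omega>_fin \<Omega>_sets])
    show "pgrad v \<in> borel_measurable \<M>"
      unfolding pgrad_def by (rule borel_measurable_vec_lambda[OF pgrad_measurable[OF v]])
    show "AE x in \<M>. norm (pgrad v x) \<le> (\<Sum>i\<in>(UNIV::'n set). B)"
      using AE_interior_on
    proof eventually_elim
      case (elim x)
      have "norm (pgrad v x) \<le> (\<Sum>i\<in>UNIV. \<bar>pgrad v x $ i\<bar>)" by (rule norm_le_l1_cart)
      also have "\<dots> \<le> (\<Sum>i\<in>(UNIV::'n set). B)" using elim B(4) by (intro sum_mono) auto
      finally show ?case .
    qed
  qed
qed

text \<open>No integrals over element faces occur: the derivative is replaced by difference
  quotients, translation invariance moves them from \<open>\<phi>\<close> to the zero extension of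
  \<open>v\<close>, and both sides converge by dominated convergence.\<close>

lemma pw_C1_weak_gradient:
  assumes v: "pw_C1 \<Omega> \<T> v"
  shows "weak_gradient \<Omega> v (pgrad v)"
  unfolding weak_gradient_def
proof (intro ballI allI)
  fix \<phi> i assume \<phi>: "\<phi> \<in> test_functions \<Omega>"
  define e where "e = (axis i 1 :: real^'n)"
  have ne: "norm e = 1" by (simp add: e_def)
  have C1\<phi>: "C1 \<phi>" by (rule test_functions_C1[OF \<phi>])
  obtain K0 where K0: "compact K0" "K0 \<subseteq> \<Omega>" "\<And>x. x \<notin> K0 \<Longrightarrow> \<phi> x = 0"
    using \<phi> by (auto simp: test_functions_iff)
  obtain B where B: "B \<ge> 0" "\<And>x. x \<in> closure \<Omega> \<Longrightarrow> \<bar>v x\<bar> \<le> B"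
    "\<And>K x. K \<in> \<T> \<Longrightarrow> x \<in> interior K \<Longrightarrow> v differentiable (at x)"
    "\<And>K x i. K \<in> \<T> \<Longrightarrow> x \<in> interior K \<Longrightarrow> \<bar>pderiv_at i v x\<bar> \<le> B"
    "\<And>K x y. K \<in> \<T> \<Longrightarrow> x \<in> K \<Longrightarrow> y \<in> K \<Longrightarrow> \<bar>v x - v y\<bar> \<le> B * norm (x - y)"
    by (rule pw_C1_bound[OF v]) (rule that; blast)
  obtain g where g [measurable]: "g \<in> borel_measurable borel"
    and g_eq: "\<And>K x. K \<in> \<T> \<Longrightarrow> x \<in> interior K \<Longrightarrow> g x = pderiv_at i v x"
    using pw_C1_pderiv_measurable[OF v] by blast
  \<comment> \<open>Shifts shorter than \<open>\<delta>\<close> keep the support of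
    \<open>\<phi>\<close> inside the domain.\<close>
  obtain \<delta> where \<delta>: "\<delta> > 0" "(\<Union>x\<in>K0. ball x \<delta>) \<subseteq> \<Omega>"
    using compact_subset_open_imp_ball_epsilon_subset[OF K0(1) op K0(2)] by blast
  obtain R where R: "\<And>x. x \<in> \<Omega> \<Longrightarrow> norm x \<le> R" using bd by (auto simp: bounded_iff)
  obtain L where L0: "L \<ge> 0" "\<forall>x\<in>cball 0 (R + \<delta>). \<forall>y\<in>cball 0 (R + \<delta>). \<bar>\<phi> x - \<phi> y\<bar> \<le> L * norm (x - y)"
    using C1_Lipschitz[of \<phi> "cball 0 (R + \<delta>)", OF C1\<phi> compact_cball convex_cball] by (elim exE conjE)
  then have L: "L \<ge> 0" "\<And>x y. x \<in> cball 0 (R + \<delta>) \<Longrightarrow> y \<in> cball 0 (R + \<delta>) \<Longrightarrow> \<bar>\<phi> x - \<phi> y\<bar> \<le> L * norm (x - y)"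
    by auto
  obtain M where M: "M \<ge> 0" "\<And>x. x \<in> cball 0 R \<Longrightarrow> \<bar>\<phi> x\<bar> \<le> M"
    using C1_compact_bound[of \<phi> "cball 0 R", OF C1\<phi> compact_cball] by (elim exE conjE) auto
  have \<phi>M: "\<bar>\<phi> x\<bar> \<le> M" for x
    using M K0(2) K0(3)[of x] R by (cases "x \<in> K0") (auto simp: subset_iff)
  \<comment> \<open>The jump of the zero extension at the boundary of the domain is never seen,
    because the quotients of \<open>V\<close> are multiplied by \<open>\<phi>\<close> and all shifts
    are shorter than \<open>\<delta>\<close>.\<close>
  define V where "V = (\<lambda>x. if x \<in> \<Omega> then v x else 0)"
  have V [measurable]: "V \<in> borel_measurable borel"
    unfolding V_def using v op
    by (intro borel_measurable_continuous_on_if continuous_intros)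
      (auto simp: pw_C1_def intro: continuous_on_subset[OF _ closure_subset])
  have VB: "\<bar>V x\<bar> \<le> B" for x using B(1,2) closure_subset[of \<Omega>] by (auto simp: V_def subset_iff)
  have [measurable]: "\<phi> \<in> borel_measurable borel"
    using C1_continuous[OF C1\<phi>] by (rule borel_measurable_continuous_onI)
  have [measurable]: "pderiv_at j \<phi> \<in> borel_measurable borel" for j
    using C1\<phi> by (auto simp: C1_def intro: borel_measurable_continuous_onI)
  define t where "t = (\<lambda>n::nat. \<delta> * inverse (real (Suc (Suc n))))"
  have t: "0 < t n" "t n < \<delta>" for n
    using \<delta>(1) by (auto simp: t_def field_simps intro: add_pos_nonneg)
  have t0: "t \<longlonglongrightarrow> 0"
    unfolding t_def using LIMSEQ_Suc[OF LIMSEQ_inverse_real_of_nat] by (intro tendsto_mult_right_zero) simp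
  then have t_at: "filterlim t (at 0) sequentially"
    using t(1) by (auto simp: filterlim_at intro!: always_eventually) (metis less_irrefl)
  have dq: "(\<lambda>n. (f (x + t n *\<^sub>R e) - f x) / t n) \<longlonglongrightarrow> pderiv_at i f x" if "C1 f" for f x
  proof -
    have "((\<lambda>s. f (x + s *\<^sub>R axis i 1)) has_real_derivative pderiv_at i f (x + 0 *\<^sub>R axis i 1)) (at 0)"
      using that by (intro has_real_derivative_line) (simp add: C1_def)
    then have D: "((\<lambda>h. (f (x + h *\<^sub>R e) - f x) / h) \<longlongrightarrow> pderiv_at i f x) (at 0)"
      by (simp add: DERIV_def e_def)
    show ?thesis by (rule filterlim_compose[OF D t_at])
  qed
  have dq': "(\<lambda>n. (f (x - t n *\<^sub>R e) - f x) / t n) \<longlonglongrightarrow> - pderiv_at i f x" if "C1 f" for f x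
  proof -
    have "((\<lambda>s. f (x + s *\<^sub>R axis i 1)) has_real_derivative pderiv_at i f (x + 0 *\<^sub>R axis i 1)) (at 0)"
      using that by (intro has_real_derivative_line) (simp add: C1_def)
    then have D: "((\<lambda>h. (f (x + h *\<^sub>R e) - f x) / h) \<longlongrightarrow> pderiv_at i f x) (at 0)"
      by (simp add: DERIV_def e_def)
    have "filterlim (\<lambda>n. - t n) (at 0) sequentially"
      using t(1) tendsto_minus[OF t0] by (auto simp: filterlim_at intro!: always_eventually) (metis less_irrefl)
    from tendsto_minus[OF filterlim_compose[OF D this]] show ?thesis by simp
  qed
  have small: "norm (t n *\<^sub>R e) < \<delta>" for n using t[of n] ne by simp
  have [measurable]: "K0 \<in> sets borel" using K0(1) by (simp add: compact_imp_closed)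
  have K0b: "bounded K0" using K0(1) by (rule compact_imp_bounded)
  have lhs: "(\<lambda>n. \<integral>x. V x * ((\<phi> (x + t n *\<^sub>R e) - \<phi> x) / t n) \<partial>lborel) \<longlonglongrightarrow> (\<integral>x. V x * pderiv_at i \<phi> x \<partial>lborel)"
  proof (rule integral_dominated_convergence[where w="\<lambda>x. indicator \<Omega> x *\<^sub>R (B * L)"])
    show "integrable lborel (\<lambda>x. indicator \<Omega> x *\<^sub>R (B * L))"
      by (rule integrable_bounded_support[where S=\<Omega> and B="B * L"], measurable)
        (use bd B(1) L(1) in \<open>auto split: split_indicator\<close>)
    show "AE x in lborel. (\<lambda>n. V x * ((\<phi> (x + t n *\<^sub>R e) - \<phi> x) / t n)) \<longlonglongrightarrow> V x * pderiv_at i \<phi> x"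
      by (intro AE_I2 tendsto_intros dq C1\<phi>)
    show "AE x in lborel. norm (V x * ((\<phi> (x + t n *\<^sub>R e) - \<phi> x) / t n)) \<le> indicator \<Omega> x *\<^sub>R (B * L)" for n
    proof (rule AE_I2)
      fix x
      show "norm (V x * ((\<phi> (x + t n *\<^sub>R e) - \<phi> x) / t n)) \<le> indicator \<Omega> x *\<^sub>R (B * L)"
      proof (cases "x \<in> \<Omega>")
        case True
        have "norm (x + t n *\<^sub>R e) \<le> R + \<delta>"
          using norm_triangle_ineq[of x "t n *\<^sub>R e"] small[of n] R[OF True] by linarith
        then have "\<bar>\<phi> (x + t n *\<^sub>R e) - \<phi> x\<bar> \<le> L * norm (t n *\<^sub>R e)"
          using L(2)[of "x + t n *\<^sub>R e" x] R[OF True] \<delta>(1) by simp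
        then have "\<bar>(\<phi> (x + t n *\<^sub>R e) - \<phi> x) / t n\<bar> \<le> L"
          using t(1)[of n] ne by (simp add: field_simps)
        then have "\<bar>V x\<bar> * \<bar>(\<phi> (x + t n *\<^sub>R e) - \<phi> x) / t n\<bar> \<le> B * L"
          using VB[of x] B(1) by (intro mult_mono) auto
        then show ?thesis using True by (simp add: abs_mult)
      qed (simp add: V_def)
    qed
  qed measurable
  have AEg: "AE x in lborel. x \<in> \<Omega> \<longrightarrow> (\<exists>K\<in>\<T>. x \<in> interior K)"
    using AE_interior by (simp add: AE_lebesgue_lborel)
  \<comment> \<open>Pointwise convergence is checked at points of \<open>K0\<close> that are
    interior to an element; off \<open>K0\<close> the integrand is zero.\<close>
  have rhs: "(\<lambda>n. \<integral>x. (V (x - t n *\<^sub>R e) - V x) / t n * \<phi> x \<partial>lborel) \<longlonglongrightarrow> (\<integral>x. indicator \<Omega> x * (- g x * \<phi> x) \<partial>lborel)"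
  proof (rule integral_dominated_convergence[where w="\<lambda>x. indicator K0 x *\<^sub>R (B * M)"])
    show "integrable lborel (\<lambda>x. indicator K0 x *\<^sub>R (B * M))"
      by (rule integrable_bounded_support[where S=K0 and B="B * M"], measurable)
        (use K0b B(1) M(1) in \<open>auto split: split_indicator\<close>)
    show "AE x in lborel. (\<lambda>n. (V (x - t n *\<^sub>R e) - V x) / t n * \<phi> x) \<longlonglongrightarrow> indicator \<Omega> x * (- g x * \<phi> x)"
      using AEg
    proof eventually_elim
      case (elim x)
      show ?case
      proof (cases "x \<in> K0")
        case True
        then have x: "x \<in> \<Omega>" using K0(2) by blast
        then obtain K where K: "K \<in> \<T>" "x \<in> interior K" using elim by blast
        obtain p where p: "C1 p" "\<And>x. x \<in> K \<Longrightarrow> v x = p x" using v K(1) by (auto simp: pw_C1_def)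
        have Vp: "V y = p y" if "y \<in> interior K" for y
          using that interior_elem_subset[OF K(1)] p(2) interior_subset[of K] by (auto simp: V_def)
        have "pderiv_at i v x = pderiv_at i p x"
          by (rule pderiv_at_cong(2)[OF open_interior K(2)]) (use p interior_subset[of K] in \<open>auto simp: C1_def\<close>)
        then have gx: "g x = pderiv_at i p x" using g_eq[OF K] by simp
        have "(\<lambda>n. x - t n *\<^sub>R e) \<longlonglongrightarrow> x - 0 *\<^sub>R e" by (intro tendsto_intros t0)
        then have "\<forall>\<^sub>F n in sequentially. x - t n *\<^sub>R e \<in> interior K"
          using K(2) by (simp add: topological_tendstoD)
        then have "\<forall>\<^sub>F n in sequentially. (p (x - t n *\<^sub>R e) - p x) / t n * \<phi> x = (V (x - t n *\<^sub>R e) - V x) / t n * \<phi> x"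
          by eventually_elim (simp add: Vp K(2))
        moreover have "(\<lambda>n. (p (x - t n *\<^sub>R e) - p x) / t n * \<phi> x) \<longlonglongrightarrow> - pderiv_at i p x * \<phi> x"
          by (intro tendsto_intros dq' p)
        ultimately have "(\<lambda>n. (V (x - t n *\<^sub>R e) - V x) / t n * \<phi> x) \<longlonglongrightarrow> - pderiv_at i p x * \<phi> x"
          by (rule Lim_transform_eventually[rotated])
        then show ?thesis using x gx by simp
      qed (simp add: K0(3))
    qed
    show "AE x in lborel. norm ((V (x - t n *\<^sub>R e) - V x) / t n * \<phi> x) \<le> indicator K0 x *\<^sub>R (B * M)" for n
    proof (rule AE_I2)
      fix x
      show "norm ((V (x - t n *\<^sub>R e) - V x) / t n * \<phi> x) \<le> indicator K0 x *\<^sub>R (B * M)"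
      proof (cases "x \<in> K0")
        case True
        have ball: "ball x \<delta> \<subseteq> \<Omega>" using \<delta>(2) True by blast
        have "x - t n *\<^sub>R e \<in> ball x \<delta>" using small[of n] by (simp add: dist_norm)
        then have "closed_segment (x - t n *\<^sub>R e) x \<subseteq> ball x \<delta>"
          using \<delta>(1) by (intro closed_segment_subset) auto
        then have seg: "closed_segment (x - t n *\<^sub>R e) x \<subseteq> \<Omega>" using ball by blast
        \<comment> \<open>The segment may cross several elements; the Lipschitz bound along segments
          still controls the quotient by \<open>B\<close>, uniformly in \<open>n\<close>.\<close>
        have "\<bar>v (x - t n *\<^sub>R e) - v x\<bar> \<le> B * norm (x - t n *\<^sub>R e - x)"
          using seg closure_subset[of \<Omega>] by (intro pw_C1_segment[OF v B(5)]) auto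
        moreover have "x - t n *\<^sub>R e \<in> \<Omega>" "x \<in> \<Omega>" using seg by auto
        ultimately have "\<bar>(V (x - t n *\<^sub>R e) - V x) / t n\<bar> \<le> B"
          using t(1)[of n] ne by (simp add: V_def field_simps)
        then have "\<bar>(V (x - t n *\<^sub>R e) - V x) / t n\<bar> * \<bar>\<phi> x\<bar> \<le> B * M"
          using \<phi>M[of x] B(1) by (intro mult_mono) auto
        then show ?thesis using True by (simp add: abs_mult)
      qed (simp add: K0(3))
    qed
  qed measurable
  have eq: "(\<integral>x. V x * ((\<phi> (x + t n *\<^sub>R e) - \<phi> x) / t n) \<partial>lborel) =
      (\<integral>x. (V (x - t n *\<^sub>R e) - V x) / t n * \<phi> x \<partial>lborel)" for n
  proof -
    have i1: "integrable lborel (\<lambda>x. V x * \<phi> (x + t n *\<^sub>R e))"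
      by (rule integrable_bounded_support[where S=\<Omega> and B="B * M"])
        (measurable, rule bd, simp add: abs_mult mult_mono VB \<phi>M B(1), simp add: V_def)
    have i2: "integrable lborel (\<lambda>x. V x * \<phi> x)"
      by (rule integrable_bounded_support[where S=\<Omega> and B="B * M"])
        (measurable, rule bd, simp add: abs_mult mult_mono VB \<phi>M B(1), simp add: V_def)
    have i3: "integrable lborel (\<lambda>x. V (x - t n *\<^sub>R e) * \<phi> x)"
      by (rule integrable_bounded_support[where S=K0 and B="B * M"])
        (measurable, rule K0b, simp add: abs_mult mult_mono VB \<phi>M B(1), simp add: K0(3))
    \<comment> \<open>Translation invariance of Lebesgue measure on the whole space; the extension
      by zero has removed the domain from the integral.\<close>
    have s: "(\<integral>x. V x * \<phi> (x + t n *\<^sub>R e) \<partial>lborel) = (\<integral>x. V (x - t n *\<^sub>R e) * \<phi> x \<partial>lborel)"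
      using lborel_integral_shift[of "\<lambda>x. V (x - t n *\<^sub>R e) * \<phi> x" "t n *\<^sub>R e"] by simp
    have "(\<integral>x. V x * ((\<phi> (x + t n *\<^sub>R e) - \<phi> x) / t n) \<partial>lborel) =
        (\<integral>x. (V x * \<phi> (x + t n *\<^sub>R e) - V x * \<phi> x) / t n \<partial>lborel)"
      by (simp add: algebra_simps diff_divide_distrib)
    also have "\<dots> = ((\<integral>x. V (x - t n *\<^sub>R e) * \<phi> x \<partial>lborel) - (\<integral>x. V x * \<phi> x \<partial>lborel)) / t n"
      using i1 i2 s by simp
    also have "\<dots> = (\<integral>x. (V (x - t n *\<^sub>R e) * \<phi> x - V x * \<phi> x) / t n \<partial>lborel)"
      using i2 i3 by simp
    finally show ?thesis by (simp add: algebra_simps diff_divide_distrib)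
  qed
  have lim: "(\<integral>x. V x * pderiv_at i \<phi> x \<partial>lborel) = (\<integral>x. indicator \<Omega> x * (- g x * \<phi> x) \<partial>lborel)"
    using lhs rhs unfolding eq by (rule LIMSEQ_unique)
  have "(\<integral>x. v x * pderiv_at i \<phi> x \<partial>\<M>) = (\<integral>x. V x * pderiv_at i \<phi> x \<partial>\<M>)"
    by (intro Bochner_Integration.integral_cong) (auto simp: V_def)
  also have "\<dots> = (\<integral>x. indicator \<Omega> x *\<^sub>R (V x * pderiv_at i \<phi> x) \<partial>lborel)"
    by (rule integral_lebesgue_on_lborel) measurable
  also have "\<dots> = (\<integral>x. V x * pderiv_at i \<phi> x \<partial>lborel)"
    by (intro Bochner_Integration.integral_cong) (auto simp: V_def)
  also have "\<dots> = (\<integral>x. - g x * \<phi> x \<partial>\<M>)"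
    unfolding lim by (subst integral_lebesgue_on_lborel) auto
  also have "\<dots> = - (\<integral>x. g x * \<phi> x \<partial>\<M>)" by simp
  also have "(\<integral>x. g x * \<phi> x \<partial>\<M>) = (\<integral>x. (pgrad v x $ i) * \<phi> x \<partial>\<M>)"
  proof (rule integral_cong_AE)
    have \<phi>l: "\<phi> \<in> borel_measurable \<M>" "g \<in> borel_measurable \<M>"
      by (auto intro!: measurable_restrict_space1 measurable_completion)
    show "(\<lambda>x. g x * \<phi> x) \<in> borel_measurable \<M>" by (intro borel_measurable_times \<phi>l)
    show "(\<lambda>x. pgrad v x $ i * \<phi> x) \<in> borel_measurable \<M>"
      using pgrad_measurable[OF v] \<phi>l by (auto intro: borel_measurable_times)
    show "AE x in \<M>. g x * \<phi> x = pgrad v x $ i * \<phi> x"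
      using AE_interior_on by eventually_elim (use g_eq in auto)
  qed
  finally show "(\<integral>x. v x * pderiv_at i \<phi> x \<partial>\<M>) = - (\<integral>x. (pgrad v x $ i) * \<phi> x \<partial>\<M>)" .
qed

lemma pw_C1_wgrad: "pw_C1 \<Omega> \<T> v \<Longrightarrow> wgrad \<Omega> v (pgrad v)"
  by (simp add: wgrad_def pgrad_L2 pw_C1_weak_gradient)

lemma pw_C1_grad: "pw_C1 \<Omega> \<T> v \<Longrightarrow> AE x in \<M>. grad \<Omega> v x = pgrad v x"
  by (rule grad_AE[OF op bd pw_C1_wgrad])

end

section \<open>Integration by parts with zero boundary values; inequalities of Poincare and
  Korn\<close>

lemma L2_inner_tendsto_right:
  assumes "a \<in> L2 \<Omega>" "b \<in> L2 \<Omega>" "\<And>m. B m \<in> L2 \<Omega>" "(\<lambda>m. L2_norm \<Omega> (\<lambda>x. b x - B m x)) \<longlonglongrightarrow> 0"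
  shows "(\<lambda>m::nat. L2_inner \<Omega> a (B m)) \<longlonglongrightarrow> L2_inner \<Omega> a b"
proof (rule LIM_zero_cancel, rule Lim_null_comparison)
  show "\<forall>\<^sub>F m in sequentially. norm (L2_inner \<Omega> a (B m) - L2_inner \<Omega> a b) \<le> L2_norm \<Omega> a * L2_norm \<Omega> (\<lambda>x. b x - B m x)"
  proof (rule always_eventually, rule allI)
    fix m
    have "L2_inner \<Omega> a (B m) - L2_inner \<Omega> a b = - L2_inner \<Omega> a (\<lambda>x. b x - B m x)"
      using assms(1-3) by (subst L2_inner_diff_right) auto
    then show "norm (L2_inner \<Omega> a (B m) - L2_inner \<Omega> a b) \<le> L2_norm \<Omega> a * L2_norm \<Omega> (\<lambda>x. b x - B m x)"
      using L2_Cauchy_Schwarz[OF assms(1) L2_diff[OF assms(2) assms(3)[of m]]] by simp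
  qed
  show "(\<lambda>m. L2_norm \<Omega> a * L2_norm \<Omega> (\<lambda>x. b x - B m x)) \<longlonglongrightarrow> 0"
    by (rule tendsto_mult_right_zero[OF assms(4)])
qed

lemma L2_norm_vec_power2:
  fixes v :: "real^'n \<Rightarrow> 'b::euclidean_space^'m"
  assumes "v \<in> L2 \<Omega>"
  shows "(L2_norm \<Omega> v)\<^sup>2 = (\<Sum>i\<in>UNIV. (L2_norm \<Omega> (\<lambda>x. v x $ i))\<^sup>2)"
  unfolding L2_norm_power2 by (rule L2_inner_cart_sum) (rule L2_component[OF assms])+

lemma L2_norm_matrix_power2:
  fixes v :: "real^'n \<Rightarrow> real^'k^'m"
  assumes "v \<in> L2 \<Omega>"
  shows "(L2_norm \<Omega> v)\<^sup>2 = (\<Sum>i\<in>UNIV. \<Sum>j\<in>UNIV. (L2_norm \<Omega> (\<lambda>x. v x $ i $ j))\<^sup>2)"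
  unfolding L2_norm_vec_power2[OF assms]
  by (intro sum.cong refl L2_norm_vec_power2 L2_component assms)

text \<open>The field is reassembled from its components by the coordinate embeddings, which are
  linear and hence Borel.\<close>

lemma L2_vecI:
  fixes v :: "real^'n \<Rightarrow> 'b::euclidean_space^'m"
  assumes "\<And>i. (\<lambda>x. v x $ i) \<in> L2 \<Omega>"
  shows "v \<in> L2 \<Omega>"
proof -
  have "(\<lambda>x. axis i (v x $ i)) \<in> L2 \<Omega>" for i
  proof (rule L2_dominated[OF assms[of i], of _ 1])
    have "linear (\<lambda>y::'b. (axis i y :: 'b^'m))"
      by (rule linearI) (auto simp: vec_eq_iff axis_def)
    then have "(\<lambda>y::'b. (axis i y :: 'b^'m)) \<in> borel_measurable borel"
      by (intro borel_measurable_continuous_onI linear_continuous_on) (simp add: linear_conv_bounded_linear)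
    then show "(\<lambda>x. axis i (v x $ i)) \<in> borel_measurable (lebesgue_on \<Omega>)"
      using L2_measurable[OF assms[of i]] by (rule measurable_compose[rotated])
    have "norm (axis i y :: 'b^'m) \<le> norm y" for y :: 'b
      unfolding norm_vec_def[of "axis i y"]
      by (rule order_trans[OF L2_set_le_sum]) (auto simp: axis_def if_distrib cong: if_cong)
    then show "AE x in lebesgue_on \<Omega>. norm (axis i (v x $ i) :: 'b^'m) \<le> 1 * norm (v x $ i)" by simp
  qed
  then have "(\<lambda>x. \<Sum>i\<in>UNIV. axis i (v x $ i)) \<in> L2 \<Omega>" by (intro L2_sum)
  moreover have "(\<Sum>i\<in>UNIV. axis i (v x $ i)) = v x" for x
    by (simp add: vec_eq_iff axis_def if_distrib cong: if_cong)
  ultimately show ?thesis by simp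
qed

context mesh
begin

lemma pw_C1_I: "C1 p \<Longrightarrow> pw_C1 \<Omega> \<T> p"
  by (auto simp: pw_C1_def intro: C1_continuous)

lemma pw_C1_add:
  assumes "pw_C1 \<Omega> \<T> v" "pw_C1 \<Omega> \<T> w" shows "pw_C1 \<Omega> \<T> (\<lambda>x. v x + w x)"
  unfolding pw_C1_def
proof (intro conjI ballI)
  show "continuous_on (closure \<Omega>) (\<lambda>x. v x + w x)"
    using assms by (intro continuous_on_add) (auto simp: pw_C1_def)
  fix K assume K: "K \<in> \<T>"
  obtain p where p: "C1 p" "\<And>x. x \<in> K \<Longrightarrow> v x = p x" using assms(1) K by (auto simp: pw_C1_def)
  obtain q where q: "C1 q" "\<And>x. x \<in> K \<Longrightarrow> w x = q x" using assms(2) K by (auto simp: pw_C1_def)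
  show "\<exists>p. C1 p \<and> (\<forall>x\<in>K. v x + w x = p x)"
    by (rule exI[of _ "\<lambda>x. p x + q x"]) (use p q C1_add in auto)
qed

lemma pw_C1_mult:
  assumes "pw_C1 \<Omega> \<T> v" "pw_C1 \<Omega> \<T> w" shows "pw_C1 \<Omega> \<T> (\<lambda>x. v x * w x)"
  unfolding pw_C1_def
proof (intro conjI ballI)
  show "continuous_on (closure \<Omega>) (\<lambda>x. v x * w x)"
    using assms by (intro continuous_on_mult) (auto simp: pw_C1_def)
  fix K assume K: "K \<in> \<T>"
  obtain p where p: "C1 p" "\<And>x. x \<in> K \<Longrightarrow> v x = p x" using assms(1) K by (auto simp: pw_C1_def)
  obtain q where q: "C1 q" "\<And>x. x \<in> K \<Longrightarrow> w x = q x" using assms(2) K by (auto simp: pw_C1_def)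
  show "\<exists>p. C1 p \<and> (\<forall>x\<in>K. v x * w x = p x)"
    by (rule exI[of _ "\<lambda>x. p x * q x"]) (use p q C1_mult in auto)
qed

lemma pw_C1_cmult: "pw_C1 \<Omega> \<T> v \<Longrightarrow> pw_C1 \<Omega> \<T> (\<lambda>x. a * v x)"
  by (rule pw_C1_mult[OF pw_C1_I[OF C1_const]])

lemma pw_C1_diff: "pw_C1 \<Omega> \<T> v \<Longrightarrow> pw_C1 \<Omega> \<T> w \<Longrightarrow> pw_C1 \<Omega> \<T> (\<lambda>x. v x - w x)"
  using pw_C1_add[of v "\<lambda>x. -1 * w x"] pw_C1_cmult[of w "-1"] by simp

lemma pw_C1_differentiable:
  assumes v: "pw_C1 \<Omega> \<T> v" and K: "K \<in> \<T>" "x \<in> interior K" shows "v differentiable (at x)"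
proof -
  obtain p where p: "C1 p" "\<And>x. x \<in> K \<Longrightarrow> v x = p x" using v K(1) by (auto simp: pw_C1_def)
  show ?thesis
    by (rule pderiv_at_cong(1)[OF open_interior K(2), of _ p])
      (use p interior_subset[of K] in \<open>auto simp: C1_def\<close>)
qed

lemma pw_C1_AE_differentiable:
  "pw_C1 \<Omega> \<T> v \<Longrightarrow> AE x in \<M>. v differentiable (at x)"
  using AE_interior_on by eventually_elim (auto intro: pw_C1_differentiable)

lemma pderiv_at_L2: "pw_C1 \<Omega> \<T> v \<Longrightarrow> (\<lambda>x. pderiv_at i v x) \<in> L2 \<Omega>"
  using L2_component[OF pgrad_L2, of v i] by simp

lemma AE_pderiv_diff:
  assumes "pw_C1 \<Omega> \<T> v" "pw_C1 \<Omega> \<T> w"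
  shows "AE x in \<M>. pderiv_at i (\<lambda>x. v x - w x) x = pderiv_at i v x - pderiv_at i w x"
  using pw_C1_AE_differentiable[OF assms(1)] pw_C1_AE_differentiable[OF assms(2)]
  by eventually_elim (rule pderiv_at_minus)

lemma AE_pderiv_mult:
  assumes "pw_C1 \<Omega> \<T> v" "pw_C1 \<Omega> \<T> w"
  shows "AE x in \<M>. pderiv_at i (\<lambda>x. v x * w x) x = v x * pderiv_at i w x + pderiv_at i v x * w x"
  using pw_C1_AE_differentiable[OF assms(1)] pw_C1_AE_differentiable[OF assms(2)]
  by eventually_elim (rule pderiv_at_mult)

lemma test_ibp:
  assumes "pw_C1 \<Omega> \<T> v" "\<phi> \<in> test_functions \<Omega>"
  shows "ip v (pderiv_at i \<phi>) = - ip (pderiv_at i v) \<phi>"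
  using pw_C1_weak_gradient[OF assms(1)] assms(2) unfolding weak_gradient_L2_inner by simp

lemma test_pw_C1: "\<phi> \<in> test_functions \<Omega> \<Longrightarrow> pw_C1 \<Omega> \<T> \<phi>"
  by (intro pw_C1_I test_functions_C1)

text \<open>\<open>H1_norm\<close> involves the chosen gradient of the difference. For piecewise C1
  functions this is a.e. the difference of the classical derivatives, and that is the form in which
  the limits below are taken.\<close>

lemma H10_approx:
  assumes v: "v \<in> H10 \<Omega>" "pw_C1 \<Omega> \<T> v"
  shows "\<exists>\<phi>. (\<forall>m::nat. \<phi> m \<in> test_functions \<Omega>) \<and>
    (\<lambda>m. nrm (\<lambda>x. v x - \<phi> m x)) \<longlonglongrightarrow> 0 \<and>
    (\<forall>i. (\<lambda>m. nrm (\<lambda>x. pderiv_at i v x - pderiv_at i (\<phi> m) x)) \<longlonglongrightarrow> 0)"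
proof -
  obtain \<phi> where \<phi>: "\<And>m::nat. \<phi> m \<in> test_functions \<Omega>"
    and lim: "(\<lambda>m. H1_norm \<Omega> (\<lambda>x. v x - \<phi> m x)) \<longlonglongrightarrow> 0"
    using v(1) by (auto simp: H10_def)
  have pw: "pw_C1 \<Omega> \<T> (\<lambda>x. v x - \<phi> m x)" for m by (intro pw_C1_diff v test_pw_C1 \<phi>)
  have le1: "nrm (\<lambda>x. v x - \<phi> m x) \<le> H1_norm \<Omega> (\<lambda>x. v x - \<phi> m x)" for m
    by (simp add: H1_norm_def real_le_rsqrt)
  have le2: "nrm (\<lambda>x. pderiv_at i v x - pderiv_at i (\<phi> m) x) \<le> H1_norm \<Omega> (\<lambda>x. v x - \<phi> m x)" for m i
  proof -
    let ?g = "grad \<Omega> (\<lambda>x. v x - \<phi> m x)"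
    have gL: "?g \<in> L2 \<Omega>" using wgrad_grad[OF pw_C1_wgrad[OF pw[of m]]] by (simp add: wgrad_def)
    have "AE x in \<M>. norm (pderiv_at i v x - pderiv_at i (\<phi> m) x) \<le> 1 * norm (?g x)"
      using AE_pderiv_diff[OF v(2) test_pw_C1[OF \<phi>], of i m] pw_C1_grad[OF pw[of m]]
    proof eventually_elim
      case (elim x)
      show ?case using Finite_Cartesian_Product.norm_nth_le[of "?g x" i] elim by simp
    qed
    then have "nrm (\<lambda>x. pderiv_at i v x - pderiv_at i (\<phi> m) x) \<le> 1 * nrm ?g"
      by (intro L2_norm_mono gL L2_measurable L2_diff pderiv_at_L2 v test_pw_C1 \<phi>) auto
    also have "\<dots> \<le> H1_norm \<Omega> (\<lambda>x. v x - \<phi> m x)" by (simp add: H1_norm_def real_le_rsqrt)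
    finally show ?thesis .
  qed
  show ?thesis
  proof (intro exI[of _ \<phi>] conjI allI \<phi>)
    show "(\<lambda>m. nrm (\<lambda>x. v x - \<phi> m x)) \<longlonglongrightarrow> 0"
      by (rule real_tendsto_sandwich[OF _ _ tendsto_const lim]) (auto intro!: always_eventually le1)
    show "(\<lambda>m. nrm (\<lambda>x. pderiv_at i v x - pderiv_at i (\<phi> m) x)) \<longlonglongrightarrow> 0" for i
      by (rule real_tendsto_sandwich[OF _ _ tendsto_const lim]) (auto intro!: always_eventually le2)
  qed
qed

text \<open>For a test function in place of \<open>v\<close> this is the weak gradient of
  \<open>p\<close>, and both sides are continuous along the approximating sequence. The boundary
  condition enters through \<open>v\<close> alone, so \<open>p\<close> may be a pressure or a
  product of velocity components.\<close>

lemma H10_ibp: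
  assumes p: "pw_C1 \<Omega> \<T> p" and v: "v \<in> H10 \<Omega>" "pw_C1 \<Omega> \<T> v"
  shows "ip p (pderiv_at i v) = - ip (pderiv_at i p) v"
proof -
  obtain \<phi> where \<phi>': "\<forall>m::nat. \<phi> m \<in> test_functions \<Omega>"
    "(\<lambda>m. nrm (\<lambda>x. v x - \<phi> m x)) \<longlonglongrightarrow> 0"
    "\<forall>i. (\<lambda>m. nrm (\<lambda>x. pderiv_at i v x - pderiv_at i (\<phi> m) x)) \<longlonglongrightarrow> 0"
    using H10_approx[OF v] by (elim exE conjE)
  note \<phi> = \<phi>'(1)[rule_format] \<phi>'(2) \<phi>'(3)[rule_format]
  have l1: "(\<lambda>m. ip p (pderiv_at i (\<phi> m))) \<longlonglongrightarrow> ip p (pderiv_at i v)"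
    by (rule L2_inner_tendsto_right) (intro pw_C1_L2 p pderiv_at_L2 v test_pw_C1 \<phi>)+
  have l2: "(\<lambda>m. ip (pderiv_at i p) (\<phi> m)) \<longlonglongrightarrow> ip (pderiv_at i p) v"
    by (rule L2_inner_tendsto_right) (intro pw_C1_L2 p pderiv_at_L2 v test_pw_C1 \<phi>)+
  have "(\<lambda>m. ip p (pderiv_at i (\<phi> m))) \<longlonglongrightarrow> - ip (pderiv_at i p) v"
    using tendsto_minus[OF l2] by (simp add: test_ibp[OF p \<phi>(1)])
  with l1 show ?thesis by (rule LIMSEQ_unique)
qed

text \<open>For a test function in place of \<open>v\<close>, both sides are minus the pairing of
  \<open>w\<close> with a mixed second derivative, which is symmetric. Density passes the identity
  to \<open>v\<close> without second derivatives of \<open>v\<close> or \<open>w\<close>.\<close>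

lemma H10_cross_derivatives:
  assumes v: "v \<in> H10 \<Omega>" "pw_C1 \<Omega> \<T> v" and w: "pw_C1 \<Omega> \<T> w"
  shows "ip (pderiv_at j v) (pderiv_at i w) = ip (pderiv_at i v) (pderiv_at j w)"
proof -
  obtain \<phi> where \<phi>': "\<forall>m::nat. \<phi> m \<in> test_functions \<Omega>"
    "(\<lambda>m. nrm (\<lambda>x. v x - \<phi> m x)) \<longlonglongrightarrow> 0"
    "\<forall>i. (\<lambda>m. nrm (\<lambda>x. pderiv_at i v x - pderiv_at i (\<phi> m) x)) \<longlonglongrightarrow> 0"
    using H10_approx[OF v] by (elim exE conjE)
  note \<phi> = \<phi>'(1)[rule_format] \<phi>'(2) \<phi>'(3)[rule_format]
  have lim: "(\<lambda>m. ip (pderiv_at i w) (pderiv_at j (\<phi> m))) \<longlonglongrightarrow> ip (pderiv_at i w) (pderiv_at j v)" for i j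
    by (rule L2_inner_tendsto_right) (intro w pderiv_at_L2 v test_pw_C1 \<phi>)+
  have "ip (pderiv_at i w) (pderiv_at j (\<phi> m)) = ip (pderiv_at j w) (pderiv_at i (\<phi> m))" for m
  proof -
    have "pderiv_at i (pderiv_at j (\<phi> m)) = pderiv_at j (pderiv_at i (\<phi> m))"
      using \<phi>(1)[of m] by (intro ext pderiv_at_commute) (simp add: test_functions_iff)
    then show ?thesis
      using test_ibp[OF w test_functions_pderiv_at[OF \<phi>(1)], of i j m]
        test_ibp[OF w test_functions_pderiv_at[OF \<phi>(1)], of j i m] by simp
  qed
  then have "ip (pderiv_at i w) (pderiv_at j v) = ip (pderiv_at j w) (pderiv_at i v)"
    using lim[of i j] lim[of j i] LIMSEQ_unique by simp
  then show ?thesis by (simp add: L2_inner_commute)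
qed

text \<open>Integrate \<open>x\<^sub>i v\<close> by parts against \<open>\<partial>\<^sub>i v\<close>.\<close>

lemma Poincare:
  assumes v: "v \<in> H10 \<Omega>" "pw_C1 \<Omega> \<T> v" and R: "\<And>x. x \<in> \<Omega> \<Longrightarrow> norm x \<le> R" "R \<ge> 0"
  shows "nrm v \<le> 2 * R * nrm (pderiv_at i v)"
proof (cases "nrm v = 0")
  case False
  have pw: "pw_C1 \<Omega> \<T> (\<lambda>x. x $ i * v x)" by (intro pw_C1_mult v pw_C1_I C1_coord)
  have vL: "v \<in> L2 \<Omega>" "pderiv_at i v \<in> L2 \<Omega>" using pw_C1_L2[OF v(2)] pderiv_at_L2[OF v(2)] by auto
  have xL: "(\<lambda>x. x $ i * v x) \<in> L2 \<Omega>" by (rule pw_C1_L2[OF pw])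
  have xdL: "(\<lambda>x. x $ i * pderiv_at i v x) \<in> L2 \<Omega>"
  proof (rule L2_dominated[OF vL(2)])
    have xm: "(\<lambda>x::real^'n. x $ i) \<in> borel_measurable \<M>"
      by (intro measurable_restrict_space1 measurable_completion) simp
    show "(\<lambda>x. x $ i * pderiv_at i v x) \<in> borel_measurable \<M>"
      by (rule borel_measurable_times[OF xm L2_measurable[OF vL(2)]])
    show "AE x in \<M>. norm (x $ i * pderiv_at i v x) \<le> R * norm (pderiv_at i v x)"
    proof (rule AE_I2)
      fix x assume "x \<in> space \<M>"
      then have "norm x \<le> R" using R by simp
      then have "\<bar>x $ i\<bar> \<le> R" using component_le_norm_cart[of x i] by linarith
      then show "norm (x $ i * pderiv_at i v x) \<le> R * norm (pderiv_at i v x)"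
        by (simp add: abs_mult mult_right_mono)
    qed
  qed
  have "ip (\<lambda>x. x $ i * v x) (pderiv_at i v) = - ip (pderiv_at i (\<lambda>x. x $ i * v x)) v"
    by (rule H10_ibp[OF pw v])
  also have "ip (pderiv_at i (\<lambda>x. x $ i * v x)) v = ip (\<lambda>x. x $ i * pderiv_at i v x + v x) v"
  proof (rule L2_inner_cong_AE[OF \<Omega>_sets])
    show "AE x in \<M>. pderiv_at i (\<lambda>x. x $ i * v x) x = x $ i * pderiv_at i v x + v x"
      using AE_pderiv_mult[OF pw_C1_I[OF C1_coord] v(2), of i i]
      by eventually_elim (simp add: pderiv_at_coord)
  qed (auto intro: L2_add xdL vL)
  also have "\<dots> = ip (\<lambda>x. x $ i * pderiv_at i v x) v + ip v v"
    by (rule L2_inner_add_left[OF xdL vL(1) vL(1)])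
  also have "ip (\<lambda>x. x $ i * pderiv_at i v x) v = ip (\<lambda>x. x $ i * v x) (pderiv_at i v)"
    by (simp add: L2_inner_def mult_ac)
  finally have e: "(nrm v)\<^sup>2 = - 2 * ip (\<lambda>x. x $ i * v x) (pderiv_at i v)"
    by (simp add: L2_norm_power2)
  have "nrm (\<lambda>x. x $ i * v x) \<le> R * nrm v"
  proof (rule L2_norm_mono[OF vL(1) L2_measurable[OF xL] _ R(2)], rule AE_I2)
    fix x assume "x \<in> space \<M>"
    then have "norm x \<le> R" using R by simp
    then have "\<bar>x $ i\<bar> \<le> R" using component_le_norm_cart[of x i] by linarith
    then show "norm (x $ i * v x) \<le> R * norm (v x)" by (simp add: abs_mult mult_right_mono)
  qed
  then have "\<bar>ip (\<lambda>x. x $ i * v x) (pderiv_at i v)\<bar> \<le> R * nrm v * nrm (pderiv_at i v)"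
    by (intro order_trans[OF L2_Cauchy_Schwarz[OF xL vL(2)]] mult_right_mono) auto
  then have "(nrm v)\<^sup>2 \<le> 2 * (R * nrm v * nrm (pderiv_at i v))"
    using e abs_ge_minus_self[of "ip (\<lambda>x. x $ i * v x) (pderiv_at i v)"] by linarith
  then have "nrm v * nrm v \<le> nrm v * (2 * R * nrm (pderiv_at i v))"
    by (simp add: power2_eq_square mult_ac)
  moreover have "nrm v > 0" using False L2_norm_nonneg[of \<Omega> v] by linarith
  ultimately show ?thesis by (simp add: mult_le_cancel_left_pos)
qed (use R in simp)

definition pwH10 :: "(real^'n \<Rightarrow> real^'n) \<Rightarrow> bool" where
  "pwH10 u \<longleftrightarrow> (\<forall>i. (\<lambda>x. u x $ i) \<in> H10 \<Omega> \<and> pw_C1 \<Omega> \<T> (\<lambda>x. u x $ i))"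

text \<open>A classical counterpart of \<open>jacobian\<close> that allows pointwise computation;
  for piecewise C1 fields the two agree almost everywhere.\<close>

definition pjac :: "(real^'n \<Rightarrow> real^'n) \<Rightarrow> real^'n \<Rightarrow> real^'n^'n" where
  "pjac u = (\<lambda>x. \<chi> i j. pderiv_at j (\<lambda>y. u y $ i) x)"

lemma pjac_nth [simp]: "pjac u x $ i $ j = pderiv_at j (\<lambda>y. u y $ i) x"
  by (simp add: pjac_def)

context
  fixes u :: "real^'n \<Rightarrow> real^'n"
  assumes u: "\<And>i. pw_C1 \<Omega> \<T> (\<lambda>x. u x $ i)"
begin

lemma jacobian_AE: "AE x in \<M>. jacobian \<Omega> u x = pjac u x"
proof -
  have "AE x in \<M>. \<forall>i. grad \<Omega> (\<lambda>y. u y $ i) x = pgrad (\<lambda>y. u y $ i) x"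
    using pw_C1_grad[OF u] by (subst AE_all_countable) simp
  then show ?thesis
    by eventually_elim (simp add: jacobian_def pjac_def pgrad_def vec_eq_iff)
qed

lemma pjac_L2: "pjac u \<in> L2 \<Omega>"
  by (intro L2_vecI) (simp add: pderiv_at_L2[OF u])

lemma jacobian_L2: "jacobian \<Omega> u \<in> L2 \<Omega>"
  by (rule L2_AE[OF \<Omega>_sets pjac_L2 jacobian_AE])

lemma pw_C1_vec_L2: "u \<in> L2 \<Omega>"
  by (intro L2_vecI pw_C1_L2 u)

lemma divergence_AE: "AE x in \<M>. divergence \<Omega> u x = (\<Sum>i\<in>UNIV. pderiv_at i (\<lambda>y. u y $ i) x)"
  using jacobian_AE by eventually_elim (simp add: divergence_def)

lemma divergence_L2: "divergence \<Omega> u \<in> L2 \<Omega>"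
  by (rule L2_AE[OF \<Omega>_sets _ divergence_AE]) (intro L2_sum pderiv_at_L2 u)

lemma symgrad_L2: "symgrad \<Omega> u \<in> L2 \<Omega>"
proof -
  have "(\<lambda>x. transpose (jacobian \<Omega> u x)) \<in> L2 \<Omega>"
    by (intro L2_vecI) (simp add: transpose_def L2_component jacobian_L2)
  then show ?thesis unfolding symgrad_def by (intro L2_scaleR L2_add jacobian_L2)
qed

end

text \<open>With zero boundary values, twice the squared norm of the symmetric gradient is the
  squared norm of the gradient plus that of the divergence, because the cross terms
  \<open>(d i j, d j i)\<close> equal \<open>(d i i, d j j)\<close>. The constant 2 involves neither
  domain nor mesh.\<close>

lemma Korn:
  assumes u: "pwH10 u"
  shows "(nrm (jacobian \<Omega> u))\<^sup>2 \<le> 2 * (nrm (symgrad \<Omega> u))\<^sup>2"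
proof -
  have pw: "\<And>i. pw_C1 \<Omega> \<T> (\<lambda>x. u x $ i)" and h: "\<And>i. (\<lambda>x. u x $ i) \<in> H10 \<Omega>"
    using u by (auto simp: pwH10_def)
  define d where "d = (\<lambda>i j. pderiv_at j (\<lambda>y. u y $ i))"
  have dL: "d i j \<in> L2 \<Omega>" for i j unfolding d_def using pderiv_at_L2[OF pw] by simp
  have J: "(nrm (jacobian \<Omega> u))\<^sup>2 = (\<Sum>i\<in>UNIV. \<Sum>j\<in>UNIV. ip (d i j) (d i j))"
  proof -
    have "nrm (jacobian \<Omega> u) = nrm (pjac u)"
      by (rule L2_norm_cong_AE[OF \<Omega>_sets pjac_L2[OF pw] jacobian_AE[OF pw]])
    then show ?thesis
      using L2_norm_matrix_power2[OF pjac_L2[OF pw]] by (simp add: d_def L2_norm_power2)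
  qed
  define S where "S = (\<lambda>x. \<chi> i j. (1/2) *\<^sub>R (d i j x + d j i x))"
  have SL: "S \<in> L2 \<Omega>"
    unfolding S_def by (intro L2_vecI, unfold vec_lambda_beta, intro L2_scaleR L2_add dL)
  have "AE x in \<M>. symgrad \<Omega> u x = S x"
    using jacobian_AE[OF pw]
    by eventually_elim (simp add: symgrad_def S_def vec_eq_iff transpose_def d_def)
  then have "nrm (symgrad \<Omega> u) = nrm S" by (rule L2_norm_cong_AE[OF \<Omega>_sets SL])
  then have S1: "(nrm (symgrad \<Omega> u))\<^sup>2 =
      (\<Sum>i\<in>UNIV. \<Sum>j\<in>UNIV. ip (\<lambda>x. (1/2) *\<^sub>R (d i j x + d j i x)) (\<lambda>x. (1/2) *\<^sub>R (d i j x + d j i x)))"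
    using L2_norm_matrix_power2[OF SL] by (simp add: S_def L2_norm_power2)
  have S2: "ip (\<lambda>x. (1/2) *\<^sub>R (d i j x + d j i x)) (\<lambda>x. (1/2) *\<^sub>R (d i j x + d j i x)) =
     1/4 * ip (d i j) (d i j) + 1/4 * ip (d j i) (d j i) + 1/2 * ip (d i i) (d j j)" for i j
  proof -
    have "ip (\<lambda>x. (1/2) *\<^sub>R (d i j x + d j i x)) (\<lambda>x. (1/2) *\<^sub>R (d i j x + d j i x)) =
      1/4 * ip (\<lambda>x. d i j x + d j i x) (\<lambda>x. d i j x + d j i x)"
      unfolding L2_inner_scaleR_left L2_inner_scaleR_right by simp
    also have "\<dots> = 1/4 * (ip (d i j) (d i j) + 2 * ip (d i j) (d j i) + ip (d j i) (d j i))"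
      using dL by (simp add: L2_inner_add_left L2_inner_add_right L2_add L2_inner_commute[of _ "d j i" "d i j"])
    also have "ip (d i j) (d j i) = ip (d i i) (d j j)"
      unfolding d_def by (rule H10_cross_derivatives[OF h pw pw])
    finally show ?thesis by (simp add: algebra_simps)
  qed
  \<comment> \<open>\<open>D\<close> is the divergence; the double sum of the cross terms is its
    squared norm, hence nonnegative.\<close>
  define D where "D = (\<lambda>x. \<Sum>i\<in>UNIV. d i i x)"
  have DL: "D \<in> L2 \<Omega>" unfolding D_def by (intro L2_sum dL)
  have D_left: "ip D y = (\<Sum>i\<in>UNIV. ip (d i i) y)" if "y \<in> L2 \<Omega>" for y
    unfolding D_def by (rule L2_inner_sum_left) (use dL that in auto)
  have "ip D D = (\<Sum>i\<in>UNIV. ip D (d i i))"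
    unfolding D_left[OF DL] by (simp only: L2_inner_commute[of \<Omega> D])
  also have "\<dots> = (\<Sum>i\<in>UNIV. \<Sum>j\<in>UNIV. ip (d j j) (d i i))" by (simp only: D_left[OF dL])
  also have "\<dots> = (\<Sum>i\<in>UNIV. \<Sum>j\<in>UNIV. ip (d i i) (d j j))" by (rule sum.swap)
  finally have nn: "0 \<le> (\<Sum>i\<in>UNIV. \<Sum>j\<in>UNIV. ip (d i i) (d j j))"
    using L2_inner_self_nonneg[of \<Omega> D] by simp
  have sw: "(\<Sum>i\<in>UNIV. \<Sum>j\<in>UNIV. ip (d j i) (d j i)) = (\<Sum>i\<in>UNIV. \<Sum>j\<in>UNIV. ip (d i j) (d i j))"
    by (rule sum.swap)
  have "(nrm (symgrad \<Omega> u))\<^sup>2 = 1/4 * (\<Sum>i\<in>UNIV. \<Sum>j\<in>UNIV. ip (d i j) (d i j))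
      + 1/4 * (\<Sum>i\<in>UNIV. \<Sum>j\<in>UNIV. ip (d j i) (d j i))
      + 1/2 * (\<Sum>i\<in>UNIV. \<Sum>j\<in>UNIV. ip (d i i) (d j j))"
    unfolding S1 S2 sum.distrib sum_distrib_left by simp
  with nn sw J show ?thesis by simp
qed

section \<open>The convective form and the pressure term\<close>

lemma conv_AE:
  assumes "\<And>i. pw_C1 \<Omega> \<T> (\<lambda>x. u x $ i)" "\<And>i. pw_C1 \<Omega> \<T> (\<lambda>x. v x $ i)"
  shows "AE x in \<M>. \<forall>i. conv \<Omega> u v x $ i =
    (\<Sum>j\<in>UNIV. pderiv_at j (\<lambda>y. v y $ i) x * u x $ j) + 1/2 * (\<Sum>j\<in>UNIV. pderiv_at j (\<lambda>y. u y $ j) x) * v x $ i"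
  using jacobian_AE[of v, OF assms(2)] divergence_AE[of u, OF assms(1)]
  by eventually_elim (simp add: conv_def matrix_vector_mult_def)

text \<open>One factor is bounded on the domain, which keeps the product square integrable; the
  products in the convective term are of this kind.\<close>

lemma pw_C1_mult_L2:
  assumes w: "w \<in> L2 \<Omega>" and v: "pw_C1 \<Omega> \<T> v"
  shows "(\<lambda>x. w x * v x) \<in> L2 \<Omega>"
proof -
  obtain B where B: "B \<ge> 0" "\<And>x. x \<in> closure \<Omega> \<Longrightarrow> \<bar>v x\<bar> \<le> B"
    "\<And>K x. K \<in> \<T> \<Longrightarrow> x \<in> interior K \<Longrightarrow> v differentiable (at x)"
    "\<And>K x i. K \<in> \<T> \<Longrightarrow> x \<in> interior K \<Longrightarrow> \<bar>pderiv_at i v x\<bar> \<le> B"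
    "\<And>K x y. K \<in> \<T> \<Longrightarrow> x \<in> K \<Longrightarrow> y \<in> K \<Longrightarrow> \<bar>v x - v y\<bar> \<le> B * norm (x - y)"
    by (rule pw_C1_bound[OF v]) (rule that; blast)
  show ?thesis
  proof (rule L2_dominated[OF w, of _ B])
    show "(\<lambda>x. w x * v x) \<in> borel_measurable \<M>"
      by (intro borel_measurable_times L2_measurable w pw_C1_L2 v)
    show "AE x in \<M>. norm (w x * v x) \<le> B * norm (w x)"
    proof (rule AE_I2)
      fix x assume "x \<in> space \<M>"
      then have "\<bar>v x\<bar> \<le> B" using B(2) closure_subset[of \<Omega>] by auto
      then have "\<bar>v x\<bar> * \<bar>w x\<bar> \<le> B * \<bar>w x\<bar>" by (rule mult_right_mono) simp
      then show "norm (w x * v x) \<le> B * norm (w x)" by (simp add: abs_mult mult.commute)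
    qed
  qed
qed

lemma conv_L2:
  assumes "\<And>i. pw_C1 \<Omega> \<T> (\<lambda>x. u x $ i)" "\<And>i. pw_C1 \<Omega> \<T> (\<lambda>x. v x $ i)"
  shows "conv \<Omega> u v \<in> L2 \<Omega>"
proof (rule L2_vecI)
  fix i
  show "(\<lambda>x. conv \<Omega> u v x $ i) \<in> L2 \<Omega>"
  proof (rule L2_AE[OF \<Omega>_sets])
    show "AE x in \<M>. conv \<Omega> u v x $ i =
      (\<Sum>j\<in>UNIV. pderiv_at j (\<lambda>y. v y $ i) x * u x $ j) + (\<Sum>j\<in>UNIV. (1/2) *\<^sub>R pderiv_at j (\<lambda>y. u y $ j) x) * v x $ i"
      using conv_AE[of u v, OF assms] by eventually_elim (simp add: sum_divide_distrib)
    show "(\<lambda>x. (\<Sum>j\<in>UNIV. pderiv_at j (\<lambda>y. v y $ i) x * u x $ j) +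
        (\<Sum>j\<in>UNIV. (1/2) *\<^sub>R pderiv_at j (\<lambda>y. u y $ j) x) * v x $ i) \<in> L2 \<Omega>"
      by (intro L2_add L2_sum pw_C1_mult_L2 pderiv_at_L2 L2_scaleR assms)
  qed
qed

lemma conv_form_eq: "conv_form \<Omega> u v w = ip (conv \<Omega> u v) w"
  by (simp add: conv_form_def L2_inner_def)

text \<open>The half divergence term exists for the sake of this identity. For each pair
  \<open>i\<close>, \<open>j\<close>, integrating the square of \<open>u_i\<close> by parts against
  the \<open>j\<close>-th derivative of \<open>u_j\<close> makes the two contributions cancel,
  although \<open>u\<close> need not be solenoidal.\<close>

lemma conv_form_skew:
  assumes u: "pwH10 u"
  shows "conv_form \<Omega> u u u = 0"
proof -
  have pw: "\<And>i. pw_C1 \<Omega> \<T> (\<lambda>x. u x $ i)" and h: "\<And>i. (\<lambda>x. u x $ i) \<in> H10 \<Omega>"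
    using u by (auto simp: pwH10_def)
  define d where "d = (\<lambda>i j. pderiv_at j (\<lambda>y. u y $ i))"
  have dL: "d i j \<in> L2 \<Omega>" for i j unfolding d_def using pderiv_at_L2[OF pw] by simp
  define A where "A = (\<lambda>i j x. d i j x * u x $ j)"
  define B where "B = (\<lambda>i j x. (1/2) *\<^sub>R (d j j x * u x $ i))"
  have AL: "A i j \<in> L2 \<Omega>" "B i j \<in> L2 \<Omega>" for i j
    unfolding A_def B_def by (intro pw_C1_mult_L2 L2_scaleR dL pw)+
  have uL: "(\<lambda>x. u x $ i) \<in> L2 \<Omega>" for i by (intro pw_C1_L2 pw)
  have "conv_form \<Omega> u u u = (\<Sum>i\<in>UNIV. ip (\<lambda>x. conv \<Omega> u u x $ i) (\<lambda>x. u x $ i))"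
    unfolding conv_form_eq by (intro L2_inner_cart_sum L2_component conv_L2 pw pw_C1_vec_L2)
  also have "\<dots> = (\<Sum>i\<in>UNIV. ip (\<lambda>x. \<Sum>j\<in>UNIV. A i j x + B i j x) (\<lambda>x. u x $ i))"
  proof (intro sum.cong refl L2_inner_cong_AE[OF \<Omega>_sets])
    fix i
    show "AE x in \<M>. conv \<Omega> u u x $ i = (\<Sum>j\<in>UNIV. A i j x + B i j x)"
      using conv_AE[of u u, OF pw pw]
      by eventually_elim (simp add: A_def B_def d_def sum.distrib sum_divide_distrib sum_distrib_right)
  qed (rule L2_sum L2_add AL uL | simp)+
  also have "\<dots> = (\<Sum>i\<in>UNIV. \<Sum>j\<in>UNIV. ip (A i j) (\<lambda>x. u x $ i) + ip (B i j) (\<lambda>x. u x $ i))"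
    using AL uL by (simp add: L2_inner_sum_left L2_inner_add_left L2_add)
  also have "\<dots> = 0"
  proof (intro sum.neutral ballI)
    fix i j
    have "ip (\<lambda>x. u x $ i * u x $ i) (d j j) = - ip (pderiv_at j (\<lambda>x. u x $ i * u x $ i)) (\<lambda>x. u x $ j)"
      unfolding d_def by (rule H10_ibp) (intro pw_C1_mult pw h)+
    also have "ip (pderiv_at j (\<lambda>x. u x $ i * u x $ i)) (\<lambda>x. u x $ j) =
        ip (\<lambda>x. 2 *\<^sub>R (d i j x * u x $ i)) (\<lambda>x. u x $ j)"
    proof (rule L2_inner_cong_AE[OF \<Omega>_sets])
      show "AE x in \<M>. pderiv_at j (\<lambda>x. u x $ i * u x $ i) x = 2 *\<^sub>R (d i j x * u x $ i)"
        using AE_pderiv_mult[OF pw pw, of j i i] by eventually_elim (simp add: d_def)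
    qed (rule L2_scaleR pw_C1_mult_L2 dL pw uL | simp)+
    also have "\<dots> = 2 * ip (A i j) (\<lambda>x. u x $ i)"
      by (simp add: L2_inner_scaleR_left[where a=2, simplified] L2_inner_def A_def mult_ac)
    finally have "ip (\<lambda>x. u x $ i * u x $ i) (d j j) = - 2 * ip (A i j) (\<lambda>x. u x $ i)" by simp
    moreover have "ip (B i j) (\<lambda>x. u x $ i) = 1/2 * ip (\<lambda>x. u x $ i * u x $ i) (d j j)"
      by (simp add: L2_inner_def B_def mult_ac)
    ultimately show "ip (A i j) (\<lambda>x. u x $ i) + ip (B i j) (\<lambda>x. u x $ i) = 0" by simp
  qed
  finally show ?thesis .
qed

text \<open>Integration by parts in each component. A constant added to \<open>p\<close> changes
  neither side, in accordance with pressures being classes modulo constants.\<close>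

lemma pressure_ibp:
  assumes p: "pw_C1 \<Omega> \<T> p" and u: "pwH10 u"
  shows "ip p (divergence \<Omega> u) = - ip (grad \<Omega> p) u"
proof -
  have pw: "\<And>i. pw_C1 \<Omega> \<T> (\<lambda>x. u x $ i)" and h: "\<And>i. (\<lambda>x. u x $ i) \<in> H10 \<Omega>"
    using u by (auto simp: pwH10_def)
  have "ip p (divergence \<Omega> u) = ip p (\<lambda>x. \<Sum>i\<in>UNIV. 1 *\<^sub>R pderiv_at i (\<lambda>y. u y $ i) x)"
    using divergence_AE[OF pw] by (intro L2_inner_cong_AE[OF \<Omega>_sets] pw_C1_L2 p L2_lincomb pderiv_at_L2 pw) auto
  also have "\<dots> = (\<Sum>i\<in>UNIV. 1 * ip p (\<lambda>x. pderiv_at i (\<lambda>y. u y $ i) x))"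
    by (intro L2_inner_lincomb_right pw_C1_L2 p pderiv_at_L2 pw)
  also have "\<dots> = (\<Sum>i\<in>UNIV. - ip (\<lambda>x. pgrad p x $ i) (\<lambda>x. u x $ i))"
    using H10_ibp[OF p h pw] by simp
  also have "\<dots> = - ip (pgrad p) u"
    using L2_inner_cart_sum[of "pgrad p" \<Omega> u] pderiv_at_L2[OF p] pw_C1_L2[OF pw] by (simp add: sum_negf)
  also have "ip (pgrad p) u = ip (grad \<Omega> p) u"
    by (intro L2_inner_cong_AE[OF \<Omega>_sets, symmetric] pgrad_L2 p pw_C1_vec_L2 pw pw_C1_grad) auto
  finally show ?thesis .
qed

end

section \<open>Polynomials and inverse estimates\<close>

definition monomial_fun :: "('n \<Rightarrow> nat) \<Rightarrow> real^'n \<Rightarrow> real" where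
  "monomial_fun \<alpha> x = (\<Prod>i\<in>UNIV. (x $ i) ^ \<alpha> i)"

definition degs :: "nat \<Rightarrow> ('n::finite \<Rightarrow> nat) set" where
  "degs k = {\<alpha>. (\<Sum>i\<in>UNIV. \<alpha> i) \<le> k}"

lemma finite_degs: "finite (degs k :: ('n::finite \<Rightarrow> nat) set)"
proof (rule finite_subset)
  show "degs k \<subseteq> (UNIV::'n set) \<rightarrow>\<^sub>E {..k}"
  proof
    fix \<alpha> :: "'n \<Rightarrow> nat" assume "\<alpha> \<in> degs k"
    then have "\<alpha> i \<le> k" for i
      using member_le_sum[of i UNIV \<alpha>] by (auto simp: degs_def)
    then show "\<alpha> \<in> (UNIV::'n set) \<rightarrow>\<^sub>E {..k}" by auto
  qed
qed (rule finite_PiE, auto)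

lemma polys_iff: "p \<in> polys k \<longleftrightarrow> (\<exists>c. p = (\<lambda>x. \<Sum>\<alpha>\<in>degs k. c \<alpha> * monomial_fun \<alpha> x))"
  by (simp add: polys_def degs_def monomial_fun_def)

lemma monomial_polys: "\<alpha> \<in> degs k \<Longrightarrow> monomial_fun \<alpha> \<in> polys k"
  unfolding polys_iff
  by (rule exI[of _ "\<lambda>\<beta>. if \<beta> = \<alpha> then 1 else 0"]) (auto simp: finite_degs if_distrib[of "\<lambda>c. c * _"] cong: if_cong)

lemma polys_zero: "(\<lambda>x. 0) \<in> polys k"
  unfolding polys_iff by (rule exI[of _ "\<lambda>\<beta>. 0"]) simp

lemma polys_add: "p \<in> polys k \<Longrightarrow> q \<in> polys k \<Longrightarrow> (\<lambda>x. p x + q x) \<in> polys k"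
proof -
  assume "p \<in> polys k" "q \<in> polys k"
  then obtain c d where "p = (\<lambda>x. \<Sum>\<alpha>\<in>degs k. c \<alpha> * monomial_fun \<alpha> x)" "q = (\<lambda>x. \<Sum>\<alpha>\<in>degs k. d \<alpha> * monomial_fun \<alpha> x)"
    unfolding polys_iff by (elim exE)
  then have "(\<lambda>x. p x + q x) = (\<lambda>x. \<Sum>\<alpha>\<in>degs k. (c \<alpha> + d \<alpha>) * monomial_fun \<alpha> x)"
    by (simp add: sum.distrib distrib_right)
  then show ?thesis unfolding polys_iff by (rule exI[of _ "\<lambda>\<alpha>. c \<alpha> + d \<alpha>"])
qed

lemma polys_cmult: "p \<in> polys k \<Longrightarrow> (\<lambda>x. a * p x) \<in> polys k"
proof -
  assume "p \<in> polys k"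
  then obtain c where "p = (\<lambda>x. \<Sum>\<alpha>\<in>degs k. c \<alpha> * monomial_fun \<alpha> x)"
    unfolding polys_iff by (elim exE)
  then have "(\<lambda>x. a * p x) = (\<lambda>x. \<Sum>\<alpha>\<in>degs k. (a * c \<alpha>) * monomial_fun \<alpha> x)"
    by (simp add: sum_distrib_left mult.assoc)
  then show ?thesis unfolding polys_iff by (rule exI[of _ "\<lambda>\<alpha>. a * c \<alpha>"])
qed

lemma polys_sum: "(\<And>j. j \<in> J \<Longrightarrow> f j \<in> polys k) \<Longrightarrow> (\<lambda>x. \<Sum>j\<in>J. a j * f j x) \<in> polys k"
  by (induction J rule: infinite_finite_induct) (auto intro!: polys_add polys_cmult polys_zero)

lemma polys_mono:
  assumes "p \<in> polys a" "a \<le> b" shows "p \<in> polys b"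
proof -
  obtain c where c: "p = (\<lambda>x. \<Sum>\<alpha>\<in>degs a. c \<alpha> * monomial_fun \<alpha> x)"
    using assms(1) unfolding polys_iff by (elim exE)
  show ?thesis unfolding c using assms(2) by (intro polys_sum monomial_polys) (auto simp: degs_def)
qed

lemma polys_mult:
  assumes "p \<in> polys a" "q \<in> polys b" shows "(\<lambda>x. p x * q x) \<in> polys (a + b)"
proof -
  obtain c where c: "p = (\<lambda>x. \<Sum>\<alpha>\<in>degs a. c \<alpha> * monomial_fun \<alpha> x)"
    using assms(1) unfolding polys_iff by (elim exE)
  obtain d where d: "q = (\<lambda>x. \<Sum>\<alpha>\<in>degs b. d \<alpha> * monomial_fun \<alpha> x)"
    using assms(2) unfolding polys_iff by (elim exE)
  have m: "monomial_fun (\<lambda>i. \<alpha> i + \<beta> i) x = monomial_fun \<alpha> x * monomial_fun \<beta> x" for \<alpha> \<beta> :: "'a \<Rightarrow> nat" and x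
    by (simp add: monomial_fun_def power_add prod.distrib)
  have "(\<lambda>x. \<Sum>\<alpha>\<in>degs a. c \<alpha> * (\<Sum>\<beta>\<in>degs b. d \<beta> * monomial_fun (\<lambda>i. \<alpha> i + \<beta> i) x)) \<in> polys (a + b)"
    by (intro polys_sum monomial_polys) (auto simp: degs_def sum.distrib intro: add_mono)
  moreover have "(\<Sum>\<alpha>\<in>degs a. c \<alpha> * (\<Sum>\<beta>\<in>degs b. d \<beta> * monomial_fun (\<lambda>i. \<alpha> i + \<beta> i) x)) = p x * q x" for x
    unfolding c d m by (subst sum_product) (simp add: sum_distrib_left mult_ac)
  ultimately show ?thesis by simp
qed

lemma polys_const: "(\<lambda>x::real^'n. c) \<in> polys k"
proof -
  have "(\<lambda>x. c * monomial_fun (\<lambda>_::'n. 0) x) \<in> polys k"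
    by (intro polys_cmult monomial_polys) (simp add: degs_def)
  then show ?thesis by (simp add: monomial_fun_def)
qed

lemma polys_coord: "(\<lambda>x::real^'n. x $ i) \<in> polys 1"
proof -
  have "monomial_fun (\<lambda>j. if j = i then 1 else 0) \<in> polys 1"
    by (intro monomial_polys) (simp add: degs_def)
  moreover have "monomial_fun (\<lambda>j. if j = i then 1 else 0) x = x $ i" for x :: "real^'n"
  proof -
    have "monomial_fun (\<lambda>j. if j = i then 1 else 0) x = (\<Prod>j\<in>UNIV. if j = i then x $ i else 1)"
      unfolding monomial_fun_def by (intro prod.cong) auto
    then show ?thesis by simp
  qed
  ultimately show ?thesis by (metis (no_types, lifting) ext)
qed

lemma polys_power: "p \<in> polys a \<Longrightarrow> (\<lambda>x. p x ^ n) \<in> polys (n * a)"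
  by (induction n) (auto intro: polys_const polys_mult)

lemma polys_prod: "(\<And>j. j \<in> J \<Longrightarrow> f j \<in> polys (a j)) \<Longrightarrow> (\<lambda>x. \<Prod>j\<in>J. f j x) \<in> polys (\<Sum>j\<in>J. a j)"
  by (induction J rule: infinite_finite_induct) (auto intro: polys_const polys_mult)

lemma polys_affine:
  assumes "p \<in> polys k" shows "(\<lambda>y. p (x0 + h *\<^sub>R y)) \<in> polys k"
proof -
  obtain c where c: "p = (\<lambda>x. \<Sum>\<alpha>\<in>degs k. c \<alpha> * monomial_fun \<alpha> x)"
    using assms unfolding polys_iff by (elim exE)
  have "(\<lambda>y. monomial_fun \<alpha> (x0 + h *\<^sub>R y)) \<in> polys k" if "\<alpha> \<in> degs k" for \<alpha>
  proof (rule polys_mono)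
    have "(\<lambda>y. \<Prod>i\<in>UNIV. (x0 $ i + h * y $ i) ^ \<alpha> i) \<in> polys (\<Sum>i\<in>UNIV. \<alpha> i * 1)"
      by (intro polys_prod polys_power polys_add polys_cmult polys_coord polys_const)
    then show "(\<lambda>y. monomial_fun \<alpha> (x0 + h *\<^sub>R y)) \<in> polys (\<Sum>i\<in>UNIV. \<alpha> i)"
      by (simp add: monomial_fun_def)
  qed (use that in \<open>simp add: degs_def\<close>)
  then show ?thesis unfolding c by (rule polys_sum)
qed

lemma C1_polys: "p \<in> polys k \<Longrightarrow> C1 p"
  unfolding polys_iff monomial_fun_def
  by (elim exE, hypsubst) (intro C1_sum C1_cmult C1_prod C1_power C1_coord)

text \<open>Along the ray through \<open>y\<close> the polynomial becomes one in the single variable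
  \<open>t\<close> with infinitely many zeros near 0, so all its coefficients vanish;
  \<open>t = 1\<close> gives the claim.\<close>

lemma polys_eq_0:
  assumes p: "p \<in> polys k" and \<rho>: "\<rho> > 0" and z: "\<And>x. x \<in> ball 0 \<rho> \<Longrightarrow> p x = 0"
  shows "p y = 0"
proof -
  obtain c where c: "p = (\<lambda>x. \<Sum>\<alpha>\<in>degs k. c \<alpha> * monomial_fun \<alpha> x)"
    using p unfolding polys_iff by (elim exE)
  \<comment> \<open>\<open>b i\<close> is the homogeneous part of degree \<open>i\<close>, evaluated
    at \<open>y\<close>.\<close>
  define b where "b = (\<lambda>i. \<Sum>\<alpha>\<in>{\<alpha>\<in>degs k. (\<Sum>i\<in>UNIV. \<alpha> i) = i}. c \<alpha> * monomial_fun \<alpha> y)"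
  have mono: "monomial_fun \<alpha> (t *\<^sub>R y) = monomial_fun \<alpha> y * t ^ (\<Sum>i\<in>UNIV. \<alpha> i)" for \<alpha> t
    by (simp add: monomial_fun_def power_mult_distrib prod.distrib power_sum mult.commute)
  have pt: "p (t *\<^sub>R y) = (\<Sum>i\<le>k. b i * t ^ i)" for t
  proof -
    have "p (t *\<^sub>R y) = (\<Sum>\<alpha>\<in>degs k. c \<alpha> * monomial_fun \<alpha> y * t ^ (\<Sum>i\<in>UNIV. \<alpha> i))"
      by (simp add: c mono mult.assoc)
    also have "\<dots> = (\<Sum>i\<le>k. \<Sum>\<alpha>\<in>{\<alpha>\<in>degs k. (\<Sum>i\<in>UNIV. \<alpha> i) = i}. c \<alpha> * monomial_fun \<alpha> y * t ^ (\<Sum>i\<in>UNIV. \<alpha> i))"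
      by (rule sum.group[symmetric]) (auto simp: finite_degs, auto simp: degs_def)
    also have "\<dots> = (\<Sum>i\<le>k. b i * t ^ i)"
      unfolding b_def sum_distrib_right by (intro sum.cong) auto
    finally show ?thesis .
  qed
  have "{0<..<\<rho> / (norm y + 1)} \<subseteq> {t. (\<Sum>i\<le>k. b i * t ^ i) = 0}"
  proof
    fix t assume t: "t \<in> {0<..<\<rho> / (norm y + 1)}"
    then have "t * (norm y + 1) < \<rho>" by (simp add: pos_less_divide_eq add_nonneg_pos)
    then have "t * norm y < \<rho>" using t by (simp add: distrib_left)
    then have "t *\<^sub>R y \<in> ball 0 \<rho>" using t by simp
    then have "p (t *\<^sub>R y) = 0" by (rule z)
    then show "t \<in> {t. (\<Sum>i\<le>k. b i * t ^ i) = 0}" using pt[of t] by simp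
  qed
  moreover have "infinite {0<..<\<rho> / (norm y + 1)}"
    using \<rho> by (intro infinite_Ioo) (simp add: add_nonneg_pos)
  ultimately have "infinite {t. (\<Sum>i\<le>k. b i * t ^ i) = 0}" using finite_subset by blast
  then have "\<And>i. i \<le> k \<Longrightarrow> b i = 0" using polyfun_roots_finite[of b _ k] by blast
  then show ?thesis using pt[of 1] by simp
qed

section \<open>Norm equivalence on polynomials and scaling to elements\<close>

lemma continuous_AE_eq_open:
  fixes f g :: "real^'n \<Rightarrow> real"
  assumes S: "open S" and f: "continuous_on UNIV f" "continuous_on UNIV g"
    and ae: "AE x in lebesgue_on S. f x = g x" and x: "x \<in> S"
  shows "f x = g x"
proof (rule ccontr)
  assume ne: "f x \<noteq> g x"
  have "open (S \<inter> {x. f x \<noteq> g x})" by (intro open_Int S open_Collect_neq f)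
  moreover have "S \<inter> {x. f x \<noteq> g x} \<noteq> {}" using ne x by blast
  ultimately have "\<not> negligible (S \<inter> {x. f x \<noteq> g x})" by (rule open_not_negligible)
  moreover have "AE x in lebesgue. x \<in> S \<longrightarrow> f x = g x"
    using ae S by (subst (asm) AE_restrict_space_iff) auto
  then have "AE x in lebesgue. x \<notin> S \<inter> {x. f x \<noteq> g x}" by eventually_elim auto
  then have "negligible (S \<inter> {x. f x \<noteq> g x})"
    by (simp add: negligible_iff_null_sets completion.null_sets_iff_AE)
  ultimately show False by blast
qed

text \<open>Equivalence of norms in finite dimension made explicit: the coefficients of
  \<open>p\<close> in a basis orthonormal on the small ball are at most its norm there, and the
  finitely many basis polynomials have bounded derivatives on the unit ball.\<close>

lemma polys_pderiv_bound:
  assumes \<rho>: "\<rho> > 0"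
  shows "\<exists>C\<ge>0. \<forall>p\<in>(polys k :: (real^'n \<Rightarrow> real) set). \<forall>i. \<forall>y\<in>cball 0 1. \<bar>pderiv_at i p y\<bar> \<le> C * L2_norm (ball 0 \<rho>) p"
proof -
  let ?S = "ball 0 \<rho> :: (real^'n) set"
  have L2: "p \<in> L2 ?S" if "p \<in> polys k" for p by (rule C1_L2(1)[OF open_ball bounded_ball C1_polys[OF that]])
  have mL: "monomial_fun \<alpha> \<in> L2 ?S" if "\<alpha> \<in> degs k" for \<alpha> by (rule L2[OF monomial_polys[OF that]])
  obtain m A e where e_def: "\<forall>j x. e j x = (\<Sum>\<alpha>\<in>degs k. A j \<alpha> *\<^sub>R monomial_fun \<alpha> x)"
    and e: "orthonormal_fam ?S m e"
    and sp: "\<forall>\<alpha>\<in>degs k. AE x in lebesgue_on ?S. monomial_fun \<alpha> x = (\<Sum>j<m. L2_inner ?S (monomial_fun \<alpha>) (e j) *\<^sub>R e j x)"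
  proof -
    have "\<exists>m A e. (\<forall>j x. e j x = (\<Sum>\<alpha>\<in>degs k. A j \<alpha> *\<^sub>R monomial_fun \<alpha> x)) \<and> orthonormal_fam ?S m e \<and>
      (\<forall>\<alpha>\<in>degs k. AE x in lebesgue_on ?S. monomial_fun \<alpha> x = (\<Sum>j<m. L2_inner ?S (monomial_fun \<alpha>) (e j) *\<^sub>R e j x))"
      by (rule gram_schmidt[OF finite_degs mL])
    then show thesis using that by (elim exE conjE)
  qed
  have e_fun: "e j = (\<lambda>x. \<Sum>\<alpha>\<in>degs k. A j \<alpha> * monomial_fun \<alpha> x)" for j using e_def by auto
  have eP: "e j \<in> polys k" for j unfolding e_fun by (intro polys_sum monomial_polys)
  \<comment> \<open>The a.e. expansion on the ball becomes an identity on the whole space, first by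
    continuity and then by \<open>polys_eq_0\<close>; the derivatives are estimated on the unit
    ball, which the small ball need not cover.\<close>
  have repr: "p y = (\<Sum>j<m. L2_inner ?S p (e j) * e j y)" if p: "p \<in> polys k" for p y
  proof -
    obtain c where c: "p = (\<lambda>x. \<Sum>\<alpha>\<in>degs k. c \<alpha> * monomial_fun \<alpha> x)"
      using p unfolding polys_iff by (elim exE)
    have mono: "monomial_fun \<alpha> x = (\<Sum>j<m. L2_inner ?S (monomial_fun \<alpha>) (e j) * e j x)" if \<alpha>: "\<alpha> \<in> degs k" for \<alpha> x
    proof -
      let ?q = "\<lambda>x. \<Sum>j<m. L2_inner ?S (monomial_fun \<alpha>) (e j) * e j x"
      have q: "?q \<in> polys k" by (intro polys_sum eP)
      have eq: "monomial_fun \<alpha> x = ?q x" if "x \<in> ?S" for x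
      proof (rule continuous_AE_eq_open[OF open_ball _ _ _ that])
        show "continuous_on UNIV (monomial_fun \<alpha>)" "continuous_on UNIV ?q"
          by (rule C1_continuous, rule C1_polys, rule monomial_polys[OF \<alpha>])
            (rule C1_continuous, rule C1_polys, rule q)
        show "AE x in lebesgue_on ?S. monomial_fun \<alpha> x = ?q x" using sp \<alpha> by simp
      qed
      define r where "r = (\<lambda>x. monomial_fun \<alpha> x + (-1) * ?q x)"
      have "r \<in> polys k" unfolding r_def by (rule polys_add[OF monomial_polys[OF \<alpha>] polys_cmult[OF q]])
      moreover have "r x = 0" if "x \<in> ?S" for x unfolding r_def by (simp only: eq[OF that])
      ultimately have "r x = 0" using polys_eq_0[OF _ \<rho>] by blast
      then show ?thesis by (simp add: r_def)
    qed
    have inner: "L2_inner ?S p (e j) = (\<Sum>\<alpha>\<in>degs k. c \<alpha> * L2_inner ?S (monomial_fun \<alpha>) (e j))" for j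
      unfolding c using L2_inner_lincomb_left[of "degs k" monomial_fun ?S "e j" c, OF mL L2[OF eP]] by simp
    have "p y = (\<Sum>\<alpha>\<in>degs k. \<Sum>j<m. c \<alpha> * L2_inner ?S (monomial_fun \<alpha>) (e j) * e j y)"
      unfolding c by (intro sum.cong refl) (simp add: mono sum_distrib_left mult.assoc)
    also have "\<dots> = (\<Sum>j<m. L2_inner ?S p (e j) * e j y)"
      by (subst sum.swap) (simp add: inner sum_distrib_right)
    finally show ?thesis .
  qed
  have "\<exists>B. \<forall>j. 0 \<le> B j \<and> (\<forall>x\<in>cball 0 1. \<bar>e j x\<bar> \<le> B j) \<and> (\<forall>i. \<forall>x\<in>cball 0 1. \<bar>pderiv_at i (e j) x\<bar> \<le> B j)"
    by (intro choice allI C1_compact_bound C1_polys[OF eP] compact_cball)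
  then obtain B where "\<forall>j. 0 \<le> B j \<and> (\<forall>x\<in>cball 0 1. \<bar>e j x\<bar> \<le> B j) \<and> (\<forall>i. \<forall>x\<in>cball 0 1. \<bar>pderiv_at i (e j) x\<bar> \<le> B j)"
    by (rule exE)
  then have B: "0 \<le> B j" "x \<in> cball 0 1 \<Longrightarrow> \<bar>pderiv_at i (e j) x\<bar> \<le> B j" for i j x by auto
  have "\<bar>pderiv_at i p y\<bar> \<le> (\<Sum>j<m. B j) * L2_norm ?S p" if p: "p \<in> polys k" and y: "y \<in> cball 0 1" for p i y
  proof -
    have "(p has_derivative (\<lambda>h. \<Sum>j<m. L2_inner ?S p (e j) * (\<Sum>i\<in>UNIV. h $ i * pderiv_at i (e j) y))) (at y)"
    proof -
      have "((\<lambda>y. \<Sum>j<m. L2_inner ?S p (e j) * e j y) has_derivative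
        (\<lambda>h. \<Sum>j<m. L2_inner ?S p (e j) * (\<Sum>i\<in>UNIV. h $ i * pderiv_at i (e j) y))) (at y)"
        using C1_polys[OF eP] by (intro has_derivative_sum has_derivative_mult_right pderiv_at_has_derivative) (simp add: C1_def)
      then show ?thesis by (simp only: repr[OF p, symmetric])
    qed
    from has_derivative_pderiv_at[OF this, of i]
    have "pderiv_at i p y = (\<Sum>j<m. L2_inner ?S p (e j) * (\<Sum>l\<in>UNIV. axis i 1 $ l * pderiv_at l (e j) y))" .
    also have "\<dots> = (\<Sum>j<m. L2_inner ?S p (e j) * pderiv_at i (e j) y)"
      by (intro sum.cong refl arg_cong2[where f="(*)"]) (simp add: axis_def if_distrib[of "\<lambda>c. c * _"] cong: if_cong)
    finally have "\<bar>pderiv_at i p y\<bar> \<le> (\<Sum>j<m. \<bar>L2_inner ?S p (e j) * pderiv_at i (e j) y\<bar>)" by simp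
    also have "\<dots> \<le> (\<Sum>j<m. B j * L2_norm ?S p)"
    proof (rule sum_mono)
      fix j assume j: "j \<in> {..<m}"
      have "L2_inner ?S (e j) (e j) = 1" using e j by (simp add: orthonormal_fam_def)
      then have "L2_norm ?S (e j) = 1" by (simp add: L2_norm_def)
      then have "\<bar>L2_inner ?S p (e j)\<bar> \<le> L2_norm ?S p" using L2_Cauchy_Schwarz[OF L2[OF p] L2[OF eP], of j] by simp
      then have "\<bar>L2_inner ?S p (e j)\<bar> * \<bar>pderiv_at i (e j) y\<bar> \<le> L2_norm ?S p * B j"
        using B(2)[OF y] by (intro mult_mono) auto
      then show "\<bar>L2_inner ?S p (e j) * pderiv_at i (e j) y\<bar> \<le> B j * L2_norm ?S p" by (simp add: abs_mult mult.commute)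
    qed
    finally show ?thesis by (simp add: sum_distrib_right)
  qed
  then show ?thesis using B(1) by (intro exI[of _ "\<Sum>j<m. B j"]) (auto intro: sum_nonneg)
qed

lemma lborel_integral_affine:
  fixes f :: "real^'n \<Rightarrow> real"
  assumes [measurable]: "f \<in> borel_measurable borel" and h: "h > 0"
  shows "(\<integral>x. f x \<partial>lborel) = h ^ CARD('n) * (\<integral>y. f (x0 + h *\<^sub>R y) \<partial>lborel)"
proof -
  have "(\<integral>x. f x \<partial>lborel) = (\<integral>x. f x \<partial>density (distr lborel borel (\<lambda>x. x0 + h *\<^sub>R x)) (\<lambda>_. ennreal (\<bar>h\<bar> ^ DIM(real^'n))))"
    using lborel_affine[of h x0] h by simp
  also have "\<dots> = (\<integral>x. (\<bar>h\<bar> ^ DIM(real^'n)) *\<^sub>R f x \<partial>distr lborel borel (\<lambda>x. x0 + h *\<^sub>R x))"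
    by (intro integral_density) (use h in auto)
  also have "\<dots> = (\<integral>x. (\<bar>h\<bar> ^ DIM(real^'n)) *\<^sub>R f (x0 + h *\<^sub>R x) \<partial>lborel)"
    by (intro integral_distr) auto
  finally show ?thesis using h by simp
qed

lemma pderiv_at_affine:
  assumes "C1 p"
  shows "pderiv_at i (\<lambda>y. p (x0 + h *\<^sub>R y)) y = h * pderiv_at i p (x0 + h *\<^sub>R y)"
proof -
  have "((\<lambda>y. x0 + h *\<^sub>R y) has_derivative (\<lambda>v. h *\<^sub>R v)) (at y)" by (auto intro!: derivative_eq_intros)
  from has_derivative_compose[OF this pderiv_at_has_derivative[of p "x0 + h *\<^sub>R y"]]
  have D: "((\<lambda>y. p (x0 + h *\<^sub>R y)) has_derivative (\<lambda>v. \<Sum>i\<in>UNIV. (h *\<^sub>R v) $ i * pderiv_at i p (x0 + h *\<^sub>R y))) (at y)"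
    using assms by (simp add: C1_def)
  show ?thesis
    unfolding has_derivative_pderiv_at[OF D]
    by (simp add: axis_def if_distrib[of "\<lambda>c. _ * c * _"] cong: if_cong)
qed

lemma L2_norm_lborel:
  assumes "open S" "continuous_on UNIV (p :: real^'n \<Rightarrow> real)"
  shows "(L2_norm S p)\<^sup>2 = (\<integral>x. indicator S x * (p x)\<^sup>2 \<partial>lborel)"
proof -
  have [measurable]: "p \<in> borel_measurable borel" using assms(2) by (rule borel_measurable_continuous_onI)
  have "(L2_norm S p)\<^sup>2 = (\<integral>x. p x * p x \<partial>lebesgue_on S)" by (simp add: L2_norm_power2 L2_inner_def)
  also have "\<dots> = (\<integral>x. indicator S x *\<^sub>R (p x * p x) \<partial>lborel)"
    using assms(1) by (intro integral_lebesgue_on_lborel) auto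
  finally show ?thesis by (simp add: power2_eq_square)
qed

text \<open>Under \<open>x = x0 + h y\<close> the element contains the image of the ball of radius
  \<open>\<rho>\<close> and lies in the image of the unit ball. A derivative costs a factor
  \<open>1 / h\<close>, and the squared norm scales with \<open>h\<close> to the power of the
  dimension. \<open>C\<close> is fixed before element, centre and scale.\<close>

lemma polys_inverse_element:
  fixes \<rho> :: real
  assumes \<rho>: "\<rho> > 0"
  shows "\<exists>C\<ge>0. \<forall>K x0 h. \<forall>p\<in>(polys k :: (real^'n \<Rightarrow> real) set). \<forall>i. h > 0 \<longrightarrow> ball x0 (\<rho> * h) \<subseteq> K \<longrightarrow> K \<subseteq> cball x0 h \<longrightarrow>
     (\<forall>x\<in>K. \<bar>pderiv_at i p x\<bar> \<le> C / h * sqrt ((L2_norm (interior K) p)\<^sup>2 / h ^ CARD('n))) \<and>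
     (\<forall>M. (\<forall>x\<in>K. \<bar>p x\<bar> \<le> M) \<longrightarrow> (\<forall>x\<in>K. \<bar>pderiv_at i p x\<bar> \<le> C / h * M))"
proof -
  obtain C where C: "C \<ge> 0" "\<forall>p\<in>(polys k :: (real^'n \<Rightarrow> real) set). \<forall>i. \<forall>y\<in>cball 0 1. \<bar>pderiv_at i p y\<bar> \<le> C * L2_norm (ball 0 \<rho>) p"
    using polys_pderiv_bound[OF \<rho>, of k] by (elim exE conjE)
  let ?S = "ball 0 \<rho> :: (real^'n) set"
  \<comment> \<open>\<open>V\<close> is the norm of the constant 1 on the small ball and turns a
    bound by the maximum into one by the norm. The factor \<open>1 + V\<close> serves both
    estimates.\<close>
  define V where "V = sqrt (\<integral>x. indicator ?S x \<partial>lborel)"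
  have V: "V \<ge> 0" unfolding V_def by (intro real_sqrt_ge_zero Bochner_Integration.integral_nonneg) auto
  have bound: "(\<forall>x\<in>K. \<bar>pderiv_at i p x\<bar> \<le> C * (1 + V) / h * sqrt ((L2_norm (interior K) p)\<^sup>2 / h ^ CARD('n))) \<and>
     (\<forall>M. (\<forall>x\<in>K. \<bar>p x\<bar> \<le> M) \<longrightarrow> (\<forall>x\<in>K. \<bar>pderiv_at i p x\<bar> \<le> C * (1 + V) / h * M))"
    if p: "p \<in> polys k" and h: "h > 0" and K: "ball x0 (\<rho> * h) \<subseteq> K" "K \<subseteq> cball x0 h" for p :: "real^'n \<Rightarrow> real" and K x0 h i
  proof -
    define P where "P = (\<lambda>y. p (x0 + h *\<^sub>R y))"
    have P: "P \<in> polys k" unfolding P_def by (rule polys_affine[OF p])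
    have cp: "continuous_on UNIV p" "continuous_on UNIV P"
      using C1_continuous[OF C1_polys[OF p]] C1_continuous[OF C1_polys[OF P]] by auto
    have [measurable]: "p \<in> borel_measurable borel" "P \<in> borel_measurable borel" using cp by (auto intro: borel_measurable_continuous_onI)
    have *: "\<bar>pderiv_at i p x\<bar> \<le> C / h * L2_norm ?S P" if x: "x \<in> K" for x
    proof -
      define y where "y = (1/h) *\<^sub>R (x - x0)"
      have xy: "x = x0 + h *\<^sub>R y" using h by (simp add: y_def)
      have "norm (x - x0) \<le> h" using K(2) x by (auto simp: dist_norm norm_minus_commute)
      moreover have "norm y = norm (x - x0) / h" using h by (simp add: y_def)
      ultimately have "y \<in> cball 0 1" using h by simp
      then have "\<bar>pderiv_at i P y\<bar> \<le> C * L2_norm ?S P" using C(2) P by blast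
      then have "\<bar>h * pderiv_at i p x\<bar> \<le> C * L2_norm ?S P" unfolding P_def pderiv_at_affine[OF C1_polys[OF p]] xy by simp
      then show ?thesis using h by (simp add: abs_mult field_simps)
    qed
    have "(L2_norm ?S P)\<^sup>2 = (\<integral>y. indicator ?S y * (P y)\<^sup>2 \<partial>lborel)"
      by (rule L2_norm_lborel) (auto simp: cp)
    also have "\<dots> = (\<integral>y. indicator (ball x0 (\<rho> * h)) (x0 + h *\<^sub>R y) * (p (x0 + h *\<^sub>R y))\<^sup>2 \<partial>lborel)"
      using h by (intro Bochner_Integration.integral_cong refl)
        (simp add: P_def indicator_def dist_norm mult.commute)
    also have "\<dots> = (\<integral>x. indicator (ball x0 (\<rho> * h)) x * (p x)\<^sup>2 \<partial>lborel) / h ^ CARD('n)"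
    proof -
      have "(\<lambda>x. indicator (ball x0 (\<rho> * h)) x * (p x)\<^sup>2) \<in> borel_measurable borel"
        using \<open>p \<in> borel_measurable borel\<close>
        by (intro borel_measurable_times borel_measurable_indicator borel_measurable_power) auto
      from lborel_integral_affine[OF this h, of x0] show ?thesis using h by simp
    qed
    also have "(\<integral>x. indicator (ball x0 (\<rho> * h)) x * (p x)\<^sup>2 \<partial>lborel) \<le> (\<integral>x. indicator (interior K) x * (p x)\<^sup>2 \<partial>lborel)"
    proof (rule integral_mono)
      obtain B where "0 \<le> B" "\<forall>x\<in>cball x0 h. \<bar>p x\<bar> \<le> B" "\<forall>i. \<forall>x\<in>cball x0 h. \<bar>pderiv_at i p x\<bar> \<le> B"
        using C1_compact_bound[of p "cball x0 h", OF C1_polys[OF p] compact_cball] by (elim exE conjE)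
      then have B: "\<And>x. x \<in> cball x0 h \<Longrightarrow> \<bar>p x\<bar> \<le> B" by blast
      have int: "integrable lborel (\<lambda>x. indicator S x * (p x)\<^sup>2)" if S: "open S" "S \<subseteq> cball x0 h" for S
      proof (rule integrable_bounded_support[where S="cball x0 h" and B="B\<^sup>2"])
        fix x
        show "\<bar>indicator S x * (p x)\<^sup>2\<bar> \<le> B\<^sup>2"
        proof (cases "x \<in> S")
          case True
          then have "\<bar>p x\<bar> \<le> B" using B S(2) by blast
          then have "\<bar>p x\<bar>\<^sup>2 \<le> B\<^sup>2" by (intro power_mono) auto
          then show ?thesis using True by simp
        qed simp
        have [measurable]: "S \<in> sets borel" using S(1) by simp
        show "(\<lambda>x. indicator S x * (p x)\<^sup>2) \<in> borel_measurable borel" by measurable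
      qed (use S in \<open>auto split: split_indicator\<close>)
      show "integrable lborel (\<lambda>x. indicator (interior K) x * (p x)\<^sup>2)"
        using K(2) interior_subset[of K] by (intro int) auto
      show "integrable lborel (\<lambda>x. indicator (ball x0 (\<rho> * h)) x * (p x)\<^sup>2)"
        using K by (intro int) auto
      have "ball x0 (\<rho> * h) \<subseteq> interior K" using K(1) by (intro interior_maximal) auto
      then show "indicator (ball x0 (\<rho> * h)) x * (p x)\<^sup>2 \<le> indicator (interior K) x * (p x)\<^sup>2" for x
        by (intro mult_right_mono) (auto split: split_indicator)
    qed
    also have "(\<integral>x. indicator (interior K) x * (p x)\<^sup>2 \<partial>lborel) = (L2_norm (interior K) p)\<^sup>2"
      by (rule L2_norm_lborel[symmetric]) (auto simp: cp)
    finally have "(L2_norm ?S P)\<^sup>2 \<le> (L2_norm (interior K) p)\<^sup>2 / h ^ CARD('n)"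
      using h by (simp add: divide_right_mono)
    then have n1: "L2_norm ?S P \<le> sqrt ((L2_norm (interior K) p)\<^sup>2 / h ^ CARD('n))" by (rule real_le_rsqrt)
    have Chn: "0 \<le> C / h" using C(1) h by simp
    have le: "C / h * a \<le> C * (1 + V) / h * a" if "a \<ge> 0" for a
    proof (rule mult_right_mono[OF _ that])
      have "C * 1 \<le> C * (1 + V)" using C(1) V by (intro mult_left_mono) auto
      then show "C / h \<le> C * (1 + V) / h" using h by (intro divide_right_mono) auto
    qed
    have "\<bar>pderiv_at i p x\<bar> \<le> C * (1 + V) / h * sqrt ((L2_norm (interior K) p)\<^sup>2 / h ^ CARD('n))" if x: "x \<in> K" for x
      using *[OF x] mult_left_mono[OF n1 Chn] le[of "sqrt ((L2_norm (interior K) p)\<^sup>2 / h ^ CARD('n))"] h by force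
    moreover have "\<bar>pderiv_at i p x\<bar> \<le> C * (1 + V) / h * M" if M: "\<forall>x\<in>K. \<bar>p x\<bar> \<le> M" and x: "x \<in> K" for M x
    proof -
      have M0: "0 \<le> M" using M x abs_ge_zero order_trans by blast
      have "(L2_norm ?S P)\<^sup>2 = (\<integral>y. indicator ?S y * (P y)\<^sup>2 \<partial>lborel)"
        by (rule L2_norm_lborel) (auto simp: cp)
      also have "\<dots> \<le> (\<integral>y. M\<^sup>2 * indicator ?S y \<partial>lborel)"
      proof (rule Bochner_Integration.integral_mono')
        show "integrable lborel (\<lambda>y. M\<^sup>2 * indicator ?S y)"
          by (intro integrable_mult_right integrable_real_indicator) (use emeasure_bounded_finite[OF bounded_ball] in \<open>auto simp: less_top\<close>)
        fix y
        show "indicator ?S y * (P y)\<^sup>2 \<le> M\<^sup>2 * indicator ?S y"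
        proof (cases "y \<in> ?S")
          case True
          then have "x0 + h *\<^sub>R y \<in> ball x0 (\<rho> * h)" using h by (simp add: dist_norm mult.commute)
          then have "\<bar>P y\<bar> \<le> M" using M K(1) by (auto simp: P_def)
          then have "\<bar>P y\<bar>\<^sup>2 \<le> M\<^sup>2" by (intro power_mono) auto
          then show ?thesis using True by simp
        qed simp
      qed auto
      also have "\<dots> = (M * V)\<^sup>2"
        unfolding V_def by (simp add: power_mult_distrib)
      finally have "(L2_norm ?S P)\<^sup>2 \<le> (M * V)\<^sup>2" .
      then have "L2_norm ?S P \<le> M * V" by (rule power2_le_imp_le) (simp add: M0 V)
      also have "\<dots> \<le> M * (1 + V)" using M0 by (intro mult_left_mono) auto
      finally have "C / h * L2_norm ?S P \<le> C / h * (M * (1 + V))"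
        by (intro mult_left_mono[OF _ Chn])
      moreover have "C * (1 + V) / h * M = C / h * (M * (1 + V))" by simp
      ultimately show ?thesis using *[OF x] by linarith
    qed
    ultimately show ?thesis by blast
  qed
  show ?thesis by (rule exI[of _ "C * (1 + V)"]) (use bound C(1) V in auto)
qed

lemma L2_lebesgue: "(L2_norm S f)\<^sup>2 = (\<integral>x. indicator S x *\<^sub>R (f x \<bullet> f x) \<partial>lebesgue)" if "S \<in> sets lebesgue"
  unfolding L2_norm_power2 L2_inner_def using that by (subst integral_restrict_space) auto

lemma L2_norm_add_le:
  assumes "v \<in> L2 \<Omega>" "w \<in> L2 \<Omega>" "L2_norm \<Omega> v \<le> a" "L2_norm \<Omega> w \<le> b"
  shows "L2_norm \<Omega> (\<lambda>x. v x + w x) \<le> a + b"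
  using L2_norm_triangle[OF assms(1,2)] assms(3,4) by linarith

lemma L2_norm_sum_le:
  assumes "\<And>i. i \<in> I \<Longrightarrow> v i \<in> L2 \<Omega>"
  shows "L2_norm \<Omega> (\<lambda>x. \<Sum>i\<in>I. v i x) \<le> (\<Sum>i\<in>I. L2_norm \<Omega> (v i))"
  using assms
proof (induction I rule: infinite_finite_induct)
  case (insert i I)
  have "L2_norm \<Omega> (\<lambda>x. v i x + (\<Sum>j\<in>I. v j x)) \<le> L2_norm \<Omega> (v i) + (\<Sum>j\<in>I. L2_norm \<Omega> (v j))"
    by (rule L2_norm_add_le) (use insert in \<open>auto intro: L2_sum\<close>)
  then show ?case using insert by simp
qed auto

section \<open>Mesh size and elementwise splitting of the norm\<close>

context mesh
begin

lemma mesh_nonempty: "\<T> \<noteq> {}"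
  using cover ne closure_subset[of \<Omega>] by auto

lemma diameter_elem_le: "K \<in> \<T> \<Longrightarrow> diameter K \<le> mesh_size \<T>"
  unfolding mesh_size_def using fin by (intro Max_ge) auto

lemma mesh_size_pos: "mesh_size \<T> > 0"
proof -
  obtain K where K: "K \<in> \<T>" using mesh_nonempty by blast
  obtain x where "x \<in> interior K" using int_ne[OF K] by blast
  then obtain e where e: "e > 0" "ball x e \<subseteq> K" by (meson mem_interior)
  obtain i :: 'n where True by blast
  have "x + (e/2) *\<^sub>R axis i 1 \<in> ball x e" using e by (simp add: dist_norm)
  then have "x + (e/2) *\<^sub>R axis i 1 \<in> K" "x \<in> K" using e by auto
  then have "dist (x + (e/2) *\<^sub>R axis i 1) x \<le> diameter K"
    using compact_imp_bounded[OF elem(1)[OF K]] by (intro diameter_bounded_bound)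
  then have "diameter K > 0" using e by (simp add: dist_norm)
  then show ?thesis using diameter_elem_le[OF K] by linarith
qed

lemma mesh_size_le: "mesh_size \<T> \<le> diameter (closure \<Omega>)"
proof -
  have "mesh_size \<T> \<in> diameter ` \<T>" unfolding mesh_size_def using fin mesh_nonempty by (intro Max_in) auto
  then obtain K where K: "K \<in> \<T>" "mesh_size \<T> = diameter K" by auto
  then show ?thesis using diameter_subset[OF elem_subset[OF K(1)] bounded_closure[OF bd]] by simp
qed

lemma elem_cball: "K \<in> \<T> \<Longrightarrow> x \<in> K \<Longrightarrow> K \<subseteq> cball x (mesh_size \<T>)"
proof
  fix y assume K: "K \<in> \<T>" "x \<in> K" "y \<in> K"
  then have "dist x y \<le> diameter K"
    using compact_imp_bounded[OF elem(1)] by (intro diameter_bounded_bound)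
  then show "y \<in> cball x (mesh_size \<T>)" using diameter_elem_le[OF K(1)] by simp
qed

text \<open>The element interiors are disjoint and exhaust the domain up to a null set.\<close>

lemma L2_norm_split:
  assumes f: "f \<in> L2 \<Omega>"
  shows "(nrm f)\<^sup>2 = (\<Sum>K\<in>\<T>. (L2_norm (interior K) f)\<^sup>2)"
proof -
  have "integrable \<M> (\<lambda>x. f x \<bullet> f x)" by (rule L2_inner_integrable[OF f f])
  then have int: "integrable lebesgue (\<lambda>x. indicator \<Omega> x *\<^sub>R (f x \<bullet> f x))"
    by (subst (asm) integrable_restrict_space) auto
  have intK: "integrable lebesgue (\<lambda>x. indicator (interior K) x *\<^sub>R (f x \<bullet> f x))" if K: "K \<in> \<T>" for K
  proof -
    have "integrable lebesgue (\<lambda>x. indicator (interior K) x *\<^sub>R (indicator \<Omega> x *\<^sub>R (f x \<bullet> f x)))"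
      by (intro integrable_mult_indicator int) simp
    moreover have e: "indicator (interior K) x *\<^sub>R (indicator \<Omega> x *\<^sub>R (f x \<bullet> f x)) = indicator (interior K) x *\<^sub>R (f x \<bullet> f x)" for x
      using interior_elem_subset[OF K] by (auto simp: indicator_def)
    ultimately show ?thesis by (simp only: e)
  qed
  have "(nrm f)\<^sup>2 = (\<integral>x. indicator \<Omega> x *\<^sub>R (f x \<bullet> f x) \<partial>lebesgue)" by (rule L2_lebesgue) simp
  also have "\<dots> = (\<integral>x. (\<Sum>K\<in>\<T>. indicator (interior K) x *\<^sub>R (f x \<bullet> f x)) \<partial>lebesgue)"
  proof (rule integral_cong_AE)
    show "(\<lambda>x. indicator \<Omega> x *\<^sub>R (f x \<bullet> f x)) \<in> borel_measurable lebesgue" using int by auto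
    show "(\<lambda>x. \<Sum>K\<in>\<T>. indicator (interior K) x *\<^sub>R (f x \<bullet> f x)) \<in> borel_measurable lebesgue"
      by (intro borel_measurable_sum borel_measurable_integrable intK)
    show "AE x in lebesgue. indicator \<Omega> x *\<^sub>R (f x \<bullet> f x) = (\<Sum>K\<in>\<T>. indicator (interior K) x *\<^sub>R (f x \<bullet> f x))"
      using AE_interior
    proof eventually_elim
      case (elim x)
      show ?case
      proof (cases "x \<in> \<Omega>")
        case True
        then obtain L where L: "L \<in> \<T>" "x \<in> interior L" using elim by blast
        have "(\<Sum>K\<in>\<T>. indicator (interior K) x *\<^sub>R (f x \<bullet> f x)) = (\<Sum>K\<in>\<T>. if K = L then f x \<bullet> f x else 0)"
          using disj[OF L(1)] L(2) by (intro sum.cong) (auto simp: indicator_def)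
        then show ?thesis using True L fin by simp
      next
        case False
        then have "x \<notin> interior K" if "K \<in> \<T>" for K using interior_elem_subset[OF that] by blast
        then show ?thesis using False by simp
      qed
    qed
  qed
  also have "\<dots> = (\<Sum>K\<in>\<T>. \<integral>x. indicator (interior K) x *\<^sub>R (f x \<bullet> f x) \<partial>lebesgue)"
    by (rule Bochner_Integration.integral_sum) (rule intK)
  also have "\<dots> = (\<Sum>K\<in>\<T>. (L2_norm (interior K) f)\<^sup>2)"
    by (intro sum.cong refl L2_lebesgue[symmetric]) simp
  finally show ?thesis .
qed

lemma L2_subdomain:
  assumes f: "f \<in> L2 \<Omega>" and S: "open S" "S \<subseteq> \<Omega>"
  shows "f \<in> L2 S"
proof -
  have e: "lebesgue_on S = restrict_space \<M> S"
    using S by (subst restrict_restrict_space) (auto simp: Int_absorb1)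
  have m: "f \<in> borel_measurable (lebesgue_on S)"
    unfolding e by (rule measurable_restrict_space1[OF L2_measurable[OF f]])
  have "integrable (lebesgue_on S) (\<lambda>x. (norm (f x))\<^sup>2)"
  proof -
    have Ss: "S \<in> sets \<M>" using S by (auto simp: sets_restrict_space)
    have "integrable \<M> (\<lambda>x. indicator S x *\<^sub>R (norm (f x))\<^sup>2)"
      by (intro integrable_mult_indicator L2_integrable_norm2 f Ss)
    then show ?thesis unfolding e by (subst integrable_restrict_space) (use Ss S in \<open>auto simp: Int_absorb2\<close>)
  qed
  with m show ?thesis by (simp add: L2_def)
qed

lemma Sh_pw_C1: "v \<in> Sh \<Omega> k \<T> \<Longrightarrow> pw_C1 \<Omega> \<T> v"
  unfolding Sh_def pw_C1_def using C1_polys by blast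

text \<open>Every neighbourhood of a point of the closure meets the open domain in a set that is not
  negligible, so continuity upgrades an a.e. bound to a bound everywhere.\<close>

lemma AE_bound_closure:
  assumes v: "continuous_on (closure \<Omega>) (v :: real^'n \<Rightarrow> real)" and ae: "AE x in \<M>. v x \<le> M" and x: "x \<in> closure \<Omega>"
  shows "v x \<le> M"
proof (rule ccontr)
  assume "\<not> v x \<le> M"
  then have "v x \<in> {M<..}" by simp
  then obtain U where U: "open U" "x \<in> U" "\<forall>y\<in>closure \<Omega>. y \<in> U \<longrightarrow> v y \<in> {M<..}"
    using v x unfolding continuous_on_topological by (metis open_greaterThan)
  have "open (U \<inter> \<Omega>)" by (intro open_Int U op)
  moreover have "U \<inter> \<Omega> \<noteq> {}" using x U(1,2) by (metis closure_iff_nhds_not_empty disjoint_iff inf_commute order_refl)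
  ultimately have "\<not> negligible (U \<inter> \<Omega>)" by (rule open_not_negligible)
  moreover have "AE x in lebesgue. x \<in> \<Omega> \<longrightarrow> v x \<le> M"
    using ae by (subst (asm) AE_restrict_space_iff) auto
  then have "AE x in lebesgue. x \<notin> U \<inter> \<Omega>"
  proof eventually_elim
    case (elim y)
    then show ?case using U(3) closure_subset[of \<Omega>] by fastforce
  qed
  then have "negligible (U \<inter> \<Omega>)"
    by (simp add: negligible_iff_null_sets completion.null_sets_iff_AE)
  ultimately show False by blast
qed

end

text \<open>\<open>C\<close> is chosen before domain and mesh and depends only on
  \<open>\<rho>\<close>, the degree and the dimension: this is the source of uniformity in the mesh
  size. The version for the supremum is needed for the divergence factor in the convective
  term.\<close>

lemma inverse_estimate:
  fixes \<rho> :: real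
  assumes \<rho>: "\<rho> > 0"
  shows "\<exists>C\<ge>0. \<forall>\<Omega> (\<T> :: (real^'n) set set). mesh \<Omega> \<T> \<longrightarrow> (\<forall>K\<in>\<T>. \<exists>x. ball x (\<rho> * mesh_size \<T>) \<subseteq> K) \<longrightarrow>
     (\<forall>v\<in>Sh \<Omega> k \<T>. \<forall>i. L2_norm \<Omega> (pderiv_at i v) \<le> C / mesh_size \<T> * L2_norm \<Omega> v \<and>
       (\<forall>M. (\<forall>x\<in>closure \<Omega>. \<bar>v x\<bar> \<le> M) \<longrightarrow> (AE x in lebesgue_on \<Omega>. \<bar>pderiv_at i v x\<bar> \<le> C / mesh_size \<T> * M)))"
proof -
  obtain C where C: "C \<ge> 0" and est: "\<forall>K x0 h. \<forall>p\<in>(polys k :: (real^'n \<Rightarrow> real) set). \<forall>i. h > 0 \<longrightarrow> ball x0 (\<rho> * h) \<subseteq> K \<longrightarrow> K \<subseteq> cball x0 h \<longrightarrow>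
     (\<forall>x\<in>K. \<bar>pderiv_at i p x\<bar> \<le> C / h * sqrt ((L2_norm (interior K) p)\<^sup>2 / h ^ CARD('n))) \<and>
     (\<forall>M. (\<forall>x\<in>K. \<bar>p x\<bar> \<le> M) \<longrightarrow> (\<forall>x\<in>K. \<bar>pderiv_at i p x\<bar> \<le> C / h * M))"
    using polys_inverse_element[OF \<rho>, of k, where 'n='n] by (elim exE conjE)
  \<comment> \<open>Volume of the unit ball: an element has at most \<open>U\<close> times the
    volume power of \<open>h\<close> by which the scaled estimate divides, so the powers of
    \<open>h\<close> cancel.\<close>
  define U where "U = unit_ball_vol (real CARD('n))"
  have U: "U \<ge> 0" by (simp add: U_def)
  define C' where "C' = C * (1 + sqrt U)"
  have C': "C \<le> C'" "C * sqrt U \<le> C'" "0 \<le> C'" using C U by (auto simp: C'_def distrib_left)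
  have main: "L2_norm \<Omega> (pderiv_at i v) \<le> C' / mesh_size \<T> * L2_norm \<Omega> v \<and>
       (\<forall>M. (\<forall>x\<in>closure \<Omega>. \<bar>v x\<bar> \<le> M) \<longrightarrow> (AE x in lebesgue_on \<Omega>. \<bar>pderiv_at i v x\<bar> \<le> C' / mesh_size \<T> * M))"
    if mesh: "mesh \<Omega> \<T>" and ball: "\<forall>K\<in>\<T>. \<exists>x. ball x (\<rho> * mesh_size \<T>) \<subseteq> K" and v: "v \<in> Sh \<Omega> k \<T>"
    for \<Omega> and \<T> :: "(real^'n) set set" and v i
  proof -
    interpret mesh \<Omega> \<T> by (rule mesh)
    define h where "h = mesh_size \<T>"
    have h: "h > 0" using mesh_size_pos by (simp add: h_def)
    have pw: "pw_C1 \<Omega> \<T> v" by (rule Sh_pw_C1[OF v])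
    have loc: "\<exists>p x0. p \<in> polys k \<and> (\<forall>x\<in>K. v x = p x) \<and> (\<forall>x\<in>interior K. pderiv_at i v x = pderiv_at i p x) \<and>
        ball x0 (\<rho> * h) \<subseteq> K \<and> K \<subseteq> cball x0 h" if K: "K \<in> \<T>" for K
    proof -
      obtain x0 where x0: "ball x0 (\<rho> * h) \<subseteq> K" using ball K h_def by blast
      have "x0 \<in> K" using x0 \<rho> h by auto
      then have "K \<subseteq> cball x0 h" using elem_cball[OF K] by (simp add: h_def)
      moreover obtain p where p: "p \<in> polys k" "\<forall>x\<in>K. v x = p x" using v K by (auto simp: Sh_def)
      moreover have "pderiv_at i v x = pderiv_at i p x" if x: "x \<in> interior K" for x
        by (rule pderiv_at_cong(2)[OF open_interior x])
          (use p interior_subset[of K] C1_polys[OF p(1)] in \<open>auto simp: C1_def\<close>)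
      ultimately show ?thesis using x0 by blast
    qed
    have dL: "pderiv_at i v \<in> L2 \<Omega>" using pderiv_at_L2[OF pw] by simp
    have "(L2_norm (interior K) (pderiv_at i v))\<^sup>2 \<le> (C' / h)\<^sup>2 * (L2_norm (interior K) v)\<^sup>2" if K: "K \<in> \<T>" for K
    proof -
      obtain p x0 where p: "p \<in> polys k" "\<forall>x\<in>K. v x = p x" "\<forall>x\<in>interior K. pderiv_at i v x = pderiv_at i p x"
        and x0: "ball x0 (\<rho> * h) \<subseteq> K" "K \<subseteq> cball x0 h" using loc[OF K] by (elim exE conjE)
      define I where "I = (L2_norm (interior K) v)\<^sup>2"
      have I: "(L2_norm (interior K) p)\<^sup>2 = I"
        unfolding I_def L2_norm_power2 L2_inner_def
        using p(2) interior_subset[of K] by (intro Bochner_Integration.integral_cong) auto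
      define B where "B = C / h * sqrt (I / h ^ CARD('n))"
      have I0: "I \<ge> 0" by (simp add: I_def)
      have B0: "B \<ge> 0" unfolding B_def using C h I0 by simp
      have bd: "\<bar>pderiv_at i v x\<bar> \<le> B" if "x \<in> interior K" for x
        using est[rule_format, OF p(1) h x0, of i] p(3) that interior_subset[of K] by (auto simp: B_def I)
      have Km: "interior K \<in> sets lebesgue" by simp
      have Kf: "interior K \<in> lmeasurable"
        using compact_imp_bounded[OF elem(1)[OF K]] by (intro bounded_set_imp_lmeasurable bounded_subset[OF _ interior_subset]) auto
      have "measure lebesgue (interior K) \<le> measure lebesgue (cball x0 h)"
        using x0(2) interior_subset[of K] by (intro measure_mono_fmeasurable) auto
      also have "\<dots> = U * h ^ CARD('n)" using content_cball[of h x0] h by (simp add: U_def)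
      finally have meas: "measure lebesgue (interior K) \<le> U * h ^ CARD('n)" .
      have int1: "integrable (lebesgue_on (interior K)) (\<lambda>x. pderiv_at i v x * pderiv_at i v x)"
        using L2_inner_integrable[of "pderiv_at i v" "interior K" "pderiv_at i v"]
          L2_subdomain[OF dL open_interior interior_elem_subset[OF K]] by simp
      have int2: "integrable (lebesgue_on (interior K)) (\<lambda>x. B\<^sup>2)"
        using Kf by (intro finite_measure.integrable_const finite_measureI)
          (auto simp: emeasure_restrict_space fmeasurable_def)
      have "(L2_norm (interior K) (pderiv_at i v))\<^sup>2 = (\<integral>x. pderiv_at i v x * pderiv_at i v x \<partial>lebesgue_on (interior K))"
        by (simp add: L2_norm_power2 L2_inner_def)
      also have "\<dots> \<le> (\<integral>x. B\<^sup>2 \<partial>lebesgue_on (interior K))"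
      proof (rule integral_mono[OF int1 int2])
        fix x assume "x \<in> space (lebesgue_on (interior K))"
        then have "\<bar>pderiv_at i v x\<bar>\<^sup>2 \<le> B\<^sup>2" using bd by (intro power_mono) auto
        then show "pderiv_at i v x * pderiv_at i v x \<le> B\<^sup>2" by (simp add: power2_eq_square)
      qed
      also have "\<dots> = measure lebesgue (interior K) * B\<^sup>2"
        by (simp add: measure_restrict_space)
      also have "\<dots> \<le> U * h ^ CARD('n) * B\<^sup>2" using meas by (intro mult_right_mono) auto
      also have "\<dots> = (C * sqrt U / h)\<^sup>2 * I"
      proof -
        have "B\<^sup>2 = (C / h)\<^sup>2 * (I / h ^ CARD('n))" unfolding B_def using I0 h by (simp add: power_mult_distrib power_divide)
        then show ?thesis using h U by (simp add: power_divide power_mult_distrib)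
      qed
      also have "\<dots> \<le> (C' / h)\<^sup>2 * I"
        using C' C U h I0 by (intro mult_right_mono power_mono divide_right_mono) auto
      finally show ?thesis by (simp add: I_def)
    qed
    then have "(L2_norm \<Omega> (pderiv_at i v))\<^sup>2 \<le> (\<Sum>K\<in>\<T>. (C' / h)\<^sup>2 * (L2_norm (interior K) v)\<^sup>2)"
      unfolding L2_norm_split[OF dL] by (rule sum_mono)
    also have "\<dots> = (C' / h * L2_norm \<Omega> v)\<^sup>2"
      unfolding power_mult_distrib L2_norm_split[OF pw_C1_L2[OF pw]] by (simp add: sum_distrib_left)
    finally have "L2_norm \<Omega> (pderiv_at i v) \<le> C' / h * L2_norm \<Omega> v"
      by (rule power2_le_imp_le) (use C' h in simp)
    moreover have "AE x in lebesgue_on \<Omega>. \<bar>pderiv_at i v x\<bar> \<le> C' / h * M" if M: "\<forall>x\<in>closure \<Omega>. \<bar>v x\<bar> \<le> M" for M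
      using AE_interior_on
    proof eventually_elim
      case (elim x)
      then obtain K where K: "K \<in> \<T>" "x \<in> interior K" by blast
      obtain p x0 where p: "p \<in> polys k" "\<forall>x\<in>K. v x = p x" "\<forall>x\<in>interior K. pderiv_at i v x = pderiv_at i p x"
        and x0: "ball x0 (\<rho> * h) \<subseteq> K" "K \<subseteq> cball x0 h" using loc[OF K(1)] by (elim exE conjE)
      have xK: "x \<in> K" using K(2) interior_subset by blast
      have pM: "\<forall>x\<in>K. \<bar>p x\<bar> \<le> M" using M p(2) elem_subset[OF K(1)] by (metis subsetD)
      then have M0: "0 \<le> M" using xK abs_ge_zero order_trans by blast
      have "\<bar>pderiv_at i p x\<bar> \<le> C / h * M" using est p(1) h x0 pM xK by blast
      also have "\<dots> \<le> C' / h * M" using C' h M0 by (intro mult_right_mono divide_right_mono) auto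
      finally show ?case using p(3) K(2) by simp
    qed
    ultimately show ?thesis by (simp add: h_def)
  qed
  show ?thesis by (rule exI[of _ C']) (use main C' in blast)
qed

section \<open>Linear structure of the discrete spaces\<close>

context mesh
begin

text \<open>Converse to \<open>H10_approx\<close>: for piecewise C1 functions, membership can be
  verified with classical derivatives.\<close>

lemma H10I:
  assumes z: "pw_C1 \<Omega> \<T> z" and \<xi>: "\<And>m::nat. \<xi> m \<in> test_functions \<Omega>"
    and l1: "(\<lambda>m. nrm (\<lambda>x. z x - \<xi> m x)) \<longlonglongrightarrow> 0"
    and l2: "\<And>i. (\<lambda>m. nrm (\<lambda>x. pderiv_at i z x - pderiv_at i (\<xi> m) x)) \<longlonglongrightarrow> 0"
  shows "z \<in> H10 \<Omega>"
proof -
  have "z \<in> H1 \<Omega>"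
    unfolding H1_def using pw_C1_L2[OF z] pw_C1_wgrad[OF z] by (auto simp: wgrad_def)
  moreover have "(\<lambda>m. H1_norm \<Omega> (\<lambda>x. z x - \<xi> m x)) \<longlonglongrightarrow> 0"
  proof -
    have pw: "pw_C1 \<Omega> \<T> (\<lambda>x. z x - \<xi> m x)" for m by (intro pw_C1_diff z test_pw_C1 \<xi>)
    have "(nrm (grad \<Omega> (\<lambda>x. z x - \<xi> m x)))\<^sup>2 =
        (\<Sum>i\<in>UNIV. (nrm (\<lambda>x. pderiv_at i z x - pderiv_at i (\<xi> m) x))\<^sup>2)" for m
    proof -
      have "nrm (grad \<Omega> (\<lambda>x. z x - \<xi> m x)) = nrm (pgrad (\<lambda>x. z x - \<xi> m x))"
        by (rule L2_norm_cong_AE[OF \<Omega>_sets pgrad_L2[OF pw] pw_C1_grad[OF pw]])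
      moreover have "nrm (pderiv_at i (\<lambda>x. z x - \<xi> m x)) = nrm (\<lambda>x. pderiv_at i z x - pderiv_at i (\<xi> m) x)" for i
        by (rule L2_norm_cong_AE[OF \<Omega>_sets L2_diff[OF pderiv_at_L2[OF z] pderiv_at_L2[OF test_pw_C1[OF \<xi>]]]
            AE_pderiv_diff[OF z test_pw_C1[OF \<xi>]]])
      ultimately show ?thesis using L2_norm_vec_power2[OF pgrad_L2[OF pw[of m]]] by simp
    qed
    then have e: "H1_norm \<Omega> (\<lambda>x. z x - \<xi> m x) = sqrt ((nrm (\<lambda>x. z x - \<xi> m x))\<^sup>2 +
        (\<Sum>i\<in>UNIV. (nrm (\<lambda>x. pderiv_at i z x - pderiv_at i (\<xi> m) x))\<^sup>2))" for m
      by (simp add: H1_norm_def)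
    have "(\<lambda>m. sqrt ((nrm (\<lambda>x. z x - \<xi> m x))\<^sup>2 +
        (\<Sum>i\<in>UNIV. (nrm (\<lambda>x. pderiv_at i z x - pderiv_at i (\<xi> m) x))\<^sup>2))) \<longlonglongrightarrow> sqrt (0\<^sup>2 + (\<Sum>i\<in>(UNIV::'n set). 0\<^sup>2))"
      by (intro tendsto_intros l1 l2)
    then show ?thesis unfolding e by simp
  qed
  ultimately show ?thesis using \<xi> by (auto simp: H10_def)
qed

text \<open>The approximating sequences are combined with the same coefficients; linearity of the
  derivatives is used almost everywhere, at points where the functions are differentiable.\<close>

lemma H10_lincomb:
  assumes v: "v \<in> H10 \<Omega>" "pw_C1 \<Omega> \<T> v" and w: "w \<in> H10 \<Omega>" "pw_C1 \<Omega> \<T> w"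
  shows "(\<lambda>x. a * v x + b * w x) \<in> H10 \<Omega>"
proof -
  obtain \<phi> where \<phi>': "\<forall>m::nat. \<phi> m \<in> test_functions \<Omega>"
    "(\<lambda>m. nrm (\<lambda>x. v x - \<phi> m x)) \<longlonglongrightarrow> 0"
    "\<forall>i. (\<lambda>m. nrm (\<lambda>x. pderiv_at i v x - pderiv_at i (\<phi> m) x)) \<longlonglongrightarrow> 0"
    using H10_approx[OF v] by (elim exE conjE)
  obtain \<psi> where \<psi>': "\<forall>m::nat. \<psi> m \<in> test_functions \<Omega>"
    "(\<lambda>m. nrm (\<lambda>x. w x - \<psi> m x)) \<longlonglongrightarrow> 0"
    "\<forall>i. (\<lambda>m. nrm (\<lambda>x. pderiv_at i w x - pderiv_at i (\<psi> m) x)) \<longlonglongrightarrow> 0"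
    using H10_approx[OF w] by (elim exE conjE)
  note \<phi> = \<phi>'(1)[rule_format] \<phi>'(2) \<phi>'(3)[rule_format] and \<psi> = \<psi>'(1)[rule_format] \<psi>'(2) \<psi>'(3)[rule_format]
  have lim: "(\<lambda>m. nrm (\<lambda>x. Z m x)) \<longlonglongrightarrow> 0"
    if A: "\<And>m. A m \<in> L2 \<Omega>" "(\<lambda>m. nrm (A m)) \<longlonglongrightarrow> 0" and B: "\<And>m. B m \<in> L2 \<Omega>" "(\<lambda>m. nrm (B m)) \<longlonglongrightarrow> 0"
    and Z: "\<And>m. AE x in \<M>. Z m x = a *\<^sub>R A m x + b *\<^sub>R B m x" for A B Z :: "nat \<Rightarrow> real^'n \<Rightarrow> real"
  proof (rule real_tendsto_sandwich[OF _ _ tendsto_const])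
    show "\<forall>\<^sub>F m in sequentially. 0 \<le> nrm (\<lambda>x. Z m x)" by simp
    show "\<forall>\<^sub>F m in sequentially. nrm (\<lambda>x. Z m x) \<le> \<bar>a\<bar> * nrm (A m) + \<bar>b\<bar> * nrm (B m)"
    proof (rule always_eventually, rule allI)
      fix m
      have "nrm (\<lambda>x. Z m x) = nrm (\<lambda>x. a *\<^sub>R A m x + b *\<^sub>R B m x)"
        by (rule L2_norm_cong_AE[OF \<Omega>_sets L2_add[OF L2_scaleR[OF A(1)] L2_scaleR[OF B(1)]] Z])
      also have "\<dots> \<le> \<bar>a\<bar> * nrm (A m) + \<bar>b\<bar> * nrm (B m)"
        using L2_norm_triangle[OF L2_scaleR[OF A(1)] L2_scaleR[OF B(1)], of a m b m] by (simp only: L2_norm_scaleR)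
      finally show "nrm (\<lambda>x. Z m x) \<le> \<bar>a\<bar> * nrm (A m) + \<bar>b\<bar> * nrm (B m)" .
    qed
    have "(\<lambda>m. \<bar>a\<bar> * nrm (A m) + \<bar>b\<bar> * nrm (B m)) \<longlonglongrightarrow> \<bar>a\<bar> * 0 + \<bar>b\<bar> * 0" by (intro tendsto_intros A B)
    then show "(\<lambda>m. \<bar>a\<bar> * nrm (A m) + \<bar>b\<bar> * nrm (B m)) \<longlonglongrightarrow> 0" by simp
  qed
  have pwz: "pw_C1 \<Omega> \<T> (\<lambda>x. a * v x + b * w x)" by (rule pw_C1_add[OF pw_C1_cmult[OF v(2)] pw_C1_cmult[OF w(2)]])
  show ?thesis
  proof (rule H10I[OF pwz])
    show "(\<lambda>x. a * \<phi> m x + b * \<psi> m x) \<in> test_functions \<Omega>" for m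
      by (rule test_functions_add[OF test_functions_cmult[OF \<phi>(1)] test_functions_cmult[OF \<psi>(1)]])
    show "(\<lambda>m. nrm (\<lambda>x. a * v x + b * w x - (a * \<phi> m x + b * \<psi> m x))) \<longlonglongrightarrow> 0"
      by (rule lim[OF _ \<phi>(2) _ \<psi>(2)])
        (auto intro!: L2_diff pw_C1_L2[OF v(2)] pw_C1_L2[OF w(2)] pw_C1_L2[OF test_pw_C1[OF \<phi>(1)]] pw_C1_L2[OF test_pw_C1[OF \<psi>(1)]]
          simp: algebra_simps)
    have lin: "AE x in \<M>. pderiv_at i (\<lambda>x. a * f x + b * g x) x = a * pderiv_at i f x + b * pderiv_at i g x"
      if "pw_C1 \<Omega> \<T> f" "pw_C1 \<Omega> \<T> g" for f g i
      using pw_C1_AE_differentiable[OF that(1)] pw_C1_AE_differentiable[OF that(2)]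
    proof eventually_elim
      case (elim x)
      have d: "(\<lambda>x. a * f x) differentiable (at x)" "(\<lambda>x. b * g x) differentiable (at x)"
        using elim by (auto intro!: differentiable_mult)
      show ?case
        unfolding pderiv_at_add[OF d]
        using pderiv_at_mult[of "\<lambda>x. a" x f i] pderiv_at_mult[of "\<lambda>x. b" x g i] elim
        by (simp add: pderiv_at_const)
    qed
    show "(\<lambda>m. nrm (\<lambda>x. pderiv_at i (\<lambda>x. a * v x + b * w x) x - pderiv_at i (\<lambda>x. a * \<phi> m x + b * \<psi> m x) x)) \<longlonglongrightarrow> 0" for i
    proof (rule lim[OF _ \<phi>(3)[of i] _ \<psi>(3)[of i]])
      show "AE x in \<M>. pderiv_at i (\<lambda>x. a * v x + b * w x) x - pderiv_at i (\<lambda>x. a * \<phi> m x + b * \<psi> m x) x =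
          a *\<^sub>R (pderiv_at i v x - pderiv_at i (\<phi> m) x) + b *\<^sub>R (pderiv_at i w x - pderiv_at i (\<psi> m) x)" for m
        using lin[OF v(2) w(2), of i] lin[OF test_pw_C1[OF \<phi>(1)] test_pw_C1[OF \<psi>(1)], of i m m]
        by eventually_elim (simp add: algebra_simps)
    qed (intro L2_diff pderiv_at_L2 v w test_pw_C1 \<phi>(1) \<psi>(1))+
  qed
qed

lemma Sh_lincomb:
  assumes "v \<in> Sh \<Omega> k \<T>" "w \<in> Sh \<Omega> k \<T>" shows "(\<lambda>x. a * v x + b * w x) \<in> Sh \<Omega> k \<T>"
  unfolding Sh_def
proof (intro CollectI conjI ballI)
  show "continuous_on (closure \<Omega>) (\<lambda>x. a * v x + b * w x)"
    using assms by (intro continuous_intros) (auto simp: Sh_def)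
  fix K assume K: "K \<in> \<T>"
  obtain p where p: "p \<in> polys k" "\<forall>x\<in>K. v x = p x" using assms(1) K by (auto simp: Sh_def)
  obtain q where q: "q \<in> polys k" "\<forall>x\<in>K. w x = q x" using assms(2) K by (auto simp: Sh_def)
  show "\<exists>p\<in>polys k. \<forall>x\<in>K. a * v x + b * w x = p x"
    by (rule bexI[OF _ polys_add[OF polys_cmult[OF p(1), of a] polys_cmult[OF q(1), of b]]]) (use p(2) q(2) in auto)
qed

lemma Sh_const: "(\<lambda>x. c) \<in> Sh \<Omega> k \<T>"
  unfolding Sh_def by (auto intro: continuous_intros bexI[OF _ polys_const])

lemma lin_closed_Sh: "lin_closed (Sh \<Omega> k \<T>)"
  unfolding lin_closed_def using Sh_lincomb Sh_const by simp

lemma lin_closed_Shd: "lin_closed (Shd \<Omega> k \<T>)"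
  unfolding lin_closed_def Shd_def using Sh_lincomb Sh_const by simp

lemma zero_test: "(\<lambda>x. 0) \<in> test_functions \<Omega>"
  by (auto simp: test_functions_iff intro: smooth_fun.const exI[of _ "{}"])

lemma zero_H10: "(\<lambda>x. 0) \<in> H10 \<Omega>"
  by (rule H10I[where \<xi>="\<lambda>m x. 0"]) (auto simp: zero_test intro: pw_C1_I C1_const)

lemma lin_closed_Vh: "lin_closed (Vh \<Omega> k \<T>)"
  unfolding lin_closed_def
proof (intro conjI ballI allI)
  show "(\<lambda>x. 0) \<in> Vh \<Omega> k \<T>" by (simp add: Vh_def Sh_const zero_H10)
  fix v w a b assume v: "v \<in> Vh \<Omega> k \<T>" and w: "w \<in> Vh \<Omega> k \<T>"
  show "(\<lambda>x. a *\<^sub>R v x + b *\<^sub>R w x) \<in> Vh \<Omega> k \<T>"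
    unfolding Vh_def
  proof (intro CollectI allI)
    fix i
    have c: "(\<lambda>x. v x $ i) \<in> Sh \<Omega> k \<T>" "(\<lambda>x. v x $ i) \<in> H10 \<Omega>" "(\<lambda>x. w x $ i) \<in> Sh \<Omega> k \<T>" "(\<lambda>x. w x $ i) \<in> H10 \<Omega>"
      using v w by (auto simp: Vh_def)
    show "(\<lambda>x. (a *\<^sub>R v x + b *\<^sub>R w x) $ i) \<in> Sh \<Omega> k \<T> \<inter> H10 \<Omega>"
      using Sh_lincomb[OF c(1,3), of a b]
        H10_lincomb[OF c(2) Sh_pw_C1[OF c(1)] c(4) Sh_pw_C1[OF c(3)], of a b] by simp
  qed
qed

lemma Vh_pwH10: "u \<in> Vh \<Omega> k \<T> \<Longrightarrow> pwH10 u"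
  unfolding Vh_def pwH10_def using Sh_pw_C1 by blast

lemma Vh_pw: "u \<in> Vh \<Omega> k \<T> \<Longrightarrow> pw_C1 \<Omega> \<T> (\<lambda>x. u x $ i)"
  unfolding Vh_def using Sh_pw_C1 by blast

lemma Vh_Shd: "Vh \<Omega> k \<T> \<subseteq> Shd \<Omega> k \<T>"
  by (auto simp: Vh_def Shd_def)

lemma Shd_L2: "Shd \<Omega> k \<T> \<subseteq> L2 \<Omega>"
  by (auto simp: Shd_def intro!: L2_vecI pw_C1_L2 Sh_pw_C1)

end

section \<open>Finite element and subscale spaces\<close>

text \<open>Stable under changes on null sets, to match the definition of the subscale
  spaces.\<close>

definition AE_span :: "(real^'n) set \<Rightarrow> 'i set \<Rightarrow> ('i \<Rightarrow> real^'n \<Rightarrow> 'b::euclidean_space) \<Rightarrow> (real^'n \<Rightarrow> 'b) set" where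
  "AE_span \<Omega> I g = {w. \<exists>a. AE x in lebesgue_on \<Omega>. w x = (\<Sum>i\<in>I. a i *\<^sub>R g i x)}"

lemma L2_onb_AE_span:
  fixes g :: "'i \<Rightarrow> real^'n \<Rightarrow> 'b::euclidean_space"
  assumes \<Omega>: "\<Omega> \<in> sets lebesgue" and I: "finite I" and g: "\<And>i. i \<in> I \<Longrightarrow> g i \<in> L2 \<Omega>"
  shows "\<exists>m e. L2_onb \<Omega> (AE_span \<Omega> I g) m e"
proof (rule L2_onb_exists[OF _ _ I _ _ \<Omega>])
  show "AE_span \<Omega> I g \<subseteq> L2 \<Omega>"
  proof
    fix w assume "w \<in> AE_span \<Omega> I g"
    then obtain a where a: "AE x in lebesgue_on \<Omega>. w x = (\<Sum>i\<in>I. a i *\<^sub>R g i x)" by (auto simp: AE_span_def)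
    show "w \<in> L2 \<Omega>" by (rule L2_AE[OF \<Omega> _ a]) (rule L2_lincomb, rule g)
  qed
  show "lin_closed (AE_span \<Omega> I g)"
    unfolding lin_closed_def
  proof (intro conjI ballI allI)
    show "(\<lambda>x. 0) \<in> AE_span \<Omega> I g" unfolding AE_span_def by (intro CollectI exI[of _ "\<lambda>_. 0"]) simp
    fix v w and s t :: real assume v: "v \<in> AE_span \<Omega> I g" and w: "w \<in> AE_span \<Omega> I g"
    obtain a where a: "AE x in lebesgue_on \<Omega>. v x = (\<Sum>i\<in>I. a i *\<^sub>R g i x)" using v by (auto simp: AE_span_def)
    obtain b where b: "AE x in lebesgue_on \<Omega>. w x = (\<Sum>i\<in>I. b i *\<^sub>R g i x)" using w by (auto simp: AE_span_def)
    have "AE x in lebesgue_on \<Omega>. s *\<^sub>R v x + t *\<^sub>R w x = (\<Sum>i\<in>I. (s * a i + t * b i) *\<^sub>R g i x)"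
      using a b by eventually_elim (simp add: scaleR_sum_right scaleR_add_left sum.distrib)
    then show "(\<lambda>x. s *\<^sub>R v x + t *\<^sub>R w x) \<in> AE_span \<Omega> I g"
      unfolding AE_span_def by (intro CollectI exI[of _ "\<lambda>i. s * a i + t * b i"])
  qed
  show "g i \<in> AE_span \<Omega> I g" if "i \<in> I" for i
    unfolding AE_span_def using that I
    by (intro CollectI exI[of _ "\<lambda>j. if j = i then 1 else 0"]) (simp add: if_distrib[of "\<lambda>c. c *\<^sub>R _"] cong: if_cong)
  show "\<exists>c. AE x in lebesgue_on \<Omega>. w x = (\<Sum>i\<in>I. c i *\<^sub>R g i x)" if "w \<in> AE_span \<Omega> I g" for w
    using that by (simp add: AE_span_def)
qed

lemma AE_finite_ball:
  assumes "finite J" "\<And>j. j \<in> J \<Longrightarrow> AE x in M. P j x"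
  shows "AE x in M. \<forall>j\<in>J. P j x"
  using assms by (simp add: AE_ball_countable countable_finite)

section \<open>Differential operators on linear combinations\<close>

context mesh
begin

text \<open>\<open>grad\<close> is a choice and linear only almost everywhere. The hypothesis, an
  a.e. expansion of \<open>w\<close>, has the same form for all operators below, so that basis
  expansions can be inserted directly.\<close>

lemma jacobian_lincomb:
  assumes v: "\<And>j i. j \<in> J \<Longrightarrow> pw_C1 \<Omega> \<T> (\<lambda>x. v j x $ i)"
    and w: "AE x in \<M>. w x = (\<Sum>j\<in>J. a j *\<^sub>R v j x)"
  shows "AE x in \<M>. jacobian \<Omega> w x = (\<Sum>j\<in>J. a j *\<^sub>R jacobian \<Omega> (v j) x)"
proof -
  have "AE x in \<M>. grad \<Omega> (\<lambda>y. w y $ i) x = (\<Sum>j\<in>J. a j *\<^sub>R grad \<Omega> (\<lambda>y. v j y $ i) x)" for i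
  proof (rule grad_lincomb_AE[OF op bd])
    show "AE x in \<M>. w x $ i = (\<Sum>j\<in>J. a j * v j x $ i)"
      using w by eventually_elim simp
  qed (auto intro: pw_C1_L2 pw_C1_wgrad v)
  then have "AE x in \<M>. \<forall>i. grad \<Omega> (\<lambda>y. w y $ i) x = (\<Sum>j\<in>J. a j *\<^sub>R grad \<Omega> (\<lambda>y. v j y $ i) x)"
    by (subst AE_all_countable) simp
  then show ?thesis
    by eventually_elim (simp add: jacobian_def vec_eq_iff)
qed

lemma divergence_lincomb:
  assumes "\<And>j i. j \<in> J \<Longrightarrow> pw_C1 \<Omega> \<T> (\<lambda>x. v j x $ i)" "AE x in \<M>. w x = (\<Sum>j\<in>J. a j *\<^sub>R v j x)"
  shows "AE x in \<M>. divergence \<Omega> w x = (\<Sum>j\<in>J. a j *\<^sub>R divergence \<Omega> (v j) x)"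
proof -
  have "AE x in \<M>. jacobian \<Omega> w x = (\<Sum>j\<in>J. a j *\<^sub>R jacobian \<Omega> (v j) x)"
    by (rule jacobian_lincomb[OF assms])
  then show ?thesis
    by eventually_elim (simp add: divergence_def sum_distrib_left sum.swap[of _ J])
qed

lemma symgrad_lincomb:
  assumes "\<And>j i. j \<in> J \<Longrightarrow> pw_C1 \<Omega> \<T> (\<lambda>x. v j x $ i)" "AE x in \<M>. w x = (\<Sum>j\<in>J. a j *\<^sub>R v j x)"
  shows "AE x in \<M>. symgrad \<Omega> w x = (\<Sum>j\<in>J. a j *\<^sub>R symgrad \<Omega> (v j) x)"
proof -
  have "AE x in \<M>. jacobian \<Omega> w x = (\<Sum>j\<in>J. a j *\<^sub>R jacobian \<Omega> (v j) x)"
    by (rule jacobian_lincomb[OF assms])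
  then show ?thesis
  proof eventually_elim
    case (elim x)
    show ?case
      unfolding symgrad_def elim
      by (simp add: vec_eq_iff transpose_def sum.distrib[symmetric] sum_distrib_left algebra_simps)
  qed
qed

lemma conv_lincomb_right:
  assumes "\<And>j i. j \<in> J \<Longrightarrow> pw_C1 \<Omega> \<T> (\<lambda>x. v j x $ i)" "AE x in \<M>. w x = (\<Sum>j\<in>J. a j *\<^sub>R v j x)"
  shows "AE x in \<M>. conv \<Omega> u w x = (\<Sum>j\<in>J. a j *\<^sub>R conv \<Omega> u (v j) x)"
proof -
  have "AE x in \<M>. jacobian \<Omega> w x = (\<Sum>j\<in>J. a j *\<^sub>R jacobian \<Omega> (v j) x)"
    by (rule jacobian_lincomb[OF assms])
  then show ?thesis using assms(2)
proof eventually_elim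
  case (elim x)
  have "(\<Sum>j\<in>J. a j *\<^sub>R jacobian \<Omega> (v j) x) *v u x = (\<Sum>j\<in>J. a j *\<^sub>R (jacobian \<Omega> (v j) x *v u x))"
    by (simp add: vec_eq_iff matrix_vector_mult_def sum_distrib_left sum_distrib_right sum.swap[of _ J] mult.assoc)
  then show ?case
    unfolding conv_def elim by (simp add: sum.distrib scaleR_add_right scaleR_sum_right mult.commute)
qed
qed

lemma conv_lincomb_left:
  assumes "\<And>j i. j \<in> J \<Longrightarrow> pw_C1 \<Omega> \<T> (\<lambda>x. v j x $ i)" "AE x in \<M>. w x = (\<Sum>j\<in>J. a j *\<^sub>R v j x)"
  shows "AE x in \<M>. conv \<Omega> w u x = (\<Sum>j\<in>J. a j *\<^sub>R conv \<Omega> (v j) u x)"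
proof -
  have "AE x in \<M>. divergence \<Omega> w x = (\<Sum>j\<in>J. a j *\<^sub>R divergence \<Omega> (v j) x)"
    by (rule divergence_lincomb[OF assms])
  then show ?thesis using assms(2)
proof eventually_elim
  case (elim x)
  have "jacobian \<Omega> u x *v (\<Sum>j\<in>J. a j *\<^sub>R v j x) = (\<Sum>j\<in>J. a j *\<^sub>R (jacobian \<Omega> u x *v v j x))"
    by (simp add: vec_eq_iff matrix_vector_mult_def sum_distrib_left sum.swap[of _ J] mult_ac)
  then show ?case
    unfolding conv_def elim
    by (simp add: sum.distrib scaleR_add_right scaleR_sum_left sum_distrib_left sum_divide_distrib)
qed
qed

lemma grad_L2: "pw_C1 \<Omega> \<T> p \<Longrightarrow> grad \<Omega> p \<in> L2 \<Omega>"
  by (rule L2_AE[OF \<Omega>_sets pgrad_L2 pw_C1_grad])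

end

lemma sum_lessThan_append:
  fixes f g :: "nat \<Rightarrow> 'a::comm_monoid_add"
  shows "(\<Sum>j<m + n. if j < m then f j else g (j - m)) = (\<Sum>j<m. f j) + (\<Sum>j<n. g j)"
  by (induction n) (auto simp: add.assoc)

section \<open>Bases, projections and subscales on one mesh\<close>

locale fe_space = mesh \<Omega> \<T> for \<Omega> :: "(real^'n) set" and \<T> +
  fixes k nu np :: nat and \<phi> :: "nat \<Rightarrow> real^'n \<Rightarrow> real^'n" and \<psi> :: "nat \<Rightarrow> real^'n \<Rightarrow> real"
  assumes vb: "velocity_basis \<Omega> k \<T> nu \<phi>" and pb: "pressure_basis \<Omega> k \<T> np \<psi>"
begin

abbreviation "V \<equiv> Vh \<Omega> k \<T>"
abbreviation "W1 \<equiv> subscale1 \<Omega> k \<T> nu \<phi>"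
abbreviation "W2 \<equiv> subscale2 \<Omega> k \<T> np \<psi>"
abbreviation "RF \<equiv> residual_fields \<Omega> k \<T>"

lemma \<phi>_V: "i < nu \<Longrightarrow> \<phi> i \<in> V" and \<psi>_Sh: "i < np \<Longrightarrow> \<psi> i \<in> Sh \<Omega> k \<T>"
  using vb pb by (auto simp: velocity_basis_def pressure_basis_def)

lemma AE_closure: "(\<And>x. x \<in> closure \<Omega> \<Longrightarrow> P x) \<Longrightarrow> AE x in \<M>. P x"
  using closure_subset[of \<Omega>] by (intro AE_I2) auto

lemma V_expansion: "v \<in> V \<Longrightarrow> \<exists>a. AE x in \<M>. v x = (\<Sum>i<nu. a i *\<^sub>R \<phi> i x)"
proof -
  assume "v \<in> V"
  then have "\<exists>!a. a \<in> {..<nu} \<rightarrow>\<^sub>E UNIV \<and> (\<forall>x\<in>closure \<Omega>. v x = (\<Sum>i<nu. a i *\<^sub>R \<phi> i x))"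
    using vb by (simp add: velocity_basis_def)
  then obtain a where "\<forall>x\<in>closure \<Omega>. v x = (\<Sum>i<nu. a i *\<^sub>R \<phi> i x)" by (elim ex1E conjE)
  then have "AE x in \<M>. v x = (\<Sum>i<nu. a i *\<^sub>R \<phi> i x)" by (intro AE_closure) simp
  then show ?thesis by (rule exI[of _ a])
qed

lemma Sh_expansion: "q \<in> Sh \<Omega> k \<T> \<Longrightarrow> \<exists>a c. AE x in \<M>. q x = (\<Sum>i<np. a i * \<psi> i x) + c"
proof -
  assume "q \<in> Sh \<Omega> k \<T>"
  then have "\<exists>!a. a \<in> {..<np} \<rightarrow>\<^sub>E UNIV \<and> (\<exists>c. \<forall>x\<in>closure \<Omega>. q x = (\<Sum>i<np. a i * \<psi> i x) + c)"
    using pb by (simp add: pressure_basis_def)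
  then obtain a c where "\<forall>x\<in>closure \<Omega>. q x = (\<Sum>i<np. a i * \<psi> i x) + c" by (elim ex1E conjE exE)
  then have "AE x in \<M>. q x = (\<Sum>i<np. a i * \<psi> i x) + c" by (intro AE_closure) simp
  then show ?thesis by (intro exI)
qed

lemma V_L2: "V \<subseteq> L2 \<Omega>" using Vh_Shd[of k] Shd_L2[of k] by blast

lemma onb_V: "\<exists>m e. L2_onb \<Omega> V m e"
  by (rule L2_onb_exists[OF V_L2 lin_closed_Vh finite_lessThan[of nu], of \<phi>])
    (use \<phi>_V V_expansion in auto)

text \<open>The pressure basis spans \<open>Sh\<close> only up to constants; the constant 1 in
  position \<open>np\<close> completes it. The index therefore runs up to and including
  \<open>np\<close>.\<close>

definition shb :: "nat \<Rightarrow> real^'n \<Rightarrow> real" where "shb i = (if i < np then \<psi> i else (\<lambda>x. 1))"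

lemma shb_Sh: "shb i \<in> Sh \<Omega> k \<T>" by (simp add: shb_def \<psi>_Sh Sh_const)

lemma Sh_expansion': "q \<in> Sh \<Omega> k \<T> \<Longrightarrow> \<exists>a. AE x in \<M>. q x = (\<Sum>i\<le>np. a i *\<^sub>R shb i x)"
proof -
  assume q: "q \<in> Sh \<Omega> k \<T>"
  obtain a c where a: "AE x in \<M>. q x = (\<Sum>i<np. a i * \<psi> i x) + c"
    using Sh_expansion[OF q] by (elim exE)
  have "AE x in \<M>. q x = (\<Sum>i\<le>np. (if i < np then a i else c) *\<^sub>R shb i x)"
    using a by eventually_elim (simp add: lessThan_Suc_atMost[symmetric] shb_def)
  then show ?thesis by (rule exI[of _ "\<lambda>i. if i < np then a i else c"])
qed

lemma Sh_L2: "Sh \<Omega> k \<T> \<subseteq> L2 \<Omega>"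
  using pw_C1_L2 Sh_pw_C1 by blast

lemma onb_Sh: "\<exists>m e. L2_onb \<Omega> (Sh \<Omega> k \<T>) m e"
  by (rule L2_onb_exists[OF Sh_L2 lin_closed_Sh finite_atMost[of np], of shb])
    (use shb_Sh Sh_expansion' in auto)

lemma onb_Shd: "\<exists>m e. L2_onb \<Omega> (Shd \<Omega> k \<T>) m e"
proof (rule L2_onb_exists[OF Shd_L2 lin_closed_Shd, of "UNIV \<times> {..np}" "\<lambda>(j, i) x. axis j (shb i x)"])
  show "(case l of (j, i) \<Rightarrow> \<lambda>x. axis j (shb i x)) \<in> Shd \<Omega> k \<T>" for l
  proof -
    have "(\<lambda>x. axis j (shb i x) $ i') \<in> Sh \<Omega> k \<T>" for j i i'
      using shb_Sh[of i] Sh_const[of 0] by (cases "i' = j") (auto simp: axis_def)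
    then show ?thesis by (auto simp: Shd_def split: prod.splits)
  qed
  fix w assume w: "w \<in> Shd \<Omega> k \<T>"
  have "\<forall>j. \<exists>a. AE x in \<M>. w x $ j = (\<Sum>i\<le>np. a i *\<^sub>R shb i x)"
    using w by (intro allI Sh_expansion') (simp add: Shd_def)
  then obtain a where a: "\<And>j. AE x in \<M>. w x $ j = (\<Sum>i\<le>np. a j i *\<^sub>R shb i x)"
    using choice[of "\<lambda>j a. AE x in \<M>. w x $ j = (\<Sum>i\<le>np. a i *\<^sub>R shb i x)"] by blast
  have "AE x in \<M>. \<forall>j. w x $ j = (\<Sum>i\<le>np. a j i *\<^sub>R shb i x)"
    using a by (subst AE_all_countable) simp
  then have "AE x in \<M>. w x = (\<Sum>(j, i)\<in>UNIV \<times> {..np}. a j i *\<^sub>R axis j (shb i x))"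
  proof eventually_elim
    case (elim x)
    have "(\<Sum>(j, i)\<in>UNIV \<times> {..np}. a j i *\<^sub>R axis j (shb i x)) $ l = w x $ l" for l
    proof -
      have "(\<Sum>(j, i)\<in>UNIV \<times> {..np}. a j i *\<^sub>R axis j (shb i x)) $ l =
        (\<Sum>j\<in>UNIV. \<Sum>i\<le>np. if j = l then a l i * shb i x else 0)"
        unfolding sum.cartesian_product[symmetric] sum_component
        by (intro sum.cong refl) (auto simp: axis_def)
      also have "\<dots> = (\<Sum>i\<le>np. \<Sum>j\<in>UNIV. if j = l then a l i * shb i x else 0)" by (rule sum.swap)
      also have "\<dots> = w x $ l" using elim by simp
      finally show ?thesis .
    qed
    then show ?case by (simp add: vec_eq_iff)
  qed
  then show "\<exists>c. AE x in \<M>. w x = (\<Sum>l\<in>UNIV \<times> {..np}. c l *\<^sub>R (case l of (j, i) \<Rightarrow> \<lambda>x. axis j (shb i x)) x)"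
    by (intro exI[of _ "\<lambda>(j, i). a j i"]) (simp add: case_prod_beta)
qed auto

definition "PV = L2_proj \<Omega> V"
definition "Pp = L2_perp \<Omega> (Shd \<Omega> k \<T>)"

lemma PV_in: "v \<in> L2 \<Omega> \<Longrightarrow> PV v \<in> V"
  using onb_V unfolding PV_def by (elim exE) (rule L2_proj_in[OF \<Omega>_sets])

lemma PV_L2: "v \<in> L2 \<Omega> \<Longrightarrow> PV v \<in> L2 \<Omega>"
  using PV_in V_L2 by blast

lemma PV_orth: "v \<in> L2 \<Omega> \<Longrightarrow> y \<in> V \<Longrightarrow> ip (PV v) y = ip v y"
  using onb_V unfolding PV_def by (elim exE) (rule L2_proj_orth[OF \<Omega>_sets])

lemma PV_lincomb:
  "(\<And>i. i \<in> I \<Longrightarrow> v i \<in> L2 \<Omega>) \<Longrightarrow> AE x in \<M>. PV (\<lambda>x. \<Sum>i\<in>I. a i *\<^sub>R v i x) x = (\<Sum>i\<in>I. a i *\<^sub>R PV (v i) x)"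
  using onb_V unfolding PV_def by (elim exE) (rule L2_proj_lincomb[OF \<Omega>_sets])

lemma PV_cong: "v \<in> L2 \<Omega> \<Longrightarrow> AE x in \<M>. v' x = v x \<Longrightarrow> AE x in \<M>. PV v' x = PV v x"
  using onb_V unfolding PV_def by (elim exE) (rule L2_proj_cong_AE[OF \<Omega>_sets])

lemma Pp_L2: "v \<in> L2 \<Omega> \<Longrightarrow> Pp v \<in> L2 \<Omega>"
  using onb_Shd unfolding Pp_def by (elim exE) (rule L2_perp_L2[OF \<Omega>_sets])

lemma Pp_orth: "v \<in> L2 \<Omega> \<Longrightarrow> y \<in> Shd \<Omega> k \<T> \<Longrightarrow> ip (Pp v) y = 0"
  using onb_Shd unfolding Pp_def by (elim exE) (rule L2_perp_orth[OF \<Omega>_sets])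

lemma Pp_lincomb:
  "(\<And>i. i \<in> I \<Longrightarrow> v i \<in> L2 \<Omega>) \<Longrightarrow> AE x in \<M>. Pp (\<lambda>x. \<Sum>i\<in>I. a i *\<^sub>R v i x) x = (\<Sum>i\<in>I. a i *\<^sub>R Pp (v i) x)"
  using onb_Shd unfolding Pp_def by (elim exE) (rule L2_perp_lincomb[OF \<Omega>_sets])

lemma Pp_cong: "v \<in> L2 \<Omega> \<Longrightarrow> AE x in \<M>. v' x = v x \<Longrightarrow> AE x in \<M>. Pp v' x = Pp v x"
  using onb_Shd unfolding Pp_def by (elim exE) (rule L2_perp_cong_AE[OF \<Omega>_sets])

text \<open>The part removed by \<open>Pp\<close> lies in \<open>Shd\<close> and is invisible to
  \<open>w\<close>. In this way the subscale equations, stated with unprojected terms, become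
  equations for projected ones.\<close>

lemma Pp_diff_Shd:
  assumes v: "v \<in> L2 \<Omega>" and w: "w \<in> L2 \<Omega>" "\<And>y. y \<in> Shd \<Omega> k \<T> \<Longrightarrow> ip y w = 0"
  shows "ip (Pp v) w = ip v w"
proof -
  obtain m e where e: "L2_onb \<Omega> (Shd \<Omega> k \<T>) m e" using onb_Shd by (elim exE)
  have p: "L2_proj \<Omega> (Shd \<Omega> k \<T>) v \<in> Shd \<Omega> k \<T>" by (rule L2_proj_in[OF \<Omega>_sets e v])
  then have "L2_proj \<Omega> (Shd \<Omega> k \<T>) v \<in> L2 \<Omega>" using Shd_L2 by blast
  then show ?thesis
    unfolding Pp_def L2_perp_def using v w p by (subst L2_inner_diff_left) auto
qed

lemma subscale1_span: "W1 = AE_span \<Omega> ({..<nu} \<times> {..<nu}) (\<lambda>(i, j). Pp (conv \<Omega> (\<phi> i) (\<phi> j)))"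
proof (intro set_eqI iffI)
  fix w assume "w \<in> W1"
  then obtain a where "AE x in \<M>. w x = (\<Sum>i<nu. \<Sum>j<nu. a i j *\<^sub>R Pp (conv \<Omega> (\<phi> i) (\<phi> j)) x)"
    by (auto simp: subscale1_def Pp_def)
  then have "AE x in \<M>. w x = (\<Sum>l\<in>{..<nu} \<times> {..<nu}. (\<lambda>(i, j). a i j) l *\<^sub>R (\<lambda>(i, j). Pp (conv \<Omega> (\<phi> i) (\<phi> j))) l x)"
    by (simp add: sum.cartesian_product case_prod_beta)
  then show "w \<in> AE_span \<Omega> ({..<nu} \<times> {..<nu}) (\<lambda>(i, j). Pp (conv \<Omega> (\<phi> i) (\<phi> j)))"
    unfolding AE_span_def by (intro CollectI exI)
next
  fix w assume "w \<in> AE_span \<Omega> ({..<nu} \<times> {..<nu}) (\<lambda>(i, j). Pp (conv \<Omega> (\<phi> i) (\<phi> j)))"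
  then obtain a where "AE x in \<M>. w x = (\<Sum>l\<in>{..<nu} \<times> {..<nu}. a l *\<^sub>R (\<lambda>(i, j). Pp (conv \<Omega> (\<phi> i) (\<phi> j))) l x)"
    by (auto simp: AE_span_def)
  then have "AE x in \<M>. w x = (\<Sum>i<nu. \<Sum>j<nu. (\<lambda>i j. a (i, j)) i j *\<^sub>R Pp (conv \<Omega> (\<phi> i) (\<phi> j)) x)"
    by (simp add: sum.cartesian_product case_prod_beta)
  then show "w \<in> W1" unfolding subscale1_def Pp_def by (intro CollectI exI)
qed

lemma subscale2_span: "W2 = AE_span \<Omega> {..<np} (\<lambda>i. Pp (grad \<Omega> (\<psi> i)))"
  by (simp add: subscale2_def AE_span_def Pp_def)

lemma conv_V_L2: "u \<in> V \<Longrightarrow> v \<in> V \<Longrightarrow> conv \<Omega> u v \<in> L2 \<Omega>"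
  by (intro conv_L2 Vh_pw)

lemma grad_Sh_L2: "p \<in> Sh \<Omega> k \<T> \<Longrightarrow> grad \<Omega> p \<in> L2 \<Omega>"
  by (intro grad_L2 Sh_pw_C1)

lemma onb_W1: "\<exists>m e. L2_onb \<Omega> W1 m e"
  unfolding subscale1_span
  by (rule L2_onb_AE_span[OF \<Omega>_sets]) (auto intro: Pp_L2 conv_V_L2 \<phi>_V)

lemma onb_W2: "\<exists>m e. L2_onb \<Omega> W2 m e"
  unfolding subscale2_span
  by (rule L2_onb_AE_span[OF \<Omega>_sets]) (auto intro: Pp_L2 grad_Sh_L2 \<psi>_Sh)

lemma AE_span_orth:
  assumes g: "\<And>i. i \<in> I \<Longrightarrow> g i \<in> L2 \<Omega>" "\<And>i. i \<in> I \<Longrightarrow> ip (g i) y = 0"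
    and w: "w \<in> AE_span \<Omega> I g" and y: "y \<in> L2 \<Omega>"
  shows "ip w y = 0"
proof -
  obtain a where "AE x in \<M>. w x = (\<Sum>i\<in>I. a i *\<^sub>R g i x)" using w by (auto simp: AE_span_def)
  then have "ip w y = ip (\<lambda>x. \<Sum>i\<in>I. a i *\<^sub>R g i x) y"
    by (intro L2_inner_cong_AE[OF \<Omega>_sets] L2_lincomb g y) auto
  also have "\<dots> = (\<Sum>i\<in>I. a i * ip (g i) y)" by (intro L2_inner_lincomb_left g y)
  also have "\<dots> = 0" using g(2) by (intro sum.neutral) simp
  finally show ?thesis .
qed

text \<open>The generators are images of \<open>Pp\<close>, which are orthogonal to
  \<open>Shd\<close>.\<close>

lemma W1_orth:
  assumes w: "w \<in> W1" and y: "y \<in> Shd \<Omega> k \<T>" shows "ip w y = 0"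
  by (rule AE_span_orth[OF _ _ w[unfolded subscale1_span] subsetD[OF Shd_L2 y]])
    (auto intro!: Pp_L2 Pp_orth conv_V_L2 \<phi>_V y)

lemma W2_orth:
  assumes w: "w \<in> W2" and y: "y \<in> Shd \<Omega> k \<T>" shows "ip w y = 0"
  by (rule AE_span_orth[OF _ _ w[unfolded subscale2_span] subsetD[OF Shd_L2 y]])
    (auto intro!: Pp_L2 Pp_orth grad_Sh_L2 \<psi>_Sh y)

lemma conv_expansion:
  assumes u: "u \<in> V" and v: "v \<in> V"
    and a: "AE x in \<M>. u x = (\<Sum>i<nu. a i *\<^sub>R \<phi> i x)" and b: "AE x in \<M>. v x = (\<Sum>i<nu. b i *\<^sub>R \<phi> i x)"
  shows "AE x in \<M>. conv \<Omega> u v x = (\<Sum>i<nu. \<Sum>j<nu. (a i * b j) *\<^sub>R conv \<Omega> (\<phi> i) (\<phi> j) x)"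
proof -
  have 1: "AE x in \<M>. conv \<Omega> u v x = (\<Sum>i<nu. a i *\<^sub>R conv \<Omega> (\<phi> i) v x)"
    by (rule conv_lincomb_left[OF _ a]) (auto intro: Vh_pw \<phi>_V)
  have "AE x in \<M>. conv \<Omega> (\<phi> i) v x = (\<Sum>j<nu. b j *\<^sub>R conv \<Omega> (\<phi> i) (\<phi> j) x)" for i
    by (rule conv_lincomb_right[OF _ b]) (auto intro: Vh_pw \<phi>_V)
  then have "AE x in \<M>. \<forall>i\<in>{..<nu}. conv \<Omega> (\<phi> i) v x = (\<Sum>j<nu. b j *\<^sub>R conv \<Omega> (\<phi> i) (\<phi> j) x)"
    by (intro AE_finite_ball) auto
  with 1 show ?thesis by eventually_elim (simp add: scaleR_sum_right)
qed

text \<open>The convective term is bilinear, so its expansion runs over pairs of basis functions;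
  the space is generated by such pairs for this purpose.\<close>

lemma Pp_conv_W1:
  assumes u: "u \<in> V" and v: "v \<in> V"
  shows "Pp (conv \<Omega> u v) \<in> W1"
proof -
  obtain a where a: "AE x in \<M>. u x = (\<Sum>i<nu. a i *\<^sub>R \<phi> i x)" using V_expansion[OF u] by (elim exE)
  obtain b where b: "AE x in \<M>. v x = (\<Sum>i<nu. b i *\<^sub>R \<phi> i x)" using V_expansion[OF v] by (elim exE)
  let ?I = "{..<nu} \<times> {..<nu}"
  let ?g = "\<lambda>l. conv \<Omega> (\<phi> (fst l)) (\<phi> (snd l))" and ?c = "\<lambda>l. a (fst l) * b (snd l)"
  have gL: "?g l \<in> L2 \<Omega>" if "l \<in> ?I" for l
  proof -
    have "fst l < nu" "snd l < nu" using that by auto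
    then show ?thesis by (intro conv_V_L2 \<phi>_V)
  qed
  have e: "AE x in \<M>. conv \<Omega> u v x = (\<Sum>l\<in>?I. ?c l *\<^sub>R ?g l x)"
    using conv_expansion[OF u v a b] by eventually_elim (simp add: sum.cartesian_product case_prod_beta)
  have "AE x in \<M>. Pp (conv \<Omega> u v) x = Pp (\<lambda>x. \<Sum>l\<in>?I. ?c l *\<^sub>R ?g l x) x"
    by (rule Pp_cong[OF _ e]) (rule L2_lincomb, rule gL)
  moreover have "AE x in \<M>. Pp (\<lambda>x. \<Sum>l\<in>?I. ?c l *\<^sub>R ?g l x) x = (\<Sum>l\<in>?I. ?c l *\<^sub>R Pp (?g l) x)"
    by (rule Pp_lincomb[OF gL])
  ultimately have "AE x in \<M>. Pp (conv \<Omega> u v) x = (\<Sum>l\<in>?I. ?c l *\<^sub>R (case l of (i, j) \<Rightarrow> Pp (conv \<Omega> (\<phi> i) (\<phi> j))) x)"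
    by eventually_elim (simp add: case_prod_beta)
  then show ?thesis unfolding subscale1_span AE_span_def by (intro CollectI exI)
qed

text \<open>The gradient annihilates the additive constant that the quotient leaves open, so the
  pressure basis alone expands gradients.\<close>

lemma grad_expansion:
  assumes a: "AE x in \<M>. q x = (\<Sum>i<np. a i * \<psi> i x) + c"
  shows "AE x in \<M>. grad \<Omega> q x = (\<Sum>i<np. a i *\<^sub>R grad \<Omega> (\<psi> i) x)"
proof -
  let ?b = "\<lambda>i. if i < np then a i else c"
  have g1: "AE x in \<M>. grad \<Omega> (\<lambda>x. 1::real) x = 0"
    using pw_C1_grad[OF pw_C1_I[OF C1_const[of 1]]]
    by eventually_elim (simp add: pgrad_def pderiv_at_const vec_eq_iff)
  have "AE x in \<M>. grad \<Omega> q x = (\<Sum>i\<le>np. ?b i *\<^sub>R grad \<Omega> (shb i) x)"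
  proof (rule grad_lincomb_AE[OF op bd])
    show "AE x in \<M>. q x = (\<Sum>i\<le>np. ?b i * shb i x)"
      using a by eventually_elim (simp add: lessThan_Suc_atMost[symmetric] shb_def)
  qed (auto intro: pw_C1_L2 pw_C1_wgrad Sh_pw_C1 shb_Sh)
  with g1 show ?thesis
    by eventually_elim (simp add: lessThan_Suc_atMost[symmetric] shb_def)
qed

lemma Pp_grad_W2:
  assumes p: "p \<in> Sh \<Omega> k \<T>" shows "Pp (grad \<Omega> p) \<in> W2"
proof -
  obtain a c where a: "AE x in \<M>. p x = (\<Sum>i<np. a i * \<psi> i x) + c" using Sh_expansion[OF p] by (elim exE)
  have gL: "grad \<Omega> (\<psi> i) \<in> L2 \<Omega>" if "i \<in> {..<np}" for i using that by (auto intro: grad_Sh_L2 \<psi>_Sh)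
  have "AE x in \<M>. Pp (grad \<Omega> p) x = Pp (\<lambda>x. \<Sum>i<np. a i *\<^sub>R grad \<Omega> (\<psi> i) x) x"
    by (rule Pp_cong[OF L2_lincomb[OF gL] grad_expansion[OF a]])
  moreover have "AE x in \<M>. Pp (\<lambda>x. \<Sum>i<np. a i *\<^sub>R grad \<Omega> (\<psi> i) x) x = (\<Sum>i<np. a i *\<^sub>R Pp (grad \<Omega> (\<psi> i)) x)"
    by (rule Pp_lincomb[OF gL])
  ultimately have "AE x in \<M>. Pp (grad \<Omega> p) x = (\<Sum>i<np. a i *\<^sub>R Pp (grad \<Omega> (\<psi> i)) x)"
    by eventually_elim simp
  then show ?thesis unfolding subscale2_span AE_span_def by (intro CollectI exI)
qed

text \<open>The operator \<open>B\<close> of the overview; the mesh condition bounds it from below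
  on residual fields.\<close>

definition "Bres z = (\<lambda>x. PV z x + Pp z x)"

lemma Bres_L2: "z \<in> L2 \<Omega> \<Longrightarrow> Bres z \<in> L2 \<Omega>"
  unfolding Bres_def by (intro L2_add PV_L2 Pp_L2)

lemma Bres_lincomb:
  assumes "\<And>i. i \<in> I \<Longrightarrow> v i \<in> L2 \<Omega>"
  shows "AE x in \<M>. Bres (\<lambda>x. \<Sum>i\<in>I. a i *\<^sub>R v i x) x = (\<Sum>i\<in>I. a i *\<^sub>R Bres (v i) x)"
proof -
  have "AE x in \<M>. PV (\<lambda>x. \<Sum>i\<in>I. a i *\<^sub>R v i x) x = (\<Sum>i\<in>I. a i *\<^sub>R PV (v i) x)"
    by (rule PV_lincomb[OF assms])
  moreover have "AE x in \<M>. Pp (\<lambda>x. \<Sum>i\<in>I. a i *\<^sub>R v i x) x = (\<Sum>i\<in>I. a i *\<^sub>R Pp (v i) x)"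
    by (rule Pp_lincomb[OF assms])
  ultimately show ?thesis unfolding Bres_def
    by eventually_elim (simp add: sum.distrib scaleR_add_right)
qed

lemma Bres_cong: "v \<in> L2 \<Omega> \<Longrightarrow> AE x in \<M>. v' x = v x \<Longrightarrow> AE x in \<M>. Bres v' x = Bres v x"
  using PV_cong[of v v'] Pp_cong[of v v'] unfolding Bres_def by (auto elim: eventually_elim2)

lemma RF_L2: "RF \<subseteq> L2 \<Omega>"
  by (auto simp: residual_fields_def intro!: L2_lincomb L2_add grad_Sh_L2 conv_V_L2)

lemma RF_I: "q \<in> Sh \<Omega> k \<T> \<Longrightarrow> v \<in> V \<Longrightarrow> (\<lambda>x. grad \<Omega> q x + conv \<Omega> v v x) \<in> RF"
  unfolding residual_fields_def
  by (intro CollectI exI[of _ "1::nat"] exI[of _ "\<lambda>_. 1::real"] exI[of _ "\<lambda>_. q"] exI[of _ "\<lambda>_. v"]) simp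

text \<open>A single field \<open>grad q + conv v v\<close> is quadratic in \<open>v\<close>, so a
  sum cannot be merged into one pair \<open>(q, v)\<close>. The definition admits finite lists of
  pairs, and lists can be concatenated.\<close>

lemma lin_closed_RF: "lin_closed RF"
  unfolding lin_closed_def
proof (intro conjI ballI allI)
  show "(\<lambda>x. 0) \<in> RF" unfolding residual_fields_def by (intro CollectI exI[of _ "0::nat"]) simp
  fix z w and s t :: real assume "z \<in> RF" "w \<in> RF"
  then obtain m a q v n b r u where z: "\<forall>j<m::nat. q j \<in> Sh \<Omega> k \<T> \<and> v j \<in> V" "z = (\<lambda>x. \<Sum>j<m. a j *\<^sub>R (grad \<Omega> (q j) x + conv \<Omega> (v j) (v j) x))"
    and w: "\<forall>j<n::nat. r j \<in> Sh \<Omega> k \<T> \<and> u j \<in> V" "w = (\<lambda>x. \<Sum>j<n. b j *\<^sub>R (grad \<Omega> (r j) x + conv \<Omega> (u j) (u j) x))"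
    unfolding residual_fields_def by (elim CollectE exE conjE)
  let ?a = "\<lambda>j. if j < m then s * a j else t * b (j - m)" and ?q = "\<lambda>j. if j < m then q j else r (j - m)"
    and ?v = "\<lambda>j. if j < m then v j else u (j - m)"
  have "(\<lambda>x. s *\<^sub>R z x + t *\<^sub>R w x) = (\<lambda>x. \<Sum>j<m + n. ?a j *\<^sub>R (grad \<Omega> (?q j) x + conv \<Omega> (?v j) (?v j) x))"
  proof
    fix x
    define G where "G = (\<lambda>j. (t * b j) *\<^sub>R (grad \<Omega> (r j) x + conv \<Omega> (u j) (u j) x))"
    have "(\<Sum>j<m + n. ?a j *\<^sub>R (grad \<Omega> (?q j) x + conv \<Omega> (?v j) (?v j) x)) =
      (\<Sum>j<m + n. if j < m then (s * a j) *\<^sub>R (grad \<Omega> (q j) x + conv \<Omega> (v j) (v j) x)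
        else G (j - m))"
      unfolding G_def by (intro sum.cong) auto
    also have "\<dots> = s *\<^sub>R z x + t *\<^sub>R w x"
      unfolding z(2) w(2) by (subst sum_lessThan_append) (simp add: scaleR_sum_right G_def)
    finally show "s *\<^sub>R z x + t *\<^sub>R w x = (\<Sum>j<m + n. ?a j *\<^sub>R (grad \<Omega> (?q j) x + conv \<Omega> (?v j) (?v j) x))" by simp
  qed
  moreover have "\<forall>j<m + n. ?q j \<in> Sh \<Omega> k \<T> \<and> ?v j \<in> V" using z(1) w(1) by auto
  ultimately show "(\<lambda>x. s *\<^sub>R z x + t *\<^sub>R w x) \<in> RF"
    unfolding residual_fields_def by (intro CollectI exI[of _ "m + n"] exI[of _ ?a] exI[of _ ?q] exI[of _ ?v]) simp
qed

end

section \<open>Estimates at a fixed time\<close>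

text \<open>Bessel's inequality bounds the size of orthonormal families, so a maximal one exists.\<close>

lemma L2_onb_subspace:
  assumes \<Omega>: "\<Omega> \<in> sets lebesgue" and U: "L2_onb \<Omega> U M e" and W: "W \<subseteq> U" "lin_closed W"
  shows "\<exists>m f. L2_onb \<Omega> W m f"
proof -
  have UL: "U \<subseteq> L2 \<Omega>" using U by (simp add: L2_onb_def)
  define P where "P = (\<lambda>m. \<exists>f. (\<forall>i<m. f i \<in> W) \<and> orthonormal_fam \<Omega> m f)"
  have bound: "m \<le> M" if Pm: "P m" for m
  proof -
    obtain f where f: "\<forall>i<m. f i \<in> W" "orthonormal_fam \<Omega> m f" using Pm unfolding P_def by (elim exE conjE)
    have eL: "e j \<in> L2 \<Omega>" if "j < M" for j using U that by (auto simp: L2_onb_def orthonormal_fam_def)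
    have "real m = (\<Sum>i<m. (L2_norm \<Omega> (f i))\<^sup>2)"
      using f(2) by (simp add: L2_norm_power2 orthonormal_fam_def)
    also have "\<dots> = (\<Sum>i<m. \<Sum>j<M. (L2_inner \<Omega> (f i) (e j))\<^sup>2)"
      using f(1) W(1) by (intro sum.cong refl L2_onb_norm[OF \<Omega> U]) auto
    also have "\<dots> = (\<Sum>j<M. \<Sum>i<m. (L2_inner \<Omega> (e j) (f i))\<^sup>2)"
      by (subst sum.swap) (simp add: L2_inner_commute)
    also have "\<dots> \<le> (\<Sum>j<M. (L2_norm \<Omega> (e j))\<^sup>2)"
      by (intro sum_mono orthonormal_fam_Bessel f(2) eL) simp
    also have "\<dots> = (\<Sum>j<M. 1)"
      using U by (intro sum.cong) (auto simp: L2_norm_power2 L2_onb_def orthonormal_fam_def)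
    finally show ?thesis by simp
  qed
  have P0: "P 0" unfolding P_def by (rule exI[of _ "\<lambda>_ _. 0"]) (simp add: orthonormal_fam_def)
  define m where "m = Max {m. P m}"
  have finP: "finite {m. P m}"
  proof (rule finite_subset)
    show "{m. P m} \<subseteq> {..M}"
    proof
      fix m assume "m \<in> {m. P m}"
      then show "m \<in> {..M}" using bound[of m] by simp
    qed
  qed simp
  have "m \<in> {m. P m}" unfolding m_def
  proof (rule Max_in[OF finP])
    have "0 \<in> {m. P m}" using P0 by simp
    then show "{m. P m} \<noteq> {}" by (metis empty_iff)
  qed
  then have Pm: "P m" by simp
  have nP: "\<not> P (Suc m)"
  proof
    assume "P (Suc m)"
    then have "Suc m \<le> m" unfolding m_def by (intro Max_ge[OF finP]) simp
    then show False by simp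
  qed
  obtain f where f: "\<forall>i<m. f i \<in> W" "orthonormal_fam \<Omega> m f" using Pm unfolding P_def by (elim exE conjE)
  have fL: "f i \<in> L2 \<Omega>" if "i < m" for i using f(2) that by (simp add: orthonormal_fam_def)
  have "AE x in lebesgue_on \<Omega>. w x = (\<Sum>j<m. L2_inner \<Omega> w (f j) *\<^sub>R f j x)" if w: "w \<in> W" for w
  proof -
    let ?s = "\<lambda>x. \<Sum>j<m. L2_inner \<Omega> w (f j) *\<^sub>R f j x"
    define r where "r = (\<lambda>x. 1 *\<^sub>R w x + (-1) *\<^sub>R ?s x)"
    have sW: "?s \<in> W" by (rule lin_closed_sum[OF W(2)]) (use f(1) in simp)
    have rW: "r \<in> W" unfolding r_def by (rule lin_closedD[OF W(2) w sW])
    have rL: "r \<in> L2 \<Omega>" and wL: "w \<in> L2 \<Omega>" and sL: "?s \<in> L2 \<Omega>" using rW w sW W(1) UL by auto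
    have r_orth: "L2_inner \<Omega> r (f i) = 0" if i: "i < m" for i
    proof -
      have "L2_inner \<Omega> r (f i) = L2_inner \<Omega> w (f i) - L2_inner \<Omega> ?s (f i)"
        unfolding r_def using L2_inner_diff_left[OF wL sL fL[OF i]] by simp
      also have "L2_inner \<Omega> ?s (f i) = L2_inner \<Omega> w (f i)"
        using orthonormal_fam_coeff[OF f(2) i, of "\<lambda>j. L2_inner \<Omega> w (f j)"] by simp
      finally show ?thesis by simp
    qed
    have "L2_norm \<Omega> r = 0"
    proof (rule ccontr)
      assume "L2_norm \<Omega> r \<noteq> 0"
      then have n: "L2_norm \<Omega> r > 0" using L2_norm_nonneg[of \<Omega> r] by linarith
      \<comment> \<open>The normalised remainder would extend the maximal family to length
        \<open>Suc m\<close>.\<close>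
      define q where "q = (\<lambda>x. (1 / L2_norm \<Omega> r) *\<^sub>R r x + 0 *\<^sub>R r x)"
      have qW: "q \<in> W" unfolding q_def by (rule lin_closedD[OF W(2) rW rW])
      have q_eq: "q = (\<lambda>x. (1 / L2_norm \<Omega> r) *\<^sub>R r x)" by (simp add: q_def)
      have qq: "L2_inner \<Omega> q q = 1"
        unfolding q_eq L2_inner_scaleR_left L2_inner_scaleR_right using n
        by (simp add: L2_norm_power2[symmetric] power2_eq_square)
      have qf: "L2_inner \<Omega> q (f i) = 0" if "i < m" for i
        unfolding q_eq L2_inner_scaleR_left using r_orth[OF that] by simp
      define f' where "f' = (\<lambda>i. if i < m then f i else q)"
      have "\<forall>i<Suc m. f' i \<in> W" using f(1) qW by (simp add: f'_def)
      moreover have "orthonormal_fam \<Omega> (Suc m) f'"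
        unfolding orthonormal_fam_def
      proof (intro conjI allI impI)
        show "f' i \<in> L2 \<Omega>" if "i < Suc m" for i using fL qW W(1) UL by (auto simp: f'_def)
        fix i j assume "i < Suc m" "j < Suc m"
        then consider "i < m" "j < m" | "i < m" "j = m" | "i = m" "j < m" | "i = m" "j = m" by linarith
        then show "L2_inner \<Omega> (f' i) (f' j) = (if i = j then 1 else 0)"
        proof cases
          case 1 then show ?thesis using f(2) by (simp add: f'_def orthonormal_fam_def)
        next
          case 2 then show ?thesis using qf[of i] by (simp add: f'_def L2_inner_commute[of _ "f i"])
        next
          case 3 then show ?thesis using qf[of j] by (simp add: f'_def)
        next
          case 4 then show ?thesis using qq by (simp add: f'_def)
        qed
      qed
      ultimately have "P (Suc m)" unfolding P_def by (intro exI[of _ f'] conjI)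
      then show False using nP by simp
    qed
    then have "AE x in lebesgue_on \<Omega>. r x = 0" using rL by (simp add: L2_norm_eq_0_iff)
    then show ?thesis unfolding r_def by eventually_elim simp
  qed
  then have "L2_onb \<Omega> W m f" using W UL f unfolding L2_onb_def by auto
  then show ?thesis by blast
qed

lemma norm_transpose: "norm (transpose A) = norm (A :: real^'n^'m)"
proof -
  have "(norm (transpose A))\<^sup>2 = (norm A)\<^sup>2"
    unfolding power2_norm_eq_inner inner_vec_def transpose_def by simp (rule sum.swap)
  then show ?thesis by simp
qed

lemma norm_matrix_vector_le: "norm (A *v x) \<le> norm (A :: real^'n^'m) * norm x"
proof -
  have "norm (A *v x) = L2_set (\<lambda>i. \<bar>A $ i \<bullet> x\<bar>) UNIV"
    by (simp add: norm_vec_def matrix_vector_mult_def inner_vec_def)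
  also have "\<dots> \<le> L2_set (\<lambda>i. norm (A $ i) * norm x) UNIV"
    by (intro L2_set_mono Cauchy_Schwarz_ineq2) simp
  also have "\<dots> = norm A * norm x"
    by (simp add: L2_set_left_distrib norm_vec_def[of A])
  finally show ?thesis .
qed

text \<open>Measurability in the first argument is given for a fixed second argument only.
  \<open>g\<close> is therefore approximated by grid values, of which there are countably many at
  each level, and the Lipschitz condition passes to the limit.\<close>

lemma Caratheodory_measurable:
  fixes \<mu> :: "'a \<Rightarrow> real \<Rightarrow> real"
  assumes meas: "\<And>t. t \<ge> 0 \<Longrightarrow> (\<lambda>x. \<mu> x t) \<in> borel_measurable M"
    and lip: "\<And>x s t. x \<in> space M \<Longrightarrow> s \<ge> 0 \<Longrightarrow> t \<ge> 0 \<Longrightarrow> \<bar>\<mu> x t - \<mu> x s\<bar> \<le> C * \<bar>t - s\<bar>"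
    and g [measurable]: "g \<in> borel_measurable M" and g0: "\<And>x. g x \<ge> 0"
  shows "(\<lambda>x. \<mu> x (g x)) \<in> borel_measurable M"
proof (rule borel_measurable_LIMSEQ_real)
  define q where "q = (\<lambda>n x. nat \<lfloor>real (Suc n) * g x\<rfloor>)"
  have q_eq: "real (q n x) = of_int \<lfloor>real (Suc n) * g x\<rfloor>" for n x
    unfolding q_def using g0[of x] by (simp add: zero_le_mult_iff)
  have q: "\<bar>g x - real (q n x) / real (Suc n)\<bar> \<le> inverse (real (Suc n))" for n x
  proof -
    have "real (q n x) \<le> real (Suc n) * g x" "real (Suc n) * g x < real (q n x) + 1"
      unfolding q_eq by linarith+
    then have "\<bar>real (Suc n) * g x - real (q n x)\<bar> \<le> 1" by linarith
    then have "\<bar>real (Suc n) * g x - real (q n x)\<bar> / real (Suc n) \<le> 1 / real (Suc n)" by (intro divide_right_mono) auto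
    moreover have "\<bar>g x - real (q n x) / real (Suc n)\<bar> = \<bar>real (Suc n) * g x - real (q n x)\<bar> / real (Suc n)"
    proof -
      have "g x - real (q n x) / real (Suc n) = (real (Suc n) * g x - real (q n x)) / real (Suc n)"
        by (simp add: field_simps del: of_nat_Suc)
      then show ?thesis by (simp only: abs_divide abs_of_nat)
    qed
    ultimately show ?thesis by (simp add: inverse_eq_divide)
  qed
  have "q n \<in> measurable M (count_space UNIV)" for n unfolding q_def by measurable
  then show "(\<lambda>x. \<mu> x (real (q n x) / real (Suc n))) \<in> borel_measurable M" for n
    by (rule measurable_compose_countable[rotated, of _ _ "\<lambda>m x. \<mu> x (real m / real (Suc n))"]) (auto intro: meas)
  fix x assume x: "x \<in> space M"
  show "(\<lambda>n. \<mu> x (real (q n x) / real (Suc n))) \<longlonglongrightarrow> \<mu> x (g x)"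
  proof (rule LIM_zero_cancel, rule Lim_null_comparison)
    show "\<forall>\<^sub>F n in sequentially. norm (\<mu> x (real (q n x) / real (Suc n)) - \<mu> x (g x)) \<le> \<bar>C\<bar> * inverse (real (Suc n))"
    proof (rule always_eventually, rule allI)
      fix n
      have "\<bar>\<mu> x (real (q n x) / real (Suc n)) - \<mu> x (g x)\<bar> \<le> C * \<bar>real (q n x) / real (Suc n) - g x\<bar>"
        using g0 by (intro lip x) auto
      also have "\<dots> \<le> \<bar>C\<bar> * \<bar>real (q n x) / real (Suc n) - g x\<bar>" by (intro mult_right_mono) auto
      also have "\<dots> \<le> \<bar>C\<bar> * inverse (real (Suc n))" using q[of x n] by (intro mult_left_mono) (auto simp: abs_minus_commute)
      finally show "norm (\<mu> x (real (q n x) / real (Suc n)) - \<mu> x (g x)) \<le> \<bar>C\<bar> * inverse (real (Suc n))" by simp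
    qed
    show "(\<lambda>n. \<bar>C\<bar> * inverse (real (Suc n))) \<longlonglongrightarrow> 0"
      by (rule tendsto_mult_right_zero[OF LIMSEQ_inverse_real_of_nat])
  qed
qed

text \<open>The setting at a fixed time. \<open>Ci\<close> carries the inverse estimate and
  \<open>R\<close> the size of the domain, so that the constants \<open>Cg\<close>,
  \<open>Cf\<close>, \<open>CQ\<close> and \<open>C2\<close> below involve no mesh quantity.\<close>

locale vms = fe_space \<Omega> \<T> k nu np \<phi> \<psi> for \<Omega> :: "(real^'n) set" and \<T> k nu np \<phi> \<psi> +
  fixes Ci \<beta>0 c1 c2 \<mu>0 \<mu>inf C\<mu> R :: real and \<mu> :: "real^'n \<Rightarrow> real \<Rightarrow> real" and \<mu>c :: "(real^'n \<Rightarrow> real^'n) \<Rightarrow> real"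
  assumes Ci: "Ci \<ge> 0" and inv: "\<And>v i. v \<in> Sh \<Omega> k \<T> \<Longrightarrow> nrm (pderiv_at i v) \<le> Ci / mesh_size \<T> * nrm v"
    and inv_sup: "\<And>v i M. v \<in> Sh \<Omega> k \<T> \<Longrightarrow> (\<And>x. x \<in> closure \<Omega> \<Longrightarrow> \<bar>v x\<bar> \<le> M) \<Longrightarrow>
       AE x in \<M>. \<bar>pderiv_at i v x\<bar> \<le> Ci / mesh_size \<T> * M"
    and beta: "\<beta>0 > 0" and mesh_cond: "\<And>z. z \<in> RF \<Longrightarrow> nrm z \<le> 1 / \<beta>0 * nrm (Bres z)"
    and c: "c1 > 0" "c2 > 0" and mu_const: "\<mu>0 > \<mu>inf" "\<mu>inf > 0"
    and mu_lip: "\<And>x s t. x \<in> closure \<Omega> \<Longrightarrow> s \<ge> 0 \<Longrightarrow> t \<ge> 0 \<Longrightarrow> \<bar>\<mu> x t - \<mu> x s\<bar> \<le> C\<mu> * \<bar>t - s\<bar>"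
    and mu_bd: "\<And>x t. x \<in> closure \<Omega> \<Longrightarrow> t \<ge> 0 \<Longrightarrow> \<mu>inf \<le> \<mu> x t \<and> \<mu> x t \<le> \<mu>0"
    and mu_meas: "\<And>t. t \<ge> 0 \<Longrightarrow> (\<lambda>x. \<mu> x t) \<in> borel_measurable \<M>"
    and R: "R \<ge> 0" "\<And>x. x \<in> \<Omega> \<Longrightarrow> norm x \<le> R"
    and mc: "\<And>w. w \<in> V \<Longrightarrow> \<mu>inf \<le> \<mu>c w \<and> \<mu>c w \<le> \<mu>0"
begin

abbreviation "h \<equiv> mesh_size \<T>"

lemma h_pos: "h > 0" by (rule mesh_size_pos)

lemma Bres_lincomb2:
  assumes v: "v \<in> L2 \<Omega>" and w: "w \<in> L2 \<Omega>"
  shows "AE x in \<M>. Bres (\<lambda>x. s *\<^sub>R v x + t *\<^sub>R w x) x = s *\<^sub>R Bres v x + t *\<^sub>R Bres w x"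
proof -
  have "AE x in \<M>. Bres (\<lambda>x. \<Sum>b\<in>UNIV. (if b then s else t) *\<^sub>R (if b then v else w) x) x =
      (\<Sum>b\<in>UNIV. (if b then s else t) *\<^sub>R Bres (if b then v else w) x)"
    by (rule Bres_lincomb) (use v w in auto)
  then show ?thesis by (simp add: UNIV_bool add.commute)
qed

text \<open>Orthonormality is imposed on the images under \<open>Bres\<close> and not on the fields.
  The mesh condition makes \<open>Bres\<close> injective up to null functions, so every residual
  field is recovered from the coefficients of its image.\<close>

lemma residual_basis:
  "\<exists>N z. (\<forall>l<N. z l \<in> RF) \<and> orthonormal_fam \<Omega> N (\<lambda>l. Bres (z l)) \<and>
    (\<forall>r\<in>RF. AE x in \<M>. r x = (\<Sum>l<N. ip (Bres r) (Bres (z l)) *\<^sub>R z l x))"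
proof -
  \<comment> \<open>Indices of finitely many generators, pressure gradients and convective terms of
    pairs, of a space that contains all residual fields.\<close>
  define I where "I = {..<np} <+> ({..<nu} \<times> {..<nu})"
  define G where "G = (\<lambda>l. case l of Inl i \<Rightarrow> grad \<Omega> (\<psi> i) | Inr (i, j) \<Rightarrow> conv \<Omega> (\<phi> i) (\<phi> j))"
  have fI: "finite I" by (simp add: I_def)
  have GL: "G l \<in> L2 \<Omega>" if "l \<in> I" for l
    using that by (auto simp: I_def G_def intro!: grad_Sh_L2 \<psi>_Sh conv_V_L2 \<phi>_V)
  obtain m0 e0 where Y: "L2_onb \<Omega> (AE_span \<Omega> I G) m0 e0" using L2_onb_AE_span[OF \<Omega>_sets fI, of G] GL by blast
  obtain M e where U: "L2_onb \<Omega> (AE_span \<Omega> I (\<lambda>l. Bres (G l))) M e"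
    using L2_onb_AE_span[OF \<Omega>_sets fI, of "\<lambda>l. Bres (G l)"] GL Bres_L2 by blast
  have gen: "(\<lambda>x. grad \<Omega> q x + conv \<Omega> v v x) \<in> AE_span \<Omega> I G" if q: "q \<in> Sh \<Omega> k \<T>" and v: "v \<in> V" for q v
  proof -
    obtain a c where a: "AE x in \<M>. q x = (\<Sum>i<np. a i * \<psi> i x) + c" using Sh_expansion[OF q] by (elim exE)
    obtain b where b: "AE x in \<M>. v x = (\<Sum>i<nu. b i *\<^sub>R \<phi> i x)" using V_expansion[OF v] by (elim exE)
    let ?c = "\<lambda>l. case l of Inl i \<Rightarrow> a i | Inr (i, j) \<Rightarrow> b i * b j"
    have "AE x in \<M>. grad \<Omega> q x + conv \<Omega> v v x = (\<Sum>l\<in>I. ?c l *\<^sub>R G l x)"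
      using grad_expansion[OF a] conv_expansion[OF v v b b]
    proof eventually_elim
      case (elim x)
      have "(\<Sum>l\<in>I. ?c l *\<^sub>R G l x) = (\<Sum>i<np. a i *\<^sub>R grad \<Omega> (\<psi> i) x) + (\<Sum>l\<in>{..<nu} \<times> {..<nu}. (b (fst l) * b (snd l)) *\<^sub>R conv \<Omega> (\<phi> (fst l)) (\<phi> (snd l)) x)"
        unfolding I_def by (subst sum.Plus) (auto simp: G_def case_prod_beta)
      then show ?case using elim by (simp add: sum.cartesian_product case_prod_beta)
    qed
    then show ?thesis unfolding AE_span_def by (intro CollectI exI[of _ ?c])
  qed
  have RFY: "RF \<subseteq> AE_span \<Omega> I G"
  proof
    fix r assume "r \<in> RF"
    then obtain m a q v where r: "\<forall>j<m::nat. q j \<in> Sh \<Omega> k \<T> \<and> v j \<in> V" "r = (\<lambda>x. \<Sum>j<m. a j *\<^sub>R (grad \<Omega> (q j) x + conv \<Omega> (v j) (v j) x))"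
      unfolding residual_fields_def by (elim CollectE exE conjE)
    have lc: "lin_closed (AE_span \<Omega> I G)" using Y by (simp add: L2_onb_def)
    show "r \<in> AE_span \<Omega> I G" unfolding r(2) by (rule lin_closed_sum[OF lc]) (use r(1) gen in simp)
  qed
  \<comment> \<open>The image of the residual fields, enlarged by changes on null sets:
    \<open>Bres\<close> is linear only almost everywhere, so the bare image need not be a linear
    space.\<close>
  define BZ where "BZ = {b. \<exists>r\<in>RF. AE x in \<M>. b x = Bres r x}"
  have BZU: "BZ \<subseteq> AE_span \<Omega> I (\<lambda>l. Bres (G l))"
  proof
    fix b assume "b \<in> BZ"
    then obtain r where r: "r \<in> RF" "AE x in \<M>. b x = Bres r x" by (auto simp: BZ_def)
    obtain c where c: "AE x in \<M>. r x = (\<Sum>l\<in>I. c l *\<^sub>R G l x)" using RFY r(1) by (auto simp: AE_span_def)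
    have "AE x in \<M>. Bres r x = Bres (\<lambda>x. \<Sum>l\<in>I. c l *\<^sub>R G l x) x"
      by (rule Bres_cong[OF _ c]) (rule L2_lincomb, rule GL)
    moreover have "AE x in \<M>. Bres (\<lambda>x. \<Sum>l\<in>I. c l *\<^sub>R G l x) x = (\<Sum>l\<in>I. c l *\<^sub>R Bres (G l) x)"
      by (rule Bres_lincomb[OF GL])
    ultimately have "AE x in \<M>. b x = (\<Sum>l\<in>I. c l *\<^sub>R Bres (G l) x)"
      using r(2) by eventually_elim simp
    then show "b \<in> AE_span \<Omega> I (\<lambda>l. Bres (G l))" unfolding AE_span_def by (intro CollectI exI[of _ c])
  qed
  have BZl: "lin_closed BZ"
    unfolding lin_closed_def
  proof (intro conjI ballI allI)
    have "AE x in \<M>. Bres (\<lambda>x. 0) x = 0"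
      using Bres_lincomb2[of "\<lambda>x. 0" "\<lambda>x. 0" 0 0] by simp
    then have "AE x in \<M>. 0 = Bres (\<lambda>x. 0) x" by eventually_elim simp
    moreover have "(\<lambda>x. 0) \<in> RF" using lin_closed_RF by (simp add: lin_closed_def)
    ultimately show "(\<lambda>x. 0) \<in> BZ" unfolding BZ_def by blast
    fix b d and s t :: real assume "b \<in> BZ" "d \<in> BZ"
    then obtain r q where r: "r \<in> RF" "AE x in \<M>. b x = Bres r x" and q: "q \<in> RF" "AE x in \<M>. d x = Bres q x"
      by (auto simp: BZ_def)
    have "(\<lambda>x. s *\<^sub>R r x + t *\<^sub>R q x) \<in> RF" by (rule lin_closedD[OF lin_closed_RF r(1) q(1)])
    moreover have "AE x in \<M>. s *\<^sub>R b x + t *\<^sub>R d x = Bres (\<lambda>x. s *\<^sub>R r x + t *\<^sub>R q x) x"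
      using r(2) q(2) Bres_lincomb2[OF subsetD[OF RF_L2 r(1)] subsetD[OF RF_L2 q(1)], of s t] by eventually_elim simp
    ultimately show "(\<lambda>x. s *\<^sub>R b x + t *\<^sub>R d x) \<in> BZ" unfolding BZ_def by blast
  qed
  obtain N f where f: "L2_onb \<Omega> BZ N f" using L2_onb_subspace[OF \<Omega>_sets U BZU BZl] by (elim exE)
  \<comment> \<open>Preimages of the orthonormal basis, chosen one by one.\<close>
  have "\<forall>l. \<exists>z. l < N \<longrightarrow> z \<in> RF \<and> (AE x in \<M>. f l x = Bres z x)"
    using f by (auto simp: L2_onb_def BZ_def)
  then obtain z where "\<forall>l. l < N \<longrightarrow> z l \<in> RF \<and> (AE x in \<M>. f l x = Bres (z l) x)"
    by (rule choice[THEN exE])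
  then have z: "l < N \<Longrightarrow> z l \<in> RF" "l < N \<Longrightarrow> AE x in \<M>. f l x = Bres (z l) x" for l by auto
  have zL: "l < N \<Longrightarrow> z l \<in> L2 \<Omega>" for l using z(1) RF_L2 by blast
  have inner_f: "ip y (f l) = ip y (Bres (z l))" if "l < N" "y \<in> L2 \<Omega>" for l y
    using that z(2)[of l] Bres_L2[OF zL] by (intro L2_inner_cong_AE[OF \<Omega>_sets]) auto
  have orth: "orthonormal_fam \<Omega> N (\<lambda>l. Bres (z l))"
    unfolding orthonormal_fam_def
  proof (intro conjI allI impI)
    show "Bres (z i) \<in> L2 \<Omega>" if "i < N" for i by (rule Bres_L2[OF zL[OF that]])
    fix i j assume ij: "i < N" "j < N"
    have "ip (Bres (z i)) (Bres (z j)) = ip (f i) (f j)"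
      using z(2) ij Bres_L2[OF zL] by (intro L2_inner_cong_AE[OF \<Omega>_sets, symmetric]) auto
    then show "ip (Bres (z i)) (Bres (z j)) = (if i = j then 1 else 0)"
      using f ij by (simp add: L2_onb_def orthonormal_fam_def)
  qed
  have "AE x in \<M>. r x = (\<Sum>l<N. ip (Bres r) (Bres (z l)) *\<^sub>R z l x)" if r: "r \<in> RF" for r
  proof -
    let ?c = "\<lambda>l. ip (Bres r) (Bres (z l))"
    have rL: "r \<in> L2 \<Omega>" using r RF_L2 by blast
    let ?s = "\<lambda>x. \<Sum>l<N. ?c l *\<^sub>R z l x"
    have sRF: "?s \<in> RF" by (rule lin_closed_sum[OF lin_closed_RF]) (use z(1) in simp)
    \<comment> \<open>The defect of the expansion is itself a residual field with null image, so the
      mesh condition forces it to vanish.\<close>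
    define d where "d = (\<lambda>x. 1 *\<^sub>R r x + (-1) *\<^sub>R ?s x)"
    have d: "d \<in> RF" unfolding d_def by (rule lin_closedD[OF lin_closed_RF r sRF])
    have "Bres r \<in> BZ" using r by (auto simp: BZ_def)
    then have "AE x in \<M>. Bres r x = (\<Sum>l<N. ip (Bres r) (f l) *\<^sub>R f l x)" using f by (simp add: L2_onb_def)
    moreover have "AE x in \<M>. \<forall>l\<in>{..<N}. f l x = Bres (z l) x" using z(2) by (intro AE_finite_ball) auto
    moreover have "AE x in \<M>. Bres ?s x = (\<Sum>l<N. ?c l *\<^sub>R Bres (z l) x)"
      by (rule Bres_lincomb) (simp add: zL)
    moreover have "AE x in \<M>. Bres d x = 1 *\<^sub>R Bres r x + (-1) *\<^sub>R Bres ?s x"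
      unfolding d_def by (rule Bres_lincomb2[OF rL]) (use sRF RF_L2 in blast)
    ultimately have "AE x in \<M>. Bres d x = 0"
      by eventually_elim (simp add: inner_f Bres_L2[OF rL])
    moreover have dL: "d \<in> L2 \<Omega>" using d RF_L2 by blast
    ultimately have "nrm (Bres d) = 0" using L2_norm_eq_0_iff[OF Bres_L2[OF dL]] by simp
    then have "nrm d = 0" using mesh_cond[OF d] L2_norm_nonneg[of \<Omega> d] by simp
    then have "AE x in \<M>. d x = 0" using L2_norm_eq_0_iff[OF dL] by simp
    then show ?thesis unfolding d_def by eventually_elim simp
  qed
  with z(1) orth show ?thesis by blast
qed

section \<open>Inverse estimates for discrete velocities\<close>

definition "Cg = real CARD('n) * Ci"

lemma Cg: "Cg \<ge> 0" by (simp add: Cg_def Ci)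

context
  fixes v assumes v: "v \<in> V"
begin

lemma V_comp: "(\<lambda>x. v x $ i) \<in> Sh \<Omega> k \<T>" "(\<lambda>x. v x $ i) \<in> H10 \<Omega>" "pw_C1 \<Omega> \<T> (\<lambda>x. v x $ i)"
  using v Vh_pw[OF v] by (auto simp: Vh_def)

lemma vL2: "v \<in> L2 \<Omega>" using v V_L2 by blast

lemma comp_norm_sum: "(\<Sum>i\<in>UNIV. (nrm (\<lambda>x. v x $ i))\<^sup>2) = (nrm v)\<^sup>2"
  using L2_norm_vec_power2[OF vL2] by simp

lemma jacobian_norm: "(nrm (jacobian \<Omega> v))\<^sup>2 = (\<Sum>i\<in>UNIV. \<Sum>j\<in>UNIV. (nrm (pderiv_at j (\<lambda>x. v x $ i)))\<^sup>2)"
proof -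
  have "nrm (jacobian \<Omega> v) = nrm (pjac v)"
    by (rule L2_norm_cong_AE[OF \<Omega>_sets pjac_L2[OF V_comp(3)] jacobian_AE[OF V_comp(3)]])
  then show ?thesis using L2_norm_matrix_power2[OF pjac_L2[OF V_comp(3)]] by simp
qed

lemma jacobian_le: "nrm (jacobian \<Omega> v) \<le> Cg / h * nrm v"
proof (rule power2_le_imp_le)
  have "(nrm (jacobian \<Omega> v))\<^sup>2 \<le> (\<Sum>i\<in>UNIV. \<Sum>j\<in>(UNIV::'n set). (Ci / h * nrm (\<lambda>x. v x $ i))\<^sup>2)"
    unfolding jacobian_norm by (intro sum_mono power_mono inv V_comp) simp
  also have "\<dots> = real CARD('n) * (Ci / h)\<^sup>2 * (\<Sum>i\<in>UNIV. (nrm (\<lambda>x. v x $ i))\<^sup>2)"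
    unfolding power_mult_distrib by (simp add: sum_distrib_left mult.assoc)
  \<comment> \<open>The factor, the dimension, is rounded up to its square so that \<open>Cg\<close>
    serves Jacobian and divergence alike.\<close>
  also have "\<dots> \<le> (real CARD('n))\<^sup>2 * (Ci / h)\<^sup>2 * (nrm v)\<^sup>2"
    unfolding comp_norm_sum by (intro mult_right_mono) (auto simp: power2_eq_square)
  also have "\<dots> = (Cg / h * nrm v)\<^sup>2" by (simp add: Cg_def power_mult_distrib power_divide)
  finally show "(nrm (jacobian \<Omega> v))\<^sup>2 \<le> (Cg / h * nrm v)\<^sup>2" .
qed (use Cg h_pos in simp)

lemma jacobian_v_L2: "jacobian \<Omega> v \<in> L2 \<Omega>" by (rule jacobian_L2[OF V_comp(3)])

lemma symgrad_v_L2: "symgrad \<Omega> v \<in> L2 \<Omega>" by (rule symgrad_L2[OF V_comp(3)])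

lemma divergence_v_L2: "divergence \<Omega> v \<in> L2 \<Omega>" by (rule divergence_L2[OF V_comp(3)])

lemma symgrad_le_jacobian: "nrm (symgrad \<Omega> v) \<le> nrm (jacobian \<Omega> v)"
proof -
  have "norm (symgrad \<Omega> v x) \<le> norm (jacobian \<Omega> v x)" for x
    using norm_triangle_ineq[of "jacobian \<Omega> v x" "transpose (jacobian \<Omega> v x)"]
    by (simp add: symgrad_def norm_transpose)
  then have "nrm (symgrad \<Omega> v) \<le> 1 * nrm (jacobian \<Omega> v)"
    by (intro L2_norm_mono jacobian_v_L2 L2_measurable[OF symgrad_v_L2]) auto
  then show ?thesis by simp
qed

lemma symgrad_le: "nrm (symgrad \<Omega> v) \<le> Cg / h * nrm v"
  using symgrad_le_jacobian jacobian_le by linarith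

lemma comp_le: "nrm (\<lambda>x. v x $ i) \<le> nrm v"
  using L2_norm_mono[OF vL2 L2_measurable[OF L2_component[OF vL2]], of i 1]
  by (simp add: component_le_norm_cart)

lemma divergence_le: "nrm (divergence \<Omega> v) \<le> Cg / h * nrm v"
proof -
  have "nrm (divergence \<Omega> v) = nrm (\<lambda>x. \<Sum>i\<in>UNIV. pderiv_at i (\<lambda>y. v y $ i) x)"
    by (rule L2_norm_cong_AE[OF \<Omega>_sets L2_sum[OF pderiv_at_L2[OF V_comp(3)]] divergence_AE[OF V_comp(3)]])
  also have "\<dots> \<le> (\<Sum>i\<in>UNIV. nrm (\<lambda>x. pderiv_at i (\<lambda>y. v y $ i) x))"
    by (rule L2_norm_sum_le) (rule pderiv_at_L2[OF V_comp(3)])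
  also have "\<dots> \<le> (\<Sum>i\<in>(UNIV::'n set). Ci / h * nrm v)"
  proof (rule sum_mono)
    fix i
    have "nrm (pderiv_at i (\<lambda>y. v y $ i)) \<le> Ci / h * nrm (\<lambda>x. v x $ i)" by (rule inv[OF V_comp(1)])
    also have "\<dots> \<le> Ci / h * nrm v" using Ci h_pos by (intro mult_left_mono comp_le) simp
    finally show "nrm (\<lambda>x. pderiv_at i (\<lambda>y. v y $ i) x) \<le> Ci / h * nrm v" .
  qed
  finally show ?thesis by (simp add: Cg_def)
qed

text \<open>\<open>Linf_norm\<close> converts an extended real, which is meaningful only if that is
  finite. Continuity on the compact closure bounds it above, and the positive measure of the domain
  keeps it nonnegative.\<close>

lemma Linf_finite: "\<exists>B. esssup \<M> (\<lambda>x. ereal (norm (v x))) = ereal B \<and> 0 \<le> B"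
proof -
  have vm: "(\<lambda>x. ereal (norm (v x))) \<in> borel_measurable \<M>"
    using L2_measurable[OF vL2] by measurable
  have "continuous_on (closure \<Omega>) (\<lambda>x. \<chi> i. v x $ i)"
    using V_comp(1) by (intro continuous_on_vec_lambda) (simp add: Sh_def)
  then have "continuous_on (closure \<Omega>) v" by simp
  then have "bounded (v ` closure \<Omega>)" using bd by (intro compact_imp_bounded compact_continuous_image) auto
  then obtain C where C: "\<And>x. x \<in> closure \<Omega> \<Longrightarrow> norm (v x) \<le> C" by (auto simp: bounded_iff)
  then have up: "esssup \<M> (\<lambda>x. ereal (norm (v x))) \<le> ereal C"
    by (intro esssup_I vm AE_closure) auto
  have "emeasure \<M> (space \<M>) \<noteq> 0"
  proof
    assume "emeasure \<M> (space \<M>) = 0"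
    then have "\<Omega> \<in> null_sets lebesgue" by (intro null_setsI) (auto simp: emeasure_restrict_space)
    then show False using open_not_negligible[OF op ne] by (simp add: negligible_iff_null_sets)
  qed
  then have "esssup \<M> (\<lambda>x. ereal 0) = ereal 0" by (rule esssup_const)
  moreover have "esssup \<M> (\<lambda>x. ereal 0) \<le> esssup \<M> (\<lambda>x. ereal (norm (v x)))"
    by (rule esssup_mono) auto
  ultimately have "ereal 0 \<le> esssup \<M> (\<lambda>x. ereal (norm (v x)))" by simp
  with up show ?thesis by (cases "esssup \<M> (\<lambda>x. ereal (norm (v x)))") auto
qed

lemma Linf_nonneg: "0 \<le> Linf_norm \<Omega> v"
  using Linf_finite by (auto simp: Linf_norm_def)

lemma Linf_AE: "AE x in \<M>. norm (v x) \<le> Linf_norm \<Omega> v"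
proof -
  obtain B where B: "esssup \<M> (\<lambda>x. ereal (norm (v x))) = ereal B" using Linf_finite by blast
  then show ?thesis using esssup_AE[of "\<lambda>x. ereal (norm (v x))" "\<M>"] by (simp add: Linf_norm_def)
qed

lemma Linf_le: "AE x in \<M>. norm (v x) \<le> B \<Longrightarrow> Linf_norm \<Omega> v \<le> B"
proof -
  assume B: "AE x in \<M>. norm (v x) \<le> B"
  have vm: "(\<lambda>x. ereal (norm (v x))) \<in> borel_measurable \<M>"
    using L2_measurable[OF vL2] by measurable
  obtain C where "esssup \<M> (\<lambda>x. ereal (norm (v x))) = ereal C" using Linf_finite by blast
  moreover have "esssup \<M> (\<lambda>x. ereal (norm (v x))) \<le> ereal B" using B by (intro esssup_I vm) simp
  ultimately show ?thesis by (simp add: Linf_norm_def)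
qed

text \<open>\<open>inv_sup\<close> asks for a bound at every point of the closure, whereas
  \<open>Linf_norm\<close> gives one almost everywhere; continuity closes the gap.\<close>

lemma divergence_sup: "AE x in \<M>. \<bar>divergence \<Omega> v x\<bar> \<le> Cg / h * Linf_norm \<Omega> v"
proof -
  have cl: "\<bar>v x $ i\<bar> \<le> Linf_norm \<Omega> v" if "x \<in> closure \<Omega>" for x i
  proof (rule AE_bound_closure[OF _ _ that])
    show "continuous_on (closure \<Omega>) (\<lambda>x. \<bar>v x $ i\<bar>)"
      using V_comp(1)[of i] by (intro continuous_on_rabs) (simp add: Sh_def)
    show "AE x in \<M>. \<bar>v x $ i\<bar> \<le> Linf_norm \<Omega> v"
      using Linf_AE by eventually_elim (use component_le_norm_cart order_trans in blast)
  qed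
  have "AE x in \<M>. \<forall>i. \<bar>pderiv_at i (\<lambda>y. v y $ i) x\<bar> \<le> Ci / h * Linf_norm \<Omega> v"
    using inv_sup[OF V_comp(1) cl] by (subst AE_all_countable) simp
  then show ?thesis using divergence_AE[OF V_comp(3)]
  proof eventually_elim
    case (elim x)
    have "\<bar>divergence \<Omega> v x\<bar> \<le> (\<Sum>i\<in>UNIV. \<bar>pderiv_at i (\<lambda>y. v y $ i) x\<bar>)" unfolding elim(2) by (rule sum_abs)
    also have "\<dots> \<le> (\<Sum>i\<in>(UNIV::'n set). Ci / h * Linf_norm \<Omega> v)" using elim(1) by (intro sum_mono) simp
    finally show ?case by (simp add: Cg_def)
  qed
qed

end

text \<open>\<open>u\<close> is measured in the supremum norm and \<open>v\<close> in
  \<open>L2\<close>: the Jacobian term contributes 1 and the half divergence 1/2. The quotient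
  \<open>Linf_norm \<Omega> u / h\<close> is, up to \<open>c2\<close>, a summand of the inverse of
  \<open>tau1\<close>.\<close>

lemma conv_le:
  assumes u: "u \<in> V" and v: "v \<in> V"
  shows "nrm (conv \<Omega> u v) \<le> 3/2 * Cg / h * Linf_norm \<Omega> u * nrm v"
proof -
  let ?L = "Linf_norm \<Omega> u"
  have L0: "0 \<le> ?L" by (rule Linf_nonneg[OF u])
  let ?A = "\<lambda>x. jacobian \<Omega> v x *v u x" and ?B = "\<lambda>x. (1/2 * divergence \<Omega> u x) *\<^sub>R v x"
  have mB: "?B \<in> borel_measurable \<M>"
    using L2_measurable[OF divergence_v_L2[OF u]] L2_measurable[OF vL2[OF v]] by measurable
  \<comment> \<open>Measurability of the matrix-vector product is read off from the whole convective
    term minus its divergence part.\<close>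
  have mA: "?A \<in> borel_measurable \<M>"
  proof -
    have "(\<lambda>x. conv \<Omega> u v x - ?B x) \<in> borel_measurable \<M>"
      by (intro borel_measurable_diff mB L2_measurable conv_V_L2 u v)
    then show ?thesis by (simp add: conv_def)
  qed
  have leA: "AE x in \<M>. norm (?A x) \<le> ?L * norm (jacobian \<Omega> v x)"
    using Linf_AE[OF u]
  proof eventually_elim
    case (elim x)
    have "norm (?A x) \<le> norm (jacobian \<Omega> v x) * norm (u x)" by (rule norm_matrix_vector_le)
    also have "\<dots> \<le> norm (jacobian \<Omega> v x) * ?L" using elim by (intro mult_left_mono) auto
    finally show ?case by (simp add: mult.commute)
  qed
  have leB: "AE x in \<M>. norm (?B x) \<le> (1/2 * (Cg / h * ?L)) * norm (v x)"
    using divergence_sup[OF u]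
  proof eventually_elim
    case (elim x)
    then have "1/2 * \<bar>divergence \<Omega> u x\<bar> * norm (v x) \<le> (1/2 * (Cg / h * ?L)) * norm (v x)" by (intro mult_right_mono) auto
    then show ?case by (simp add: abs_mult)
  qed
  have AL: "?A \<in> L2 \<Omega>" by (rule L2_dominated[OF jacobian_v_L2[OF v] mA leA])
  have BL: "?B \<in> L2 \<Omega>" by (rule L2_dominated[OF vL2[OF v] mB leB])
  have Chn: "0 \<le> Cg / h * ?L" using Cg h_pos L0 by simp
  have "nrm (conv \<Omega> u v) \<le> nrm ?A + nrm ?B"
    unfolding conv_def by (rule L2_norm_triangle[OF AL BL])
  also have "nrm ?A \<le> ?L * nrm (jacobian \<Omega> v)" by (rule L2_norm_mono[OF jacobian_v_L2[OF v] mA leA L0])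
  also have "\<dots> \<le> ?L * (Cg / h * nrm v)" by (intro mult_left_mono jacobian_le[OF v] L0)
  also have "nrm ?B \<le> (1/2 * (Cg / h * ?L)) * nrm v"
    by (rule L2_norm_mono[OF vL2[OF v] mB leB]) (use Chn in simp)
  finally show ?thesis by (simp add: algebra_simps)
qed

end

section \<open>Functionals on the space with zero boundary values\<close>

context mesh
begin

lemma H1_norm_le: "H1_norm \<Omega> w \<le> nrm w + nrm (grad \<Omega> w)"
  unfolding H1_norm_def by (rule sqrt_sum_squares_le_sum) auto

lemma H1_norm_nonneg: "0 \<le> H1_norm \<Omega> w"
  by (simp add: H1_norm_def)

text \<open>The summand \<open>0 * w x\<close> gives the argument the shape of the linearity law in
  \<open>Hm1\<close>.\<close>

lemma H1_norm_cmult: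
  assumes w: "pw_C1 \<Omega> \<T> w"
  shows "H1_norm \<Omega> (\<lambda>x. a * w x + 0 * w x) = \<bar>a\<bar> * H1_norm \<Omega> w"
proof -
  have "AE x in \<M>. grad \<Omega> (\<lambda>x. a * w x) x = (\<Sum>j\<in>{0::nat}. a *\<^sub>R grad \<Omega> w x)"
    by (rule grad_lincomb_AE[OF op bd, of "{0::nat}" "\<lambda>_. w" "\<lambda>_. pgrad w"])
      (auto intro: pw_C1_L2 pw_C1_wgrad w)
  then have "AE x in \<M>. grad \<Omega> (\<lambda>x. a * w x) x = a *\<^sub>R grad \<Omega> w x" by simp
  then have "nrm (grad \<Omega> (\<lambda>x. a * w x)) = nrm (\<lambda>x. a *\<^sub>R grad \<Omega> w x)"
    by (rule L2_norm_cong_AE[OF \<Omega>_sets L2_scaleR[OF grad_L2[OF w]]])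
  then have g: "nrm (grad \<Omega> (\<lambda>x. a * w x)) = \<bar>a\<bar> * nrm (grad \<Omega> w)"
    by (simp add: L2_norm_scaleR)
  have v: "nrm (\<lambda>x. a * w x) = \<bar>a\<bar> * nrm w"
    using L2_norm_scaleR[of \<Omega> a w] by simp
  have "H1_norm \<Omega> (\<lambda>x. a * w x) = sqrt (a\<^sup>2 * ((nrm w)\<^sup>2 + (nrm (grad \<Omega> w))\<^sup>2))"
    unfolding H1_norm_def g v by (simp add: power_mult_distrib distrib_left)
  then show ?thesis by (simp add: H1_norm_def real_sqrt_mult)
qed

text \<open>Boundedness of the functional makes the supremum in \<open>Hm1_norm\<close> a genuine
  one, and scaling to the unit ball gives the estimate. Where \<open>H1_norm\<close> is zero and
  scaling is impossible, boundedness is used once more.\<close>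

lemma Hm1_bound:
  assumes l: "l \<in> Hm1 \<Omega>"
  shows Hm1_norm_nonneg: "0 \<le> Hm1_norm \<Omega> l"
    and "w \<in> H10 \<Omega> \<Longrightarrow> pw_C1 \<Omega> \<T> w \<Longrightarrow> \<bar>l w\<bar> \<le> Hm1_norm \<Omega> l * H1_norm \<Omega> w"
proof -
  let ?S = "{v \<in> H10 \<Omega>. H1_norm \<Omega> v \<le> 1}"
  obtain B where B': "\<forall>v\<in>H10 \<Omega>. \<bar>l v\<bar> \<le> B * H1_norm \<Omega> v"
    using l unfolding Hm1_def by (elim CollectE conjE exE)
  have B: "\<bar>l v\<bar> \<le> B * H1_norm \<Omega> v" if "v \<in> H10 \<Omega>" for v by (rule bspec[OF B' that])
  have lin: "l (\<lambda>x. a * v x + b * w x) = a * l v + b * l w" if "v \<in> H10 \<Omega>" "w \<in> H10 \<Omega>" for a b v w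
    using l that by (auto simp: Hm1_def)
  have bdd: "bdd_above ((\<lambda>v. \<bar>l v\<bar>) ` ?S)"
  proof (rule bdd_aboveI)
    fix y assume "y \<in> (\<lambda>v. \<bar>l v\<bar>) ` ?S"
    then obtain v where v: "v \<in> H10 \<Omega>" "H1_norm \<Omega> v \<le> 1" "y = \<bar>l v\<bar>" by auto
    have "y \<le> B * H1_norm \<Omega> v" using B[OF v(1)] v(3) by simp
    also have "\<dots> \<le> \<bar>B\<bar> * H1_norm \<Omega> v" by (intro mult_right_mono H1_norm_nonneg) auto
    also have "\<dots> \<le> \<bar>B\<bar> * 1" by (intro mult_left_mono v) auto
    finally show "y \<le> \<bar>B\<bar>" by simp
  qed
  have up: "\<bar>l v\<bar> \<le> Hm1_norm \<Omega> l" if "v \<in> H10 \<Omega>" "H1_norm \<Omega> v \<le> 1" for v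
    unfolding Hm1_norm_def by (rule cSUP_upper[OF _ bdd]) (use that in simp)
  have "H1_norm \<Omega> (\<lambda>x. 0) = 0"
    using H1_norm_cmult[OF pw_C1_I[OF C1_const[of 0]], of 0] by simp
  then have "\<bar>l (\<lambda>x. 0)\<bar> \<le> Hm1_norm \<Omega> l" by (intro up zero_H10) simp
  then show "0 \<le> Hm1_norm \<Omega> l" by linarith
  assume w: "w \<in> H10 \<Omega>" "pw_C1 \<Omega> \<T> w"
  show "\<bar>l w\<bar> \<le> Hm1_norm \<Omega> l * H1_norm \<Omega> w"
  proof (cases "H1_norm \<Omega> w = 0")
    case True
    then show ?thesis using B[OF w(1)] by simp
  next
    case False
    define n where "n = H1_norm \<Omega> w"
    have n: "n > 0" using False H1_norm_nonneg[of w] by (simp add: n_def)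
    let ?w = "\<lambda>x. (1/n) * w x + 0 * w x"
    have "?w \<in> H10 \<Omega>" by (rule H10_lincomb[OF w w])
    moreover have "H1_norm \<Omega> ?w = 1" unfolding H1_norm_cmult[OF w(2)] using n by (simp add: n_def)
    ultimately have "\<bar>l ?w\<bar> \<le> Hm1_norm \<Omega> l" by (intro up) auto
    moreover have "l ?w = (1/n) * l w" using lin[OF w(1) w(1), of "1/n" 0] by simp
    ultimately show ?thesis using n by (simp add: n_def abs_mult field_simps)
  qed
qed

end

context vms
begin

text \<open>Cauchy-Schwarz over the components, once for the values and once for the
  gradients.\<close>

lemma force_bound:
  assumes l: "\<And>i. l i \<in> Hm1 \<Omega>" and v: "v \<in> V"
  shows "\<bar>\<Sum>i\<in>UNIV. l i (\<lambda>x. v x $ i)\<bar> \<le> sqrt (\<Sum>i\<in>UNIV. (Hm1_norm \<Omega> (l i))\<^sup>2) * (nrm v + nrm (jacobian \<Omega> v))"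
proof -
  let ?N = "\<lambda>i. Hm1_norm \<Omega> (l i)" and ?a = "\<lambda>i. nrm (\<lambda>x. v x $ i)" and ?b = "\<lambda>i. nrm (grad \<Omega> (\<lambda>x. v x $ i))"
  have N: "0 \<le> ?N i" for i by (rule Hm1_norm_nonneg[OF l])
  have b: "(\<Sum>i\<in>UNIV. (?b i)\<^sup>2) = (nrm (jacobian \<Omega> v))\<^sup>2"
    using L2_norm_vec_power2[OF jacobian_v_L2[OF v]] by (simp add: jacobian_def)
  have CS: "(\<Sum>i\<in>(UNIV::'n set). ?N i * g i) \<le> sqrt (\<Sum>i\<in>UNIV. (?N i)\<^sup>2) * sqrt (\<Sum>i\<in>UNIV. (g i)\<^sup>2)" for g
  proof -
    have "(\<Sum>i\<in>(UNIV::'n set). ?N i * g i) \<le> (\<Sum>i\<in>UNIV. \<bar>?N i\<bar> * \<bar>g i\<bar>)"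
      by (intro sum_mono) (simp only: abs_mult[symmetric] abs_ge_self)
    also have "\<dots> \<le> L2_set ?N UNIV * L2_set g UNIV" by (rule L2_set_mult_ineq)
    finally show ?thesis unfolding L2_set_def .
  qed
  have "\<bar>\<Sum>i\<in>UNIV. l i (\<lambda>x. v x $ i)\<bar> \<le> (\<Sum>i\<in>UNIV. \<bar>l i (\<lambda>x. v x $ i)\<bar>)" by (rule sum_abs)
  also have "\<dots> \<le> (\<Sum>i\<in>UNIV. ?N i * ?a i + ?N i * ?b i)"
  proof (rule sum_mono)
    fix i
    have "\<bar>l i (\<lambda>x. v x $ i)\<bar> \<le> ?N i * H1_norm \<Omega> (\<lambda>x. v x $ i)"
      by (rule Hm1_bound(2)[OF l V_comp(2)[OF v] V_comp(3)[OF v]])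
    also have "\<dots> \<le> ?N i * (?a i + ?b i)" by (intro mult_left_mono H1_norm_le N)
    finally show "\<bar>l i (\<lambda>x. v x $ i)\<bar> \<le> ?N i * ?a i + ?N i * ?b i" by (simp add: distrib_left)
  qed
  also have "\<dots> = (\<Sum>i\<in>UNIV. ?N i * ?a i) + (\<Sum>i\<in>UNIV. ?N i * ?b i)" by (rule sum.distrib)
  also have "\<dots> \<le> sqrt (\<Sum>i\<in>UNIV. (?N i)\<^sup>2) * sqrt (\<Sum>i\<in>UNIV. (?a i)\<^sup>2) + sqrt (\<Sum>i\<in>UNIV. (?N i)\<^sup>2) * sqrt (\<Sum>i\<in>UNIV. (?b i)\<^sup>2)"
    by (intro add_mono CS)
  also have "\<dots> = sqrt (\<Sum>i\<in>UNIV. (?N i)\<^sup>2) * (nrm v + nrm (jacobian \<Omega> v))"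
    unfolding b comp_norm_sum[OF v] by (simp add: distrib_left)
  finally show ?thesis .
qed

lemma Poincare_V:
  assumes v: "v \<in> V" shows "nrm v \<le> 2 * R * nrm (jacobian \<Omega> v)"
proof (rule power2_le_imp_le)
  \<comment> \<open>A single coordinate direction is enough for Poincare's inequality.\<close>
  obtain j :: 'n where True by blast
  have "(nrm v)\<^sup>2 = (\<Sum>i\<in>UNIV. (nrm (\<lambda>x. v x $ i))\<^sup>2)" by (rule comp_norm_sum[OF v, symmetric])
  also have "\<dots> \<le> (\<Sum>i\<in>UNIV. (2 * R * nrm (pderiv_at j (\<lambda>x. v x $ i)))\<^sup>2)"
    by (intro sum_mono power_mono Poincare V_comp[OF v] R) auto
  also have "\<dots> = (2 * R)\<^sup>2 * (\<Sum>i\<in>UNIV. (nrm (pderiv_at j (\<lambda>x. v x $ i)))\<^sup>2)"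
    unfolding power_mult_distrib[of "2 * R"] by (rule sum_distrib_left[symmetric])
  also have "\<dots> \<le> (2 * R)\<^sup>2 * (nrm (jacobian \<Omega> v))\<^sup>2"
    unfolding jacobian_norm[OF v]
    by (intro mult_left_mono sum_mono member_le_sum) auto
  finally show "(nrm v)\<^sup>2 \<le> (2 * R * nrm (jacobian \<Omega> v))\<^sup>2" by (simp add: power_mult_distrib)
qed (use R in simp)

section \<open>Viscous stress, stabilisation and the energy at a fixed time\<close>

definition vstress :: "(real^'n \<Rightarrow> real^'n) \<Rightarrow> real^'n \<Rightarrow> real^'n^'n" where
  "vstress u = (\<lambda>x. (2 * \<mu> x (norm (symgrad \<Omega> u x))) *\<^sub>R symgrad \<Omega> u x)"

lemma mu_nonneg: "x \<in> closure \<Omega> \<Longrightarrow> t \<ge> 0 \<Longrightarrow> 0 \<le> \<mu> x t"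
  using mu_bd[of x t] mu_const by linarith

lemma mu_comp_measurable:
  assumes "g \<in> borel_measurable \<M>" "\<And>x. g x \<ge> 0"
  shows "(\<lambda>x. \<mu> x (g x)) \<in> borel_measurable \<M>"
proof (rule Caratheodory_measurable[OF mu_meas _ assms])
  show "\<bar>\<mu> x t - \<mu> x s\<bar> \<le> C\<mu> * \<bar>t - s\<bar>" if "x \<in> space \<M>" "s \<ge> 0" "t \<ge> 0" for x s t
    using that closure_subset[of \<Omega>] by (intro mu_lip) auto
qed auto

lemma vstress_measurable:
  assumes u: "u \<in> V" shows "vstress u \<in> borel_measurable \<M>"
proof -
  have m: "symgrad \<Omega> u \<in> borel_measurable \<M>" by (rule L2_measurable[OF symgrad_v_L2[OF u]])
  have "(\<lambda>x. \<mu> x (norm (symgrad \<Omega> u x))) \<in> borel_measurable \<M>"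
    using m by (intro mu_comp_measurable) auto
  with m show ?thesis unfolding vstress_def by measurable
qed

lemma vstress_le: "AE x in \<M>. norm (vstress u x) \<le> (2 * \<mu>0) * norm (symgrad \<Omega> u x)"
proof (rule AE_closure)
  fix x assume x: "x \<in> closure \<Omega>"
  have "\<bar>2 * \<mu> x (norm (symgrad \<Omega> u x))\<bar> \<le> 2 * \<mu>0"
    using mu_bd[OF x, of "norm (symgrad \<Omega> u x)"] mu_nonneg[OF x, of "norm (symgrad \<Omega> u x)"] by simp
  then show "norm (vstress u x) \<le> (2 * \<mu>0) * norm (symgrad \<Omega> u x)"
    unfolding vstress_def norm_scaleR by (rule mult_right_mono) simp
qed

lemma vstress_L2: "u \<in> V \<Longrightarrow> vstress u \<in> L2 \<Omega>"
  by (rule L2_dominated[OF symgrad_v_L2 vstress_measurable vstress_le])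

lemma vstress_norm: "u \<in> V \<Longrightarrow> nrm (vstress u) \<le> 2 * \<mu>0 * nrm (symgrad \<Omega> u)"
  using mu_const by (intro L2_norm_mono symgrad_v_L2 vstress_measurable vstress_le) auto

lemma vstress_coercive:
  assumes u: "u \<in> V"
  shows "2 * \<mu>inf * (nrm (symgrad \<Omega> u))\<^sup>2 \<le> ip (vstress u) (symgrad \<Omega> u)"
proof -
  have "2 * \<mu>inf * (nrm (symgrad \<Omega> u))\<^sup>2 = (\<integral>x. 2 * \<mu>inf * (symgrad \<Omega> u x \<bullet> symgrad \<Omega> u x) \<partial>\<M>)"
    by (simp add: L2_norm_power2 L2_inner_def)
  also have "\<dots> \<le> (\<integral>x. vstress u x \<bullet> symgrad \<Omega> u x \<partial>\<M>)"
  proof (rule integral_mono_AE)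
    show "integrable \<M> (\<lambda>x. 2 * \<mu>inf * (symgrad \<Omega> u x \<bullet> symgrad \<Omega> u x))"
      by (intro integrable_mult_right L2_inner_integrable symgrad_v_L2[OF u])
    show "integrable \<M> (\<lambda>x. vstress u x \<bullet> symgrad \<Omega> u x)"
      by (intro L2_inner_integrable symgrad_v_L2[OF u] vstress_L2[OF u])
    show "AE x in \<M>. 2 * \<mu>inf * (symgrad \<Omega> u x \<bullet> symgrad \<Omega> u x) \<le> vstress u x \<bullet> symgrad \<Omega> u x"
    proof (rule AE_closure)
      fix x assume x: "x \<in> closure \<Omega>"
      have "2 * \<mu>inf \<le> 2 * \<mu> x (norm (symgrad \<Omega> u x))" using mu_bd[OF x, of "norm (symgrad \<Omega> u x)"] by simp
      then show "2 * \<mu>inf * (symgrad \<Omega> u x \<bullet> symgrad \<Omega> u x) \<le> vstress u x \<bullet> symgrad \<Omega> u x"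
        unfolding vstress_def inner_scaleR_left by (rule mult_right_mono) simp
    qed
  qed
  finally show ?thesis by (simp add: L2_inner_def)
qed

text \<open>The inverse of \<open>tau1\<close>, written as a sum so that its terms can be compared
  one by one with those of the inverse of \<open>tau0\<close>.\<close>

definition s1 :: "(real^'n \<Rightarrow> real^'n) \<Rightarrow> real" where "s1 u = c1 * \<mu>c u / h\<^sup>2 + c2 * Linf_norm \<Omega> u / h"

abbreviation t2 :: "(real^'n \<Rightarrow> real^'n) \<Rightarrow> real" where "t2 u \<equiv> tau2 \<Omega> c1 c2 \<mu>c h u"

definition Pd :: "(real^'n \<Rightarrow> real^'n) \<Rightarrow> real^'n \<Rightarrow> real" where
  "Pd u = L2_perp \<Omega> (Sh \<Omega> k \<T>) (divergence \<Omega> u)"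

lemma s1_pos: "u \<in> V \<Longrightarrow> s1 u > 0"
  unfolding s1_def using c h_pos mc[of u] mu_const Linf_nonneg[of u]
  by (intro add_pos_nonneg divide_pos_pos mult_pos_pos divide_nonneg_pos mult_nonneg_nonneg) auto

lemma inverse_tau1: "inverse (tau1 \<Omega> c1 c2 \<mu>c h u) = s1 u"
  by (simp add: tau1_def s1_def)

lemma t2_eq: "t2 u = h\<^sup>2 * s1 u / c1"
  by (simp add: tau2_def tau1_def s1_def field_simps)

lemma t2_nonneg: "u \<in> V \<Longrightarrow> t2 u \<ge> 0"
  unfolding t2_eq using s1_pos[of u] c by simp

lemma Pd_L2: "u \<in> V \<Longrightarrow> Pd u \<in> L2 \<Omega>"
  using onb_Sh unfolding Pd_def by (elim exE) (rule L2_perp_L2[OF \<Omega>_sets _ divergence_v_L2])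

lemma Pd_div:
  assumes u: "u \<in> V" shows "ip (divergence \<Omega> u) (Pd u) = (nrm (Pd u))\<^sup>2"
proof -
  obtain m e where e: "L2_onb \<Omega> (Sh \<Omega> k \<T>) m e" using onb_Sh by (elim exE)
  let ?d = "divergence \<Omega> u" and ?P = "L2_proj \<Omega> (Sh \<Omega> k \<T>) (divergence \<Omega> u)"
  have d: "?d \<in> L2 \<Omega>" by (rule divergence_v_L2[OF u])
  have P: "?P \<in> Sh \<Omega> k \<T>" by (rule L2_proj_in[OF \<Omega>_sets e d])
  have PL: "?P \<in> L2 \<Omega>" using P Sh_L2 by blast
  have "ip (Pd u) (Pd u) = ip ?d (Pd u) - ip ?P (Pd u)"
    using L2_inner_diff_left[OF d PL Pd_L2[OF u]] by (simp add: Pd_def L2_perp_def)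
  moreover have "ip ?P (Pd u) = 0"
    using L2_perp_orth[OF \<Omega>_sets e d P] by (simp add: Pd_def L2_inner_commute)
  ultimately show ?thesis by (simp add: L2_norm_power2)
qed

lemma momentum_iff:
  "momentum_eq \<Omega> k \<T> \<mu> \<mu>c c1 c2 f t u u' p u1 v \<longleftrightarrow>
    ip u' v + ip (vstress u) (symgrad \<Omega> v) + ip (conv \<Omega> u u) v - ip p (divergence \<Omega> v)
     + t2 u * ip (divergence \<Omega> v) (Pd u) - ip (conv \<Omega> u v) u1 = (\<Sum>i\<in>UNIV. f i t (\<lambda>x. v x $ i))"
proof -
  have "ip (\<lambda>x. t2 u * divergence \<Omega> v x) (Pd u) = t2 u * ip (divergence \<Omega> v) (Pd u)"
    using L2_inner_scaleR_left[of \<Omega> "t2 u" "divergence \<Omega> v" "Pd u"] by simp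
  then show ?thesis by (simp add: momentum_eq_def vstress_def Pd_def conv_form_eq)
qed

text \<open>Coercivity yields \<open>2 * \<mu>inf\<close>; only one copy is kept here, the other
  absorbs the force.\<close>

definition Diss :: "(real^'n \<Rightarrow> real^'n) \<Rightarrow> (real^'n \<Rightarrow> real^'n) \<Rightarrow> (real^'n \<Rightarrow> real^'n) \<Rightarrow> real" where
  "Diss u u1 u2 = \<mu>inf * (nrm (symgrad \<Omega> u))\<^sup>2 + t2 u * (nrm (Pd u))\<^sup>2
     + s1 u * ((nrm u1)\<^sup>2 + (nrm u2)\<^sup>2)"

lemma Diss_parts:
  assumes u: "u \<in> V"
  shows "0 \<le> Diss u u1 u2" "\<mu>inf * (nrm (symgrad \<Omega> u))\<^sup>2 \<le> Diss u u1 u2" "t2 u * (nrm (Pd u))\<^sup>2 \<le> Diss u u1 u2"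
    "s1 u * (nrm u1)\<^sup>2 \<le> Diss u u1 u2" "s1 u * (nrm u2)\<^sup>2 \<le> Diss u u1 u2"
proof -
  have "0 \<le> \<mu>inf * (nrm (symgrad \<Omega> u))\<^sup>2" "0 \<le> t2 u * (nrm (Pd u))\<^sup>2"
    "0 \<le> s1 u * (nrm u1)\<^sup>2" "0 \<le> s1 u * (nrm u2)\<^sup>2"
    using mu_const t2_nonneg[OF u] s1_pos[OF u] by auto
  then show "0 \<le> Diss u u1 u2" "\<mu>inf * (nrm (symgrad \<Omega> u))\<^sup>2 \<le> Diss u u1 u2" "t2 u * (nrm (Pd u))\<^sup>2 \<le> Diss u u1 u2"
    "s1 u * (nrm u1)\<^sup>2 \<le> Diss u u1 u2" "s1 u * (nrm u2)\<^sup>2 \<le> Diss u u1 u2"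
    unfolding Diss_def distrib_left by linarith+
qed

text \<open>Poincare bounds value norm plus gradient norm by \<open>2 * R + 1\<close> times the
  gradient norm, Korn costs \<open>sqrt 2\<close>, and Young's inequality with weight
  \<open>\<mu>inf\<close> on the symmetric gradient leaves the factor
  \<open>1 / (2 * \<mu>inf)\<close>.\<close>

definition "Cf = (2 * R + 1)\<^sup>2 / (2 * \<mu>inf)"

text \<open>When the tested equations are added, the pressure terms cancel by the mass equation, the
  convective coupling of \<open>u\<close> and \<open>u1\<close> occurs once with each sign, and the
  convective form of \<open>u\<close> with itself vanishes. Only the force remains on the
  right.\<close>

lemma energy_static:
  assumes u: "u \<in> V" and p: "p \<in> Sh \<Omega> k \<T>" and l: "\<And>i. f i t \<in> Hm1 \<Omega>"
    and mom: "momentum_eq \<Omega> k \<T> \<mu> \<mu>c c1 c2 f t u u' p u1 u"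
    and mass: "ip p (divergence \<Omega> u) - ip (grad \<Omega> p) u2 = 0"
    and sub1: "ip u1' u1 + s1 u * ip u1 u1 + ip (conv \<Omega> u u) u1 = 0"
    and sub2: "ip u2' u2 + s1 u * ip u2 u2 + ip (grad \<Omega> p) u2 = 0"
  shows "ip u' u + ip u1' u1 + ip u2' u2 + Diss u u1 u2 \<le> Cf * (\<Sum>i\<in>UNIV. (Hm1_norm \<Omega> (f i t))\<^sup>2)"
proof -
  let ?F = "\<Sum>i\<in>UNIV. (Hm1_norm \<Omega> (f i t))\<^sup>2" and ?s = "nrm (symgrad \<Omega> u)" and ?J = "nrm (jacobian \<Omega> u)"
  have F: "0 \<le> ?F" by (intro sum_nonneg) auto
  have skew: "ip (conv \<Omega> u u) u = 0" using conv_form_skew[OF Vh_pwH10[OF u]] by (simp add: conv_form_eq)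
  have e: "ip u' u + ip u1' u1 + ip u2' u2 + ip (vstress u) (symgrad \<Omega> u)
      + t2 u * (nrm (Pd u))\<^sup>2 + s1 u * ((nrm u1)\<^sup>2 + (nrm u2)\<^sup>2) = (\<Sum>i\<in>UNIV. f i t (\<lambda>x. u x $ i))"
    using mom mass sub1 sub2 skew unfolding momentum_iff Pd_div[OF u] by (simp add: L2_norm_power2 distrib_left)
  have J: "?J \<le> sqrt 2 * ?s"
    using real_le_rsqrt[OF Korn[OF Vh_pwH10[OF u]]] by (simp add: real_sqrt_mult)
  have "(\<Sum>i\<in>UNIV. f i t (\<lambda>x. u x $ i)) \<le> sqrt ?F * (nrm u + ?J)"
    using force_bound[of "\<lambda>i. f i t", OF l u] by linarith
  also have "\<dots> \<le> sqrt ?F * ((2 * R + 1) * (sqrt 2 * ?s))"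
  proof (rule mult_left_mono)
    have "nrm u + ?J \<le> (2 * R + 1) * ?J" using Poincare_V[OF u] by (simp add: distrib_right)
    also have "\<dots> \<le> (2 * R + 1) * (sqrt 2 * ?s)" using R(1) by (intro mult_left_mono J) simp
    finally show "nrm u + ?J \<le> (2 * R + 1) * (sqrt 2 * ?s)" .
  qed (simp add: F)
  also have "\<dots> \<le> Cf * ?F + \<mu>inf * ?s\<^sup>2"
  proof -
    define a where "a = sqrt ?F * (2 * R + 1)"
    have a2: "a\<^sup>2 = ?F * (2 * R + 1)\<^sup>2" unfolding a_def using F by (simp add: power_mult_distrib)
    have "0 \<le> (a - sqrt 2 * \<mu>inf * ?s)\<^sup>2" by simp
    then have "2 * (a * (sqrt 2 * \<mu>inf * ?s)) \<le> a\<^sup>2 + 2 * \<mu>inf\<^sup>2 * ?s\<^sup>2"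
      by (simp add: power2_diff power_mult_distrib)
    then have "2 * \<mu>inf * (a * (sqrt 2 * ?s)) \<le> 2 * \<mu>inf * (a\<^sup>2 / (2 * \<mu>inf) + \<mu>inf * ?s\<^sup>2)"
      using mu_const by (simp add: algebra_simps power2_eq_square)
    then have "a * (sqrt 2 * ?s) \<le> a\<^sup>2 / (2 * \<mu>inf) + \<mu>inf * ?s\<^sup>2"
      using mu_const by (simp add: mult_le_cancel_left_pos)
    then show ?thesis unfolding a2 by (simp add: a_def Cf_def mult_ac)
  qed
  finally have "(\<Sum>i\<in>UNIV. f i t (\<lambda>x. u x $ i)) \<le> Cf * ?F + \<mu>inf * ?s\<^sup>2" .
  then show ?thesis using e vstress_coercive[OF u] unfolding Diss_def by linarith
qed

text \<open>What the momentum equation leaves of the residual on \<open>V\<close> besides the time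
  derivative: stress, grad-div term, coupling to the subscale and force.\<close>

definition X :: "('n \<Rightarrow> (real^'n \<Rightarrow> real) \<Rightarrow> real) \<Rightarrow> (real^'n \<Rightarrow> real^'n) \<Rightarrow> (real^'n \<Rightarrow> real^'n) \<Rightarrow> (real^'n \<Rightarrow> real^'n) \<Rightarrow> real" where
  "X l u u1 v = - ip (vstress u) (symgrad \<Omega> v) - t2 u * ip (divergence \<Omega> v) (Pd u)
     + ip (conv \<Omega> u v) u1 + (\<Sum>i\<in>UNIV. l i (\<lambda>x. v x $ i))"

lemma residual_V:
  assumes u: "u \<in> V" and p: "p \<in> Sh \<Omega> k \<T>" and v: "v \<in> V"
    and mom: "momentum_eq \<Omega> k \<T> \<mu> \<mu>c c1 c2 f t u u' p u1 v"
  shows "ip (\<lambda>x. grad \<Omega> p x + conv \<Omega> u u x) v = - ip u' v + X (\<lambda>i. f i t) u u1 v"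
proof -
  have "ip (\<lambda>x. grad \<Omega> p x + conv \<Omega> u u x) v = ip (grad \<Omega> p) v + ip (conv \<Omega> u u) v"
    by (rule L2_inner_add_left[OF grad_Sh_L2[OF p] conv_V_L2[OF u u] vL2[OF v]])
  moreover have "ip (grad \<Omega> p) v = - ip p (divergence \<Omega> v)"
    using pressure_ibp[OF Sh_pw_C1[OF p] Vh_pwH10[OF v]] by simp
  ultimately show ?thesis using mom unfolding momentum_iff X_def by linarith
qed

text \<open>Bound of \<open>sqrt \<tau> / h\<close> under
  \<open>c1 * \<mu>0 * \<tau> \<le> h^2\<close>; it pays for the negative power of \<open>h\<close>
  from an inverse estimate.\<close>

definition "CQ = 1 / sqrt (c1 * \<mu>0)"
text \<open>One summand for each term of \<open>X\<close>, in the order stress, grad-div, coupling,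
  force; \<open>dm\<close> stands for an upper bound of the mesh size.\<close>

definition "C2 dm = 2 * \<mu>0 * Cg * CQ / sqrt \<mu>inf + Cg / sqrt c1 + 3 * Cg / (2 * c2) + CQ * (dm + Cg)"

lemma mult_mono3: "0 \<le> a \<Longrightarrow> 0 \<le> b \<Longrightarrow> a \<le> a' \<Longrightarrow> b \<le> b' \<Longrightarrow> a * b \<le> a' * (b'::real)"
  by (intro mult_mono) auto

text \<open>Of the two factors \<open>sqrt (s1 u)\<close>, one is compensated by
  \<open>sqrt \<tau>\<close> and the other by the dissipation.\<close>

lemma tau0_s1:
  assumes "u \<in> V" "0 \<le> \<tau>" "\<tau> * s1 u \<le> 1" "0 \<le> y" "s1 u * y\<^sup>2 \<le> D"
  shows "sqrt \<tau> * (s1 u * y) \<le> sqrt D"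
proof -
  have s: "s1 u > 0" by (rule s1_pos[OF assms(1)])
  have 1: "sqrt \<tau> * sqrt (s1 u) \<le> 1" using assms(3) by (simp add: real_sqrt_mult[symmetric])
  have 2: "sqrt (s1 u) * y \<le> sqrt D"
    using real_sqrt_le_mono[OF assms(5)] assms(4) by (simp add: real_sqrt_mult)
  have "sqrt \<tau> * (s1 u * y) = (sqrt \<tau> * sqrt (s1 u)) * (sqrt (s1 u) * y)" using s by simp
  also have "\<dots> \<le> 1 * (sqrt (s1 u) * y)" using 1 s assms(4) by (intro mult_right_mono) auto
  also have "\<dots> \<le> sqrt D" using 2 by simp
  finally show ?thesis .
qed

text \<open>The bound is in terms of \<open>nrm v\<close> alone, while each term of \<open>X\<close>
  contains a derivative of \<open>v\<close> and loses a power of \<open>h\<close> to an inverse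
  estimate. The weight \<open>sqrt \<tau>\<close> regains it, in a different way for each
  term.\<close>

lemma X_bound:
  assumes u: "u \<in> V" and v: "v \<in> V" and u1: "u1 \<in> L2 \<Omega>" and l: "\<And>i. l i \<in> Hm1 \<Omega>"
    and \<tau>: "\<tau> > 0" "\<tau> * s1 u \<le> 1" "c1 * \<mu>0 * \<tau> \<le> h\<^sup>2" and dm: "h \<le> dm"
  shows "sqrt \<tau> * \<bar>X l u u1 v\<bar> \<le> C2 dm * (sqrt (Diss u u1 u2) + sqrt (\<Sum>i\<in>UNIV. (Hm1_norm \<Omega> (l i))\<^sup>2)) * nrm v"
proof -
  let ?D = "Diss u u1 u2" and ?F = "\<Sum>i\<in>UNIV. (Hm1_norm \<Omega> (l i))\<^sup>2" and ?n = "nrm v"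
  note D = Diss_parts[OF u, where ?u1.0=u1 and ?u2.0=u2]
  have F: "0 \<le> ?F" by (intro sum_nonneg) auto
  have mu0: "\<mu>0 > 0" using mu_const by linarith
  have q: "sqrt \<tau> / h \<le> CQ"
  proof -
    have "sqrt (c1 * \<mu>0) * sqrt \<tau> \<le> h" using real_sqrt_le_mono[OF \<tau>(3)] h_pos by (simp add: real_sqrt_mult)
    then show ?thesis using h_pos c mu0 by (simp add: CQ_def field_simps)
  qed
  have q0: "0 \<le> sqrt \<tau> / h" using \<tau> h_pos by simp
  have CQ0: "0 \<le> CQ" using q q0 by linarith
  have sD: "0 \<le> sqrt ?D" using D(1) by simp
  have sF: "0 \<le> sqrt ?F" using F by simp
  have ta: "sqrt \<tau> * \<bar>ip (vstress u) (symgrad \<Omega> v)\<bar> \<le> 2 * \<mu>0 * Cg * CQ / sqrt \<mu>inf * sqrt ?D * ?n"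
  proof -
    have s: "nrm (symgrad \<Omega> u) \<le> sqrt ?D / sqrt \<mu>inf"
      using real_sqrt_le_mono[OF D(2)] mu_const by (simp add: real_sqrt_mult field_simps)
    have "\<bar>ip (vstress u) (symgrad \<Omega> v)\<bar> \<le> nrm (vstress u) * nrm (symgrad \<Omega> v)"
      by (rule L2_Cauchy_Schwarz[OF vstress_L2[OF u] symgrad_v_L2[OF v]])
    also have "\<dots> \<le> (2 * \<mu>0 * (sqrt ?D / sqrt \<mu>inf)) * (Cg / h * ?n)"
    proof (rule mult_mono3)
      have "nrm (vstress u) \<le> 2 * \<mu>0 * nrm (symgrad \<Omega> u)" by (rule vstress_norm[OF u])
      also have "\<dots> \<le> 2 * \<mu>0 * (sqrt ?D / sqrt \<mu>inf)" using mu0 by (intro mult_left_mono s) simp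
      finally show "nrm (vstress u) \<le> 2 * \<mu>0 * (sqrt ?D / sqrt \<mu>inf)" .
      show "0 \<le> nrm (vstress u)" "0 \<le> nrm (symgrad \<Omega> v)" by simp_all
    qed (rule symgrad_le[OF v])
    finally have "sqrt \<tau> * \<bar>ip (vstress u) (symgrad \<Omega> v)\<bar> \<le> sqrt \<tau> * ((2 * \<mu>0 * (sqrt ?D / sqrt \<mu>inf)) * (Cg / h * ?n))"
      using \<tau> by (intro mult_left_mono) auto
    also have "\<dots> = (sqrt \<tau> / h) * (2 * \<mu>0 * (sqrt ?D / sqrt \<mu>inf) * Cg * ?n)" by (simp add: mult_ac)
    also have "\<dots> \<le> CQ * (2 * \<mu>0 * (sqrt ?D / sqrt \<mu>inf) * Cg * ?n)"
      using q mu0 sD Cg mu_const by (intro mult_right_mono mult_nonneg_nonneg divide_nonneg_nonneg) auto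
    finally show ?thesis by (simp add: mult_ac)
  qed
  \<comment> \<open>Grad-div: \<open>\<tau> * t2 u\<close> is at most \<open>h^2 / c1\<close>, so
    one factor \<open>sqrt (t2 u)\<close> compensates the inverse estimate and the other is part of
    the dissipation.\<close>
  have tb: "sqrt \<tau> * \<bar>t2 u * ip (divergence \<Omega> v) (Pd u)\<bar> \<le> Cg / sqrt c1 * sqrt ?D * ?n"
  proof -
    have t20: "0 \<le> t2 u" by (rule t2_nonneg[OF u])
    have p: "sqrt (t2 u) * nrm (Pd u) \<le> sqrt ?D"
      using real_sqrt_le_mono[OF D(3)] by (simp add: real_sqrt_mult)
    have "\<tau> * t2 u = (h\<^sup>2 / c1) * (\<tau> * s1 u)" by (simp add: t2_eq)
    also have "\<dots> \<le> (h\<^sup>2 / c1) * 1" using \<tau>(2) c by (intro mult_left_mono) auto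
    finally have "sqrt (\<tau> * t2 u) \<le> sqrt (h\<^sup>2 / c1)" by simp
    then have r: "sqrt \<tau> * sqrt (t2 u) / h \<le> 1 / sqrt c1"
      using h_pos c by (simp add: real_sqrt_mult real_sqrt_divide field_simps)
    have "\<bar>ip (divergence \<Omega> v) (Pd u)\<bar> \<le> nrm (divergence \<Omega> v) * nrm (Pd u)"
      by (rule L2_Cauchy_Schwarz[OF divergence_v_L2[OF v] Pd_L2[OF u]])
    also have "\<dots> \<le> (Cg / h * ?n) * nrm (Pd u)" by (intro mult_right_mono divergence_le[OF v]) simp
    finally have "t2 u * \<bar>ip (divergence \<Omega> v) (Pd u)\<bar> \<le> t2 u * ((Cg / h * ?n) * nrm (Pd u))"
      by (rule mult_left_mono[OF _ t20])
    then have "sqrt \<tau> * \<bar>t2 u * ip (divergence \<Omega> v) (Pd u)\<bar> \<le> sqrt \<tau> * (t2 u * ((Cg / h * ?n) * nrm (Pd u)))"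
      using \<tau> t20 by (intro mult_left_mono) (auto simp: abs_mult)
    also have "\<dots> = (sqrt \<tau> * sqrt (t2 u) / h) * (sqrt (t2 u) * nrm (Pd u)) * (Cg * ?n)"
      using t20 by (simp add: real_sqrt_mult_self)
    also have "\<dots> \<le> (1 / sqrt c1) * sqrt ?D * (Cg * ?n)"
      using r p \<tau> t20 h_pos c Cg by (intro mult_right_mono mult_mono3) auto
    finally show ?thesis by (simp add: mult_ac)
  qed
  \<comment> \<open>Coupling: the convective bound is a multiple of a summand of \<open>s1\<close>,
    after which \<open>tau0_s1\<close> applies to \<open>u1\<close>.\<close>
  have tc: "sqrt \<tau> * \<bar>ip (conv \<Omega> u v) u1\<bar> \<le> 3 * Cg / (2 * c2) * sqrt ?D * ?n"
  proof -
    have L: "c2 * (Linf_norm \<Omega> u / h) \<le> s1 u"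
      unfolding s1_def using c mc[OF u] mu_const by (simp add: divide_nonneg_nonneg)
    have "\<bar>ip (conv \<Omega> u v) u1\<bar> \<le> nrm (conv \<Omega> u v) * nrm u1"
      by (rule L2_Cauchy_Schwarz[OF conv_V_L2[OF u v] u1])
    also have "\<dots> \<le> (3/2 * Cg / h * Linf_norm \<Omega> u * ?n) * nrm u1" by (intro mult_right_mono conv_le[OF u v]) simp
    also have "\<dots> = (c2 * (Linf_norm \<Omega> u / h)) * (3 * Cg / (2 * c2) * ?n * nrm u1)" using c by (simp add: field_simps)
    also have "\<dots> \<le> s1 u * (3 * Cg / (2 * c2) * ?n * nrm u1)"
      using c Cg by (intro mult_right_mono[OF L]) auto
    finally have "sqrt \<tau> * \<bar>ip (conv \<Omega> u v) u1\<bar> \<le> sqrt \<tau> * (s1 u * (3 * Cg / (2 * c2) * ?n * nrm u1))"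
      using \<tau> by (intro mult_left_mono) auto
    also have "\<dots> = (sqrt \<tau> * (s1 u * nrm u1)) * (3 * Cg / (2 * c2) * ?n)" by simp
    also have "\<dots> \<le> sqrt ?D * (3 * Cg / (2 * c2) * ?n)"
      using c Cg \<tau> by (intro mult_right_mono tau0_s1[OF u _ \<tau>(2) _ D(4)]) auto
    finally show ?thesis by (simp add: mult_ac)
  qed
  \<comment> \<open>Force: after factoring out \<open>1 / h\<close>, the value norm of
    \<open>v\<close> carries \<open>h\<close>, which is at most \<open>dm\<close>, and the gradient
    norm carries \<open>Cg\<close>.\<close>
  have td: "sqrt \<tau> * \<bar>\<Sum>i\<in>UNIV. l i (\<lambda>x. v x $ i)\<bar> \<le> CQ * (dm + Cg) * sqrt ?F * ?n"
  proof -
    have "\<bar>\<Sum>i\<in>UNIV. l i (\<lambda>x. v x $ i)\<bar> \<le> sqrt ?F * (?n + nrm (jacobian \<Omega> v))" by (rule force_bound[OF l v])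
    also have "\<dots> \<le> sqrt ?F * (?n + Cg / h * ?n)" using jacobian_le[OF v] sF by (intro mult_left_mono) auto
    finally have "sqrt \<tau> * \<bar>\<Sum>i\<in>UNIV. l i (\<lambda>x. v x $ i)\<bar> \<le> sqrt \<tau> * (sqrt ?F * (?n + Cg / h * ?n))"
      using \<tau> by (intro mult_left_mono) auto
    also have "\<dots> = (sqrt \<tau> / h) * (h + Cg) * (sqrt ?F * ?n)" using h_pos by (simp add: field_simps)
    also have "\<dots> \<le> CQ * (dm + Cg) * (sqrt ?F * ?n)"
      using q q0 dm Cg h_pos sF by (intro mult_right_mono mult_mono3 mult_nonneg_nonneg) auto
    finally show ?thesis by (simp add: mult_ac)
  qed
  have nn: "0 \<le> 2 * \<mu>0 * Cg * CQ / sqrt \<mu>inf" "0 \<le> Cg / sqrt c1" "0 \<le> 3 * Cg / (2 * c2)" "0 \<le> CQ * (dm + Cg)"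
    using mu0 Cg CQ0 c mu_const dm h_pos by auto
  have "sqrt \<tau> * \<bar>X l u u1 v\<bar> \<le> sqrt \<tau> * (\<bar>ip (vstress u) (symgrad \<Omega> v)\<bar> + \<bar>t2 u * ip (divergence \<Omega> v) (Pd u)\<bar>
      + \<bar>ip (conv \<Omega> u v) u1\<bar> + \<bar>\<Sum>i\<in>UNIV. l i (\<lambda>x. v x $ i)\<bar>)"
    unfolding X_def using \<tau> by (intro mult_left_mono) auto
  also have "\<dots> \<le> (2 * \<mu>0 * Cg * CQ / sqrt \<mu>inf + Cg / sqrt c1 + 3 * Cg / (2 * c2)) * (sqrt ?D * ?n) + CQ * (dm + Cg) * (sqrt ?F * ?n)"
    using ta tb tc td by (simp add: distrib_left distrib_right mult.assoc)
  also have "\<dots> \<le> C2 dm * (sqrt ?D * ?n) + C2 dm * (sqrt ?F * ?n)"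
  proof (intro add_mono mult_right_mono)
    show "2 * \<mu>0 * Cg * CQ / sqrt \<mu>inf + Cg / sqrt c1 + 3 * Cg / (2 * c2) \<le> C2 dm" "CQ * (dm + Cg) \<le> C2 dm"
      unfolding C2_def using nn by linarith+
    show "0 \<le> sqrt ?D * ?n" "0 \<le> sqrt ?F * ?n" using sD sF by (auto intro: mult_nonneg_nonneg)
  qed
  finally show ?thesis by (simp add: algebra_simps)
qed

end

section \<open>Absolutely continuous functions of time\<close>

lemma Ioo_sets [simp]: "{a<..<b::real} \<in> sets lebesgue"
  by (rule fmeasurableD) simp

lemma integrable_lebesgue_on_AE:
  fixes v w :: "'a::euclidean_space \<Rightarrow> real"
  assumes S: "S \<in> sets lebesgue" and v: "integrable (lebesgue_on S) v" and eq: "AE x in lebesgue_on S. v x = w x"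
  shows "integrable (lebesgue_on S) w"
  using integrable_cong_AE_imp[OF v borel_measurable_lebesgue_on_AE[OF S borel_measurable_integrable[OF v] eq]] eq
  by (simp add: eq_commute)

lemma AE_lebesgue_on_subset:
  assumes "S \<subseteq> S'" "S \<in> sets lebesgue" "S' \<in> sets lebesgue" "AE x in lebesgue_on S'. P x"
  shows "AE x in lebesgue_on S. P x"
  using assms by (subst (asm) AE_restrict_space_iff, simp, subst AE_restrict_space_iff, simp) (auto elim: eventually_mono)

lemma integrable_lebesgue_on_subset:
  fixes v :: "'a::euclidean_space \<Rightarrow> real"
  assumes sub: "S \<subseteq> S'" and S: "S \<in> sets lebesgue" and S': "S' \<in> sets lebesgue" and v: "integrable (lebesgue_on S') v"
  shows "integrable (lebesgue_on S) v"
proof -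
  have "integrable lebesgue (\<lambda>x. indicator S' x *\<^sub>R v x)" using v S' by (simp add: integrable_restrict_space)
  then have "integrable lebesgue (\<lambda>x. indicator S x *\<^sub>R (indicator S' x *\<^sub>R v x))" by (rule integrable_mult_indicator[OF S])
  moreover have "(\<lambda>x. indicator S x *\<^sub>R (indicator S' x *\<^sub>R v x)) = (\<lambda>x. indicator S x *\<^sub>R v x)"
    using sub by (auto simp: indicator_def fun_eq_iff)
  ultimately have "integrable lebesgue (\<lambda>x. indicator S x *\<^sub>R v x)" by simp
  then show ?thesis using S by (simp add: integrable_restrict_space)
qed

text \<open>Absolute continuity in the form of an integral from 0, which is what
  \<open>has_time_deriv\<close> provides after pairing with a fixed function of space.\<close>

definition acd :: "real \<Rightarrow> (real \<Rightarrow> real) \<Rightarrow> (real \<Rightarrow> real) \<Rightarrow> bool" where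
  "acd T a \<alpha> \<longleftrightarrow> integrable (lebesgue_on {0<..<T}) \<alpha> \<and> (\<forall>t\<in>{0..T}. a t = a 0 + (\<integral>s. \<alpha> s \<partial>lebesgue_on {0<..<t}))"

lemma acd_integrable: "acd T a \<alpha> \<Longrightarrow> t \<le> T \<Longrightarrow> integrable (lebesgue_on {0<..<t}) \<alpha>"
  by (rule integrable_lebesgue_on_subset[of _ "{0<..<T}"]) (auto simp: acd_def)

lemma acd_eq: "acd T a \<alpha> \<Longrightarrow> t \<in> {0..T} \<Longrightarrow> a t = a 0 + (\<integral>s. \<alpha> s \<partial>lebesgue_on {0<..<t})"
  unfolding acd_def by blast

lemma acd_cong:
  assumes a: "acd T a \<alpha>" and ab: "\<And>t. t \<in> {0..T} \<Longrightarrow> a t = b t" and eq: "AE t in lebesgue_on {0<..<T}. \<alpha> t = \<beta> t"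
  shows "acd T b \<beta>"
  unfolding acd_def
proof (intro conjI ballI)
  show \<beta>: "integrable (lebesgue_on {0<..<T}) \<beta>"
    by (rule integrable_lebesgue_on_AE[OF _ _ eq]) (use a in \<open>auto simp: acd_def\<close>)
  fix t assume t: "t \<in> {0..T}"
  have "(\<integral>s. \<alpha> s \<partial>lebesgue_on {0<..<t}) = (\<integral>s. \<beta> s \<partial>lebesgue_on {0<..<t})"
  proof (rule integral_cong_AE)
    have sub: "{0<..<t} \<subseteq> {0<..<T}" using t by auto
    show "AE s in lebesgue_on {0<..<t}. \<alpha> s = \<beta> s" by (rule AE_lebesgue_on_subset[OF sub _ _ eq]) auto
    show "\<alpha> \<in> borel_measurable (lebesgue_on {0<..<t})"
      using acd_integrable[OF a, of t] t by (intro borel_measurable_integrable) auto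
    show "\<beta> \<in> borel_measurable (lebesgue_on {0<..<t})"
      by (intro borel_measurable_integrable integrable_lebesgue_on_subset[OF sub _ _ \<beta>]) auto
  qed
  then show "b t = b 0 + (\<integral>s. \<beta> s \<partial>lebesgue_on {0<..<t})" using acd_eq[OF a t] ab[of t] ab[of 0] t by auto
qed

text \<open>Continuity comes from the indefinite gauge integral, into which the Lebesgue integral
  over the open interval is converted.\<close>

lemma acd_continuous:
  assumes a: "acd T a \<alpha>" shows "continuous_on {0..T} a"
proof -
  have i: "\<alpha> integrable_on {0..T}"
    using integrable_on_lebesgue_on[of "{0<..<T}" \<alpha>] a has_integral_Icc_iff_Ioo[of \<alpha> _ 0 T]
    by (auto simp: acd_def integrable_on_def)
  have "continuous_on {0..T} (\<lambda>t. a 0 + integral {0..t} \<alpha>)"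
    by (intro continuous_intros indefinite_integral_continuous_1 i)
  moreover have "a 0 + integral {0..t} \<alpha> = a t" if t: "t \<in> {0..T}" for t
    using acd_eq[OF a t] lebesgue_integral_eq_integral[OF acd_integrable[OF a, of t]] t
    by (simp add: integral_open_interval_real)
  ultimately show ?thesis by (simp cong: continuous_on_cong_simp)
qed

lemma continuous_Ioo_measurable:
  fixes b :: "real \<Rightarrow> real"
  assumes "continuous_on {0..T} b" "t \<le> T"
  shows "b \<in> borel_measurable (lebesgue_on {0<..<t})"
  by (rule continuous_imp_measurable_on_sets_lebesgue[OF continuous_on_subset[OF assms(1)]]) (use assms(2) in auto)

lemma integrable_mult_continuous:
  fixes b \<alpha> :: "real \<Rightarrow> real"
  assumes b: "continuous_on {0..T} b" and t: "t \<le> T" and \<alpha>: "integrable (lebesgue_on {0<..<t}) \<alpha>"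
  shows "integrable (lebesgue_on {0<..<t}) (\<lambda>s. \<alpha> s * b s)"
proof -
  obtain B where B': "\<forall>s\<in>{0..T}. \<bar>b s\<bar> \<le> B"
    using compact_imp_bounded[OF compact_continuous_image[OF b]] by (auto simp: bounded_iff)
  have B: "\<bar>b s\<bar> \<le> B" if "s \<in> {0..T}" for s by (rule bspec[OF B' that])
  show ?thesis
  proof (rule Bochner_Integration.integrable_bound[OF integrable_mult_right[OF integrable_norm[OF \<alpha>], of B]])
    show "(\<lambda>s. \<alpha> s * b s) \<in> borel_measurable (lebesgue_on {0<..<t})"
      using borel_measurable_integrable[OF \<alpha>] continuous_Ioo_measurable[OF b t] by measurable
    show "AE s in lebesgue_on {0<..<t}. norm (\<alpha> s * b s) \<le> norm (B * norm (\<alpha> s))"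
    proof (rule AE_I2)
      fix s assume "s \<in> space (lebesgue_on {0<..<t})"
      then have "\<bar>b s\<bar> \<le> B" using t by (intro B) auto
      then have "\<bar>\<alpha> s\<bar> * \<bar>b s\<bar> \<le> \<bar>\<alpha> s\<bar> * \<bar>B\<bar>" by (intro mult_left_mono) auto
      then show "norm (\<alpha> s * b s) \<le> norm (B * norm (\<alpha> s))" by (simp add: abs_mult mult.commute)
    qed
  qed
qed

text \<open>Fubini on the square: the product is the double integral of
  \<open>\<alpha> s * \<beta> r\<close>, split along the diagonal into two triangles. It is the
  integrated product rule for merely integrable derivatives.\<close>

lemma integral_product_Ioo:
  fixes \<alpha> \<beta> :: "real \<Rightarrow> real"
  assumes \<alpha>: "integrable (lebesgue_on {0<..<t}) \<alpha>" and \<beta>: "integrable (lebesgue_on {0<..<t}) \<beta>" and t: "0 \<le> t"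
  shows "(\<integral>s. \<alpha> s \<partial>lebesgue_on {0<..<t}) * (\<integral>s. \<beta> s \<partial>lebesgue_on {0<..<t})
    = (\<integral>s. \<alpha> s * (\<integral>r. \<beta> r \<partial>lebesgue_on {0<..<s}) \<partial>lebesgue_on {0<..<t})
    + (\<integral>s. \<beta> s * (\<integral>r. \<alpha> r \<partial>lebesgue_on {0<..<s}) \<partial>lebesgue_on {0<..<t})"
proof -
  define M where "M = lebesgue_on {0<..<t}"
  note \<alpha>' = \<alpha>[folded M_def] and \<beta>' = \<beta>[folded M_def]
  have [measurable]: "\<alpha> \<in> borel_measurable M" "\<beta> \<in> borel_measurable M" using \<alpha>' \<beta>' by auto
  have id_M [measurable]: "(\<lambda>x. x) \<in> borel_measurable M" unfolding M_def
    by (intro measurable_restrict_space1) (simp add: measurable_completion)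
  interpret finite_measure M unfolding M_def by (rule finite_measure_lebesgue_on) simp
  interpret P: pair_sigma_finite M M by unfold_locales
  let ?A = "\<lambda>s. \<integral>r. \<alpha> r \<partial>lebesgue_on {0<..<s}" and ?B = "\<lambda>s. \<integral>r. \<beta> r \<partial>lebesgue_on {0<..<s}"
  let ?f = "\<lambda>(s, r). if s < r then \<alpha> s * \<beta> r else 0"
  \<comment> \<open>The inner integrals have a variable domain; truncating the integrand expresses
    them over the fixed space \<open>M\<close>.\<close>
  have low: "(\<integral>r. (if r < s then g r else 0) \<partial>M) = (\<integral>r. g r \<partial>lebesgue_on {0<..<s})" if s: "s \<in> {0<..<t}" for s and g :: "real \<Rightarrow> real"
  proof -
    have "(\<integral>r. (if r < s then g r else 0) \<partial>M) = (\<integral>r. (if r \<in> {0<..<s} then g r else 0) \<partial>M)"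
      by (rule Bochner_Integration.integral_cong) (auto simp: M_def)
    also have "\<dots> = (\<integral>r. g r \<partial>lebesgue_on {0<..<s})" unfolding M_def using s by (intro integral_restrict) auto
    finally show ?thesis .
  qed
  have fm: "?f \<in> borel_measurable (M \<Otimes>\<^sub>M M)" by measurable
  have int_if: "integrable M (\<lambda>r. if Q r then g r else 0)" if "integrable M g" "Measurable.pred M Q" for Q and g :: "real \<Rightarrow> real"
    by (rule Bochner_Integration.integrable_bound[OF that(1)]) (use that(2) borel_measurable_integrable[OF that(1)] in auto)
  have fi: "integrable (M \<Otimes>\<^sub>M M) ?f"
  proof (rule P.Fubini_integrable[OF fm])
    have i: "integrable M (\<lambda>r. if s < r then \<beta> r else 0)" for s by (rule int_if[OF \<beta>']) measurable
    show "AE s in M. integrable M (\<lambda>r. case (s, r) of (s, r) \<Rightarrow> if s < r then \<alpha> s * \<beta> r else 0)"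
    proof (rule AE_I2)
      fix s
      have "(\<lambda>r. case (s, r) of (s, r) \<Rightarrow> if s < r then \<alpha> s * \<beta> r else 0) = (\<lambda>r. \<alpha> s * (if s < r then \<beta> r else 0))" by auto
      then show "integrable M (\<lambda>r. case (s, r) of (s, r) \<Rightarrow> if s < r then \<alpha> s * \<beta> r else 0)"
        using integrable_mult_right[OF i, of "\<alpha> s" s] by simp
    qed
    show "integrable M (\<lambda>s. \<integral>r. norm (case (s, r) of (s, r) \<Rightarrow> if s < r then \<alpha> s * \<beta> r else 0) \<partial>M)"
    proof (rule Bochner_Integration.integrable_bound[OF integrable_mult_right[OF \<alpha>', of "\<integral>r. norm (\<beta> r) \<partial>M"]])
      show "(\<lambda>s. \<integral>r. norm (case (s, r) of (s, r) \<Rightarrow> if s < r then \<alpha> s * \<beta> r else 0) \<partial>M) \<in> borel_measurable M" by measurable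
      show "AE s in M. norm (\<integral>r. norm (case (s, r) of (s, r) \<Rightarrow> if s < r then \<alpha> s * \<beta> r else 0) \<partial>M) \<le> norm ((\<integral>r. norm (\<beta> r) \<partial>M) * \<alpha> s)"
      proof (rule AE_I2)
        fix s
        have e: "norm (case (s, r) of (s, r) \<Rightarrow> if s < r then \<alpha> s * \<beta> r else 0) = \<bar>\<alpha> s\<bar> * norm (if s < r then \<beta> r else 0)" for r
          by (simp add: abs_mult)
        have "(\<integral>r. norm (if s < r then \<beta> r else 0) \<partial>M) \<le> (\<integral>r. norm (\<beta> r) \<partial>M)"
          by (rule integral_mono[OF integrable_norm[OF i] integrable_norm[OF \<beta>']]) auto
        then have "\<bar>\<alpha> s\<bar> * (\<integral>r. norm (if s < r then \<beta> r else 0) \<partial>M) \<le> \<bar>\<alpha> s\<bar> * (\<integral>r. norm (\<beta> r) \<partial>M)"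
          by (rule mult_left_mono) simp
        then show "norm (\<integral>r. norm (case (s, r) of (s, r) \<Rightarrow> if s < r then \<alpha> s * \<beta> r else 0) \<partial>M) \<le> norm ((\<integral>r. norm (\<beta> r) \<partial>M) * \<alpha> s)"
          unfolding e by (simp add: abs_mult mult.commute)
      qed
    qed
  qed
  have sw: "(\<integral>s. (\<integral>r. ?f (s, r) \<partial>M) \<partial>M) = (\<integral>r. (\<integral>s. ?f (s, r) \<partial>M) \<partial>M)"
    using P.Fubini_integral[of "\<lambda>s r. ?f (s, r)"] fi by simp
  have U: "(\<integral>r. (\<integral>s. ?f (s, r) \<partial>M) \<partial>M) = (\<integral>s. \<beta> s * ?A s \<partial>M)"
  proof (rule Bochner_Integration.integral_cong[OF refl])
    fix r assume "r \<in> space M"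
    then have r: "r \<in> {0<..<t}" by (simp add: M_def)
    have "(\<integral>s. ?f (s, r) \<partial>M) = (\<integral>s. (if s < r then \<alpha> s else 0) * \<beta> r \<partial>M)"
      by (rule Bochner_Integration.integral_cong) auto
    then show "(\<integral>s. ?f (s, r) \<partial>M) = \<beta> r * ?A r" using low[OF r, of \<alpha>] by simp
  qed
  have L: "\<alpha> s * (\<integral>r. \<beta> r \<partial>M) = (\<integral>r. ?f (s, r) \<partial>M) + \<alpha> s * ?B s" if "s \<in> space M" for s
  proof -
    from that have s: "s \<in> {0<..<t}" by (simp add: M_def)
    have i1: "integrable M (\<lambda>r. if s < r then \<beta> r else 0)" and i2: "integrable M (\<lambda>r. if r < s then \<beta> r else 0)"
      by (rule int_if[OF \<beta>'], measurable)+
    \<comment> \<open>A diagonal point is a null set, so the two strict inequalities cover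
      everything.\<close>
    have "AE r in lebesgue. r \<noteq> s" by (simp add: AE_completion AE_lborel_singleton)
    then have "AE r in M. r \<noteq> s" unfolding M_def by (subst AE_restrict_space_iff) (auto elim: eventually_mono)
    then have "(\<integral>r. \<beta> r \<partial>M) = (\<integral>r. (if s < r then \<beta> r else 0) + (if r < s then \<beta> r else 0) \<partial>M)"
      by (intro integral_cong_AE) (auto elim: eventually_mono)
    also have "\<dots> = (\<integral>r. (if s < r then \<beta> r else 0) \<partial>M) + ?B s"
      using i1 i2 low[OF s, of \<beta>] by simp
    finally have "\<alpha> s * (\<integral>r. \<beta> r \<partial>M) = \<alpha> s * (\<integral>r. (if s < r then \<beta> r else 0) \<partial>M) + \<alpha> s * ?B s" by (simp add: distrib_left)
    also have "\<alpha> s * (\<integral>r. (if s < r then \<beta> r else 0) \<partial>M) = (\<integral>r. \<alpha> s * (if s < r then \<beta> r else 0) \<partial>M)" by simp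
    also have "\<dots> = (\<integral>r. ?f (s, r) \<partial>M)" by (rule Bochner_Integration.integral_cong) auto
    finally show ?thesis .
  qed
  have i1: "integrable M (\<lambda>s. \<integral>r. ?f (s, r) \<partial>M)" using P.integrable_fst'[OF fi] by simp
  have i2: "integrable M (\<lambda>s. \<alpha> s * ?B s)"
  proof -
    have "integrable M (\<lambda>s. \<alpha> s * (\<integral>r. \<beta> r \<partial>M) - (\<integral>r. ?f (s, r) \<partial>M))" using i1 \<alpha>' by simp
    then show ?thesis by (rule Bochner_Integration.integrable_cong[THEN iffD1, rotated 2]) (use L in auto)
  qed
  have "(\<integral>s. \<alpha> s \<partial>M) * (\<integral>r. \<beta> r \<partial>M) = (\<integral>s. \<alpha> s * (\<integral>r. \<beta> r \<partial>M) \<partial>M)" by simp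
  also have "\<dots> = (\<integral>s. (\<integral>r. ?f (s, r) \<partial>M) + \<alpha> s * ?B s \<partial>M)" by (rule Bochner_Integration.integral_cong[OF refl L])
  also have "\<dots> = (\<integral>s. \<beta> s * ?A s \<partial>M) + (\<integral>s. \<alpha> s * ?B s \<partial>M)"
    unfolding Bochner_Integration.integral_add[OF i1 i2] sw U ..
  finally show ?thesis by (simp add: M_def add.commute)
qed

text \<open>\<open>integral_product_Ioo\<close> handles the parts that vanish at 0; the initial
  values \<open>a 0\<close> and \<open>b 0\<close> are split off first.\<close>

lemma acd_mult:
  assumes a: "acd T a \<alpha>" and b: "acd T b \<beta>"
  shows "acd T (\<lambda>t. a t * b t) (\<lambda>t. \<alpha> t * b t + \<beta> t * a t)"
  unfolding acd_def
proof (intro conjI ballI)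
  have i: "integrable (lebesgue_on {0<..<t}) (\<lambda>s. \<alpha> s * b s)" "integrable (lebesgue_on {0<..<t}) (\<lambda>s. \<beta> s * a s)" if "t \<le> T" for t
    using acd_continuous[OF a] acd_continuous[OF b] that acd_integrable[OF a that] acd_integrable[OF b that]
    by (auto intro: integrable_mult_continuous)
  then show "integrable (lebesgue_on {0<..<T}) (\<lambda>t. \<alpha> t * b t + \<beta> t * a t)" by simp
  fix t assume t: "t \<in> {0..T}"
  let ?M = "lebesgue_on {0<..<t}"
  let ?A = "\<lambda>s. \<integral>r. \<alpha> r \<partial>lebesgue_on {0<..<s}" and ?B = "\<lambda>s. \<integral>r. \<beta> r \<partial>lebesgue_on {0<..<s}"
  have tT: "t \<le> T" using t by simp
  have al: "integrable ?M \<alpha>" and be: "integrable ?M \<beta>" by (rule acd_integrable[OF a tT], rule acd_integrable[OF b tT])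
  have e: "\<alpha> s * ?B s = \<alpha> s * b s - \<alpha> s * b 0" "\<beta> s * ?A s = \<beta> s * a s - \<beta> s * a 0" if "s \<in> space ?M" for s
    using acd_eq[OF a, of s] acd_eq[OF b, of s] that t by (auto simp: algebra_simps)
  have 1: "(\<integral>s. \<alpha> s * ?B s \<partial>?M) = (\<integral>s. \<alpha> s * b s \<partial>?M) - ?A t * b 0"
  proof -
    have "(\<integral>s. \<alpha> s * ?B s \<partial>?M) = (\<integral>s. \<alpha> s * b s - \<alpha> s * b 0 \<partial>?M)" by (rule Bochner_Integration.integral_cong[OF refl e(1)])
    then show ?thesis using i(1)[OF tT] al by simp
  qed
  have 2: "(\<integral>s. \<beta> s * ?A s \<partial>?M) = (\<integral>s. \<beta> s * a s \<partial>?M) - ?B t * a 0"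
  proof -
    have "(\<integral>s. \<beta> s * ?A s \<partial>?M) = (\<integral>s. \<beta> s * a s - \<beta> s * a 0 \<partial>?M)" by (rule Bochner_Integration.integral_cong[OF refl e(2)])
    then show ?thesis using i(2)[OF tT] be by simp
  qed
  have "a t * b t = (a 0 + ?A t) * (b 0 + ?B t)" using acd_eq[OF a t] acd_eq[OF b t] by simp
  also have "\<dots> = a 0 * b 0 + ?A t * b 0 + ?B t * a 0 + ?A t * ?B t" by (simp add: algebra_simps)
  also have "\<dots> = a 0 * b 0 + ((\<integral>s. \<alpha> s * b s \<partial>?M) + (\<integral>s. \<beta> s * a s \<partial>?M))"
    using integral_product_Ioo[OF al be] t unfolding 1 2 by simp
  finally show "a t * b t = a 0 * b 0 + (\<integral>s. \<alpha> s * b s + \<beta> s * a s \<partial>?M)"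
    using i[OF tT] by simp
qed

lemma acd_sum:
  assumes "\<And>j. j \<in> J \<Longrightarrow> acd T (a j) (\<alpha> j)"
  shows "acd T (\<lambda>t. \<Sum>j\<in>J. a j t) (\<lambda>t. \<Sum>j\<in>J. \<alpha> j t)"
  unfolding acd_def
proof (intro conjI ballI)
  show "integrable (lebesgue_on {0<..<T}) (\<lambda>t. \<Sum>j\<in>J. \<alpha> j t)" using assms by (simp add: acd_def)
  fix t assume t: "t \<in> {0..T}"
  have "(\<integral>s. (\<Sum>j\<in>J. \<alpha> j s) \<partial>lebesgue_on {0<..<t}) = (\<Sum>j\<in>J. \<integral>s. \<alpha> j s \<partial>lebesgue_on {0<..<t})"
    using acd_integrable[OF assms] t by (intro Bochner_Integration.integral_sum) auto
  moreover have "(\<Sum>j\<in>J. a j t) = (\<Sum>j\<in>J. a j 0 + (\<integral>s. \<alpha> j s \<partial>lebesgue_on {0<..<t}))"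
    by (intro sum.cong refl acd_eq[OF assms t])
  ultimately show "(\<Sum>j\<in>J. a j t) = (\<Sum>j\<in>J. a j 0) + (\<integral>s. (\<Sum>j\<in>J. \<alpha> j s) \<partial>lebesgue_on {0<..<t})"
    by (simp add: sum.distrib)
qed

text \<open>\<open>q\<close> vanishes at both ends, so the derivative moves from \<open>a\<close> to
  \<open>q\<close> without boundary terms. The coefficients \<open>F\<close> are merely measurable;
  integrability of their sum is supplied by the majorant \<open>P2\<close> together with
  \<open>\<sigma> > 0\<close>.\<close>

lemma acd_weak_pairing:
  assumes T: "T > 0" and a: "\<And>j. j \<in> J \<Longrightarrow> acd T (a j) (\<alpha> j)" and q: "\<And>j. j \<in> J \<Longrightarrow> acd T (q j) (\<kappa> j)"
    and q0: "\<And>j. j \<in> J \<Longrightarrow> q j 0 = 0" "\<And>j. j \<in> J \<Longrightarrow> q j T = 0"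
    and F: "\<And>j. j \<in> J \<Longrightarrow> F j \<in> borel_measurable (lebesgue_on {0<..<T})"
    and \<sigma>: "\<sigma> > 0" and P: "integrable (lebesgue_on {0<..<T}) P1" "integrable (lebesgue_on {0<..<T}) P2"
    and P1: "AE t in lebesgue_on {0<..<T}. \<sigma> * \<bar>\<Sum>j\<in>J. \<kappa> j t * a j t\<bar> \<le> P1 t"
    and P2: "AE t in lebesgue_on {0<..<T}. \<sigma> * \<bar>\<Sum>j\<in>J. F j t * q j t\<bar> \<le> P2 t"
  shows "integrable (lebesgue_on {0<..<T}) (\<lambda>t. \<Sum>j\<in>J. (- \<alpha> j t + F j t) * q j t)"
    and "\<sigma> * \<bar>\<integral>t. (\<Sum>j\<in>J. (- \<alpha> j t + F j t) * q j t) \<partial>lebesgue_on {0<..<T}\<bar>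
      \<le> (\<integral>t. P1 t \<partial>lebesgue_on {0<..<T}) + (\<integral>t. P2 t \<partial>lebesgue_on {0<..<T})"
proof -
  let ?M = "lebesgue_on {0<..<T}"
  let ?K = "\<lambda>t. \<Sum>j\<in>J. \<kappa> j t * a j t" and ?G = "\<lambda>t. \<Sum>j\<in>J. F j t * q j t" and ?H = "\<lambda>t. \<Sum>j\<in>J. \<alpha> j t * q j t"
  have iK: "integrable ?M ?K"
    using acd_continuous[OF a] acd_integrable[OF q] by (auto intro!: Bochner_Integration.integrable_sum integrable_mult_continuous)
  have iH: "integrable ?M ?H"
    using acd_continuous[OF q] acd_integrable[OF a] by (auto intro!: Bochner_Integration.integrable_sum integrable_mult_continuous)
  have Gm: "?G \<in> borel_measurable ?M"
    using F continuous_Ioo_measurable[OF acd_continuous[OF q]] by (auto intro!: borel_measurable_sum borel_measurable_times)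
  have iG: "integrable ?M ?G"
  proof (rule Bochner_Integration.integrable_bound[OF integrable_mult_right[OF P(2), of "1/\<sigma>"] Gm])
    show "AE t in ?M. norm (?G t) \<le> norm (1 / \<sigma> * P2 t)" using P2
    proof (rule eventually_mono)
      fix t assume "\<sigma> * \<bar>?G t\<bar> \<le> P2 t"
      then have "\<bar>?G t\<bar> \<le> P2 t / \<sigma>" using \<sigma> by (simp add: field_simps)
      then show "norm (?G t) \<le> norm (1 / \<sigma> * P2 t)" by (simp only: real_norm_def) (rule order_trans[OF _ abs_ge_self], simp)
    qed
  qed
  have "acd T (\<lambda>t. \<Sum>j\<in>J. a j t * q j t) (\<lambda>t. \<Sum>j\<in>J. \<alpha> j t * q j t + \<kappa> j t * a j t)"
    by (intro acd_sum acd_mult a q)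
  from acd_eq[OF this, of T] have "(\<integral>t. (\<Sum>j\<in>J. \<alpha> j t * q j t + \<kappa> j t * a j t) \<partial>?M) = 0" using T q0 by simp
  then have HK: "(\<integral>t. ?H t \<partial>?M) + (\<integral>t. ?K t \<partial>?M) = 0" using iH iK by (simp add: sum.distrib)
  have eq: "(\<Sum>j\<in>J. (- \<alpha> j t + F j t) * q j t) = ?G t - ?H t" for t
    by (simp add: sum_subtractf[symmetric] algebra_simps)
  show "integrable ?M (\<lambda>t. \<Sum>j\<in>J. (- \<alpha> j t + F j t) * q j t)" unfolding eq using iG iH by simp
  have "(\<integral>t. (\<Sum>j\<in>J. (- \<alpha> j t + F j t) * q j t) \<partial>?M) = (\<integral>t. ?G t \<partial>?M) + (\<integral>t. ?K t \<partial>?M)"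
    unfolding eq using iG iH HK by simp
  then have "\<sigma> * \<bar>\<integral>t. (\<Sum>j\<in>J. (- \<alpha> j t + F j t) * q j t) \<partial>?M\<bar> \<le> \<sigma> * \<bar>\<integral>t. ?K t \<partial>?M\<bar> + \<sigma> * \<bar>\<integral>t. ?G t \<partial>?M\<bar>"
    using \<sigma> by (simp add: distrib_left[symmetric])
  moreover have bd: "\<sigma> * \<bar>\<integral>t. g t \<partial>?M\<bar> \<le> (\<integral>t. Q t \<partial>?M)"
    if "integrable ?M g" "integrable ?M Q" "AE t in ?M. \<sigma> * \<bar>g t\<bar> \<le> Q t" for g Q
  proof -
    have "\<sigma> * \<bar>\<integral>t. g t \<partial>?M\<bar> \<le> \<sigma> * (\<integral>t. \<bar>g t\<bar> \<partial>?M)" using \<sigma> by (intro mult_left_mono) auto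
    also have "\<dots> = (\<integral>t. \<sigma> * \<bar>g t\<bar> \<partial>?M)" by simp
    also have "\<dots> \<le> (\<integral>t. Q t \<partial>?M)" using that by (intro integral_mono_AE) auto
    finally show ?thesis .
  qed
  note add_mono[OF bd[OF iK P(1) P1] bd[OF iG P(2) P2]]
  ultimately show "\<sigma> * \<bar>\<integral>t. (\<Sum>j\<in>J. (- \<alpha> j t + F j t) * q j t) \<partial>?M\<bar> \<le> (\<integral>t. P1 t \<partial>?M) + (\<integral>t. P2 t \<partial>?M)"
    by linarith
qed

section \<open>Bochner spaces\<close>

text \<open>Strong measurability supplies simple approximants in \<open>X\<close>, and a functional
  that is Lipschitz for \<open>N\<close> carries their convergence over to real-valued
  functions.\<close>

lemma bochner_functional_measurable:
  fixes l :: "('y \<Rightarrow> 'b::euclidean_space) \<Rightarrow> real"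
  assumes g: "g \<in> bochner_Lp p T X N"
    and l: "\<And>s v. s \<in> X \<Longrightarrow> v \<in> X \<Longrightarrow> \<bar>l s - l v\<bar> \<le> c * N (\<lambda>y. s y - v y)"
  shows "(\<lambda>t. l (g t)) \<in> borel_measurable (lebesgue_on {0<..<T})"
proof -
  let ?M = "lebesgue_on {0<..<T}"
  obtain s where s: "\<forall>m. simple_function ?M (s m) \<and> (\<forall>t\<in>{0<..<T}. s m t \<in> X)"
      and lim: "AE t in ?M. (\<lambda>m::nat. N (\<lambda>y. s m t y - g t y)) \<longlonglongrightarrow> 0"
    using g unfolding bochner_Lp_def by (elim CollectE conjE exE)
  have X: "AE t in ?M. g t \<in> X" using g unfolding bochner_Lp_def by (elim CollectE conjE)
  have sp: "AE t in ?M. t \<in> {0<..<T}" by (rule AE_I2) simp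
  have m: "(\<lambda>t. l (s m t)) \<in> borel_measurable ?M" for m
  proof (rule borel_measurable_simple_function)
    have "simple_function ?M (s m)" using s by blast
    from simple_function_compose[OF this, of l] show "simple_function ?M (\<lambda>t. l (s m t))" by (simp add: comp_def)
  qed
  have conv: "AE t in ?M. (\<lambda>m. l (s m t)) \<longlonglongrightarrow> l (g t)"
    using lim X sp
  proof eventually_elim
    fix t assume t: "(\<lambda>m. N (\<lambda>y. s m t y - g t y)) \<longlonglongrightarrow> 0" "g t \<in> X" "t \<in> {0<..<T}"
    have "(\<lambda>m. c * N (\<lambda>y. s m t y - g t y)) \<longlonglongrightarrow> 0" using tendsto_mult_left[OF t(1), of c] by simp
    then have "(\<lambda>m. l (s m t) - l (g t)) \<longlonglongrightarrow> 0"
      by (rule Lim_null_comparison[rotated]) (use l s t in \<open>auto intro!: always_eventually\<close>)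
    then show "(\<lambda>m. l (s m t)) \<longlonglongrightarrow> l (g t)" by (simp add: LIM_zero_iff)
  qed
  \<comment> \<open>\<open>lim\<close> is total and yields a measurable function; it agrees with the
    claimed one wherever the sequence converges to it.\<close>
  let ?L = "\<lambda>t. lim (\<lambda>m. l (s m t))"
  have "?L \<in> borel_measurable ?M" by (rule borel_measurable_lim_metric[OF m])
  moreover have "AE t in ?M. ?L t = l (g t)" using conv by (rule eventually_mono) (rule limI)
  ultimately show ?thesis by (rule borel_measurable_lebesgue_on_AE[OF Ioo_sets])
qed

lemma L2_inner_Lipschitz:
  assumes "s \<in> L2 \<Omega>" "v \<in> L2 \<Omega>" "w \<in> L2 \<Omega>"
  shows "\<bar>L2_inner \<Omega> s w - L2_inner \<Omega> v w\<bar> \<le> L2_norm \<Omega> w * L2_norm \<Omega> (\<lambda>x. s x - v x)"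
  using L2_Cauchy_Schwarz[OF L2_diff[OF assms(1,2)] assms(3)] L2_inner_diff_left[OF assms]
  by (simp add: mult.commute)

lemma bochner_L2_inner_measurable:
  assumes "g \<in> bochner_Lp p T (L2 \<Omega>) (L2_norm \<Omega>)" "w \<in> L2 \<Omega>"
  shows "(\<lambda>t. L2_inner \<Omega> (g t) w) \<in> borel_measurable (lebesgue_on {0<..<T})"
  by (rule bochner_functional_measurable[OF assms(1)]) (rule L2_inner_Lipschitz[OF _ _ assms(2)])

lemma bochner_L2_inner_integrable:
  assumes g: "g \<in> bochner_Lp 1 T (L2 \<Omega>) (L2_norm \<Omega>)" and w: "w \<in> L2 \<Omega>"
  shows "integrable (lebesgue_on {0<..<T}) (\<lambda>t. L2_inner \<Omega> (g t) w)"
proof (rule Bochner_Integration.integrable_bound[OF integrable_mult_right])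
  show "integrable (lebesgue_on {0<..<T}) (\<lambda>t. L2_norm \<Omega> (g t))" using g by (simp add: bochner_Lp_def)
  show "AE t in lebesgue_on {0<..<T}. norm (L2_inner \<Omega> (g t) w) \<le> norm (L2_norm \<Omega> w * L2_norm \<Omega> (g t))"
  proof -
    have "AE t in lebesgue_on {0<..<T}. g t \<in> L2 \<Omega>" using g unfolding bochner_Lp_def by (elim CollectE conjE)
    then show ?thesis
      by (rule eventually_mono) (use L2_Cauchy_Schwarz[OF _ w] in \<open>auto simp: abs_mult mult.commute[of "L2_norm \<Omega> w"]\<close>)
  qed
qed (rule bochner_L2_inner_measurable[OF g w])

lemma has_time_deriv_acd:
  assumes v: "has_time_deriv \<Omega> T v v'" and w: "w \<in> L2 \<Omega>" and T: "T > 0"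
  shows "acd T (\<lambda>t. L2_inner \<Omega> (v t) w) (\<lambda>t. L2_inner \<Omega> (v' t) w)"
  unfolding acd_def
proof (intro conjI ballI)
  have v1: "\<forall>t\<in>{0..T}. v t \<in> L2 \<Omega>" and v2: "v' \<in> bochner_Lp 1 T (L2 \<Omega>) (L2_norm \<Omega>)"
    and v3: "\<forall>t\<in>{0..T}. \<forall>w\<in>L2 \<Omega>. L2_inner \<Omega> (\<lambda>x. v t x - v 0 x) w = (\<integral>s. L2_inner \<Omega> (v' s) w \<partial>lebesgue_on {0<..<t})"
    using v unfolding has_time_deriv_def by - (elim conjE, assumption)+
  show "integrable (lebesgue_on {0<..<T}) (\<lambda>t. L2_inner \<Omega> (v' t) w)" by (rule bochner_L2_inner_integrable[OF v2 w])
  fix t assume t: "t \<in> {0..T}"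
  have "L2_inner \<Omega> (\<lambda>x. v t x - v 0 x) w = L2_inner \<Omega> (v t) w - L2_inner \<Omega> (v 0) w"
    using v1 t T by (intro L2_inner_diff_left w) auto
  then show "L2_inner \<Omega> (v t) w = L2_inner \<Omega> (v 0) w + (\<integral>s. L2_inner \<Omega> (v' s) w \<partial>lebesgue_on {0<..<t})"
    using v3[rule_format, OF t w] by simp
qed

text \<open>Product rule for each coefficient in a fixed basis of \<open>W\<close>. The derivative
  \<open>v' t\<close> need not lie in \<open>W\<close>: paired with \<open>v t\<close> it is seen
  only through its coefficients.\<close>

lemma has_time_deriv_norm_acd:
  assumes v: "has_time_deriv \<Omega> T v v'" and T: "T > 0" and \<Omega>: "\<Omega> \<in> sets lebesgue" and e: "L2_onb \<Omega> W m e"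
    and W: "\<And>t. t \<in> {0..T} \<Longrightarrow> v t \<in> W"
  shows "acd T (\<lambda>t. (L2_norm \<Omega> (v t))\<^sup>2) (\<lambda>t. 2 * L2_inner \<Omega> (v' t) (v t))"
proof -
  have eL: "e j \<in> L2 \<Omega>" if "j \<in> {..<m}" for j using e that by (auto simp: L2_onb_def)
  have "acd T (\<lambda>t. \<Sum>j<m. L2_inner \<Omega> (v t) (e j) * L2_inner \<Omega> (v t) (e j))
     (\<lambda>t. \<Sum>j<m. L2_inner \<Omega> (v' t) (e j) * L2_inner \<Omega> (v t) (e j) + L2_inner \<Omega> (v' t) (e j) * L2_inner \<Omega> (v t) (e j))"
    by (intro acd_sum acd_mult has_time_deriv_acd[OF v _ T] eL)
  then show ?thesis
  proof (rule acd_cong)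
    show "(\<Sum>j<m. L2_inner \<Omega> (v t) (e j) * L2_inner \<Omega> (v t) (e j)) = (L2_norm \<Omega> (v t))\<^sup>2" if "t \<in> {0..T}" for t
      using L2_onb_norm[OF \<Omega> e W[OF that]] by (simp add: power2_eq_square)
    have "AE t in lebesgue_on {0<..<T}. v' t \<in> L2 \<Omega>"
      using v unfolding has_time_deriv_def bochner_Lp_def by (elim CollectE conjE)
    moreover have "AE t in lebesgue_on {0<..<T}. t \<in> {0..T}" by (rule AE_I2) auto
    ultimately show "AE t in lebesgue_on {0<..<T}. (\<Sum>j<m. L2_inner \<Omega> (v' t) (e j) * L2_inner \<Omega> (v t) (e j) +
        L2_inner \<Omega> (v' t) (e j) * L2_inner \<Omega> (v t) (e j)) = 2 * L2_inner \<Omega> (v' t) (v t)"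
    proof eventually_elim
      fix t assume v': "v' t \<in> L2 \<Omega>" and t: "t \<in> {0..T}"
      have "L2_inner \<Omega> (v' t) (v t) = (\<Sum>j<m. L2_inner \<Omega> (v' t) (e j) * L2_inner \<Omega> (v t) (e j))"
        using L2_onb_inner[OF \<Omega> e W[OF t] v'] by (simp add: L2_inner_commute[of \<Omega> "v' t"] mult.commute)
      then show "(\<Sum>j<m. L2_inner \<Omega> (v' t) (e j) * L2_inner \<Omega> (v t) (e j) +
        L2_inner \<Omega> (v' t) (e j) * L2_inner \<Omega> (v t) (e j)) = 2 * L2_inner \<Omega> (v' t) (v t)"
        by (simp add: sum_distrib_left mult_ac)
    qed
  qed
qed

text \<open>Functionals are raw functions of which only the values on \<open>H10\<close> matter;
  their differences occur in the measurability of the force.\<close>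

lemma Hm1_diff:
  assumes "l \<in> Hm1 \<Omega>" "l' \<in> Hm1 \<Omega>" shows "(\<lambda>\<phi>. l \<phi> - l' \<phi>) \<in> Hm1 \<Omega>"
proof -
  obtain B where B: "\<forall>v\<in>H10 \<Omega>. \<bar>l v\<bar> \<le> B * H1_norm \<Omega> v" using assms(1) unfolding Hm1_def by (elim CollectE conjE exE)
  obtain B' where B': "\<forall>v\<in>H10 \<Omega>. \<bar>l' v\<bar> \<le> B' * H1_norm \<Omega> v" using assms(2) unfolding Hm1_def by (elim CollectE conjE exE)
  have lin: "l (\<lambda>x. a * v x + b * w x) = a * l v + b * l w" "l' (\<lambda>x. a * v x + b * w x) = a * l' v + b * l' w"
    if "v \<in> H10 \<Omega>" "w \<in> H10 \<Omega>" for a b v w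
    using assms that by (auto simp: Hm1_def)
  have "\<bar>l v - l' v\<bar> \<le> (B + B') * H1_norm \<Omega> v" if "v \<in> H10 \<Omega>" for v
    using bspec[OF B that] bspec[OF B' that] by (simp add: distrib_right)
  then have "\<exists>B. \<forall>v\<in>H10 \<Omega>. \<bar>l v - l' v\<bar> \<le> B * H1_norm \<Omega> v" by (intro exI[of _ "B + B'"] ballI)
  then show ?thesis unfolding Hm1_def by (auto simp: lin algebra_simps)
qed

section \<open>Solutions of the semi-discrete problem\<close>

locale vms_flow = vms \<Omega> \<T> k nu np \<phi> \<psi> Ci \<beta>0 c1 c2 \<mu>0 \<mu>inf C\<mu> R \<mu> \<mu>c
  for \<Omega> :: "(real^'n) set" and \<T> k nu np \<phi> \<psi> Ci \<beta>0 c1 c2 \<mu>0 \<mu>inf C\<mu> R \<mu> \<mu>c +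
  fixes T :: real and f :: "'n \<Rightarrow> real \<Rightarrow> (real^'n \<Rightarrow> real) \<Rightarrow> real" and u0 :: "real^'n \<Rightarrow> real^'n"
    and u :: "real \<Rightarrow> real^'n \<Rightarrow> real^'n" and p :: "real \<Rightarrow> real^'n \<Rightarrow> real" and u1 u2 u' u1' u2' :: "real \<Rightarrow> real^'n \<Rightarrow> real^'n"
  assumes T: "T > 0" and u0: "u0 \<in> L2 \<Omega>" and force: "\<And>i. f i \<in> bochner_Lp 2 T (Hm1 \<Omega>) (Hm1_norm \<Omega>)"
    and mcm: "(\<lambda>t. \<mu>c (u t)) \<in> borel_measurable (lebesgue_on {0<..<T})"
    and uV: "\<And>t. t \<in> {0..T} \<Longrightarrow> u t \<in> V" and u1W: "\<And>t. t \<in> {0..T} \<Longrightarrow> u1 t \<in> W1" and u2W: "\<And>t. t \<in> {0..T} \<Longrightarrow> u2 t \<in> W2"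
    and pS: "\<And>t. t \<in> {0<..<T} \<Longrightarrow> p t \<in> Sh \<Omega> k \<T>"
    and init: "AE x in \<M>. u 0 x = L2_proj \<Omega> V u0 x" "AE x in \<M>. u1 0 x = L2_proj \<Omega> W1 u0 x"
      "AE x in \<M>. u2 0 x = L2_proj \<Omega> W2 u0 x"
    and deriv: "has_time_deriv \<Omega> T u u'" "has_time_deriv \<Omega> T u1 u1'" "has_time_deriv \<Omega> T u2 u2'"
    and eqs: "AE t in lebesgue_on {0<..<T}. \<forall>v\<in>V. \<forall>q\<in>Sh \<Omega> k \<T>. \<forall>v1\<in>W1. \<forall>v2\<in>W2.
          momentum_eq \<Omega> k \<T> \<mu> \<mu>c c1 c2 f t (u t) (u' t) (p t) (u1 t) v \<and>
          ip q (divergence \<Omega> (u t)) - ip (grad \<Omega> q) (u2 t) = 0 \<and>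
          ip (u1' t) v1
            + inverse (tau1 \<Omega> c1 c2 \<mu>c (mesh_size \<T>) (u t)) * ip (u1 t) v1
            + conv_form \<Omega> (u t) (u t) v1 = 0 \<and>
          ip (u2' t) v2
            + inverse (tau1 \<Omega> c1 c2 \<mu>c (mesh_size \<T>) (u t)) * ip (u2 t) v2
            + ip (grad \<Omega> (p t)) v2 = 0"
begin

abbreviation "MT \<equiv> lebesgue_on {0<..<T}"

lemma W1_L2: "W1 \<subseteq> L2 \<Omega>" and W2_L2: "W2 \<subseteq> L2 \<Omega>"
  using onb_W1 onb_W2 by (auto simp: L2_onb_def)

lemma AE_time: "AE t in MT. t \<in> {0<..<T}"
  by (rule AE_I2) simp

text \<open>The equations at one time, each with its own test function instead of the joint
  quantifier over all four.\<close>

definition "solves t \<longleftrightarrow> t \<in> {0<..<T} \<and> (\<forall>v\<in>V. momentum_eq \<Omega> k \<T> \<mu> \<mu>c c1 c2 f t (u t) (u' t) (p t) (u1 t) v)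
   \<and> (\<forall>q\<in>Sh \<Omega> k \<T>. ip q (divergence \<Omega> (u t)) - ip (grad \<Omega> q) (u2 t) = 0)
   \<and> (\<forall>y\<in>W1. ip (u1' t) y + s1 (u t) * ip (u1 t) y + ip (conv \<Omega> (u t) (u t)) y = 0)
   \<and> (\<forall>y\<in>W2. ip (u2' t) y + s1 (u t) * ip (u2 t) y + ip (grad \<Omega> (p t)) y = 0)"

lemma solvesD:
  assumes "solves t"
  shows "t \<in> {0<..<T}" and "y \<in> V \<Longrightarrow> momentum_eq \<Omega> k \<T> \<mu> \<mu>c c1 c2 f t (u t) (u' t) (p t) (u1 t) y"
    and "q \<in> Sh \<Omega> k \<T> \<Longrightarrow> ip q (divergence \<Omega> (u t)) - ip (grad \<Omega> q) (u2 t) = 0"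
    and "y \<in> W1 \<Longrightarrow> ip (u1' t) y + s1 (u t) * ip (u1 t) y + ip (conv \<Omega> (u t) (u t)) y = 0"
    and "y \<in> W2 \<Longrightarrow> ip (u2' t) y + s1 (u t) * ip (u2 t) y + ip (grad \<Omega> (p t)) y = 0"
  using assms unfolding solves_def by blast+

lemma equations: "AE t in MT. solves t"
  using eqs AE_time
proof eventually_elim
  case (elim t)
  then have t: "t \<in> {0<..<T}" "t \<in> {0..T}" by auto
  note E = elim(1)[unfolded inverse_tau1 conv_form_eq, rule_format]
  \<comment> \<open>Each equation is extracted by filling the other test slots with the solution
    itself.\<close>
  show "solves t" unfolding solves_def
    using t(1) E[OF _ pS[OF t(1)] u1W[OF t(2)] u2W[OF t(2)]] E[OF uV[OF t(2)] _ u1W[OF t(2)] u2W[OF t(2)]]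
      E[OF uV[OF t(2)] pS[OF t(1)] _ u2W[OF t(2)]] E[OF uV[OF t(2)] pS[OF t(1)] u1W[OF t(2)]] by blast
qed

lemma force_Hm1: "AE t in MT. \<forall>i. f i t \<in> Hm1 \<Omega>"
proof -
  have "AE t in MT. f i t \<in> Hm1 \<Omega>" for i
    using force[of i] unfolding bochner_Lp_def by (elim CollectE conjE)
  then have "AE t in MT. \<forall>i\<in>UNIV. f i t \<in> Hm1 \<Omega>" by (intro AE_finite_ball) auto
  then show ?thesis by simp
qed

section \<open>Energy estimate in time\<close>

definition "Fs t = (\<Sum>i\<in>UNIV. (Hm1_norm \<Omega> (f i t))\<^sup>2)"

lemma Fs_integrable: "integrable MT Fs"
  using force unfolding Fs_def bochner_Lp_def by (auto intro!: Bochner_Integration.integrable_sum)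

lemma Fs_nonneg: "0 \<le> Fs t"
  unfolding Fs_def by (intro sum_nonneg) auto

lemma force_measurable:
  assumes w: "w \<in> H10 \<Omega>" "pw_C1 \<Omega> \<T> w"
  shows "(\<lambda>t. f i t w) \<in> borel_measurable MT"
proof (rule bochner_functional_measurable[OF force])
  fix l l' assume l: "l \<in> Hm1 \<Omega>" "l' \<in> Hm1 \<Omega>"
  show "\<bar>l w - l' w\<bar> \<le> H1_norm \<Omega> w * Hm1_norm \<Omega> (\<lambda>y. l y - l' y)"
    using Hm1_bound(2)[OF Hm1_diff[OF l] w] by (simp add: mult.commute)
qed

definition "kinetic t = (nrm (u t))\<^sup>2 + (nrm (u1 t))\<^sup>2 + (nrm (u2 t))\<^sup>2"
definition "kinetic_rate t = ip (u' t) (u t) + ip (u1' t) (u1 t) + ip (u2' t) (u2 t)"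

text \<open>A majorant of the dissipation which, unlike the dissipation itself, is integrable by construction.\<close>

definition "G t = Cf * Fs t - kinetic_rate t"

text \<open>The factor 3 counts the three projected initial values; the factor 2 appears because the
  derivative of \<open>kinetic\<close> is twice \<open>kinetic_rate\<close>.\<close>

definition "M2 = 3 * (nrm u0)\<^sup>2 + 2 * Cf * (\<integral>t. Fs t \<partial>MT)"

lemma Cf_nonneg: "0 \<le> Cf"
  using mu_const by (simp add: Cf_def)

lemma kinetic_acd: "acd T kinetic (\<lambda>t. 2 * kinetic_rate t)"
proof -
  obtain m e where e: "L2_onb \<Omega> V m e" using onb_V by (elim exE)
  obtain m1 e1 where e1: "L2_onb \<Omega> W1 m1 e1" using onb_W1 by (elim exE)
  obtain m2 e2 where e2: "L2_onb \<Omega> W2 m2 e2" using onb_W2 by (elim exE)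
  have a: "acd T (\<lambda>t. (nrm (u t))\<^sup>2) (\<lambda>t. 2 * ip (u' t) (u t))"
    by (rule has_time_deriv_norm_acd[OF deriv(1) T \<Omega>_sets e], rule uV)
  have a1: "acd T (\<lambda>t. (nrm (u1 t))\<^sup>2) (\<lambda>t. 2 * ip (u1' t) (u1 t))"
    by (rule has_time_deriv_norm_acd[OF deriv(2) T \<Omega>_sets e1], rule u1W)
  have a2: "acd T (\<lambda>t. (nrm (u2 t))\<^sup>2) (\<lambda>t. 2 * ip (u2' t) (u2 t))"
    by (rule has_time_deriv_norm_acd[OF deriv(3) T \<Omega>_sets e2], rule u2W)
  \<comment> \<open>Indices 0, 1, 2 stand for the velocity and the two subscales, so that the rule
    for sums applies.\<close>
  let ?A = "\<lambda>j t. if j = (0::nat) then (nrm (u t))\<^sup>2 else if j = 1 then (nrm (u1 t))\<^sup>2 else (nrm (u2 t))\<^sup>2"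
  let ?B = "\<lambda>j t. if j = (0::nat) then 2 * ip (u' t) (u t) else if j = 1 then 2 * ip (u1' t) (u1 t) else 2 * ip (u2' t) (u2 t)"
  have "acd T (?A j) (?B j)" for j
    by (cases "j = 0"; cases "j = 1") (simp_all add: a a1 a2)
  then have "acd T (\<lambda>t. \<Sum>j<3. ?A j t) (\<lambda>t. \<Sum>j<3. ?B j t)" by (intro acd_sum)
  then show ?thesis
    by (rule acd_cong) (auto simp: kinetic_def kinetic_rate_def numeral_3_eq_3)
qed

text \<open>Each initial value is an orthogonal projection of \<open>u0\<close> and hence not larger
  in norm.\<close>

lemma kinetic_0: "kinetic 0 \<le> 3 * (nrm u0)\<^sup>2"
proof -
  have b: "(nrm v)\<^sup>2 \<le> (nrm u0)\<^sup>2"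
    if ex: "\<exists>m e. L2_onb \<Omega> W m e" and v: "AE x in \<M>. v x = L2_proj \<Omega> W u0 x" for W and v :: "real^'n \<Rightarrow> real^'n"
  proof -
    obtain m e where e: "L2_onb \<Omega> W m e" using ex by (elim exE)
    have "nrm v = nrm (L2_proj \<Omega> W u0)"
      by (rule L2_norm_cong_AE[OF \<Omega>_sets L2_proj_L2[OF \<Omega>_sets e u0] v])
    then show ?thesis using L2_norm_proj_le[OF \<Omega>_sets e u0] by (intro power_mono) auto
  qed
  show ?thesis
    using b[OF onb_V init(1)] b[OF onb_W1 init(2)] b[OF onb_W2 init(3)] unfolding kinetic_def by linarith
qed

lemma Diss_le_G: "AE t in MT. Diss (u t) (u1 t) (u2 t) \<le> G t"
  using equations force_Hm1
proof eventually_elim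
  fix t assume eq: "solves t"
   and l: "\<forall>i. f i t \<in> Hm1 \<Omega>"
  from eq have t: "t \<in> {0<..<T}" by (rule solvesD)
  then have t': "t \<in> {0..T}" by auto
  have "kinetic_rate t + Diss (u t) (u1 t) (u2 t) \<le> Cf * Fs t"
    unfolding kinetic_rate_def Fs_def
  proof (rule energy_static[OF uV[OF t'] pS[OF t]])
    show "f i t \<in> Hm1 \<Omega>" for i using l by blast
    show "momentum_eq \<Omega> k \<T> \<mu> \<mu>c c1 c2 f t (u t) (u' t) (p t) (u1 t) (u t)" by (rule solvesD(2)[OF eq uV[OF t']])
    show "ip (p t) (divergence \<Omega> (u t)) - ip (grad \<Omega> (p t)) (u2 t) = 0" by (rule solvesD(3)[OF eq pS[OF t]])
    show "ip (u1' t) (u1 t) + s1 (u t) * ip (u1 t) (u1 t) + ip (conv \<Omega> (u t) (u t)) (u1 t) = 0"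
      by (rule solvesD(4)[OF eq u1W[OF t']])
    show "ip (u2' t) (u2 t) + s1 (u t) * ip (u2 t) (u2 t) + ip (grad \<Omega> (p t)) (u2 t) = 0"
      by (rule solvesD(5)[OF eq u2W[OF t']])
  qed
  then show "Diss (u t) (u1 t) (u2 t) \<le> G t" by (simp add: G_def)
qed

lemma G_nonneg: "AE t in MT. 0 \<le> G t"
  using Diss_le_G AE_time
proof eventually_elim
  fix t assume "Diss (u t) (u1 t) (u2 t) \<le> G t" "t \<in> {0<..<T}"
  then show "0 \<le> G t" using Diss_parts(1)[OF uV, of t "u1 t" "u2 t"] by auto
qed

lemma kinetic_rate_integrable: "integrable MT kinetic_rate"
  using kinetic_acd by (auto simp: acd_def)

lemma G_integrable: "integrable MT G"
  using kinetic_rate_integrable Fs_integrable unfolding G_def by simp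

text \<open>As \<open>G\<close> is nonnegative, \<open>kinetic_rate\<close> is at most
  \<open>Cf * Fs\<close>. Extending by zero beyond \<open>t\<close> is harmless because
  \<open>Fs\<close> is nonnegative, so the bound is uniform in \<open>t\<close>.\<close>

lemma kinetic_le:
  assumes t: "t \<in> {0..T}" shows "kinetic t \<le> M2"
proof -
  have "(\<integral>s. 2 * kinetic_rate s \<partial>lebesgue_on {0<..<t}) = (\<integral>s. (if s \<in> {0<..<t} then 2 * kinetic_rate s else 0) \<partial>MT)"
    using t by (intro integral_restrict[symmetric]) auto
  also have "\<dots> \<le> (\<integral>s. 2 * Cf * Fs s \<partial>MT)"
  proof (rule integral_mono_AE)
    show "integrable MT (\<lambda>s. if s \<in> {0<..<t} then 2 * kinetic_rate s else 0)"
    proof (rule Bochner_Integration.integrable_bound[of _ "\<lambda>s. 2 * kinetic_rate s"])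
      have "(\<lambda>s. if s \<in> {0<..<t} then 2 * kinetic_rate s else 0) \<in> borel_measurable MT"
      proof (rule measurable_If_set)
        show "{0<..<t} \<inter> space MT \<in> sets MT" using t by (simp add: sets_restrict_space_iff) auto
      qed (use borel_measurable_integrable[OF kinetic_rate_integrable] in auto)
      then show "(\<lambda>s. if s \<in> {0<..<t} then 2 * kinetic_rate s else 0) \<in> borel_measurable MT" .
    qed (use kinetic_rate_integrable in auto)
    show "integrable MT (\<lambda>s. 2 * Cf * Fs s)" using Fs_integrable by simp
    show "AE s in MT. (if s \<in> {0<..<t} then 2 * kinetic_rate s else 0) \<le> 2 * Cf * Fs s"
      using G_nonneg
    proof (rule eventually_mono)
      fix s assume "0 \<le> G s"
      then show "(if s \<in> {0<..<t} then 2 * kinetic_rate s else 0) \<le> 2 * Cf * Fs s"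
        using mult_nonneg_nonneg[OF Cf_nonneg Fs_nonneg[of s]] by (simp add: G_def)
    qed
  qed
  finally show ?thesis using acd_eq[OF kinetic_acd t] kinetic_0 by (simp add: M2_def)
qed

lemma kinetic_nonneg: "0 \<le> kinetic t"
  by (simp add: kinetic_def)

text \<open>The integral of \<open>kinetic_rate\<close> is half the change of
  \<open>kinetic\<close>, and the final energy is nonnegative.\<close>

lemma G_integral: "(\<integral>t. G t \<partial>MT) \<le> M2"
proof -
  have "kinetic T = kinetic 0 + 2 * (\<integral>s. kinetic_rate s \<partial>MT)" using acd_eq[OF kinetic_acd, of T] T by simp
  moreover have "(\<integral>t. G t \<partial>MT) = Cf * (\<integral>t. Fs t \<partial>MT) - (\<integral>t. kinetic_rate t \<partial>MT)"
    unfolding G_def using Fs_integrable kinetic_rate_integrable by simp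
  moreover have "0 \<le> Cf * (\<integral>t. Fs t \<partial>MT)" by (intro mult_nonneg_nonneg Cf_nonneg integral_nonneg_AE) (simp add: Fs_nonneg)
  ultimately show ?thesis using kinetic_0 kinetic_nonneg[of T] zero_le_power2[of "nrm u0"]
    unfolding M2_def by linarith
qed

section \<open>Regularity in time of the coefficients\<close>

lemma u_coeff_continuous: "w \<in> L2 \<Omega> \<Longrightarrow> continuous_on {0..T} (\<lambda>t. ip (u t) w)"
  by (rule acd_continuous[OF has_time_deriv_acd[OF deriv(1) _ T]])

lemma inner_continuous_measurable:
  "continuous_on {0..T} a \<Longrightarrow> a \<in> borel_measurable MT" for a :: "real \<Rightarrow> real"
  by (rule continuous_Ioo_measurable) auto

text \<open>In finite dimension the supremum norm is controlled by the coefficients, which are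
  continuous in time. It follows that \<open>s1 (u t)\<close> is measurable and that the supremum in
  \<open>tau0\<close> is finite.\<close>

lemma Linf_continuous: "continuous_on {0..T} (\<lambda>t. Linf_norm \<Omega> (u t))"
proof -
  obtain m e where e: "L2_onb \<Omega> V m e" using onb_V by (elim exE)
  have eV: "e j \<in> V" if "j < m" for j using e that by (auto simp: L2_onb_def)
  let ?c = "\<lambda>v j. ip v (e j)"
  have le: "Linf_norm \<Omega> v - Linf_norm \<Omega> w \<le> (\<Sum>j<m. \<bar>?c v j - ?c w j\<bar> * Linf_norm \<Omega> (e j))" if v: "v \<in> V" and w: "w \<in> V" for v w
  proof -
    have "AE x in \<M>. v x = (\<Sum>j<m. ?c v j *\<^sub>R e j x)" "AE x in \<M>. w x = (\<Sum>j<m. ?c w j *\<^sub>R e j x)"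
      using e v w by (auto simp: L2_onb_def)
    moreover have "AE x in \<M>. \<forall>j\<in>{..<m}. norm (e j x) \<le> Linf_norm \<Omega> (e j)"
      by (intro AE_finite_ball Linf_AE eV) auto
    moreover have "AE x in \<M>. norm (w x) \<le> Linf_norm \<Omega> w" by (rule Linf_AE[OF w])
    ultimately have "AE x in \<M>. norm (v x) \<le> Linf_norm \<Omega> w + (\<Sum>j<m. \<bar>?c v j - ?c w j\<bar> * Linf_norm \<Omega> (e j))"
    proof eventually_elim
      fix x assume x: "v x = (\<Sum>j<m. ?c v j *\<^sub>R e j x)" "w x = (\<Sum>j<m. ?c w j *\<^sub>R e j x)"
        "\<forall>j\<in>{..<m}. norm (e j x) \<le> Linf_norm \<Omega> (e j)" "norm (w x) \<le> Linf_norm \<Omega> w"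
      have "v x - w x = (\<Sum>j<m. (?c v j - ?c w j) *\<^sub>R e j x)"
        unfolding x(1,2) by (simp add: sum_subtractf scaleR_diff_left)
      also have "norm \<dots> \<le> (\<Sum>j<m. \<bar>?c v j - ?c w j\<bar> * Linf_norm \<Omega> (e j))"
        using x(3) by (intro order_trans[OF norm_sum] sum_mono) (auto intro: mult_left_mono)
      finally show "norm (v x) \<le> Linf_norm \<Omega> w + (\<Sum>j<m. \<bar>?c v j - ?c w j\<bar> * Linf_norm \<Omega> (e j))"
        using x(4) norm_triangle_sub[of "v x" "w x"] by linarith
    qed
    then show ?thesis using Linf_le[OF v] by fastforce
  qed
  have ab: "\<bar>Linf_norm \<Omega> v - Linf_norm \<Omega> w\<bar> \<le> (\<Sum>j<m. \<bar>?c v j - ?c w j\<bar> * Linf_norm \<Omega> (e j))" if v: "v \<in> V" and w: "w \<in> V" for v w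
    using le[OF v w] le[OF w v] by (simp add: abs_minus_commute abs_le_iff)
  show ?thesis unfolding continuous_on_def
  proof
    fix s assume s: "s \<in> {0..T}"
    let ?d = "\<lambda>t. \<Sum>j<m. \<bar>?c (u t) j - ?c (u s) j\<bar> * Linf_norm \<Omega> (e j)"
    have "continuous_on {0..T} ?d"
      using eV V_L2 by (intro continuous_intros u_coeff_continuous) auto
    then have "(?d \<longlongrightarrow> ?d s) (at s within {0..T})" using s unfolding continuous_on_def by (rule bspec)
    then have d: "(?d \<longlongrightarrow> 0) (at s within {0..T})" by simp
    have "((\<lambda>t. Linf_norm \<Omega> (u t) - Linf_norm \<Omega> (u s)) \<longlongrightarrow> 0) (at s within {0..T})"
      by (rule Lim_null_comparison[OF _ d]) (use ab uV s in \<open>auto simp: eventually_at_filter\<close>)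
    then show "((\<lambda>t. Linf_norm \<Omega> (u t)) \<longlongrightarrow> Linf_norm \<Omega> (u s)) (at s within {0..T})" by (simp add: LIM_zero_iff)
  qed
qed

lemma s1_measurable: "(\<lambda>t. s1 (u t)) \<in> borel_measurable MT"
  using mcm inner_continuous_measurable[OF Linf_continuous] unfolding s1_def by measurable

text \<open>Dominated convergence along a sequence of times: the coefficients of \<open>u\<close>
  are bounded on the time interval, which gives a majorant independent of the sequence index, and
  the Lipschitz condition on \<open>\<mu>\<close> gives pointwise convergence.\<close>

lemma vstress_inner_continuous:
  assumes S: "S \<in> L2 \<Omega>"
  shows "continuous_on {0..T} (\<lambda>t. ip (vstress (u t)) S)"
proof (rule continuous_on_sequentiallyI)
  fix r s assume r: "\<forall>n. r n \<in> {0..T}" and s: "s \<in> {0..T}" and lim: "r \<longlonglongrightarrow> s"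
  obtain m e where e: "L2_onb \<Omega> V m e" using onb_V by (elim exE)
  have eV: "e j \<in> V" if "j < m" for j using e that by (auto simp: L2_onb_def)
  let ?c = "\<lambda>t j. ip (u t) (e j)" and ?S = "\<lambda>j. symgrad \<Omega> (e j)"
  have cc: "continuous_on {0..T} (\<lambda>t. ?c t j)" if "j < m" for j using eV[OF that] V_L2 by (intro u_coeff_continuous) auto
  have "\<exists>B. \<forall>t\<in>{0..T}. \<bar>?c t j\<bar> \<le> B" if "j < m" for j
    using compact_imp_bounded[OF compact_continuous_image[OF cc[OF that]]] by (auto simp: bounded_iff)
  then obtain B where B: "\<And>j t. j < m \<Longrightarrow> t \<in> {0..T} \<Longrightarrow> \<bar>?c t j\<bar> \<le> B j" by metis
  have ex: "AE x in \<M>. symgrad \<Omega> (u t) x = (\<Sum>j<m. ?c t j *\<^sub>R ?S j x)" if t: "t \<in> {0..T}" for t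
    by (rule symgrad_lincomb) (use e uV[OF t] in \<open>auto simp: L2_onb_def intro: Vh_pw eV\<close>)
  let ?g = "\<lambda>x. \<Sum>j<m. B j *\<^sub>R norm (?S j x)"
  have SL: "?S j \<in> L2 \<Omega>" if "j < m" for j by (rule symgrad_v_L2[OF eV[OF that]])
  have gL: "?g \<in> L2 \<Omega>"
  proof (rule L2_lincomb)
    fix j assume "j \<in> {..<m}"
    then have L: "?S j \<in> L2 \<Omega>" using SL by simp
    have m: "(\<lambda>x. norm (?S j x)) \<in> borel_measurable \<M>" using L2_measurable[OF L] by measurable
    show "(\<lambda>x. norm (?S j x)) \<in> L2 \<Omega>" by (rule L2_dominated[OF L m, of 1]) simp
  qed
  have nSL: "(\<lambda>x. norm (S x)) \<in> L2 \<Omega>"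
  proof -
    have m: "(\<lambda>x. norm (S x)) \<in> borel_measurable \<M>" using L2_measurable[OF S] by measurable
    show ?thesis by (rule L2_dominated[OF S m, of 1]) simp
  qed
  have exn: "AE x in \<M>. \<forall>n. symgrad \<Omega> (u (r n)) x = (\<Sum>j<m. ?c (r n) j *\<^sub>R ?S j x)"
    unfolding AE_all_countable using ex r by blast
  have cl: "AE x in \<M>. x \<in> closure \<Omega>" by (rule AE_closure)
  show "(\<lambda>n. ip (vstress (u (r n))) S) \<longlonglongrightarrow> ip (vstress (u s)) S"
    unfolding L2_inner_def
  proof (rule integral_dominated_convergence[where w = "\<lambda>x. (2 * \<mu>0) * (?g x \<bullet> norm (S x))"])
    show "(\<lambda>x. vstress (u s) x \<bullet> S x) \<in> borel_measurable \<M>"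
      using L2_inner_integrable[OF vstress_L2[OF uV[OF s]] S] by (rule borel_measurable_integrable)
    show "(\<lambda>x. vstress (u (r n)) x \<bullet> S x) \<in> borel_measurable \<M>" for n
      using L2_inner_integrable[OF vstress_L2[OF uV] S] r by (intro borel_measurable_integrable) auto
    show "integrable \<M> (\<lambda>x. (2 * \<mu>0) * (?g x \<bullet> norm (S x)))"
      by (intro integrable_mult_right L2_inner_integrable gL nSL)
    show "AE x in \<M>. norm (vstress (u (r n)) x \<bullet> S x) \<le> (2 * \<mu>0) * (?g x \<bullet> norm (S x))" for n
      using exn vstress_le[of "u (r n)"]
    proof eventually_elim
      fix x assume 1: "\<forall>n. symgrad \<Omega> (u (r n)) x = (\<Sum>j<m. ?c (r n) j *\<^sub>R ?S j x)"
        and 2: "norm (vstress (u (r n)) x) \<le> 2 * \<mu>0 * norm (symgrad \<Omega> (u (r n)) x)"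
      have "norm (symgrad \<Omega> (u (r n)) x) \<le> ?g x"
        unfolding 1[rule_format] using B r by (intro order_trans[OF norm_sum] sum_mono) (auto intro!: mult_right_mono)
      then have "2 * \<mu>0 * norm (symgrad \<Omega> (u (r n)) x) \<le> 2 * \<mu>0 * ?g x" using mu_const by (intro mult_left_mono) auto
      with 2 have "norm (vstress (u (r n)) x) \<le> 2 * \<mu>0 * ?g x" by (rule order_trans)
      then have "norm (vstress (u (r n)) x) * norm (S x) \<le> 2 * \<mu>0 * ?g x * norm (S x)" by (rule mult_right_mono) simp
      then show "norm (vstress (u (r n)) x \<bullet> S x) \<le> (2 * \<mu>0) * (?g x \<bullet> norm (S x))"
        using Cauchy_Schwarz_ineq2[of "vstress (u (r n)) x" "S x"] by (simp add: mult.assoc)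
    qed
    show "AE x in \<M>. (\<lambda>n. vstress (u (r n)) x \<bullet> S x) \<longlonglongrightarrow> vstress (u s) x \<bullet> S x"
      using exn ex[OF s] cl
    proof eventually_elim
      fix x assume 1: "\<forall>n. symgrad \<Omega> (u (r n)) x = (\<Sum>j<m. ?c (r n) j *\<^sub>R ?S j x)"
        and 2: "symgrad \<Omega> (u s) x = (\<Sum>j<m. ?c s j *\<^sub>R ?S j x)" and x: "x \<in> closure \<Omega>"
      have "(\<lambda>n. ?c (r n) j) \<longlonglongrightarrow> ?c s j" if "j < m" for j
        by (rule continuous_on_tendsto_compose[OF cc[OF that] lim s]) (use r in \<open>auto intro: always_eventually\<close>)
      then have c: "(\<lambda>n. symgrad \<Omega> (u (r n)) x) \<longlonglongrightarrow> symgrad \<Omega> (u s) x"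
        unfolding 1[rule_format] 2 by (intro tendsto_intros) auto
      let ?N = "\<lambda>t. norm (symgrad \<Omega> (u t) x)"
      have N: "(\<lambda>n. ?N (r n)) \<longlonglongrightarrow> ?N s" by (rule tendsto_norm[OF c])
      have "(\<lambda>n. C\<mu> * \<bar>?N (r n) - ?N s\<bar>) \<longlonglongrightarrow> 0"
        using tendsto_mult_left[OF tendsto_rabs[OF LIM_zero[OF N]], of C\<mu>] by simp
      then have "(\<lambda>n. \<mu> x (?N (r n)) - \<mu> x (?N s)) \<longlonglongrightarrow> 0"
        by (rule Lim_null_comparison[rotated]) (use mu_lip[OF x] in \<open>auto intro!: always_eventually\<close>)
      then have "(\<lambda>n. \<mu> x (?N (r n))) \<longlonglongrightarrow> \<mu> x (?N s)" by (simp add: LIM_zero_iff)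
      with c show "(\<lambda>n. vstress (u (r n)) x \<bullet> S x) \<longlonglongrightarrow> vstress (u s) x \<bullet> S x"
        unfolding vstress_def by (intro tendsto_intros)
    qed
  qed
qed

text \<open>Divergence and projection are linear almost everywhere, so in a fixed basis the time
  dependence reduces to continuous coefficients.\<close>

lemma Pd_inner_measurable:
  assumes d: "d \<in> L2 \<Omega>" shows "(\<lambda>t. ip d (Pd (u t))) \<in> borel_measurable MT"
proof -
  obtain m e where e: "L2_onb \<Omega> V m e" using onb_V by (elim exE)
  obtain ms es where es: "L2_onb \<Omega> (Sh \<Omega> k \<T>) ms es" using onb_Sh by (elim exE)
  have eV: "e j \<in> V" if "j < m" for j using e that by (auto simp: L2_onb_def)
  let ?c = "\<lambda>t j. ip (u t) (e j)"
  have eq: "ip d (Pd (u t)) = (\<Sum>j<m. ?c t j * ip d (Pd (e j)))" if t: "t \<in> {0..T}" for t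
  proof -
    have dl: "AE x in \<M>. divergence \<Omega> (u t) x = (\<Sum>j<m. ?c t j *\<^sub>R divergence \<Omega> (e j) x)"
      by (rule divergence_lincomb) (use e uV[OF t] in \<open>auto simp: L2_onb_def intro: Vh_pw eV\<close>)
    have L: "(\<lambda>x. \<Sum>j<m. ?c t j *\<^sub>R divergence \<Omega> (e j) x) \<in> L2 \<Omega>" by (rule L2_lincomb) (auto intro: divergence_v_L2 eV)
    have "AE x in \<M>. Pd (u t) x = L2_perp \<Omega> (Sh \<Omega> k \<T>) (\<lambda>x. \<Sum>j<m. ?c t j *\<^sub>R divergence \<Omega> (e j) x) x"
      unfolding Pd_def by (rule L2_perp_cong_AE[OF \<Omega>_sets es L dl])
    moreover have "AE x in \<M>. L2_perp \<Omega> (Sh \<Omega> k \<T>) (\<lambda>x. \<Sum>j<m. ?c t j *\<^sub>R divergence \<Omega> (e j) x) x = (\<Sum>j<m. ?c t j *\<^sub>R Pd (e j) x)"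
      unfolding Pd_def by (rule L2_perp_lincomb[OF \<Omega>_sets es]) (auto intro: divergence_v_L2 eV)
    ultimately have P: "AE x in \<M>. Pd (u t) x = (\<Sum>j<m. ?c t j *\<^sub>R Pd (e j) x)" by eventually_elim simp
    have "ip d (Pd (u t)) = ip d (\<lambda>x. \<Sum>j<m. ?c t j *\<^sub>R Pd (e j) x)"
      by (rule L2_inner_cong_AE[OF \<Omega>_sets d L2_lincomb _ P]) (auto intro!: Pd_L2 eV)
    also have "\<dots> = (\<Sum>j<m. ?c t j * ip d (Pd (e j)))"
      by (rule L2_inner_lincomb_right) (auto intro: Pd_L2 eV d)
    finally show ?thesis .
  qed
  have "(\<lambda>t. \<Sum>j<m. ?c t j * ip d (Pd (e j))) \<in> borel_measurable MT"
    using eV V_L2 by (intro inner_continuous_measurable continuous_intros u_coeff_continuous) auto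
  then show ?thesis by (subst measurable_cong[OF eq]) auto
qed

lemma conv_inner_measurable:
  assumes v: "v \<in> V" shows "(\<lambda>t. ip (conv \<Omega> (u t) v) (u1 t)) \<in> borel_measurable MT"
proof -
  obtain m e where e: "L2_onb \<Omega> V m e" using onb_V by (elim exE)
  have eV: "e j \<in> V" if "j < m" for j using e that by (auto simp: L2_onb_def)
  let ?c = "\<lambda>t j. ip (u t) (e j)"
  have eq: "ip (conv \<Omega> (u t) v) (u1 t) = (\<Sum>j<m. ?c t j * ip (u1 t) (conv \<Omega> (e j) v))" if t: "t \<in> {0..T}" for t
  proof -
    have u1L: "u1 t \<in> L2 \<Omega>" using u1W[OF t] W1_L2 by blast
    have c: "AE x in \<M>. conv \<Omega> (u t) v x = (\<Sum>j<m. ?c t j *\<^sub>R conv \<Omega> (e j) v x)"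
      by (rule conv_lincomb_left) (use e uV[OF t] in \<open>auto simp: L2_onb_def intro: Vh_pw eV\<close>)
    have "ip (conv \<Omega> (u t) v) (u1 t) = ip (\<lambda>x. \<Sum>j<m. ?c t j *\<^sub>R conv \<Omega> (e j) v x) (u1 t)"
      by (rule L2_inner_cong_AE[OF \<Omega>_sets _ u1L c]) (auto intro!: L2_lincomb conv_V_L2 eV v)
    also have "\<dots> = (\<Sum>j<m. ?c t j * ip (conv \<Omega> (e j) v) (u1 t))"
      by (rule L2_inner_lincomb_left) (auto intro: conv_V_L2 eV v u1L)
    finally show ?thesis by (simp add: L2_inner_commute[of \<Omega> "u1 t"])
  qed
  have "(\<lambda>t. \<Sum>j<m. ?c t j * ip (u1 t) (conv \<Omega> (e j) v)) \<in> borel_measurable MT"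
    using eV V_L2
    by (intro inner_continuous_measurable continuous_intros u_coeff_continuous
        acd_continuous[OF has_time_deriv_acd[OF deriv(2) _ T]] conv_V_L2 v) auto
  then show ?thesis by (subst measurable_cong[OF eq]) auto
qed

lemma X_measurable:
  assumes v: "v \<in> V" shows "(\<lambda>t. X (\<lambda>i. f i t) (u t) (u1 t) v) \<in> borel_measurable MT"
  using inner_continuous_measurable[OF vstress_inner_continuous[OF symgrad_v_L2[OF v]]]
    s1_measurable Pd_inner_measurable[OF divergence_v_L2[OF v]] conv_inner_measurable[OF v]
    force_measurable[OF V_comp(2)[OF v] V_comp(3)[OF v]]
  unfolding X_def t2_eq by measurable

end

section \<open>Splitting and transfer of the residual\<close>

context vms
begin

text \<open>\<open>PV\<close> is symmetric and moves to \<open>w\<close>, where the momentum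
  equation can be used; \<open>Pp\<close> is split into the two parts governed by the two subscale
  equations.\<close>

lemma residual_split:
  assumes q: "q \<in> Sh \<Omega> k \<T>" and v: "v \<in> V" and w: "w \<in> L2 \<Omega>"
  shows "ip (Bres (\<lambda>x. grad \<Omega> q x + conv \<Omega> v v x)) w
    = ip (\<lambda>x. grad \<Omega> q x + conv \<Omega> v v x) (PV w) + ip (Pp (conv \<Omega> v v)) w + ip (Pp (grad \<Omega> q)) w"
proof -
  let ?g = "grad \<Omega> q" and ?c = "conv \<Omega> v v"
  let ?r = "\<lambda>x. ?g x + ?c x"
  have g: "?g \<in> L2 \<Omega>" and c': "?c \<in> L2 \<Omega>" by (rule grad_Sh_L2[OF q], rule conv_V_L2[OF v v])
  have r: "?r \<in> L2 \<Omega>" by (rule L2_add[OF g c'])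
  have 1: "ip (Bres ?r) w = ip (PV ?r) w + ip (Pp ?r) w"
    unfolding Bres_def by (rule L2_inner_add_left[OF PV_L2[OF r] Pp_L2[OF r] w])
  have 2: "ip (PV ?r) w = ip ?r (PV w)"
    using PV_orth[OF w PV_in[OF r]] PV_orth[OF r PV_in[OF w]] by (simp add: L2_inner_commute)
  have "AE x in \<M>. Pp (\<lambda>x. \<Sum>b\<in>UNIV. 1 *\<^sub>R (if b then ?g else ?c) x) x = (\<Sum>b\<in>UNIV. 1 *\<^sub>R Pp (if b then ?g else ?c) x)"
    by (rule Pp_lincomb) (use g c' in auto)
  then have "AE x in \<M>. Pp ?r x = Pp ?c x + Pp ?g x" by (simp add: UNIV_bool add.commute)
  from L2_inner_cong_AE[OF \<Omega>_sets L2_add[OF Pp_L2[OF c'] Pp_L2[OF g]] w this]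
  have "ip (Pp ?r) w = ip (\<lambda>x. Pp ?c x + Pp ?g x) w" by simp
  also have "\<dots> = ip (Pp ?c) w + ip (Pp ?g) w"
    by (rule L2_inner_add_left[OF Pp_L2[OF c'] Pp_L2[OF g] w])
  finally show ?thesis using 1 2 by simp
qed

text \<open>The adjoint of the inverse of \<open>P\<^sub>u\<^sub>,\<^sub>0 + P\<^sub>u\<^sup>\<bottom>\<close> on the residual fields, bounded by the mesh condition.\<close>

lemma residual_transfer:
  "\<exists>L Y. (\<forall>y\<in>L2 \<Omega>. L y \<in> L2 \<Omega> \<and> nrm (L y) \<le> 1 / \<beta>0 * nrm y) \<and> (\<forall>e\<in>L2 \<Omega>. Y e \<in> L2 \<Omega>)
     \<and> (\<forall>y\<in>L2 \<Omega>. \<forall>r\<in>RF. ip r y = ip (Bres r) (L y))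
     \<and> (\<forall>y\<in>L2 \<Omega>. \<forall>e\<in>L2 \<Omega>. ip (L y) e = ip y (Y e))"
proof -
  obtain N z where z: "\<forall>l<N. z l \<in> RF" and on: "orthonormal_fam \<Omega> N (\<lambda>l. Bres (z l))"
    and ex: "\<forall>r\<in>RF. AE x in \<M>. r x = (\<Sum>l<N. ip (Bres r) (Bres (z l)) *\<^sub>R z l x)"
    using residual_basis by (elim exE conjE)
  have zL: "z l \<in> L2 \<Omega>" if "l \<in> {..<N}" for l using z that RF_L2 by auto
  have bL: "Bres (z l) \<in> L2 \<Omega>" if "l \<in> {..<N}" for l by (rule Bres_L2[OF zL[OF that]])
  \<comment> \<open>\<open>L y\<close> has the coefficients \<open>(y, z l)\<close> in the
    orthonormal family \<open>Bres (z l)\<close>; \<open>Y\<close> is the adjoint of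
    \<open>L\<close>.\<close>
  define L where "L = (\<lambda>y x. \<Sum>l<N. ip y (z l) *\<^sub>R Bres (z l) x)"
  define Y where "Y = (\<lambda>e x. \<Sum>l<N. ip (Bres (z l)) e *\<^sub>R z l x)"
  have LL: "L y \<in> L2 \<Omega>" for y unfolding L_def by (rule L2_lincomb[OF bL])
  have YL: "Y e \<in> L2 \<Omega>" for e unfolding Y_def by (rule L2_lincomb[OF zL])
  have LY: "ip (L y) e = ip y (Y e)" if y: "y \<in> L2 \<Omega>" and e: "e \<in> L2 \<Omega>" for y e
  proof -
    have "ip (L y) e = (\<Sum>l<N. ip y (z l) * ip (Bres (z l)) e)"
      unfolding L_def by (rule L2_inner_lincomb_left) (use bL e in auto)
    moreover have "ip y (Y e) = (\<Sum>l<N. ip (Bres (z l)) e * ip y (z l))"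
      unfolding Y_def by (rule L2_inner_lincomb_right) (use zL y in auto)
    ultimately show ?thesis by (simp add: mult.commute)
  qed
  have rL: "ip r y = ip (Bres r) (L y)" if y: "y \<in> L2 \<Omega>" and r: "r \<in> RF" for y r
  proof -
    have rL: "Bres r \<in> L2 \<Omega>" using r RF_L2 by (intro Bres_L2) auto
    have ae: "AE x in \<M>. r x = (\<Sum>l<N. ip (Bres r) (Bres (z l)) *\<^sub>R z l x)" using ex r by (rule bspec)
    have sL: "(\<lambda>x. \<Sum>l<N. ip (Bres r) (Bres (z l)) *\<^sub>R z l x) \<in> L2 \<Omega>" by (rule L2_lincomb[OF zL])
    have "ip r y = ip (\<lambda>x. \<Sum>l<N. ip (Bres r) (Bres (z l)) *\<^sub>R z l x) y"
      by (rule L2_inner_cong_AE[OF \<Omega>_sets sL y ae]) simp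
    also have "\<dots> = (\<Sum>l<N. ip (Bres r) (Bres (z l)) * ip (z l) y)"
      by (rule L2_inner_lincomb_left) (use zL y in auto)
    also have "\<dots> = ip (Bres r) (L y)"
      unfolding L_def by (subst L2_inner_lincomb_right) (use bL rL in \<open>auto simp: L2_inner_commute[of \<Omega> y] mult.commute\<close>)
    finally show ?thesis .
  qed
  have bd: "nrm (L y) \<le> 1 / \<beta>0 * nrm y" if y: "y \<in> L2 \<Omega>" for y
  proof -
    define s where "s = (\<lambda>x. \<Sum>l<N. ip y (z l) *\<^sub>R z l x)"
    have sRF: "s \<in> RF" unfolding s_def by (rule lin_closed_sum[OF lin_closed_RF]) (use z in auto)
    then have sL: "s \<in> L2 \<Omega>" using RF_L2 by blast
    have "AE x in \<M>. Bres s x = L y x" unfolding s_def L_def by (rule Bres_lincomb[OF zL])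
    then have "nrm (Bres s) = nrm (L y)" by (rule L2_norm_cong_AE[OF \<Omega>_sets LL])
    then have sn: "nrm s \<le> 1 / \<beta>0 * nrm (L y)" using mesh_cond[OF sRF] by simp
    \<comment> \<open>\<open>s\<close> is the residual field with image \<open>L y\<close>. The
      squared norm of \<open>L y\<close> equals \<open>(y, s)\<close>, and the mesh condition bounds
      \<open>s\<close> by \<open>L y\<close> itself, so one factor cancels.\<close>
    have "(nrm (L y))\<^sup>2 = ip y (Y (L y))"
      unfolding L2_norm_power2 by (rule LY[OF y LL])
    also have "Y (L y) = s"
      unfolding Y_def s_def L_def using orthonormal_fam_coeff[OF on]
      by (intro ext sum.cong refl) (simp add: L2_inner_commute[of \<Omega> "Bres (z _)"])
    also have "ip y s \<le> nrm y * nrm s" using L2_Cauchy_Schwarz[OF y sL] by simp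
    also have "\<dots> \<le> nrm y * (1 / \<beta>0 * nrm (L y))" by (intro mult_left_mono sn) simp
    finally have le: "nrm (L y) * nrm (L y) \<le> (1 / \<beta>0 * nrm y) * nrm (L y)"
      by (simp add: power2_eq_square mult_ac)
    have "0 \<le> 1 / \<beta>0 * nrm y" using beta by simp
    then show ?thesis
    proof (cases "nrm (L y) = 0")
      case False
      then have "0 < nrm (L y)" using L2_norm_nonneg[of \<Omega> "L y"] by linarith
      then show ?thesis by (rule mult_right_le_imp_le[OF le])
    qed simp
  qed
  show ?thesis
    by (rule exI[of _ L], rule exI[of _ Y]) (intro conjI ballI LL YL bd rL LY)
qed

end

lemma mult_le_half_squares: "a * b \<le> (a\<^sup>2 + b\<^sup>2) / (2::real)"
  using sum_squares_bound[of a b] by simp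

section \<open>Pairing of the residual with a test function of time\<close>

context vms_flow
begin

abbreviation "residual t \<equiv> \<lambda>x. grad \<Omega> (p t) x + conv \<Omega> (u t) (u t) x"

text \<open>Majorants obtained by splitting products into half the sum of squares: \<open>P1\<close>
  for terms with the derivative of the test function, \<open>P2V\<close> for \<open>X\<close> in the
  velocity block, \<open>P2W\<close> for one subscale block. Their time integrals involve only the
  energy, the force and the squared norms of the test function and its derivative.\<close>

definition "P1 v' \<tau> t = (\<tau> * M2 + (1 / \<beta>0)\<^sup>2 * (nrm (v' t))\<^sup>2) / 2"

definition "P2V v dm t = (C2 dm)\<^sup>2 * (G t + Fs t) + (1 / \<beta>0)\<^sup>2 * (nrm (v t))\<^sup>2 / 2"

definition "P2W v t = (G t + (1 / \<beta>0)\<^sup>2 * (nrm (v t))\<^sup>2) / 2"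

context
  fixes v v' :: "real \<Rightarrow> real^'n \<Rightarrow> real^'n" and L Y :: "(real^'n \<Rightarrow> real^'n) \<Rightarrow> real^'n \<Rightarrow> real^'n"
    and \<tau> dm :: real
  assumes vt: "has_time_deriv \<Omega> T v v'" and v0: "nrm (v 0) = 0" and vT: "nrm (v T) = 0"
    and vi: "integrable MT (\<lambda>t. (nrm (v t))\<^sup>2)" "integrable MT (\<lambda>t. (nrm (v' t))\<^sup>2)"
    and L: "\<And>y. y \<in> L2 \<Omega> \<Longrightarrow> L y \<in> L2 \<Omega>" "\<And>y. y \<in> L2 \<Omega> \<Longrightarrow> nrm (L y) \<le> 1 / \<beta>0 * nrm y"
    and Y: "\<And>e. e \<in> L2 \<Omega> \<Longrightarrow> Y e \<in> L2 \<Omega>"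
    and Lr: "\<And>y r. y \<in> L2 \<Omega> \<Longrightarrow> r \<in> RF \<Longrightarrow> ip r y = ip (Bres r) (L y)"
    and LY: "\<And>y e. y \<in> L2 \<Omega> \<Longrightarrow> e \<in> L2 \<Omega> \<Longrightarrow> ip (L y) e = ip y (Y e)"
    and \<tau>: "\<tau> > 0" "\<And>t. t \<in> {0..T} \<Longrightarrow> \<tau> * s1 (u t) \<le> 1" "c1 * \<mu>0 * \<tau> \<le> h\<^sup>2" and dm: "h \<le> dm"
begin

lemma vtL: "t \<in> {0..T} \<Longrightarrow> v t \<in> L2 \<Omega>"
  using vt by (simp add: has_time_deriv_def)

lemma P1_integrable: "integrable MT (P1 v' \<tau>)"
proof -
  interpret finite_measure MT by (rule finite_measure_lebesgue_on) simp
  show ?thesis unfolding P1_def[abs_def] using vi by simp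
qed

text \<open>One of the three blocks, in coefficients of an orthonormal basis \<open>e\<close>. As
  \<open>L\<close>, and with it \<open>Y\<close>, is independent of time,
  \<open>(v t, Y (e j))\<close> is the coefficient of \<open>L (v t)\<close> along
  \<open>e j\<close> and is differentiated by differentiating \<open>v\<close> alone.\<close>

lemma block:
  fixes x x' :: "real \<Rightarrow> real^'n \<Rightarrow> real^'n"
  assumes e: "L2_onb \<Omega> W m e" and x: "has_time_deriv \<Omega> T x x'" and xW: "\<And>t. t \<in> {0..T} \<Longrightarrow> x t \<in> W"
    and xM: "\<And>t. t \<in> {0..T} \<Longrightarrow> (nrm (x t))\<^sup>2 \<le> M2"
    and F: "\<And>j. j \<in> {..<m} \<Longrightarrow> F j \<in> borel_measurable MT"
    and P2: "integrable MT P2" "AE t in MT. sqrt \<tau> * \<bar>\<Sum>j<m. F j t * ip (v t) (Y (e j))\<bar> \<le> P2 t"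
  shows "integrable MT (\<lambda>t. \<Sum>j<m. (- ip (x' t) (e j) + F j t) * ip (v t) (Y (e j)))"
    and "sqrt \<tau> * \<bar>\<integral>t. (\<Sum>j<m. (- ip (x' t) (e j) + F j t) * ip (v t) (Y (e j))) \<partial>MT\<bar>
      \<le> (\<integral>t. P1 v' \<tau> t \<partial>MT) + (\<integral>t. P2 t \<partial>MT)"
proof -
  have eL: "e j \<in> L2 \<Omega>" if "j \<in> {..<m}" for j using e that by (auto simp: L2_onb_def)
  have WL: "W \<subseteq> L2 \<Omega>" using e by (simp add: L2_onb_def)
  have a: "acd T (\<lambda>t. ip (x t) (e j)) (\<lambda>t. ip (x' t) (e j))" if "j \<in> {..<m}" for j
    by (rule has_time_deriv_acd[OF x eL[OF that] T])
  have q: "acd T (\<lambda>t. ip (v t) (Y (e j))) (\<lambda>t. ip (v' t) (Y (e j)))" if "j \<in> {..<m}" for j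
    by (rule has_time_deriv_acd[OF vt Y[OF eL[OF that]] T])
  have zero: "ip (v t) (Y (e j)) = 0" if "t \<in> {0..T}" "nrm (v t) = 0" "j \<in> {..<m}" for t j
    using L2_Cauchy_Schwarz[OF vtL[OF that(1)] Y[OF eL[OF that(3)]]] that(2) by simp
  have q0: "ip (v 0) (Y (e j)) = 0" if "j \<in> {..<m}" for j by (rule zero) (use T v0 that in auto)
  have qT: "ip (v T) (Y (e j)) = 0" if "j \<in> {..<m}" for j by (rule zero) (use T vT that in auto)
  have v'L: "AE t in MT. v' t \<in> L2 \<Omega>" using vt unfolding has_time_deriv_def bochner_Lp_def by (elim CollectE conjE)
  have P1: "AE t in MT. sqrt \<tau> * \<bar>\<Sum>j<m. ip (v' t) (Y (e j)) * ip (x t) (e j)\<bar> \<le> P1 v' \<tau> t"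
    using v'L AE_time
  proof eventually_elim
    fix t assume w: "v' t \<in> L2 \<Omega>" and "t \<in> {0<..<T}"
    then have t: "t \<in> {0..T}" by auto
    \<comment> \<open>The coefficients recombine to \<open>(x t, L (v' t))\<close>, so neither the
      basis nor its length enters the bound.\<close>
    have "(\<Sum>j<m. ip (v' t) (Y (e j)) * ip (x t) (e j)) = (\<Sum>j<m. ip (x t) (e j) * ip (L (v' t)) (e j))"
      using LY[OF w eL] by (intro sum.cong) auto
    also have "\<dots> = ip (x t) (L (v' t))" using L2_onb_inner[OF \<Omega>_sets e xW[OF t] L(1)[OF w]] by simp
    finally have "\<bar>\<Sum>j<m. ip (v' t) (Y (e j)) * ip (x t) (e j)\<bar> \<le> nrm (x t) * nrm (L (v' t))"
      using L2_Cauchy_Schwarz[OF _ L(1)[OF w]] xW[OF t] WL by auto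
    also have "\<dots> \<le> nrm (x t) * (1 / \<beta>0 * nrm (v' t))" by (intro mult_left_mono L(2)[OF w]) simp
    finally have "sqrt \<tau> * \<bar>\<Sum>j<m. ip (v' t) (Y (e j)) * ip (x t) (e j)\<bar>
        \<le> sqrt \<tau> * (nrm (x t) * (1 / \<beta>0 * nrm (v' t)))" using \<tau>(1) by (intro mult_left_mono) auto
    also have "\<dots> = (sqrt \<tau> * nrm (x t)) * (1 / \<beta>0 * nrm (v' t))" by (simp only: mult.assoc)
    also have "\<dots> \<le> ((sqrt \<tau> * nrm (x t))\<^sup>2 + (1 / \<beta>0 * nrm (v' t))\<^sup>2) / 2" by (rule mult_le_half_squares)
    also have "\<dots> \<le> P1 v' \<tau> t"
      unfolding P1_def power_mult_distrib using xM[OF t] \<tau>(1) by (intro divide_right_mono add_mono order_refl) auto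
    finally show "sqrt \<tau> * \<bar>\<Sum>j<m. ip (v' t) (Y (e j)) * ip (x t) (e j)\<bar> \<le> P1 v' \<tau> t" .
  qed
  have s: "0 < sqrt \<tau>" using \<tau>(1) by simp
  note W = acd_weak_pairing[of T "{..<m}" "\<lambda>j t. ip (x t) (e j)" "\<lambda>j t. ip (x' t) (e j)"
      "\<lambda>j t. ip (v t) (Y (e j))" "\<lambda>j t. ip (v' t) (Y (e j))" F "sqrt \<tau>" "P1 v' \<tau>" P2]
  show "integrable MT (\<lambda>t. \<Sum>j<m. (- ip (x' t) (e j) + F j t) * ip (v t) (Y (e j)))"
    by (rule W(1)[OF T a q q0 qT F s P1_integrable P2(1) P1 P2(2)])
  show "sqrt \<tau> * \<bar>\<integral>t. (\<Sum>j<m. (- ip (x' t) (e j) + F j t) * ip (v t) (Y (e j))) \<partial>MT\<bar>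
      \<le> (\<integral>t. P1 v' \<tau> t \<partial>MT) + (\<integral>t. P2 t \<partial>MT)"
    by (rule W(2)[OF T a q q0 qT F s P1_integrable P2(1) P1 P2(2)])
qed

lemma P2_integrable: "integrable MT (P2V v dm)" "integrable MT (P2W v)"
  unfolding P2V_def[abs_def] P2W_def[abs_def] using vi G_integrable Fs_integrable by simp_all

text \<open>\<open>x\<close> stands for either subscale, hence the abstract hypothesis
  \<open>D\<close>; the factor \<open>s1\<close> is shared between weight and dissipation as in
  \<open>tau0_s1\<close>.\<close>

lemma subscale_block_bound:
  assumes e: "L2_onb \<Omega> W m e" and xW: "\<And>t. t \<in> {0..T} \<Longrightarrow> x t \<in> W"
    and D: "\<And>t. t \<in> {0..T} \<Longrightarrow> s1 (u t) * (nrm (x t))\<^sup>2 \<le> Diss (u t) (u1 t) (u2 t)"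
  shows "AE t in MT. sqrt \<tau> * \<bar>\<Sum>j<m. - (s1 (u t) * ip (x t) (e j)) * ip (v t) (Y (e j))\<bar> \<le> P2W v t"
  using Diss_le_G AE_time
proof eventually_elim
  fix t assume G: "Diss (u t) (u1 t) (u2 t) \<le> G t" and "t \<in> {0<..<T}"
  then have t: "t \<in> {0..T}" by auto
  have eL: "e j \<in> L2 \<Omega>" if "j \<in> {..<m}" for j using e that by (auto simp: L2_onb_def)
  have xL: "x t \<in> L2 \<Omega>" using e xW[OF t] by (auto simp: L2_onb_def)
  have s: "s1 (u t) > 0" by (rule s1_pos[OF uV[OF t]])
  have D0: "0 \<le> Diss (u t) (u1 t) (u2 t)" by (rule Diss_parts(1)[OF uV[OF t]])
  have "(\<Sum>j<m. - (s1 (u t) * ip (x t) (e j)) * ip (v t) (Y (e j)))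
      = - s1 (u t) * (\<Sum>j<m. ip (x t) (e j) * ip (L (v t)) (e j))"
    unfolding sum_distrib_left using LY[OF vtL[OF t] eL] by (intro sum.cong) auto
  also have "\<dots> = - s1 (u t) * ip (x t) (L (v t))"
    using L2_onb_inner[OF \<Omega>_sets e xW[OF t] L(1)[OF vtL[OF t]]] by simp
  finally have "sqrt \<tau> * \<bar>\<Sum>j<m. - (s1 (u t) * ip (x t) (e j)) * ip (v t) (Y (e j))\<bar>
      = sqrt \<tau> * (s1 (u t) * \<bar>ip (x t) (L (v t))\<bar>)" using s by (simp add: abs_mult)
  also have "\<dots> \<le> sqrt \<tau> * (s1 (u t) * (nrm (x t) * nrm (L (v t))))"
    using s \<tau>(1) by (intro mult_left_mono L2_Cauchy_Schwarz xL L vtL t) auto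
  also have "\<dots> = sqrt \<tau> * (s1 (u t) * nrm (x t)) * nrm (L (v t))" by simp
  also have "\<dots> \<le> sqrt (Diss (u t) (u1 t) (u2 t)) * (1 / \<beta>0 * nrm (v t))"
  proof (rule mult_mono)
    show "sqrt \<tau> * (s1 (u t) * nrm (x t)) \<le> sqrt (Diss (u t) (u1 t) (u2 t))"
      by (rule tau0_s1[OF uV[OF t] _ \<tau>(2)[OF t] _ D[OF t]]) (use \<tau>(1) in auto)
    show "nrm (L (v t)) \<le> 1 / \<beta>0 * nrm (v t)" by (rule L(2)[OF vtL[OF t]])
  qed (use D0 in auto)
  also have "\<dots> \<le> ((sqrt (Diss (u t) (u1 t) (u2 t)))\<^sup>2 + (1 / \<beta>0 * nrm (v t))\<^sup>2) / 2" by (rule mult_le_half_squares)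
  also have "\<dots> \<le> P2W v t" unfolding P2W_def power_mult_distrib using D0 G by simp
  finally show "sqrt \<tau> * \<bar>\<Sum>j<m. - (s1 (u t) * ip (x t) (e j)) * ip (v t) (Y (e j))\<bar> \<le> P2W v t" .
qed

text \<open>The sum over the basis is turned back into \<open>X\<close> at the single function
  \<open>PV (L (v t))\<close>. Linearity of \<open>X\<close> is not computed from its definition but
  read off from the residual, with which \<open>X\<close> agrees on \<open>V\<close> up to the time
  derivative.\<close>

lemma velocity_block_bound:
  assumes e: "L2_onb \<Omega> V m e"
  shows "AE t in MT. sqrt \<tau> * \<bar>\<Sum>j<m. X (\<lambda>i. f i t) (u t) (u1 t) (e j) * ip (v t) (Y (e j))\<bar> \<le> P2V v dm t"
proof -
  have u'L: "AE t in MT. u' t \<in> L2 \<Omega>" using deriv(1) unfolding has_time_deriv_def bochner_Lp_def by (elim CollectE conjE)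
  show ?thesis using equations force_Hm1 Diss_le_G u'L
  proof eventually_elim
    fix t assume eq: "solves t"
     and l: "\<forall>i. f i t \<in> Hm1 \<Omega>" and G: "Diss (u t) (u1 t) (u2 t) \<le> G t" and u'L: "u' t \<in> L2 \<Omega>"
    from eq have t0: "t \<in> {0<..<T}" by (rule solvesD)
    then have t: "t \<in> {0..T}" by auto
    have eV: "e j \<in> V" if "j \<in> {..<m}" for j using e that by (auto simp: L2_onb_def)
    have eL: "e j \<in> L2 \<Omega>" if "j \<in> {..<m}" for j using eV[OF that] V_L2 by blast
    let ?w = "PV (L (v t))" and ?X = "X (\<lambda>i. f i t) (u t) (u1 t)"
    have Lv: "L (v t) \<in> L2 \<Omega>" by (rule L(1)[OF vtL[OF t]])
    have wV: "?w \<in> V" by (rule PV_in[OF Lv])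
    have RL: "residual t \<in> L2 \<Omega>" by (intro L2_add grad_Sh_L2 conv_V_L2 pS[OF t0] uV[OF t])
    have R: "ip (residual t) y = - ip (u' t) y + ?X y" if "y \<in> V" for y
      by (rule residual_V[OF uV[OF t] pS[OF t0] that solvesD(2)[OF eq that]])
    have wc: "ip ?w (e j) = ip (v t) (Y (e j))" if "j \<in> {..<m}" for j
      using PV_orth[OF Lv eV[OF that]] LY[OF vtL[OF t] eL[OF that]] by simp
    have "(\<Sum>j<m. ?X (e j) * ip (v t) (Y (e j)))
        = (\<Sum>j<m. ip ?w (e j) * ip (residual t) (e j) + ip ?w (e j) * ip (u' t) (e j))"
      by (intro sum.cong refl) (simp add: R[OF eV] wc algebra_simps)
    also have "\<dots> = ip ?w (residual t) + ip ?w (u' t)"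
      unfolding sum.distrib using L2_onb_inner[OF \<Omega>_sets e wV RL] L2_onb_inner[OF \<Omega>_sets e wV u'L] by simp
    also have "\<dots> = ?X ?w" using R[OF wV] by (simp add: L2_inner_commute[of \<Omega> ?w])
    finally have eqX: "(\<Sum>j<m. ?X (e j) * ip (v t) (Y (e j))) = ?X ?w" .
    let ?D = "Diss (u t) (u1 t) (u2 t)"
    have D0: "0 \<le> ?D" by (rule Diss_parts(1)[OF uV[OF t]])
    have u1L: "u1 t \<in> L2 \<Omega>" using u1W[OF t] W1_L2 by blast
    have wn: "nrm ?w \<le> 1 / \<beta>0 * nrm (v t)"
      using L2_norm_proj_le[OF \<Omega>_sets e Lv] L(2)[OF vtL[OF t]] unfolding PV_def by linarith
    have lt: "f i t \<in> Hm1 \<Omega>" for i using l by blast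
    have "sqrt \<tau> * \<bar>?X ?w\<bar> \<le> C2 dm * (sqrt ?D + sqrt (Fs t)) * nrm ?w"
      unfolding Fs_def by (rule X_bound[of _ _ _ "\<lambda>i. f i t", OF uV[OF t] wV u1L lt \<tau>(1) \<tau>(2)[OF t] \<tau>(3) dm])
    also have "\<dots> \<le> ((C2 dm * (sqrt ?D + sqrt (Fs t)))\<^sup>2 + (nrm ?w)\<^sup>2) / 2" by (rule mult_le_half_squares)
    also have "\<dots> \<le> P2V v dm t"
    proof -
      have "(sqrt ?D + sqrt (Fs t))\<^sup>2 \<le> 2 * ((sqrt ?D)\<^sup>2 + (sqrt (Fs t))\<^sup>2)"
        using sum_squares_bound[of "sqrt ?D" "sqrt (Fs t)"] by (simp add: power2_sum)
      also have "\<dots> \<le> 2 * (G t + Fs t)" using D0 G Fs_nonneg[of t] by simp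
      finally have "(C2 dm)\<^sup>2 * (sqrt ?D + sqrt (Fs t))\<^sup>2 \<le> (C2 dm)\<^sup>2 * (2 * (G t + Fs t))" by (intro mult_left_mono) auto
      also have "\<dots> = 2 * ((C2 dm)\<^sup>2 * (G t + Fs t))" by simp
      finally have "(C2 dm)\<^sup>2 * (sqrt ?D + sqrt (Fs t))\<^sup>2 \<le> 2 * ((C2 dm)\<^sup>2 * (G t + Fs t))" .
      moreover have "(nrm ?w)\<^sup>2 \<le> (1 / \<beta>0 * nrm (v t))\<^sup>2" by (rule power_mono[OF wn]) simp
      moreover have "(a + b) / 2 \<le> c + d / 2" if "a \<le> 2 * c" "b \<le> d" for a b c d :: real using that by simp
      ultimately show ?thesis unfolding P2V_def power_mult_distrib by blast
    qed
    finally show "sqrt \<tau> * \<bar>\<Sum>j<m. ?X (e j) * ip (v t) (Y (e j))\<bar> \<le> P2V v dm t" unfolding eqX .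
  qed
qed

text \<open>Here the transfer by \<open>L\<close> and all the equations meet: the pairing is
  rewritten as \<open>(Bres r, L v)\<close>, split into the velocity part and the two subscale
  parts, and each part is expanded in its own basis.\<close>

lemma residual_expansion:
  assumes e: "L2_onb \<Omega> V m e" and e1: "L2_onb \<Omega> W1 m1 e1" and e2: "L2_onb \<Omega> W2 m2 e2"
  shows "AE t in MT. (\<Sum>j<m. (- ip (u' t) (e j) + X (\<lambda>i. f i t) (u t) (u1 t) (e j)) * ip (v t) (Y (e j)))
    + (\<Sum>j<m1. (- ip (u1' t) (e1 j) + - (s1 (u t) * ip (u1 t) (e1 j))) * ip (v t) (Y (e1 j)))
    + (\<Sum>j<m2. (- ip (u2' t) (e2 j) + - (s1 (u t) * ip (u2 t) (e2 j))) * ip (v t) (Y (e2 j)))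
    = ip (residual t) (v t)"
  using equations
proof eventually_elim
  fix t assume eq: "solves t"
  from eq have t0: "t \<in> {0<..<T}" by (rule solvesD)
  then have t: "t \<in> {0..T}" by auto
  have Lv: "L (v t) \<in> L2 \<Omega>" by (rule L(1)[OF vtL[OF t]])
  have wV: "PV (L (v t)) \<in> V" by (rule PV_in[OF Lv])
  have gL: "grad \<Omega> (p t) \<in> L2 \<Omega>" and cL: "conv \<Omega> (u t) (u t) \<in> L2 \<Omega>"
    by (rule grad_Sh_L2[OF pS[OF t0]], rule conv_V_L2[OF uV[OF t] uV[OF t]])
  have RL: "residual t \<in> L2 \<Omega>" by (rule L2_add[OF gL cL])
  have "ip (residual t) (PV (L (v t))) = (\<Sum>j<m. ip (PV (L (v t))) (e j) * ip (residual t) (e j))"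
    using L2_onb_inner[OF \<Omega>_sets e wV RL] by (simp add: L2_inner_commute[of \<Omega> "residual t"])
  also have "\<dots> = (\<Sum>j<m. (- ip (u' t) (e j) + X (\<lambda>i. f i t) (u t) (u1 t) (e j)) * ip (v t) (Y (e j)))"
  proof (rule sum.cong[OF refl])
    fix j assume "j \<in> {..<m}"
    then have ej: "e j \<in> V" "e j \<in> L2 \<Omega>" using e V_L2 by (auto simp: L2_onb_def)
    have "ip (residual t) (e j) = - ip (u' t) (e j) + X (\<lambda>i. f i t) (u t) (u1 t) (e j)"
      by (rule residual_V[OF uV[OF t] pS[OF t0] ej(1) solvesD(2)[OF eq ej(1)]])
    moreover have "ip (PV (L (v t))) (e j) = ip (v t) (Y (e j))"
      using PV_orth[OF Lv ej(1)] LY[OF vtL[OF t] ej(2)] by simp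
    ultimately show "ip (PV (L (v t))) (e j) * ip (residual t) (e j)
        = (- ip (u' t) (e j) + X (\<lambda>i. f i t) (u t) (u1 t) (e j)) * ip (v t) (Y (e j))"
      by (simp add: mult.commute)
  qed
  finally have 0: "ip (residual t) (PV (L (v t)))
      = (\<Sum>j<m. (- ip (u' t) (e j) + X (\<lambda>i. f i t) (u t) (u1 t) (e j)) * ip (v t) (Y (e j)))" .
  \<comment> \<open>Common to both subscales: tested with a basis function, the projected term is
    minus the time derivative minus the damping term.\<close>
  have sub: "ip (Pp g) (L (v t)) = (\<Sum>j<m'. (- ip y' (d j) + - (s1 (u t) * ip y (d j))) * ip (v t) (Y (d j)))"
    if d: "L2_onb \<Omega> W m' d" and g: "g \<in> L2 \<Omega>" and PW: "Pp g \<in> W" and orth: "\<And>w y. w \<in> W \<Longrightarrow> y \<in> Shd \<Omega> k \<T> \<Longrightarrow> ip w y = 0"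
      and eqd: "\<And>w. w \<in> W \<Longrightarrow> ip y' w + s1 (u t) * ip y w + ip g w = 0"
    for W m' d g and y y' :: "real^'n \<Rightarrow> real^'n"
  proof -
    have "ip (Pp g) (L (v t)) = (\<Sum>j<m'. ip (Pp g) (d j) * ip (L (v t)) (d j))"
      by (rule L2_onb_inner[OF \<Omega>_sets d PW Lv])
    also have "\<dots> = (\<Sum>j<m'. (- ip y' (d j) + - (s1 (u t) * ip y (d j))) * ip (v t) (Y (d j)))"
    proof (rule sum.cong[OF refl])
      fix j assume "j \<in> {..<m'}"
      then have dj: "d j \<in> W" "d j \<in> L2 \<Omega>" using d by (auto simp: L2_onb_def)
      have "ip (Pp g) (d j) = ip g (d j)"
        by (rule Pp_diff_Shd[OF g dj(2)]) (use orth[OF dj(1)] in \<open>simp add: L2_inner_commute\<close>)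
      then have "ip (Pp g) (d j) = - ip y' (d j) + - (s1 (u t) * ip y (d j))"
        using eqd[OF dj(1)] by linarith
      then show "ip (Pp g) (d j) * ip (L (v t)) (d j)
          = (- ip y' (d j) + - (s1 (u t) * ip y (d j))) * ip (v t) (Y (d j))"
        using LY[OF vtL[OF t] dj(2)] by simp
    qed
    finally show ?thesis .
  qed
  have 1: "ip (Pp (conv \<Omega> (u t) (u t))) (L (v t))
      = (\<Sum>j<m1. (- ip (u1' t) (e1 j) + - (s1 (u t) * ip (u1 t) (e1 j))) * ip (v t) (Y (e1 j)))"
    by (rule sub[OF e1 cL Pp_conv_W1[OF uV[OF t] uV[OF t]]]) (simp_all add: W1_orth solvesD(4)[OF eq])
  have 2: "ip (Pp (grad \<Omega> (p t))) (L (v t))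
      = (\<Sum>j<m2. (- ip (u2' t) (e2 j) + - (s1 (u t) * ip (u2 t) (e2 j))) * ip (v t) (Y (e2 j)))"
    by (rule sub[OF e2 gL Pp_grad_W2[OF pS[OF t0]]]) (simp_all add: W2_orth solvesD(5)[OF eq])
  have "ip (residual t) (v t) = ip (Bres (residual t)) (L (v t))"
    by (rule Lr[OF vtL[OF t] RF_I[OF pS[OF t0] uV[OF t]]])
  also have "\<dots> = ip (residual t) (PV (L (v t))) + ip (Pp (conv \<Omega> (u t) (u t))) (L (v t)) + ip (Pp (grad \<Omega> (p t))) (L (v t))"
    by (rule residual_split[OF pS[OF t0] uV[OF t] Lv])
  finally show "(\<Sum>j<m. (- ip (u' t) (e j) + X (\<lambda>i. f i t) (u t) (u1 t) (e j)) * ip (v t) (Y (e j)))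
    + (\<Sum>j<m1. (- ip (u1' t) (e1 j) + - (s1 (u t) * ip (u1 t) (e1 j))) * ip (v t) (Y (e1 j)))
    + (\<Sum>j<m2. (- ip (u2' t) (e2 j) + - (s1 (u t) * ip (u2 t) (e2 j))) * ip (v t) (Y (e2 j)))
    = ip (residual t) (v t)"
    unfolding 0 1 2 by simp
qed

text \<open>Three blocks give three copies of \<open>P1\<close>; the velocity block adds
  \<open>P2V\<close> and the two subscale blocks add \<open>P2W\<close> each.\<close>

lemma residual_pairing:
  "integrable MT (\<lambda>t. ip (residual t) (v t))"
  "sqrt \<tau> * \<bar>\<integral>t. ip (residual t) (v t) \<partial>MT\<bar> \<le> 3 * (\<integral>t. P1 v' \<tau> t \<partial>MT) + (\<integral>t. P2V v dm t \<partial>MT) + 2 * (\<integral>t. P2W v t \<partial>MT)"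
proof -
  obtain m e where e: "L2_onb \<Omega> V m e" using onb_V by (elim exE)
  obtain m1 e1 where e1: "L2_onb \<Omega> W1 m1 e1" using onb_W1 by (elim exE)
  obtain m2 e2 where e2: "L2_onb \<Omega> W2 m2 e2" using onb_W2 by (elim exE)
  let ?S = "\<lambda>t. \<Sum>j<m. (- ip (u' t) (e j) + X (\<lambda>i. f i t) (u t) (u1 t) (e j)) * ip (v t) (Y (e j))"
  let ?S1 = "\<lambda>t. \<Sum>j<m1. (- ip (u1' t) (e1 j) + - (s1 (u t) * ip (u1 t) (e1 j))) * ip (v t) (Y (e1 j))"
  let ?S2 = "\<lambda>t. \<Sum>j<m2. (- ip (u2' t) (e2 j) + - (s1 (u t) * ip (u2 t) (e2 j))) * ip (v t) (Y (e2 j))"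
  have M: "(nrm (u t))\<^sup>2 \<le> M2" "(nrm (u1 t))\<^sup>2 \<le> M2" "(nrm (u2 t))\<^sup>2 \<le> M2" if "t \<in> {0..T}" for t
    using kinetic_le[OF that] zero_le_power2[of "nrm (u t)"] zero_le_power2[of "nrm (u1 t)"] zero_le_power2[of "nrm (u2 t)"]
    unfolding kinetic_def by linarith+
  have F: "(\<lambda>t. X (\<lambda>i. f i t) (u t) (u1 t) (e j)) \<in> borel_measurable MT" if "j \<in> {..<m}" for j
    by (rule X_measurable) (use e that in \<open>auto simp: L2_onb_def\<close>)
  have Fs: "(\<lambda>t. - (s1 (u t) * ip (x t) w)) \<in> borel_measurable MT" if "has_time_deriv \<Omega> T x x'" "w \<in> L2 \<Omega>" for x x' w
    using s1_measurable inner_continuous_measurable[OF acd_continuous[OF has_time_deriv_acd[OF that T]]] by measurable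
  have e1L: "e1 j \<in> L2 \<Omega>" if "j \<in> {..<m1}" for j using e1 that by (auto simp: L2_onb_def)
  have e2L: "e2 j \<in> L2 \<Omega>" if "j \<in> {..<m2}" for j using e2 that by (auto simp: L2_onb_def)
  note b = block[OF e deriv(1) uV M(1) F P2_integrable(1) velocity_block_bound[OF e]]
  note b1 = block[OF e1 deriv(2) u1W M(2) Fs[OF deriv(2) e1L] P2_integrable(2)
      subscale_block_bound[OF e1 u1W Diss_parts(4)[OF uV]]]
  note b2 = block[OF e2 deriv(3) u2W M(3) Fs[OF deriv(3) e2L] P2_integrable(2)
      subscale_block_bound[OF e2 u2W Diss_parts(5)[OF uV]]]
  have i: "integrable MT ?S" "integrable MT ?S1" "integrable MT ?S2"
    by ((rule b(1) b1(1) b2(1); assumption)+)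
  have n: "sqrt \<tau> * \<bar>integral\<^sup>L MT ?S\<bar> \<le> (\<integral>t. P1 v' \<tau> t \<partial>MT) + (\<integral>t. P2V v dm t \<partial>MT)"
    "sqrt \<tau> * \<bar>integral\<^sup>L MT ?S1\<bar> \<le> (\<integral>t. P1 v' \<tau> t \<partial>MT) + (\<integral>t. P2W v t \<partial>MT)"
    "sqrt \<tau> * \<bar>integral\<^sup>L MT ?S2\<bar> \<le> (\<integral>t. P1 v' \<tau> t \<partial>MT) + (\<integral>t. P2W v t \<partial>MT)"
    by ((rule b(2) b1(2) b2(2); assumption)+)
  note ex = residual_expansion[OF e e1 e2]
  have iS: "integrable MT (\<lambda>t. ?S t + ?S1 t + ?S2 t)"
    by (intro Bochner_Integration.integrable_add i)
  \<comment> \<open>Integrability is transferred from the expansion, because nothing is known about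
    how the pressure depends on time.\<close>
  show iR: "integrable MT (\<lambda>t. ip (residual t) (v t))"
    by (rule integrable_lebesgue_on_AE[OF Ioo_sets iS ex])
  have "(\<integral>t. ip (residual t) (v t) \<partial>MT) = (\<integral>t. ?S t + ?S1 t + ?S2 t \<partial>MT)"
    using ex by (intro integral_cong_AE borel_measurable_integrable[OF iR] borel_measurable_integrable[OF iS]) (auto elim: eventually_mono)
  also have "\<dots> = integral\<^sup>L MT ?S + integral\<^sup>L MT ?S1 + integral\<^sup>L MT ?S2"
    using Bochner_Integration.integral_add[OF Bochner_Integration.integrable_add[OF i(1,2)] i(3)]
      Bochner_Integration.integral_add[OF i(1,2)] by simp
  finally have "sqrt \<tau> * \<bar>\<integral>t. ip (residual t) (v t) \<partial>MT\<bar>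
      \<le> sqrt \<tau> * (\<bar>integral\<^sup>L MT ?S\<bar> + \<bar>integral\<^sup>L MT ?S1\<bar> + \<bar>integral\<^sup>L MT ?S2\<bar>)"
    using \<tau>(1) by (intro mult_left_mono) auto
  then show "sqrt \<tau> * \<bar>\<integral>t. ip (residual t) (v t) \<partial>MT\<bar> \<le> 3 * (\<integral>t. P1 v' \<tau> t \<partial>MT) + (\<integral>t. P2V v dm t \<partial>MT) + 2 * (\<integral>t. P2W v t \<partial>MT)"
    using n unfolding distrib_left by linarith
qed

end

end

section \<open>The parameter \<open>tau0\<close> and the final constant\<close>

context vms_flow
begin

lemma P1_integral: "(\<integral>t. P1 v' \<tau> t \<partial>MT) = (\<tau> * M2 * T + (1 / \<beta>0)\<^sup>2 * (\<integral>t. (nrm (v' t))\<^sup>2 \<partial>MT)) / 2"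
  if i: "integrable MT (\<lambda>t. (nrm (v' t))\<^sup>2)" for v' \<tau>
proof -
  interpret finite_measure MT by (rule finite_measure_lebesgue_on) simp
  have "measure MT (space MT) = T" using T by (simp add: measure_restrict_space)
  then show ?thesis unfolding P1_def[abs_def] using i by (simp add: mult_ac)
qed

lemma P2V_integral: "(\<integral>t. P2V v dm t \<partial>MT) = (C2 dm)\<^sup>2 * ((\<integral>t. G t \<partial>MT) + (\<integral>t. Fs t \<partial>MT)) + (1 / \<beta>0)\<^sup>2 * (\<integral>t. (nrm (v t))\<^sup>2 \<partial>MT) / 2"
  if i: "integrable MT (\<lambda>t. (nrm (v t))\<^sup>2)" for v dm
  unfolding P2V_def[abs_def] using i G_integrable Fs_integrable by simp

lemma P2W_integral: "(\<integral>t. P2W v t \<partial>MT) = ((\<integral>t. G t \<partial>MT) + (1 / \<beta>0)\<^sup>2 * (\<integral>t. (nrm (v t))\<^sup>2 \<partial>MT)) / 2"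
  if i: "integrable MT (\<lambda>t. (nrm (v t))\<^sup>2)" for v
  unfolding P2W_def[abs_def] using i G_integrable by simp

text \<open>Sum of the integrated majorants over the unit ball. The coefficient 3 of the squared
  \<open>1 / \<beta>0\<close> is 3/2 from \<open>P1\<close>, 1/2 from \<open>P2V\<close> and 1 from
  the two copies of \<open>P2W\<close>; in the first term \<open>tau0\<close> is replaced by the
  bound that follows from \<open>h \<le> diameter (closure \<Omega>)\<close>.\<close>

definition "residual_const = 3/2 * ((diameter (closure \<Omega>))\<^sup>2 / (c1 * \<mu>0)) * M2 * T + 3 * (1 / \<beta>0)\<^sup>2
   + (C2 (diameter (closure \<Omega>)))\<^sup>2 * (M2 + (\<integral>t. Fs t \<partial>MT)) + M2"

abbreviation "\<tau>0 \<equiv> tau0 \<Omega> T c1 c2 \<mu>0 h u"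

text \<open>Continuity in time makes the supremum finite. The inverse of \<open>tau0\<close> then
  dominates \<open>s1\<close> term by term, since \<open>\<mu>c\<close> is at most
  \<open>\<mu>0\<close>, and its viscous summand alone gives the bound by the square of
  \<open>h\<close>.\<close>

lemma tau0_bounds:
  shows "\<tau>0 > 0" and "t \<in> {0..T} \<Longrightarrow> \<tau>0 * s1 (u t) \<le> 1" and "c1 * \<mu>0 * \<tau>0 \<le> h\<^sup>2"
proof -
  let ?S = "SUP t\<in>{0..T}. Linf_norm \<Omega> (u t)"
  define q where "q = c1 * \<mu>0 / h\<^sup>2 + c2 * ?S / h"
  have bdd: "bdd_above ((\<lambda>t. Linf_norm \<Omega> (u t)) ` {0..T})"
    by (intro bounded_imp_bdd_above compact_imp_bounded compact_continuous_image Linf_continuous) simp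
  have le: "Linf_norm \<Omega> (u t) \<le> ?S" if "t \<in> {0..T}" for t by (rule cSUP_upper[OF that bdd])
  have S0: "0 \<le> ?S" using le[of 0] Linf_nonneg[OF uV[of 0]] T by simp
  have mu0: "\<mu>0 > 0" using mu_const by linarith
  have r: "0 < c1 * \<mu>0 / h\<^sup>2" "0 \<le> c2 * ?S / h" using c mu0 h_pos S0 by auto
  then have q: "q > 0" "c1 * \<mu>0 / h\<^sup>2 \<le> q" unfolding q_def by linarith+
  have t: "\<tau>0 = inverse q" by (simp add: tau0_def q_def)
  show "\<tau>0 > 0" using q t by simp
  show "c1 * \<mu>0 * \<tau>0 \<le> h\<^sup>2" using q h_pos unfolding t by (simp add: field_simps)
  assume "t \<in> {0..T}"
  then have "s1 (u t) \<le> q" unfolding s1_def q_def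
    using c h_pos mc[OF uV] le by (intro add_mono divide_right_mono mult_left_mono) auto
  then show "\<tau>0 * s1 (u t) \<le> 1" using q unfolding t by (simp add: field_simps)
qed

lemma residual_pairing_le:
  assumes ball: "(v, v') \<in> H10_time_ball \<Omega> T"
  shows "integrable MT (\<lambda>t. ip (residual t) (v t))"
    and "sqrt \<tau>0 * \<bar>\<integral>t. ip (residual t) (v t) \<partial>MT\<bar> \<le> residual_const"
proof -
  let ?dm = "diameter (closure \<Omega>)" and ?b = "(1 / \<beta>0)\<^sup>2"
  let ?a = "\<integral>t. (nrm (v t))\<^sup>2 \<partial>MT" and ?a' = "\<integral>t. (nrm (v' t))\<^sup>2 \<partial>MT"
  have vt: "has_time_deriv \<Omega> T v v'" and v0: "nrm (v 0) = 0" "nrm (v T) = 0"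
    and vi: "integrable MT (\<lambda>t. (nrm (v t))\<^sup>2)" "integrable MT (\<lambda>t. (nrm (v' t))\<^sup>2)"
    and n: "sqrt (?a + ?a') \<le> 1"
    using ball by (simp_all add: H10_time_ball_def bochner_Lp_def)
  have a0: "0 \<le> ?a" "0 \<le> ?a'" by (simp_all add: integral_nonneg_AE)
  have "?a + ?a' \<le> 1" using n by simp
  then have a1: "?a \<le> 1" "?a' \<le> 1" using a0 by linarith+
  have M20: "0 \<le> M2" using kinetic_le[of 0] kinetic_nonneg[of 0] T by simp
  have mu0: "\<mu>0 > 0" using mu_const by linarith
  obtain L Y where L: "\<forall>y\<in>L2 \<Omega>. L y \<in> L2 \<Omega> \<and> nrm (L y) \<le> 1 / \<beta>0 * nrm y" and Y: "\<forall>e\<in>L2 \<Omega>. Y e \<in> L2 \<Omega>"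
     and Lr: "\<forall>y\<in>L2 \<Omega>. \<forall>r\<in>RF. ip r y = ip (Bres r) (L y)"
     and LY: "\<forall>y\<in>L2 \<Omega>. \<forall>e\<in>L2 \<Omega>. ip (L y) e = ip y (Y e)"
    using residual_transfer by (elim exE conjE)
  have L': "L y \<in> L2 \<Omega>" "nrm (L y) \<le> 1 / \<beta>0 * nrm y" if "y \<in> L2 \<Omega>" for y
    by (rule conjunct1[OF bspec[OF L that]], rule conjunct2[OF bspec[OF L that]])
  have Y': "Y e \<in> L2 \<Omega>" if "e \<in> L2 \<Omega>" for e by (rule bspec[OF Y that])
  have Lr': "ip r y = ip (Bres r) (L y)" if "y \<in> L2 \<Omega>" "r \<in> RF" for y r by (rule bspec[OF bspec[OF Lr that(1)] that(2)])
  have LY': "ip (L y) e = ip y (Y e)" if "y \<in> L2 \<Omega>" "e \<in> L2 \<Omega>" for y e by (rule bspec[OF bspec[OF LY that(1)] that(2)])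
  note B = residual_pairing[where v = v and v' = v' and L = L and Y = Y and \<tau> = \<tau>0 and dm = ?dm]
  show "integrable MT (\<lambda>t. ip (residual t) (v t))"
    by (rule B(1)[OF vt v0 vi L' Y' Lr' LY' tau0_bounds mesh_size_le])
  have b: "sqrt \<tau>0 * \<bar>\<integral>t. ip (residual t) (v t) \<partial>MT\<bar>
      \<le> 3 * (\<integral>t. P1 v' \<tau>0 t \<partial>MT) + (\<integral>t. P2V v ?dm t \<partial>MT) + 2 * (\<integral>t. P2W v t \<partial>MT)"
    by (rule B(2)[OF vt v0 vi L' Y' Lr' LY' tau0_bounds mesh_size_le])
  have t: "\<tau>0 * (M2 * T) \<le> ?dm\<^sup>2 / (c1 * \<mu>0) * (M2 * T)"
  proof (rule mult_right_mono)
    have "c1 * \<mu>0 * \<tau>0 \<le> ?dm\<^sup>2" using tau0_bounds(3) power_mono[OF mesh_size_le, of 2] h_pos by linarith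
    then show "\<tau>0 \<le> ?dm\<^sup>2 / (c1 * \<mu>0)" using c mu0 by (simp add: field_simps)
    show "0 \<le> M2 * T" using M20 T by simp
  qed
  have b1: "?b * ?a \<le> ?b * 1" "?b * ?a' \<le> ?b * 1" by (intro mult_left_mono a1; simp)+
  have g: "(C2 ?dm)\<^sup>2 * ((\<integral>t. G t \<partial>MT) + (\<integral>t. Fs t \<partial>MT)) \<le> (C2 ?dm)\<^sup>2 * (M2 + (\<integral>t. Fs t \<partial>MT))"
    using G_integral by (intro mult_left_mono) auto
  \<comment> \<open>Pure arithmetic with the nonlinear products replaced by variables:
    \<open>\<tau>'\<close> is the energy part of \<open>P1\<close>, while \<open>\<beta>1\<close>
    and \<open>\<beta>2\<close> are the weighted squared norms of \<open>v\<close> and of its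
    derivative.\<close>
  have sum: "x \<le> r" if "x \<le> 3 * ((\<tau>' + \<beta>2) / 2) + (S + \<beta>1 / 2) + 2 * ((g' + \<beta>1) / 2)" "\<tau>' \<le> d" "\<beta>1 \<le> \<beta> * 1" "\<beta>2 \<le> \<beta> * 1"
      "S \<le> S'" "g' \<le> m" "3/2 * d + 3 * \<beta> + S' + m = r" for x r \<tau>' \<beta>1 \<beta>2 S S' g' m d \<beta> :: real
    using that by (simp add: field_simps)
  show "sqrt \<tau>0 * \<bar>\<integral>t. ip (residual t) (v t) \<partial>MT\<bar> \<le> residual_const"
    by (rule sum[OF b[unfolded P1_integral[OF vi(2)] P2V_integral[OF vi(1)] P2W_integral[OF vi(1)] mult.assoc[of \<tau>0]] t b1 g G_integral])
      (simp add: residual_const_def)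
qed

text \<open>The weight is taken inside the supremum, and integrability of the pairing rules out the
  infinite branch for every member of the unit ball.\<close>

lemma residual_bound:
  "ennreal (sqrt \<tau>0) * Hm1_time_norm \<Omega> T residual \<le> ennreal residual_const"
  unfolding Hm1_time_norm_def SUP_mult_left_ennreal
proof (rule SUP_least)
  fix w assume w: "w \<in> H10_time_ball \<Omega> T"
  obtain v v' where "w = (v, v')" by (cases w)
  with w residual_pairing_le[of v v']
  have i: "integrable MT (\<lambda>t. ip (residual t) (v t))"
    and "sqrt \<tau>0 * \<bar>\<integral>t. ip (residual t) (v t) \<partial>MT\<bar> \<le> residual_const" by auto
  then have "ennreal (sqrt \<tau>0) * ennreal \<bar>\<integral>t. ip (residual t) (v t) \<partial>MT\<bar> \<le> ennreal residual_const"
    using tau0_bounds(1) by (subst ennreal_mult'[symmetric]) (auto intro: ennreal_leI)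
  then show "ennreal (sqrt \<tau>0) * (case w of (v, v') \<Rightarrow>
      if integrable MT (\<lambda>t. ip (residual t) (v t))
      then ennreal \<bar>\<integral>t. ip (residual t) (v t) \<partial>MT\<bar> else \<infinity>) \<le> ennreal residual_const"
    using i \<open>w = (v, v')\<close> by simp
qed

end

theorem theorem5p1:
  fixes \<Omega> :: "(real^'n) set"
    and T C\<mu> \<mu>0 \<mu>inf c1 c2 \<beta>0 :: real
    and k :: nat
    and \<mu> :: "real^'n \<Rightarrow> real \<Rightarrow> real"
    and \<TT> :: "(real^'n) set set set"
    and u0 :: "real^'n \<Rightarrow> real^'n"
    and f :: "'n \<Rightarrow> real \<Rightarrow> (real^'n \<Rightarrow> real) \<Rightarrow> real"
  assumes dim: "CARD('n) = 2 \<or> CARD('n) = 3"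
    and domain: "polyhedral_domain \<Omega>"
    and T: "T > 0"
    and visc_const: "C\<mu> > 0" "\<mu>0 > \<mu>inf" "\<mu>inf > 0"
    and visc_lipschitz: "\<And>x s t. x \<in> closure \<Omega> \<Longrightarrow> s \<ge> 0 \<Longrightarrow> t \<ge> 0 \<Longrightarrow> \<bar>\<mu> x t - \<mu> x s\<bar> \<le> C\<mu> * \<bar>t - s\<bar>"
    and visc_bounds: "\<And>x t. x \<in> closure \<Omega> \<Longrightarrow> t \<ge> 0 \<Longrightarrow> \<mu>inf \<le> \<mu> x t \<and> \<mu> x t \<le> \<mu>0"
    and visc_measurable: "\<And>t. t \<ge> 0 \<Longrightarrow> (\<lambda>x. \<mu> x t) \<in> borel_measurable (lebesgue_on \<Omega>)"
    and degree: "k \<ge> 1"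
    and partitions: "\<And>\<T>. \<T> \<in> \<TT> \<Longrightarrow> fe_partition \<Omega> \<T>"
    and quasi_uniform: "quasi_uniform \<TT>"
    and c: "c1 > 0" "c2 > 0"
    and beta: "\<beta>0 > 0"
    and mesh_condition: "\<And>\<T> z. \<T> \<in> \<TT> \<Longrightarrow> z \<in> residual_fields \<Omega> k \<T> \<Longrightarrow>
          L2_norm \<Omega> z \<le> 1 / \<beta>0 *
            L2_norm \<Omega> (\<lambda>x. L2_proj \<Omega> (Vh \<Omega> k \<T>) z x + L2_perp \<Omega> (Shd \<Omega> k \<T>) z x) \<and>
          1 / \<beta>0 *
            L2_norm \<Omega> (\<lambda>x. L2_proj \<Omega> (Vh \<Omega> k \<T>) z x + L2_perp \<Omega> (Shd \<Omega> k \<T>) z x)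
            \<le> 1 / \<beta>0 *
              (L2_norm \<Omega> (L2_proj \<Omega> (Vh \<Omega> k \<T>) z) + L2_norm \<Omega> (L2_perp \<Omega> (Shd \<Omega> k \<T>) z))"
    and initial: "u0 \<in> L2 \<Omega>"
    and force: "\<And>i. f i \<in> bochner_Lp 2 T (Hm1 \<Omega>) (Hm1_norm \<Omega>)"
  shows "\<exists>C::real. \<forall>\<T>\<in>\<TT>. \<forall>\<mu>c nu \<phi> np \<psi> u p u1 u2.
      (\<forall>w\<in>Vh \<Omega> k \<T>. \<mu>inf \<le> \<mu>c w \<and> \<mu>c w \<le> \<mu>0) \<and>
      (\<lambda>t. \<mu>c (u t)) \<in> borel_measurable (lebesgue_on {0<..<T}) \<and>
      velocity_basis \<Omega> k \<T> nu \<phi> \<and>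
      pressure_basis \<Omega> k \<T> np \<psi> \<and>
      vms_solution \<Omega> T k \<T> \<mu> \<mu>c c1 c2 f u0
        (subscale1 \<Omega> k \<T> nu \<phi>) (subscale2 \<Omega> k \<T> np \<psi>) u p u1 u2 \<longrightarrow>
      ennreal (sqrt (tau0 \<Omega> T c1 c2 \<mu>0 (mesh_size \<T>) u)) *
        Hm1_time_norm \<Omega> T (\<lambda>t x. grad \<Omega> (p t) x + conv \<Omega> (u t) (u t) x)
      \<le> ennreal C"
proof -
  \<comment> \<open>\<open>\<rho>\<close>, \<open>Ci\<close> and \<open>R\<close> are fixed before
    any mesh is chosen; this order makes the final constant uniform over the family.\<close>
  obtain \<rho> where \<rho>: "\<rho> > 0" and balls: "\<forall>\<T>\<in>\<TT>. \<forall>K\<in>\<T>. \<exists>x. ball x (\<rho> * mesh_size \<T>) \<subseteq> K"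
    using quasi_uniform unfolding quasi_uniform_def by (elim exE conjE)
  obtain Ci where Ci: "Ci \<ge> 0" and inv: "\<forall>\<Omega> (\<T> :: (real^'n) set set). mesh \<Omega> \<T> \<longrightarrow> (\<forall>K\<in>\<T>. \<exists>x. ball x (\<rho> * mesh_size \<T>) \<subseteq> K) \<longrightarrow>
     (\<forall>v\<in>Sh \<Omega> k \<T>. \<forall>i. L2_norm \<Omega> (pderiv_at i v) \<le> Ci / mesh_size \<T> * L2_norm \<Omega> v \<and>
       (\<forall>M. (\<forall>x\<in>closure \<Omega>. \<bar>v x\<bar> \<le> M) \<longrightarrow> (AE x in lebesgue_on \<Omega>. \<bar>pderiv_at i v x\<bar> \<le> Ci / mesh_size \<T> * M)))"
    using inverse_estimate[OF \<rho>, of k] by (elim exE conjE)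
  have "bounded \<Omega>" using domain by (simp add: polyhedral_domain_def)
  then obtain R where R: "R > 0" "\<forall>x\<in>\<Omega>. norm x \<le> R" unfolding bounded_pos by (elim exE conjE)
  show ?thesis
  \<comment> \<open>The witness has no mesh, basis, solution or characteristic viscosity among its
    arguments.\<close>
  proof (intro exI[of _ "vms_flow.residual_const \<Omega> Ci \<beta>0 c1 c2 \<mu>0 \<mu>inf R T f u0"] ballI allI impI, elim conjE)
    fix \<T> \<mu>c nu \<phi> np \<psi> u p u1 u2
    assume \<T>: "\<T> \<in> \<TT>" and mc: "\<forall>w\<in>Vh \<Omega> k \<T>. \<mu>inf \<le> \<mu>c w \<and> \<mu>c w \<le> \<mu>0"
      and mcm: "(\<lambda>t. \<mu>c (u t)) \<in> borel_measurable (lebesgue_on {0<..<T})"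
      and vb: "velocity_basis \<Omega> k \<T> nu \<phi>" and pb: "pressure_basis \<Omega> k \<T> np \<psi>"
      and sol: "vms_solution \<Omega> T k \<T> \<mu> \<mu>c c1 c2 f u0 (subscale1 \<Omega> k \<T> nu \<phi>) (subscale2 \<Omega> k \<T> np \<psi>) u p u1 u2"
    have mesh: "mesh \<Omega> \<T>" using domain partitions[OF \<T>] by unfold_locales
    note inv' = inv[rule_format, OF mesh bspec[OF bspec[OF balls \<T>]]]
    interpret fe_space \<Omega> \<T> k nu np \<phi> \<psi> using domain partitions[OF \<T>] vb pb by unfold_locales
    interpret vms \<Omega> \<T> k nu np \<phi> \<psi> Ci \<beta>0 c1 c2 \<mu>0 \<mu>inf C\<mu> R \<mu> \<mu>c
    proof unfold_locales
      show "L2_norm \<Omega> (pderiv_at i v) \<le> Ci / mesh_size \<T> * L2_norm \<Omega> v" if "v \<in> Sh \<Omega> k \<T>" for v i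
        using inv' that by blast
      show "AE x in lebesgue_on \<Omega>. \<bar>pderiv_at i v x\<bar> \<le> Ci / mesh_size \<T> * M"
        if "v \<in> Sh \<Omega> k \<T>" "\<And>x. x \<in> closure \<Omega> \<Longrightarrow> \<bar>v x\<bar> \<le> M" for v i M
        using inv' that by blast
      show "L2_norm \<Omega> z \<le> 1 / \<beta>0 * L2_norm \<Omega> (Bres z)" if "z \<in> RF" for z
        using mesh_condition[OF \<T> that] unfolding Bres_def PV_def Pp_def by (elim conjE)
    qed (use Ci beta c visc_const visc_lipschitz visc_bounds visc_measurable R mc in simp_all)
    from sol obtain u' u1' u2' where "vms_flow \<Omega> \<T> k nu np \<phi> \<psi> Ci \<beta>0 c1 c2 \<mu>0 \<mu>inf C\<mu> R \<mu> \<mu>c T f u0 u p u1 u2 u' u1' u2'"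
      unfolding vms_solution_def
    proof (elim conjE exE)
      fix u' u1' u2'
      assume "\<forall>t\<in>{0..T}. u t \<in> V \<and> u1 t \<in> W1 \<and> u2 t \<in> W2" "\<forall>t\<in>{0<..<T}. p t \<in> Sh \<Omega> k \<T>"
        and init: "AE x in lebesgue_on \<Omega>. u 0 x = L2_proj \<Omega> V u0 x" "AE x in lebesgue_on \<Omega>. u1 0 x = L2_proj \<Omega> W1 u0 x"
          "AE x in lebesgue_on \<Omega>. u2 0 x = L2_proj \<Omega> W2 u0 x"
        and deriv: "has_time_deriv \<Omega> T u u'" "has_time_deriv \<Omega> T u1 u1'" "has_time_deriv \<Omega> T u2 u2'"
        and eqs: "AE t in lebesgue_on {0<..<T}. \<forall>v\<in>V. \<forall>q\<in>Sh \<Omega> k \<T>. \<forall>v1\<in>W1. \<forall>v2\<in>W2.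
          momentum_eq \<Omega> k \<T> \<mu> \<mu>c c1 c2 f t (u t) (u' t) (p t) (u1 t) v \<and>
          L2_inner \<Omega> q (divergence \<Omega> (u t)) - L2_inner \<Omega> (grad \<Omega> q) (u2 t) = 0 \<and>
          L2_inner \<Omega> (u1' t) v1
            + inverse (tau1 \<Omega> c1 c2 \<mu>c (mesh_size \<T>) (u t)) * L2_inner \<Omega> (u1 t) v1
            + conv_form \<Omega> (u t) (u t) v1 = 0 \<and>
          L2_inner \<Omega> (u2' t) v2
            + inverse (tau1 \<Omega> c1 c2 \<mu>c (mesh_size \<T>) (u t)) * L2_inner \<Omega> (u2 t) v2
            + L2_inner \<Omega> (grad \<Omega> (p t)) v2 = 0"
      then have "vms_flow \<Omega> \<T> k nu np \<phi> \<psi> Ci \<beta>0 c1 c2 \<mu>0 \<mu>inf C\<mu> R \<mu> \<mu>c T f u0 u p u1 u2 u' u1' u2'"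
        by (intro vms_flow.intro vms_axioms vms_flow_axioms.intro T initial force mcm init deriv eqs) simp_all
      then show thesis by (rule that)
    qed
    then show "ennreal (sqrt (tau0 \<Omega> T c1 c2 \<mu>0 (mesh_size \<T>) u)) *
        Hm1_time_norm \<Omega> T (\<lambda>t x. grad \<Omega> (p t) x + conv \<Omega> (u t) (u t) x)
      \<le> ennreal (vms_flow.residual_const \<Omega> Ci \<beta>0 c1 c2 \<mu>0 \<mu>inf R T f u0)"
      by (rule vms_flow.residual_bound)
  qed
qed

end
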